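(* Let $\mathcal{F}$ be a torsion free sheaf on $\mathbf{P}^N$, $N\ge 2$. Then $\mathcal{F}$ is split if and only if $H^i_*\mathcal{F}=0$ for $i=1,\dots,N-1$.
   Context: $\mathbf{P}^N$ is the projective space of dimension $N$ over an algebraically closed field of characteristic $0$; sheaves are coherent. $H^i_*\mathcal{F}=\bigoplus_{m\in\mathbb{Z}}H^i(\mathcal{F}(m))$. A sheaf is split if it is isomorphic to a direct sum of line bundles $\mathcal{O}_{\mathbf{P}^N}(a_i)$. *)

theory Defs
  imports
    "HOL-Analysis.Abstract_Topology"
    "HOL-Algebra.AbelCoset"
    "HOL-Algebra.Module"
    "HOL-Algebra.Product_Groups"
    "HOL-Library.Poly_Mapping"
    "HOL-Computational_Algebra.Polynomial"
begin

section \<open>Projective space as a variety\<close>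

text \<open>
  A polynomial in the variables \<open>x\<^sub>0, x\<^sub>1, \<dots>\<close> is a finitely supported map from exponent
  vectors to coefficients.  A point of \<open>\<bold>P\<^sup>N\<close> is a punctured line of \<open>k\<^sup>N\<^sup>+\<^sup>1\<close>, i.e. the set of all
  its homogeneous coordinate vectors; a vector of \<open>k\<^sup>N\<^sup>+\<^sup>1\<close> is a function on \<^typ>\<open>nat\<close> that
  vanishes beyond \<open>N\<close>.
\<close>

type_synonym 'k mvpoly = "(nat \<Rightarrow>\<^sub>0 nat) \<Rightarrow>\<^sub>0 'k"
type_synonym 'k point = "(nat \<Rightarrow> 'k) set"

definition poly_eval :: "'k::field mvpoly \<Rightarrow> (nat \<Rightarrow> 'k) \<Rightarrow> 'k" where
  "poly_eval f v =
     (\<Sum>m\<in>Poly_Mapping.keys f. Poly_Mapping.lookup f m *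
        (\<Prod>i\<in>Poly_Mapping.keys m. v i ^ Poly_Mapping.lookup m i))"

definition forms :: "nat \<Rightarrow> nat \<Rightarrow> 'k::field mvpoly set" where
  "forms N d = {f. \<forall>m\<in>Poly_Mapping.keys f. Poly_Mapping.keys m \<subseteq> {..N} \<and>
                     (\<Sum>i\<in>Poly_Mapping.keys m. Poly_Mapping.lookup m i) = d}"

definition proj_space :: "nat \<Rightarrow> 'k::field point set" where
  "proj_space N =
     {{w. \<exists>c. c \<noteq> 0 \<and> w = (\<lambda>i. c * v i)} | v. v \<noteq> (\<lambda>_. 0) \<and> (\<forall>i>N. v i = 0)}"

definition basic_open :: "nat \<Rightarrow> 'k::field mvpoly \<Rightarrow> 'k point set" where
  "basic_open N f = {p \<in> proj_space N. \<forall>v\<in>p. poly_eval f v \<noteq> 0}"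

definition zariski :: "nat \<Rightarrow> 'k::field point topology" where
  "zariski N = topology_generated_by {basic_open N f | f d. f \<in> forms N d}"

definition regular_on :: "nat \<Rightarrow> 'k::field point set \<Rightarrow> ('k point \<Rightarrow> 'k) \<Rightarrow> bool" where
  "regular_on N U a \<longleftrightarrow>
     (\<forall>p\<in>U. \<exists>V. openin (zariski N) V \<and> p \<in> V \<and> V \<subseteq> U \<and>
        (\<exists>d. \<exists>f\<in>forms N d. \<exists>g\<in>forms N d.
           \<forall>q\<in>V. \<forall>v\<in>q. poly_eval g v \<noteq> 0 \<and> a q = poly_eval f v / poly_eval g v))"

definition regular_ring :: "nat \<Rightarrow> 'k::field point set \<Rightarrow> ('k point \<Rightarrow> 'k) ring" where
  "regular_ring N U =
     \<lparr>carrier = {a \<in> extensional U. regular_on N U a},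
      monoid.mult = (\<lambda>a b. \<lambda>p\<in>U. a p * b p), one = (\<lambda>p\<in>U. 1),
      zero = (\<lambda>p\<in>U. 0), add = (\<lambda>a b. \<lambda>p\<in>U. a p + b p)\<rparr>"


section \<open>Sheaves of modules\<close>

text \<open>
  The fields \<^const>\<open>monoid.mult\<close> and \<^const>\<open>monoid.one\<close> of the record of a module are never
  used, as in \<^theory>\<open>HOL-Algebra.Module\<close>; the constructions below leave them undefined.
\<close>

record ('p, 'k, 'a) sheaf_data =
  sections :: "'p set \<Rightarrow> ('p \<Rightarrow> 'k, 'a) module"
  restr :: "'p set \<Rightarrow> 'p set \<Rightarrow> 'a \<Rightarrow> 'a"

type_synonym ('k, 'a) proj_sheaf = "('k point, 'k, 'a) sheaf_data"

definition sheaf_of_modules :: "nat \<Rightarrow> ('k::field, 'a) proj_sheaf \<Rightarrow> bool" where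
  "sheaf_of_modules N F \<longleftrightarrow>
     (\<forall>U. openin (zariski N) U \<longrightarrow> module (regular_ring N U) (sections F U)) \<and>
     (\<forall>U V. openin (zariski N) U \<and> openin (zariski N) V \<and> V \<subseteq> U \<longrightarrow>
        abelian_group_hom (sections F U) (sections F V) (restr F U V) \<and>
        (\<forall>a\<in>carrier (regular_ring N U). \<forall>s\<in>carrier (sections F U).
           restr F U V (a \<odot>\<^bsub>sections F U\<^esub> s) =
             restrict a V \<odot>\<^bsub>sections F V\<^esub> restr F U V s)) \<and>
     (\<forall>U. openin (zariski N) U \<longrightarrow> (\<forall>s\<in>carrier (sections F U). restr F U U s = s)) \<and>
     (\<forall>U V W. openin (zariski N) U \<and> openin (zariski N) V \<and> openin (zariski N) W \<and>
        W \<subseteq> V \<and> V \<subseteq> U \<longrightarrow>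
        (\<forall>s\<in>carrier (sections F U). restr F V W (restr F U V s) = restr F U W s)) \<and>
     (\<forall>\<U> s. (\<forall>U\<in>\<U>. openin (zariski N) U \<and> s U \<in> carrier (sections F U)) \<and>
        (\<forall>U\<in>\<U>. \<forall>V\<in>\<U>. restr F U (U \<inter> V) (s U) = restr F V (U \<inter> V) (s V)) \<longrightarrow>
        (\<exists>!t. t \<in> carrier (sections F (\<Union>\<U>)) \<and> (\<forall>U\<in>\<U>. restr F (\<Union>\<U>) U t = s U)))"

definition structure_sheaf :: "nat \<Rightarrow> ('k::field, 'k point \<Rightarrow> 'k) proj_sheaf" where
  "structure_sheaf N =
     \<lparr>sections = (\<lambda>U.
        \<lparr>carrier = carrier (regular_ring N U),
         monoid.mult = undefined, one = undefined,
         zero = \<zero>\<^bsub>regular_ring N U\<^esub>, add = (\<oplus>\<^bsub>regular_ring N U\<^esub>),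
         module.smult = (\<otimes>\<^bsub>regular_ring N U\<^esub>)\<rparr>),
      restr = (\<lambda>U V a. restrict a V)\<rparr>"

definition sheaf_iso :: "nat \<Rightarrow> ('k::field, 'a) proj_sheaf \<Rightarrow> ('k, 'b) proj_sheaf \<Rightarrow> bool" where
  "sheaf_iso N F G \<longleftrightarrow>
     (\<exists>\<phi>. (\<forall>U. openin (zariski N) U \<longrightarrow>
             bij_betw (\<phi> U) (carrier (sections F U)) (carrier (sections G U)) \<and>
             abelian_group_hom (sections F U) (sections G U) (\<phi> U) \<and>
             (\<forall>a\<in>carrier (regular_ring N U). \<forall>s\<in>carrier (sections F U).
                \<phi> U (a \<odot>\<^bsub>sections F U\<^esub> s) = a \<odot>\<^bsub>sections G U\<^esub> \<phi> U s)) \<and>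
          (\<forall>U V. openin (zariski N) U \<and> openin (zariski N) V \<and> V \<subseteq> U \<longrightarrow>
             (\<forall>s\<in>carrier (sections F U). \<phi> V (restr F U V s) = restr G U V (\<phi> U s))))"

definition direct_sum :: "nat \<Rightarrow> (nat \<Rightarrow> ('k::field, 'a) proj_sheaf) \<Rightarrow> ('k, nat \<Rightarrow> 'a) proj_sheaf" where
  "direct_sum r G =
     \<lparr>sections = (\<lambda>U.
        \<lparr>carrier = (\<Pi>\<^sub>E i\<in>{..<r}. carrier (sections (G i) U)),
         monoid.mult = undefined, one = undefined,
         zero = (\<lambda>i\<in>{..<r}. \<zero>\<^bsub>sections (G i) U\<^esub>),
         add = (\<lambda>s t. \<lambda>i\<in>{..<r}. s i \<oplus>\<^bsub>sections (G i) U\<^esub> t i),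
         module.smult = (\<lambda>a s. \<lambda>i\<in>{..<r}. a \<odot>\<^bsub>sections (G i) U\<^esub> s i)\<rparr>),
      restr = (\<lambda>U V s. \<lambda>i\<in>{..<r}. restr (G i) U V (s i))\<rparr>"


section \<open>Coherent and torsion free sheaves\<close>

text \<open>
  The sections \<open>s 0, \<dots>, s (n - 1)\<close> over \<open>U\<close> generate \<open>F\<close> on \<open>U\<close>, i.e. define a surjective
  morphism of sheaves from \<open>\<O>\<^sub>U\<^sup>n\<close> to \<open>F\<close> restricted to \<open>U\<close>.
\<close>

definition generated_by ::
  "nat \<Rightarrow> ('k::field, 'a) proj_sheaf \<Rightarrow> 'k point set \<Rightarrow> nat \<Rightarrow> (nat \<Rightarrow> 'a) \<Rightarrow> bool" where
  "generated_by N F U n s \<longleftrightarrow>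
     (\<forall>V t p. openin (zariski N) V \<and> V \<subseteq> U \<and> t \<in> carrier (sections F V) \<and> p \<in> V \<longrightarrow>
        (\<exists>W a. openin (zariski N) W \<and> p \<in> W \<and> W \<subseteq> V \<and>
           (\<forall>i<n. a i \<in> carrier (regular_ring N W)) \<and>
           restr F V W t =
             (\<Oplus>\<^bsub>sections F W\<^esub>i\<in>{..<n}. a i \<odot>\<^bsub>sections F W\<^esub> restr F U W (s i))))"

definition finite_type :: "nat \<Rightarrow> ('k::field, 'a) proj_sheaf \<Rightarrow> bool" where
  "finite_type N F \<longleftrightarrow>
     (\<forall>p\<in>proj_space N. \<exists>U n s. openin (zariski N) U \<and> p \<in> U \<and>
        (\<forall>i<n. s i \<in> carrier (sections F U)) \<and> generated_by N F U n s)"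

definition relations ::
  "nat \<Rightarrow> ('k::field, 'a) proj_sheaf \<Rightarrow> 'k point set \<Rightarrow> nat \<Rightarrow> (nat \<Rightarrow> 'a) \<Rightarrow> 'k point set \<Rightarrow>
     (nat \<Rightarrow> 'k point \<Rightarrow> 'k) set" where
  "relations N F U n s V =
     {a. (\<forall>i<n. a i \<in> carrier (regular_ring N V)) \<and>
         (\<Oplus>\<^bsub>sections F V\<^esub>i\<in>{..<n}. a i \<odot>\<^bsub>sections F V\<^esub> restr F U V (s i)) = \<zero>\<^bsub>sections F V\<^esub>}"

text \<open>The kernel of the morphism from \<open>\<O>\<^sub>U\<^sup>n\<close> to \<open>F\<close> given by \<open>s\<close> is of finite type.\<close>

definition relations_finite_type ::
  "nat \<Rightarrow> ('k::field, 'a) proj_sheaf \<Rightarrow> 'k point set \<Rightarrow> nat \<Rightarrow> (nat \<Rightarrow> 'a) \<Rightarrow> bool" where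
  "relations_finite_type N F U n s \<longleftrightarrow>
     (\<forall>p\<in>U. \<exists>V (m::nat) r. openin (zariski N) V \<and> p \<in> V \<and> V \<subseteq> U \<and>
        (\<forall>j<m. r j \<in> relations N F U n s V) \<and>
        (\<forall>W a q. openin (zariski N) W \<and> W \<subseteq> V \<and> a \<in> relations N F U n s W \<and> q \<in> W \<longrightarrow>
           (\<exists>W' b. openin (zariski N) W' \<and> q \<in> W' \<and> W' \<subseteq> W \<and>
              (\<forall>j<m. b j \<in> carrier (regular_ring N W')) \<and>
              (\<forall>i<n. \<forall>x\<in>W'. a i x = (\<Sum>j<m. b j x * r j i x)))))"

definition coherent :: "nat \<Rightarrow> ('k::field, 'a) proj_sheaf \<Rightarrow> bool" where
  "coherent N F \<longleftrightarrow>
     sheaf_of_modules N F \<and> finite_type N F \<and>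
     (\<forall>U n s. openin (zariski N) U \<and> (\<forall>i<n. s i \<in> carrier (sections F U)) \<longrightarrow>
        relations_finite_type N F U n s)"

definition germ_zero ::
  "nat \<Rightarrow> ('k::field, 'a) proj_sheaf \<Rightarrow> 'k point set \<Rightarrow> 'a \<Rightarrow> 'k point \<Rightarrow> bool" where
  "germ_zero N F U s p \<longleftrightarrow>
     (\<exists>V. openin (zariski N) V \<and> p \<in> V \<and> V \<subseteq> U \<and> restr F U V s = \<zero>\<^bsub>sections F V\<^esub>)"

text \<open>Every stalk \<open>F\<^sub>p\<close> is a torsion free module over the local domain \<open>\<O>\<^sub>p\<close>.\<close>

definition torsion_free :: "nat \<Rightarrow> ('k::field, 'a) proj_sheaf \<Rightarrow> bool" where
  "torsion_free N F \<longleftrightarrow>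
     (\<forall>U. \<forall>p\<in>U. \<forall>a\<in>carrier (regular_ring N U). \<forall>s\<in>carrier (sections F U).
        openin (zariski N) U \<and> germ_zero N F U (a \<odot>\<^bsub>sections F U\<^esub> s) p \<longrightarrow>
        germ_zero N (structure_sheaf N) U a p \<or> germ_zero N F U s p)"


section \<open>Serre twists and line bundles\<close>

definition coord_open :: "nat \<Rightarrow> nat \<Rightarrow> 'k::field point set" where
  "coord_open N i = {p \<in> proj_space N. \<forall>v\<in>p. v i \<noteq> 0}"

definition coord_ratio :: "nat \<Rightarrow> nat \<Rightarrow> 'k::field point \<Rightarrow> 'k" where
  "coord_ratio i j p = (THE c. \<forall>v\<in>p. c = v i / v j)"

text \<open>
  \<open>F(m)\<close> is glued, as in Serre's FAC, from the restrictions of \<open>F\<close> to the charts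
  \<open>D\<^sub>i = {x\<^sub>i \<noteq> 0}\<close> along the transition functions \<open>(x\<^sub>i / x\<^sub>j)\<^sup>m\<close> of \<open>\<O>(m)\<close>: a section over \<open>U\<close> is a family
  \<open>s i \<in> F(U \<inter> D\<^sub>i)\<close> with \<open>s j = (x\<^sub>i / x\<^sub>j)\<^sup>m s i\<close> on \<open>U \<inter> D\<^sub>i \<inter> D\<^sub>j\<close>.  For \<open>F = \<O>\<close> a local section
  \<open>h\<close> that is homogeneous of degree \<open>m\<close> corresponds to \<open>s i = h / x\<^sub>i\<^sup>m\<close>.
\<close>

definition twist :: "nat \<Rightarrow> int \<Rightarrow> ('k::field, 'a) proj_sheaf \<Rightarrow> ('k, nat \<Rightarrow> 'a) proj_sheaf" where
  "twist N m F =
     \<lparr>sections = (\<lambda>U.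
        \<lparr>carrier =
           {s \<in> \<Pi>\<^sub>E i\<in>{..N}. carrier (sections F (U \<inter> coord_open N i)).
              \<forall>i\<le>N. \<forall>j\<le>N. let W = U \<inter> coord_open N i \<inter> coord_open N j in
                restr F (U \<inter> coord_open N j) W (s j) =
                  (\<lambda>p\<in>W. coord_ratio i j p powi m) \<odot>\<^bsub>sections F W\<^esub>
                    restr F (U \<inter> coord_open N i) W (s i)},
         monoid.mult = undefined, one = undefined,
         zero = (\<lambda>i\<in>{..N}. \<zero>\<^bsub>sections F (U \<inter> coord_open N i)\<^esub>),
         add = (\<lambda>s t. \<lambda>i\<in>{..N}. s i \<oplus>\<^bsub>sections F (U \<inter> coord_open N i)\<^esub> t i),
         module.smult = (\<lambda>a s. \<lambda>i\<in>{..N}.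
           restrict a (U \<inter> coord_open N i) \<odot>\<^bsub>sections F (U \<inter> coord_open N i)\<^esub> s i)\<rparr>),
      restr = (\<lambda>U V s. \<lambda>i\<in>{..N}. restr F (U \<inter> coord_open N i) (V \<inter> coord_open N i) (s i))\<rparr>"

definition line_bundle :: "nat \<Rightarrow> int \<Rightarrow> ('k::field, nat \<Rightarrow> 'k point \<Rightarrow> 'k) proj_sheaf" where
  "line_bundle N a = twist N a (structure_sheaf N)"

definition is_split :: "nat \<Rightarrow> ('k::field, 'a) proj_sheaf \<Rightarrow> bool" where
  "is_split N F \<longleftrightarrow> (\<exists>r a. sheaf_iso N F (direct_sum r (\<lambda>i. line_bundle N (a i))))"


section \<open>Cohomology\<close>

text \<open>
  Cohomology is the direct limit of Cech cohomology over all open coverings, ordered by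
  refinement.  A covering is a set of open sets indexed by itself; every indexed covering
  refines, and is refined by, its set of members.  A \<open>q\<close>-simplex is a list of \<open>q + 1\<close> members.
\<close>

definition covers :: "'p topology \<Rightarrow> 'p set set set" where
  "covers X = {\<U>. (\<forall>U\<in>\<U>. openin X U) \<and> \<Union>\<U> = topspace X}"

definition simplices :: "nat \<Rightarrow> 'p set set \<Rightarrow> 'p set list set" where
  "simplices q \<U> = {\<sigma>. length \<sigma> = Suc q \<and> set \<sigma> \<subseteq> \<U>}"

definition face :: "nat \<Rightarrow> 'p list \<Rightarrow> 'p list" where
  "face j \<sigma> = take j \<sigma> @ drop (Suc j) \<sigma>"

definition cech_cochains ::
  "nat \<Rightarrow> ('p, 'k, 'a) sheaf_data \<Rightarrow> 'p set set \<Rightarrow> ('p set list \<Rightarrow> 'a) monoid" where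
  "cech_cochains q F \<U> =
     product_group (simplices q \<U>) (\<lambda>\<sigma>. add_monoid (sections F (\<Inter>(set \<sigma>))))"

definition cech_differential ::
  "nat \<Rightarrow> ('p, 'k, 'a) sheaf_data \<Rightarrow> 'p set set \<Rightarrow> ('p set list \<Rightarrow> 'a) \<Rightarrow> 'p set list \<Rightarrow> 'a" where
  "cech_differential q F \<U> c =
     (\<lambda>\<sigma>\<in>simplices (Suc q) \<U>.
        \<Oplus>\<^bsub>sections F (\<Inter>(set \<sigma>))\<^esub>j\<in>{..Suc q}.
          let t = restr F (\<Inter>(set (face j \<sigma>))) (\<Inter>(set \<sigma>)) (c (face j \<sigma>))
          in if even j then t else \<ominus>\<^bsub>sections F (\<Inter>(set \<sigma>))\<^esub> t)"

definition cech_cocycles ::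
  "nat \<Rightarrow> ('p, 'k, 'a) sheaf_data \<Rightarrow> 'p set set \<Rightarrow> ('p set list \<Rightarrow> 'a) set" where
  "cech_cocycles q F \<U> =
     kernel (cech_cochains q F \<U>) (cech_cochains (Suc q) F \<U>) (cech_differential q F \<U>)"

definition cech_coboundaries ::
  "nat \<Rightarrow> ('p, 'k, 'a) sheaf_data \<Rightarrow> 'p set set \<Rightarrow> ('p set list \<Rightarrow> 'a) set" where
  "cech_coboundaries q F \<U> =
     (case q of 0 \<Rightarrow> {\<one>\<^bsub>cech_cochains 0 F \<U>\<^esub>}
      | Suc p \<Rightarrow> cech_differential p F \<U> ` carrier (cech_cochains p F \<U>))"

definition refinement :: "'p set set \<Rightarrow> 'p set set \<Rightarrow> ('p set \<Rightarrow> 'p set) \<Rightarrow> bool" where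
  "refinement \<W> \<U> \<rho> \<longleftrightarrow> (\<forall>W\<in>\<W>. \<rho> W \<in> \<U> \<and> W \<subseteq> \<rho> W)"

definition cech_pullback ::
  "nat \<Rightarrow> ('p, 'k, 'a) sheaf_data \<Rightarrow> 'p set set \<Rightarrow> ('p set \<Rightarrow> 'p set) \<Rightarrow>
     ('p set list \<Rightarrow> 'a) \<Rightarrow> 'p set list \<Rightarrow> 'a" where
  "cech_pullback q F \<W> \<rho> c =
     (\<lambda>\<sigma>\<in>simplices q \<W>. restr F (\<Inter>(set (map \<rho> \<sigma>))) (\<Inter>(set \<sigma>)) (c (map \<rho> \<sigma>)))"

text \<open>
  Two cocycles on two coverings have the same class in the limit iff they become cohomologous
  on some common refinement.
\<close>

definition cech_equiv ::
  "nat \<Rightarrow> 'p topology \<Rightarrow> ('p, 'k, 'a) sheaf_data \<Rightarrow>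
     (('p set set \<times> ('p set list \<Rightarrow> 'a)) \<times> ('p set set \<times> ('p set list \<Rightarrow> 'a))) set" where
  "cech_equiv q X F =
     {((\<U>, c), (\<V>, d)).
        \<U> \<in> covers X \<and> c \<in> cech_cocycles q F \<U> \<and> \<V> \<in> covers X \<and> d \<in> cech_cocycles q F \<V> \<and>
        (\<exists>\<W>\<in>covers X. \<exists>\<rho> \<tau>. refinement \<W> \<U> \<rho> \<and> refinement \<W> \<V> \<tau> \<and>
           (\<exists>b\<in>cech_coboundaries q F \<W>.
              cech_pullback q F \<W> \<rho> c = cech_pullback q F \<W> \<tau> d \<otimes>\<^bsub>cech_cochains q F \<W>\<^esub> b))}"

text \<open>
  The limit group, in multiplicative notation.  The sum of two classes is computed from
  representatives on a common covering.
\<close>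

definition cohomology ::
  "nat \<Rightarrow> 'p topology \<Rightarrow> ('p, 'k, 'a) sheaf_data \<Rightarrow>
     ('p set set \<times> ('p set list \<Rightarrow> 'a)) set monoid" where
  "cohomology q X F =
     \<lparr>carrier = (SIGMA \<U>:covers X. cech_cocycles q F \<U>) // cech_equiv q X F,
      monoid.mult = (\<lambda>A B. cech_equiv q X F ``
                 {(\<W>, c \<otimes>\<^bsub>cech_cochains q F \<W>\<^esub> d) | \<W> c d. (\<W>, c) \<in> A \<and> (\<W>, d) \<in> B}),
      one = cech_equiv q X F `` {({topspace X}, \<one>\<^bsub>cech_cochains q F {topspace X}\<^esub>)}\<rparr>"

definition total_cohomology ::
  "nat \<Rightarrow> nat \<Rightarrow> ('k::field, 'a) proj_sheaf \<Rightarrow>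
     (int \<Rightarrow> ('k point set set \<times> ('k point set list \<Rightarrow> nat \<Rightarrow> 'a)) set) monoid" where
  "total_cohomology N i F = sum_group UNIV (\<lambda>m. cohomology i (zariski N) (twist N m F))"

end

theory Submission
  imports Defs "HOL-Computational_Algebra.Polynomial_Factorial" "HOL-Library.Function_Algebras"
begin

text \<open>
  A section of a torsion free coherent sheaf \<open>F\<close> that vanishes on a nonempty open set is zero.  Hence
  a minimal family of sections generating \<open>F\<close> over some nonempty open set provides coordinates which
  embed \<open>F\<close>, and with it all twists \<open>F(m)\<close>, in a constant sheaf \<open>K\<^sup>r\<close> over the fraction field \<open>K\<close> of
  \<open>k[x\<^sub>0, \<dots>, x\<^sub>N]\<close>: sections over \<open>U\<close> become intersections of stalks, and Cech cochains become functions
  on lists with values in one vector space.  Partitions of unity, which come from the Nullstellensatz,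
  and the double complex of two coverings show that the cohomology can be computed on any finite
  covering by basic open sets, in particular on the standard one.

  There the line bundles have no intermediate cohomology, because their cochains can be contracted
  monomial by monomial.  Conversely, let the intermediate cohomology of \<open>F\<close> vanish and let \<open>M\<close> be the
  graded module of the global sections of all \<open>F(m)\<close>.  The double complex built from Cech cochains
  and the Koszul complex of \<open>x\<^sub>0, \<dots>, x\<^sub>N\<close> shows that every relation \<open>\<Sum>i\<le>N. x\<^sub>i v\<^sub>i = 0\<close> in \<open>M\<close> is a
  combination of the trivial ones.  As \<open>M\<close> is zero in low degrees, a minimal set of homogeneous
  generators is then a basis, by induction on the degree; it is finite since the stalks are finitely
  generated, and it identifies \<open>F\<close> with a direct sum of line bundles.
\<close>

section \<open>Polynomials and forms\<close>

text \<open>Cohomology is a limit over all open coverings and sections are elements of an abstract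
  type, so neither can be computed with directly. After the embedding, restriction maps turn into
  identities, the sheaf can be forgotten in favour of its family of stalks, and an isomorphism of
  sheaves comes from one linear map of vector spaces that matches the stalks.

  The range of degrees is explained by the Koszul double complex. A relation between global sections
  starts at list length \<open>0\<close>; the chase uses Cech exactness at the lengths
  \<open>1, ..., N\<close>, where length \<open>n\<close> stands for cohomological degree
  \<open>n - 1\<close>. Length \<open>1\<close> is harmless, because the complexes are augmented by
  the global sections, so the degrees \<open>1, ..., N - 1\<close> remain. Length
  \<open>N + 1\<close> is also where the contraction for line bundles fails, as such a list may
  contain all variables.

  The lower bound for the degrees of \<open>M\<close>, where the induction starts, comes from
  denominators: one form clears those of all local generators, and a global section of
  \<open>\<O>(k)\<close> with \<open>k < 0\<close> is zero.\<close>

abbreviation "mcoeff \<equiv> Poly_Mapping.lookup"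
abbreviation "mkeys \<equiv> Poly_Mapping.keys"

definition mon_eval :: "(nat => 'b::comm_semiring_1) => (nat \<Rightarrow>\<^sub>0 nat) => 'b" where
  "mon_eval y m = (\<Prod>i\<in>mkeys m. y i ^ mcoeff m i)"

definition mdeg :: "(nat \<Rightarrow>\<^sub>0 nat) => nat" where
  "mdeg m = (\<Sum>i\<in>mkeys m. mcoeff m i)"

definition const :: "'k::zero => 'k mvpoly" where "const c = Poly_Mapping.single 0 c"

definition var :: "nat => 'k::zero_neq_one mvpoly" where
  "var i = Poly_Mapping.single (Poly_Mapping.single i 1) 1"

lemma mon_eval_superset:
  assumes "finite A" "mkeys m \<subseteq> A"
  shows "mon_eval y m = (\<Prod>i\<in>A. y i ^ mcoeff m i)"
  unfolding mon_eval_def by (rule prod.mono_neutral_left) (use assms in \<open>auto simp: in_keys_iff\<close>)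

lemma mdeg_superset:
  assumes "finite A" "mkeys m \<subseteq> A"
  shows "mdeg m = (\<Sum>i\<in>A. mcoeff m i)"
  unfolding mdeg_def by (rule sum.mono_neutral_left) (use assms in \<open>auto simp: in_keys_iff\<close>)

lemma mkeys_add_nat: "mkeys (m + n) = mkeys m \<union> mkeys (n :: nat \<Rightarrow>\<^sub>0 nat)"
  by (auto simp: in_keys_iff lookup_add)

lemma mon_eval_add: "mon_eval y (m + n) = mon_eval y m * mon_eval y n"
  by (simp add: mon_eval_superset[of "mkeys m \<union> mkeys n"] mkeys_add_nat lookup_add power_add
      prod.distrib)

lemma mdeg_add: "mdeg (m + n) = mdeg m + mdeg n"
  by (simp add: mdeg_superset[of "mkeys m \<union> mkeys n"] mkeys_add_nat lookup_add sum.distrib)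

lemma mon_eval_0 [simp]: "mon_eval y 0 = 1"
  by (simp add: mon_eval_def)

lemma mdeg_0 [simp]: "mdeg 0 = 0"
  by (simp add: mdeg_def)

lemma mon_eval_single [simp]: "mon_eval y (Poly_Mapping.single i 1) = y i"
  by (simp add: mon_eval_def)

lemma mdeg_single [simp]: "mdeg (Poly_Mapping.single i n) = n"
  by (simp add: mdeg_def)

lemma mon_eval_scale: "mon_eval (\<lambda>i. c * y i) m = c ^ mdeg m * mon_eval y m"
  by (simp add: mon_eval_def mdeg_def power_mult_distrib prod.distrib power_sum)

lemma sum_single_mcoeff: "(\<Sum>m\<in>mkeys f. Poly_Mapping.single m (mcoeff f m)) = f"
  by (rule poly_mapping_eqI)
    (auto simp: lookup_sum lookup_single when_def in_keys_iff if_distrib sum.delta)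

lemma mvpoly_induct [case_names zero add]:
  assumes "P 0"
    and "\<And>f m c. P f ==> P (f + Poly_Mapping.single m c)"
  shows "P (f :: 'a \<Rightarrow>\<^sub>0 'b::comm_monoid_add)"
proof -
  have "P (\<Sum>m\<in>A. Poly_Mapping.single m (mcoeff f m))" if "finite A" for A
    using that by induction (auto simp: assms add.commute[of "Poly_Mapping.single _ _"])
  from this[of "mkeys f"] show ?thesis by (simp add: sum_single_mcoeff)
qed

text \<open>Used for homogeneous components in the Nullstellensatz, for distributing the monomials
  of a form over the variables in \<open>forms_split\<close>, and for the contraction in
  \<open>std_acyclic\<close>.\<close>

definition pfilter :: "('a => bool) => ('a \<Rightarrow>\<^sub>0 'b::comm_monoid_add) => ('a \<Rightarrow>\<^sub>0 'b)" where
  "pfilter P f = (\<Sum>m\<in>{m\<in>mkeys f. P m}. Poly_Mapping.single m (mcoeff f m))"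

lemma mcoeff_pfilter: "mcoeff (pfilter P f) m = (if P m then mcoeff f m else 0)"
  by (auto simp: pfilter_def lookup_sum lookup_single when_def in_keys_iff if_distrib sum.delta)

lemma pfilter_add: "pfilter P (f + g) = pfilter P f + pfilter P g"
  by (rule poly_mapping_eqI) (simp add: mcoeff_pfilter lookup_add)

lemma pfilter_0 [simp]: "pfilter P 0 = 0"
  by (rule poly_mapping_eqI) (simp add: mcoeff_pfilter)

lemma mkeys_pfilter: "mkeys (pfilter P f) = {m\<in>mkeys f. P m}"
  by (auto simp: in_keys_iff mcoeff_pfilter split: if_splits)

text \<open>Polynomials have to be evaluated in the field itself, in univariate polynomials over
  \<open>'k mvpoly\<close> and in the field of rational functions, so the target is an arbitrary
  commutative ring that receives the field.\<close>

locale k_algebra =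
  fixes \<iota> :: "'k::field => 'b::comm_ring_1"
  assumes \<iota>_add: "\<iota> (a + b) = \<iota> a + \<iota> b"
    and \<iota>_mult: "\<iota> (a * b) = \<iota> a * \<iota> b"
    and \<iota>_1: "\<iota> 1 = 1"
begin

lemma \<iota>_0: "\<iota> 0 = 0"
  using \<iota>_add[of 0 0] by simp

lemma \<iota>_diff: "\<iota> (a - b) = \<iota> a - \<iota> b"
  using \<iota>_add[of "a - b" b] by simp

lemma \<iota>_uminus: "\<iota> (- a) = - \<iota> a"
  using \<iota>_diff[of 0 a] by (simp add: \<iota>_0)

lemma \<iota>_power: "\<iota> (a ^ n) = \<iota> a ^ n"
  by (induction n) (auto simp: \<iota>_1 \<iota>_mult)

definition peval :: "(nat => 'b) => 'k mvpoly => 'b" where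
  "peval y f = (\<Sum>m\<in>mkeys f. \<iota> (mcoeff f m) * mon_eval y m)"

lemma peval_superset:
  "finite A ==> mkeys f \<subseteq> A ==> peval y f = (\<Sum>m\<in>A. \<iota> (mcoeff f m) * mon_eval y m)"
  unfolding peval_def by (rule sum.mono_neutral_left) (auto simp: in_keys_iff \<iota>_0)

lemma peval_add: "peval y (f + g) = peval y f + peval y g"
proof -
  let ?A = "mkeys f \<union> mkeys g"
  have "mkeys (f + g) \<subseteq> ?A" by (rule Poly_Mapping.keys_add)
  thus ?thesis
    by (simp add: peval_superset[of ?A] lookup_add \<iota>_add distrib_right sum.distrib)
qed

lemma peval_0 [simp]: "peval y 0 = 0"
  by (simp add: peval_def)

lemma peval_single: "peval y (Poly_Mapping.single m c) = \<iota> c * mon_eval y m"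
  by (simp add: peval_superset[of "{m}"])

lemma peval_mult: "peval y (f * g) = peval y f * peval y g"
proof (induction f rule: mvpoly_induct)
  case (add f m c)
  have "peval y (Poly_Mapping.single m c * g) = peval y (Poly_Mapping.single m c) * peval y g"
  proof (induction g rule: mvpoly_induct)
    case (add g n d)
    thus ?case
      by (simp add: distrib_left peval_add mult_single peval_single \<iota>_mult mon_eval_add ac_simps)
  qed simp
  with add show ?case by (simp add: peval_add distrib_right)
qed simp

lemma peval_const [simp]: "peval y (const c) = \<iota> c"
  by (simp add: const_def peval_single)

lemma peval_1 [simp]: "peval y 1 = 1"
  using peval_const[of y 1] by (simp add: const_def \<iota>_1)

lemma peval_var [simp]: "peval y (var i) = y i"
  by (simp add: var_def peval_single \<iota>_1 flip: One_nat_def)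

lemma peval_sum: "peval y (sum f A) = (\<Sum>a\<in>A. peval y (f a))"
  by (induction A rule: infinite_finite_induct) (auto simp: peval_add)

lemma peval_uminus: "peval y (- f) = - peval y f"
  using peval_add[of y f "- f"] by (simp add: eq_neg_iff_add_eq_0 add.commute)

lemma peval_diff: "peval y (f - g) = peval y f - peval y g"
  using peval_add[of y f "- g"] by (simp add: peval_uminus)

lemma peval_power: "peval y (f ^ n) = peval y f ^ n"
  by (induction n) (auto simp: peval_mult)

lemma peval_cong:
  assumes "\<And>m i. m \<in> mkeys f ==> i \<in> mkeys m ==> y i = z i"
  shows "peval y f = peval z f"
  unfolding peval_def mon_eval_def
  by (intro sum.cong refl arg_cong2[of _ _ _ _ "(*)"] prod.cong) (use assms in auto)

end

interpretation k_eval: k_algebra "\<lambda>c::'k::field. c"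
  rewrites "k_eval.peval = (\<lambda>v f. poly_eval f v)"
proof -
  show "k_algebra (\<lambda>c::'k. c)" by unfold_locales auto
  thus "k_algebra.peval (\<lambda>c::'k. c) = (\<lambda>v f. poly_eval f v)"
    by (intro ext) (simp add: k_algebra.peval_def poly_eval_def mon_eval_def)
qed

lemmas poly_eval_simps [simp] =
  k_eval.peval_add k_eval.peval_mult k_eval.peval_0 k_eval.peval_1 k_eval.peval_const
  k_eval.peval_var k_eval.peval_sum k_eval.peval_diff k_eval.peval_uminus k_eval.peval_power

interpretation k_poly: k_algebra "const :: 'k::field => 'k mvpoly"
  by unfold_locales (auto simp: const_def single_add mult_single)

section \<open>Polynomials in finitely many variables, and forms\<close>

definition poly_vars :: "nat => 'k::field mvpoly set" where
  "poly_vars n = {f. \<forall>m\<in>mkeys f. mkeys m \<subseteq> {..<n}}"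

lemma poly_vars_0 [simp]: "0 \<in> poly_vars n" and poly_vars_const [simp]: "const c \<in> poly_vars n"
  and poly_vars_1 [simp]: "1 \<in> poly_vars n"
  by (auto simp: poly_vars_def const_def)

lemma poly_vars_var [simp]: "i < n ==> var i \<in> poly_vars n"
  by (auto simp: poly_vars_def var_def)

lemma poly_vars_add: "f \<in> poly_vars n ==> g \<in> poly_vars n ==> f + g \<in> poly_vars n"
  using Poly_Mapping.keys_add[of f g] by (fastforce simp: poly_vars_def)

lemma poly_vars_uminus: "f \<in> poly_vars n ==> - f \<in> poly_vars n"
  by (auto simp: poly_vars_def)

lemma poly_vars_diff: "f \<in> poly_vars n ==> g \<in> poly_vars n ==> f - g \<in> poly_vars n"
  using poly_vars_add[of f n "- g"] poly_vars_uminus[of g n] by simp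

lemma poly_vars_mult: "f \<in> poly_vars n ==> g \<in> poly_vars n ==> f * g \<in> poly_vars n"
  using Poly_Mapping.keys_mult[of f g] by (fastforce simp: poly_vars_def mkeys_add_nat)

lemma poly_vars_sum: "(\<And>a. a \<in> A ==> f a \<in> poly_vars n) ==> sum f A \<in> poly_vars n"
  by (induction A rule: infinite_finite_induct) (auto intro: poly_vars_add)

lemma poly_vars_mono: "n \<le> n' ==> poly_vars n \<subseteq> poly_vars n'"
  by (force simp: poly_vars_def)

lemma forms_alt: "forms N d = {f \<in> poly_vars (Suc N). \<forall>m\<in>mkeys f. mdeg m = d}"
  by (auto simp: forms_def poly_vars_def mdeg_def lessThan_Suc_atMost)

lemma forms_0 [simp]: "0 \<in> forms N d" by (simp add: forms_alt)
lemma forms_const [simp]: "const c \<in> forms N 0" by (auto simp: forms_alt const_def poly_vars_def)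
lemma forms_1 [simp]: "1 \<in> forms N 0" by (auto simp: forms_alt)
lemma forms_var [simp]: "i \<le> N ==> var i \<in> forms N (Suc 0)"
  by (auto simp: forms_alt var_def poly_vars_def)

lemma forms_add: "f \<in> forms N d ==> g \<in> forms N d ==> f + g \<in> forms N d"
  using Poly_Mapping.keys_add[of f g] by (auto simp: forms_alt poly_vars_add)

lemma forms_uminus: "f \<in> forms N d ==> - f \<in> forms N d"
  by (auto simp: forms_alt poly_vars_uminus)

lemma forms_diff: "f \<in> forms N d ==> g \<in> forms N d ==> f - g \<in> forms N d"
  using forms_add[of f N d "- g"] forms_uminus[of g N d] by simp

lemma forms_sum: "(\<And>a. a \<in> A ==> f a \<in> forms N d) ==> sum f A \<in> forms N d"
  by (induction A rule: infinite_finite_induct) (auto intro: forms_add)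

lemma forms_mult: "f \<in> forms N d ==> g \<in> forms N e ==> f * g \<in> forms N (d + e)"
  using Poly_Mapping.keys_mult[of f g] by (fastforce simp: forms_alt poly_vars_mult mdeg_add)

lemma forms_power: "f \<in> forms N d ==> f ^ k \<in> forms N (k * d)"
  by (induction k) (auto dest: forms_mult)

lemma forms_prod:
  "(\<And>a. a \<in> A ==> f a \<in> forms N (d a)) ==> prod f A \<in> forms N (sum d A)"
  by (induction A rule: infinite_finite_induct) (auto intro: forms_mult)

lemma forms_scale: "f \<in> forms N d ==> poly_eval f (\<lambda>i. c * v i) = c ^ d * poly_eval f v"
  by (auto simp: k_eval.peval_def mon_eval_scale sum_distrib_left forms_alt ac_simps
      intro!: sum.cong)

lemma pfilter_poly_vars: "f \<in> poly_vars n ==> pfilter P f \<in> poly_vars n"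
  by (auto simp: poly_vars_def mkeys_pfilter)

lemma pfilter_forms: "f \<in> forms N d ==> pfilter P f \<in> forms N d"
  by (auto simp: forms_alt mkeys_pfilter pfilter_poly_vars)

lemma pfilter_mdeg_form:
  "f \<in> forms N d ==> pfilter (\<lambda>m. mdeg m = e) f = (if d = e then f else 0)"
  by (rule poly_mapping_eqI) (auto simp: mcoeff_pfilter forms_alt in_keys_iff)

text \<open>Kronecker substitution: \<open>x\<^sub>i \<mapsto> t\<^sup>B\<^sup>i\<close> separates any finite set of monomials when \<open>B\<close>
  exceeds all exponents.\<close>

lemma digits_inj:
  fixes B :: nat
  assumes "\<And>i. a i < B" "\<And>i. b i < B"
    and "(\<Sum>i<n. a i * B ^ i) = (\<Sum>i<n. b i * B ^ i)"
  shows "\<forall>i<n. a i = b i"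
  using assms
proof (induction n arbitrary: a b)
  case (Suc n)
  have *: "(\<Sum>i<Suc n. c i * B ^ i) = c 0 + B * (\<Sum>i<n. c (Suc i) * B ^ i)" for c :: "nat => nat"
    by (simp add: sum.lessThan_Suc_shift sum_distrib_left ac_simps del: sum.lessThan_Suc)
  have eq: "a 0 + B * (\<Sum>i<n. a (Suc i) * B ^ i) = b 0 + B * (\<Sum>i<n. b (Suc i) * B ^ i)"
    using Suc.prems(3) by (simp only: *)
  have "(a 0 + B * (\<Sum>i<n. a (Suc i) * B ^ i)) mod B = a 0"
    "(b 0 + B * (\<Sum>i<n. b (Suc i) * B ^ i)) mod B = b 0"
    using Suc.prems(1,2)[of 0] by auto
  with eq have 0: "a 0 = b 0" by simp
  with eq Suc.prems(1)[of 0] have "(\<Sum>i<n. a (Suc i) * B ^ i) = (\<Sum>i<n. b (Suc i) * B ^ i)"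
    by auto
  from Suc.IH[of "\<lambda>i. a (Suc i)" "\<lambda>i. b (Suc i)", OF _ _ this] Suc.prems
  have "\<forall>i<n. a (Suc i) = b (Suc i)" by auto
  with 0 show ?case by (auto simp: less_Suc_eq_0_disj)
qed auto

lemma poly_eval_nonzero:
  fixes f :: "'k::{alg_closed_field, field_char_0} mvpoly"
  assumes "f \<in> poly_vars n" "f ~= 0"
  obtains v where "poly_eval f v ~= 0" "\<And>i. i \<ge> n ==> v i = 0"
proof -
  \<comment> \<open>\<open>B\<close> exceeds every exponent of \<open>f\<close>; the inserted
    \<open>0\<close> keeps \<open>Max\<close> meaningful when \<open>n = 0\<close>.\<close>
  define B where "B = Suc (Max (insert 0 (\<Union>m\<in>mkeys f. mcoeff m ` {..<n})))"
  have B: "mcoeff m i < B" if "m \<in> mkeys f" for m i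
  proof (cases "i < n")
    case True
    hence "mcoeff m i \<le> Max (insert 0 (\<Union>m\<in>mkeys f. mcoeff m ` {..<n}))"
      using that by (intro Max_ge) auto
    thus ?thesis by (simp add: B_def)
  next
    case False
    hence "i \<notin> mkeys m" using assms that by (auto simp: poly_vars_def)
    thus ?thesis by (simp add: B_def in_keys_iff)
  qed
  define w where "w m = (\<Sum>i<n. mcoeff m i * B ^ i)" for m
  have inj: "inj_on w (mkeys f)"
  proof (rule inj_onI)
    fix m m' assume *: "m \<in> mkeys f" "m' \<in> mkeys f" "w m = w m'"
    hence "\<forall>i<n. mcoeff m i = mcoeff m' i"
      unfolding w_def using B by (intro digits_inj[of _ B]) auto
    moreover have "i \<notin> mkeys m" "i \<notin> mkeys m'" if "\<not> i < n" for i
      using * that assms by (auto simp: poly_vars_def)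
    hence "mcoeff m i = 0" "mcoeff m' i = 0" if "\<not> i < n" for i
      using that by (auto simp: in_keys_iff)
    ultimately show "m = m'" by (intro poly_mapping_eqI) metis
  qed
  define q where "q = (\<Sum>m\<in>mkeys f. Polynomial.monom (mcoeff f m) (w m))"
  obtain m0 where m0: "m0 \<in> mkeys f" using assms(2) by (metis all_not_in_conv keys_eq_empty)
  have "coeff q (w m0) = (\<Sum>m\<in>mkeys f. if m = m0 then mcoeff f m else 0)"
    unfolding q_def coeff_sum
    by (intro sum.cong) (use inj m0 in \<open>auto dest: inj_onD\<close>)
  hence "coeff q (w m0) ~= 0"
    using m0 by (simp add: in_keys_iff)
  hence "q ~= 0" by auto
  hence "finite {t. poly q t = 0}" by (rule poly_roots_finite)
  moreover have "infinite (UNIV :: 'k set)" by (rule infinite_UNIV_char_0)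
  ultimately obtain t where t: "poly q t ~= 0"
    by (metis (mono_tags, lifting) UNIV_I finite_subset mem_Collect_eq subsetI)
  define v where "v i = (if i < n then t ^ (B ^ i) else 0)" for i
  have "mon_eval v m = t ^ w m" if "m \<in> mkeys f" for m
  proof -
    have "mon_eval v m = (\<Prod>i<n. v i ^ mcoeff m i)"
      using that assms by (intro mon_eval_superset) (auto simp: poly_vars_def)
    also have "\<dots> = (\<Prod>i<n. t ^ (mcoeff m i * B ^ i))"
      by (intro prod.cong) (auto simp: v_def power_mult mult.commute[of "mcoeff m _"])
    finally show ?thesis by (simp add: w_def power_sum)
  qed
  hence "poly_eval f v = poly q t"
    by (simp add: k_eval.peval_def q_def poly_sum poly_monom)
  with t that[of v] show thesis by (auto simp: v_def)
qed

section \<open>The Nullstellensatz\<close>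

lemma peval_hom:
  assumes "k_algebra \<iota>" "k_algebra \<iota>'"
    and "\<And>a b. h (a + b) = h a + h b" "\<And>a b. h (a * b) = h a * h b" "\<And>c. h (\<iota> c) = \<iota>' c"
  shows "h (k_algebra.peval \<iota> y f) = k_algebra.peval \<iota>' (\<lambda>i. h (y i)) f"
proof -
  interpret A: k_algebra \<iota> by fact
  interpret B: k_algebra \<iota>' by fact
  have h0: "h 0 = 0" using assms(3)[of 0 0] by simp
  have h1: "h 1 = 1" using assms(5)[of 1] by (simp add: A.\<iota>_1 B.\<iota>_1)
  have pow: "h (a ^ n) = h a ^ n" for a n by (induction n) (auto simp: h1 assms(4))
  have "h (prod g S) = prod (\<lambda>i. h (g i)) S" for g :: "nat => _" and S
    by (induction S rule: infinite_finite_induct) (auto simp: h1 assms(4))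
  hence mon: "h (mon_eval y m) = mon_eval (\<lambda>i. h (y i)) m" for m
    by (simp add: mon_eval_def pow)
  show ?thesis
    by (induction f rule: mvpoly_induct)
      (simp_all add: h0 A.peval_add B.peval_add A.peval_single B.peval_single assms mon)
qed

lemma peval_id: "k_algebra.peval (\<lambda>c. c) v f = poly_eval f v"
proof -
  have "k_algebra (\<lambda>c::'a. c)" by unfold_locales auto
  thus ?thesis by (simp add: k_algebra.peval_def poly_eval_def mon_eval_def)
qed

text \<open>Treats \<open>poly_vars n\<close> as the algebra generated by constants and variables,
  which suits statements about subrings and about sets stable under evaluated polynomials.\<close>

lemma poly_vars_induct [consumes 1, case_names const var add mult]:
  assumes "f \<in> poly_vars n"
    and const: "\<And>c. P (const c)" and var: "\<And>i. i < n ==> P (var i)"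
    and add: "\<And>f g. P f ==> P g ==> P (f + g)" and mult: "\<And>f g. P f ==> P g ==> P (f * g)"
  shows "P (f :: 'k::field mvpoly)"
proof -
  have P1: "P 1" using const[of 1] by (simp add: const_def)
  have pow: "P g ==> P (g ^ k)" for g k by (induction k) (auto intro: mult P1)
  have prod: "(\<And>i. i \<in> S ==> P (g i)) ==> P (prod g S)" for g :: "nat => _" and S
    by (induction S rule: infinite_finite_induct) (auto intro: mult P1)
  have P0: "P 0" using const[of 0] by (simp add: const_def)
  have sum: "(\<And>i. i \<in> S ==> P (g i)) ==> P (sum g S)" for g :: "(nat \<Rightarrow>\<^sub>0 nat) => _" and S
    by (induction S rule: infinite_finite_induct) (auto intro: add P0)
  have single: "Poly_Mapping.single m c = const c * mon_eval var m" for m and c :: 'k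
  proof -
    have "mon_eval var m = (Poly_Mapping.single m 1 :: 'k mvpoly)"
    proof -
      have var_pow: "var i ^ k = (Poly_Mapping.single (Poly_Mapping.single i k) 1 :: 'k mvpoly)" for i k
        by (induction k) (auto simp: var_def mult_single simp flip: single_add)
      have "(\<Prod>i\<in>S. Poly_Mapping.single (g i) 1) = (Poly_Mapping.single (sum g S) 1 :: 'k mvpoly)"
        for g :: "nat => (nat \<Rightarrow>\<^sub>0 nat)" and S
        by (induction S rule: infinite_finite_induct) (auto simp: mult_single)
      thus ?thesis by (simp add: mon_eval_def var_pow sum_single_mcoeff)
    qed
    thus ?thesis by (simp add: const_def mult_single)
  qed
  have "P (Poly_Mapping.single m c)" if "mkeys m \<subseteq> {..<n}" for m c
    unfolding single mon_eval_def using that by (intro mult const prod pow var) auto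
  hence "P (\<Sum>m\<in>mkeys f. Poly_Mapping.single m (mcoeff f m))"
    using assms(1) by (intro sum) (auto simp: poly_vars_def)
  thus ?thesis by (simp add: sum_single_mcoeff)
qed

text \<open>Elimination takes the place of the determinant trick: in the relation for the last
  element its own coefficient is \<open>u - c d\<close>, again congruent to \<open>1\<close> modulo
  \<open>J\<close>, and the relation is substituted into the others after multiplying them by this
  coefficient. \<open>J\<close> is closed under ring operations without being an ideal of the whole
  ring, because it will be an ideal of a subring of evaluated polynomials.\<close>

lemma nakayama:
  fixes w :: "nat => 'b::comm_ring_1"
  assumes J: "0 \<in> J" "\<And>a b. a \<in> J ==> b \<in> J ==> a + b \<in> J" "\<And>a. a \<in> J ==> - a \<in> J"
    "\<And>a b. a \<in> J ==> b \<in> J ==> a * b \<in> J"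
    and I: "\<And>a b. a \<in> I ==> b \<in> I ==> a + b \<in> I" "\<And>a b. a \<in> J ==> b \<in> I ==> a * b \<in> I" "0 \<in> I"
    and w: "\<forall>l<d. \<exists>u c. u - 1 \<in> J \<and> (\<forall>m<d. c m \<in> J) \<and> u * w l - (\<Sum>m<d. c m * w m) \<in> I"
  shows "\<exists>u. u - 1 \<in> J \<and> (\<forall>l<d. u * w l \<in> I)"
  using w
proof (induction d)
  case 0
  thus ?case by (intro exI[of _ 1]) (simp add: J)
next
  case (Suc d)
  have unit_mult: "u * v - 1 \<in> J" if "u - 1 \<in> J" "v - 1 \<in> J" for u v
  proof -
    have "u * v - 1 = (u - 1) * (v - 1) + (u - 1) + (v - 1)" by (simp add: algebra_simps)
    also have "\<dots> \<in> J" using that by (intro J)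
    finally show ?thesis .
  qed
  have unit_J: "u * a \<in> J" if "u - 1 \<in> J" "a \<in> J" for u a
  proof -
    have "u * a = (u - 1) * a + a" by (simp add: algebra_simps)
    moreover have "\<dots> \<in> J" using that by (intro J)
    ultimately show ?thesis by simp
  qed
  have unit_I: "u * a \<in> I" if "u - 1 \<in> J" "a \<in> I" for u a
  proof -
    have "u * a = (u - 1) * a + a" by (simp add: algebra_simps)
    moreover have "\<dots> \<in> I" using that by (intro I)
    ultimately show ?thesis by simp
  qed
  have sum_I: "(\<And>m. m < k ==> g m \<in> I) ==> (\<Sum>m<k. g m) \<in> I" for g and k :: nat
    by (induction k) (auto intro: I)
  from Suc.prems obtain u c where uc: "u - 1 \<in> J" "\<And>m. m < Suc d ==> c m \<in> J"
    "u * w d - (\<Sum>m<Suc d. c m * w m) \<in> I" by blast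
  define v where "v = u - c d"
  have v: "v - 1 \<in> J"
    using J(2)[OF uc(1) J(3)[OF uc(2)[of d]]] by (simp add: v_def algebra_simps)
  have vd: "v * w d - (\<Sum>m<d. c m * w m) \<in> I"
    using uc(3) by (simp add: v_def algebra_simps)
  have "\<forall>l<d. \<exists>u c. u - 1 \<in> J \<and> (\<forall>m<d. c m \<in> J) \<and> u * w l - (\<Sum>m<d. c m * w m) \<in> I"
  proof (intro allI impI)
    fix l assume "l < d"
    with Suc.prems obtain u' c' where u'c': "u' - 1 \<in> J" "\<And>m. m < Suc d ==> c' m \<in> J"
      "u' * w l - (\<Sum>m<Suc d. c' m * w m) \<in> I" using less_SucI by blast
    \<comment> \<open>Adding the multiple \<open>c' d\<close> of the relation for \<open>w d\<close>
      cancels the \<open>w d\<close> term in the relation for \<open>w l\<close>.\<close>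
    have "v * (u' * w l - (\<Sum>m<Suc d. c' m * w m)) + c' d * (v * w d - (\<Sum>m<d. c m * w m)) \<in> I"
      by (intro I(1) unit_I[OF v] I(2) u'c' vd) simp
    also have "v * (u' * w l - (\<Sum>m<Suc d. c' m * w m)) + c' d * (v * w d - (\<Sum>m<d. c m * w m))
        = (v * u') * w l - (\<Sum>m<d. (v * c' m + c' d * c m) * w m)"
      by (simp add: algebra_simps sum.distrib sum_distrib_left)
    finally show "\<exists>u c. u - 1 \<in> J \<and> (\<forall>m<d. c m \<in> J) \<and> u * w l - (\<Sum>m<d. c m * w m) \<in> I"
      by (intro exI[of _ "v * u'"] exI[of _ "\<lambda>m. v * c' m + c' d * c m"] conjI allI impI
          unit_mult J(2,4) unit_J v u'c' uc) auto
  qed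
  from Suc.IH[OF this] obtain u2 where u2: "u2 - 1 \<in> J" "\<And>l. l < d ==> u2 * w l \<in> I" by blast
  have "u2 * (v * w d - (\<Sum>m<d. c m * w m)) + (\<Sum>m<d. c m * (u2 * w m)) \<in> I"
    by (intro I(1) sum_I unit_I[OF u2(1)] vd I(2) uc u2) auto
  hence *: "(v * u2) * w d \<in> I"
    by (simp add: algebra_simps sum_distrib_left)
  have "(v * u2) * w l \<in> I" if "l < d" for l
    using unit_I[OF v u2(2)[OF that]] by (simp add: ac_simps)
  with * have "(v * u2) * w l \<in> I" if "l < Suc d" for l
    using that less_Suc_eq by blast
  with unit_mult[OF v u2(1)] show ?case by (intro exI[of _ "v * u2"]) simp
qed

section \<open>Univariate polynomials: top coefficients, ring maps, ideals\<close>

lemma coeff_mult_bounds: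
  assumes "degree p \<le> a" "degree q \<le> b"
  shows "coeff (p * q) (a + b) = coeff p a * coeff (q :: 'a::comm_semiring_0 poly) b"
proof -
  have "coeff (p * q) (a + b) = (\<Sum>i\<le>a + b. coeff p i * coeff q (a + b - i))"
    by (simp add: coeff_mult)
  also have "\<dots> = (\<Sum>i\<in>{a}. coeff p i * coeff q (a + b - i))"
  proof (rule sum.mono_neutral_right)
    show "\<forall>i\<in>{..a + b} - {a}. coeff p i * coeff q (a + b - i) = 0"
    proof
      fix i assume i: "i \<in> {..a + b} - {a}"
      show "coeff p i * coeff q (a + b - i) = 0"
      proof (cases "i < a")
        case True
        hence "coeff q (a + b - i) = 0" using assms(2) by (intro coeff_eq_0) linarith
        thus ?thesis by simp
      next
        case False
        hence "coeff p i = 0" using assms(1) i by (intro coeff_eq_0) auto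
        thus ?thesis by simp
      qed
    qed
  qed auto
  finally show ?thesis by simp
qed

lemma poly_as_sum_upto: "degree p \<le> n ==> poly p x = (\<Sum>i\<le>n. coeff p i * x ^ i)"
  for p :: "'a::comm_ring_1 poly"
  unfolding poly_altdef by (rule sum.mono_neutral_left) (auto simp: coeff_eq_0)

lemma mon_eval_linear_poly:
  fixes c :: "nat => 'a::comm_ring_1 poly"
  assumes "\<And>i. degree (c i) \<le> 1"
  shows "degree (mon_eval c m) \<le> mdeg m"
    and "coeff (mon_eval c m) (mdeg m) = mon_eval (\<lambda>i. coeff (c i) 1) m"
proof -
  have pow: "degree (c i ^ k) \<le> k \<and> coeff (c i ^ k) k = coeff (c i) 1 ^ k" for i k
  proof (induction k)
    case (Suc k)
    thus ?case
      using coeff_mult_bounds[OF assms[of i], of "c i ^ k" k] degree_mult_le[of "c i" "c i ^ k"]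
        assms[of i] by auto
  qed auto
  have "degree (\<Prod>i\<in>S. c i ^ e i) \<le> (\<Sum>i\<in>S. e i) \<and>
      coeff (\<Prod>i\<in>S. c i ^ e i) (\<Sum>i\<in>S. e i) = (\<Prod>i\<in>S. coeff (c i) 1 ^ e i)" for S e
  proof (induction S rule: infinite_finite_induct)
    case (insert x F)
    thus ?case
      using coeff_mult_bounds[of "c x ^ e x" "e x" "\<Prod>i\<in>F. c i ^ e i" "\<Sum>i\<in>F. e i"]
        degree_mult_le[of "c x ^ e x" "\<Prod>i\<in>F. c i ^ e i"] pow[of x "e x"] by auto
  qed auto
  thus "degree (mon_eval c m) \<le> mdeg m"
    "coeff (mon_eval c m) (mdeg m) = mon_eval (\<lambda>i. coeff (c i) 1) m"
    by (auto simp: mon_eval_def mdeg_def)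
qed

lemma map_poly_hom:
  assumes "\<And>a b. h (a + b) = h a + h b" "\<And>a b. h (a * b) = h a * (h b :: 'b::comm_ring_1)"
  shows "map_poly h (p + q) = map_poly h p + map_poly h (q :: 'a::comm_ring_1 poly)"
    and "map_poly h (p * q) = map_poly h p * map_poly h q"
proof -
  have h0: "h 0 = 0" using assms(1)[of 0 0] by simp
  have sum: "h (sum g S) = (\<Sum>i\<in>S. h (g i))" for g :: "nat => 'a" and S
    by (induction S rule: infinite_finite_induct) (auto simp: h0 assms)
  show "map_poly h (p + q) = map_poly h p + map_poly h q"
    by (rule poly_eqI) (simp add: coeff_map_poly h0 assms)
  show "map_poly h (p * q) = map_poly h p * map_poly h q"
    by (rule poly_eqI) (simp add: coeff_map_poly h0 assms coeff_mult sum)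
qed

text \<open>A nonzero element of least degree divides all the others, by division with remainder,
  and is not constant because \<open>1\<close> is excluded; each of its roots will do.\<close>

lemma ideal_poly_common_root:
  fixes T :: "'k::alg_closed_field poly set"
  assumes add: "\<And>p q. p \<in> T ==> q \<in> T ==> p + q \<in> T" and mult: "\<And>p q. q \<in> T ==> p * q \<in> T"
    and "1 \<notin> T"
  shows "\<exists>t. \<forall>q\<in>T. poly q t = 0"
proof (cases "T \<subseteq> {0}")
  case False
  then obtain p where p: "p \<in> T" "p ~= 0" "\<And>q. q \<in> T ==> q ~= 0 ==> degree p \<le> degree q"
    using ex_has_least_nat[of "\<lambda>p. p \<in> T \<and> p ~= 0" _ degree] by (metis insertI1 subsetI)
  have "degree p > 0"
  proof (rule ccontr)
    assume "\<not> degree p > 0"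
    then obtain c where "p = [:c:]" "c ~= 0" using p(2) by (metis degree_eq_zeroE neq0_conv pCons_0_0)
    hence "[:1 / c:] * p = 1" by (simp add: one_pCons)
    with mult[OF p(1)] assms(3) show False by metis
  qed
  then obtain t where t: "poly p t = 0" using alg_closed_imp_poly_has_root by blast
  have "poly q t = 0" if "q \<in> T" for q
  proof -
    have "q mod p = q + (- (q div p)) * p" by (simp add: minus_div_mult_eq_mod)
    hence "q mod p \<in> T" using add[OF that mult[OF p(1)]] by metis
    hence "q mod p = 0" using p degree_mod_less'[of p q] by fastforce
    hence "p dvd q" by auto
    thus ?thesis using t by auto
  qed
  thus ?thesis by blast
next
  case True
  hence "\<forall>q\<in>T. poly q 0 = 0" by auto
  thus ?thesis by blast
qed

text \<open>The weak Nullstellensatz, by induction on the number of variables. If the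
  \<open>y i\<close> satisfy a nontrivial relation modulo \<open>I\<close>, a linear change of
  coordinates makes it monic in the last variable up to a constant. The induction hypothesis gives a
  zero in the other coordinates, and it extends: by Nakayama's lemma the specialisations of the
  relations at this zero form a proper ideal of univariate polynomials. \<open>I\<close> is asked to
  be stable only under the subalgebra generated by the \<open>y i\<close>.\<close>

lemma subalgebra_ideal_zero:
  fixes \<iota> :: "'k::{alg_closed_field, field_char_0} => 'b::comm_ring_1"
  assumes alg: "k_algebra \<iota>" and I: "0 \<in> I" "\<And>a b. a \<in> I ==> b \<in> I ==> a + b \<in> I" "1 \<notin> I"
    and "\<And>f a. f \<in> poly_vars n ==> a \<in> I ==> k_algebra.peval \<iota> y f * a \<in> I"
  shows "\<exists>v. \<forall>f\<in>poly_vars n. k_algebra.peval \<iota> y f \<in> I --> poly_eval f v = 0"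
  using assms(5)
proof (induction n arbitrary: y)
  interpret A: k_algebra \<iota> by (rule alg)
  case 0
  have "poly_eval f v = 0" if "f \<in> poly_vars 0" "A.peval y f \<in> I" for f v
  proof (rule ccontr)
    assume ne: "poly_eval f v ~= 0"
    have f: "f = const (mcoeff f 0)"
      using that(1)
      by (intro poly_mapping_eqI)
        (auto simp: const_def lookup_single when_def poly_vars_def in_keys_iff keys_eq_empty)
    hence c: "mcoeff f 0 ~= 0" using ne by (metis A.\<iota>_0 k_eval.peval_const)
    have "A.peval y (const (1 / mcoeff f 0)) * A.peval y f \<in> I"
      by (rule "0.prems") (use that in auto)
    also have "A.peval y (const (1 / mcoeff f 0)) * A.peval y f = 1"
      by (subst f) (use c in \<open>simp flip: A.\<iota>_mult add: A.\<iota>_1\<close>)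
    finally show False using I by simp
  qed
  thus ?case by blast
next
  interpret A: k_algebra \<iota> by (rule alg)
  case (Suc n)
  note Imult = Suc.prems
  show ?case
  proof (cases "\<forall>f\<in>poly_vars (Suc n). A.peval y f \<in> I --> f = 0")
    case True
    thus ?thesis by (metis k_eval.peval_0)
  next
    case False
    then obtain f0 where f0: "f0 \<in> poly_vars (Suc n)" "A.peval y f0 \<in> I" "f0 ~= 0" by blast
    have Iuminus: "- a \<in> I" if "a \<in> I" for a
      using Imult[OF poly_vars_uminus[OF poly_vars_1] that] by (simp add: A.peval_uminus)
    have Idiff: "a - b \<in> I" if "a \<in> I" "b \<in> I" for a b
      using I(2)[OF that(1) Iuminus[OF that(2)]] by simp
    define d where "d = Max (mdeg ` mkeys f0)"
    have d: "mdeg m \<le> d" if "m \<in> mkeys f0" for m using that by (auto simp: d_def)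
    have ne: "mdeg ` mkeys f0 ~= {}" using f0(3) by simp
    obtain m0 where m0: "m0 \<in> mkeys f0" "mdeg m0 = d"
      using Max_in[OF _ ne] by (auto simp: d_def)
    define fd where "fd = pfilter (\<lambda>m. mdeg m = d) f0"
    have fd_form: "fd \<in> forms n d"
      using f0 by (auto simp: fd_def forms_alt pfilter_poly_vars mkeys_pfilter)
    have "m0 \<in> mkeys fd" using m0 by (simp add: fd_def mkeys_pfilter)
    moreover have "var n ~= (0 :: 'k mvpoly)"
    proof
      assume "var n = (0 :: 'k mvpoly)"
      hence "poly_eval (var n) (\<lambda>_. 1 :: 'k) = 0" by (simp only: k_eval.peval_0)
      thus False by simp
    qed
    \<comment> \<open>The factor \<open>var n\<close> makes the last coordinate of the point
      nonzero, so that it can be scaled to \<open>1\<close> in \<open>lam\<close>.\<close>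
    ultimately have "fd * var n ~= 0" by auto
    moreover have "fd * var n \<in> poly_vars (Suc n)"
      using fd_form by (auto simp: forms_alt intro!: poly_vars_mult)
    ultimately obtain v where v: "poly_eval (fd * var n) v ~= 0"
      using poly_eval_nonzero by blast
    hence vn: "v n ~= 0" and "poly_eval fd v ~= 0" by auto
    define lam where "lam i = v i / v n" for i
    have "poly_eval fd lam = (1 / v n) ^ d * poly_eval fd v"
      using forms_scale[OF fd_form, of "1 / v n" v] by (simp add: lam_def[abs_def])
    with \<open>poly_eval fd v ~= 0\<close> vn have fd_lam: "poly_eval fd lam ~= 0" by simp
    have lam_n: "lam n = 1" using vn by (simp add: lam_def)

    \<comment> \<open>Noether normalisation by the shear \<open>y i = z i + lam i * y n\<close>. A
      polynomial in the new coordinates is an element of \<open>P\<close>, the last coordinate being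
      the variable of the univariate polynomial; \<open>c\<close> substitutes the old coordinates
      and \<open>Z\<close> evaluates at the new ones.\<close>
    define z where "z i = (if i < n then y i - \<iota> (lam i) * y n else y i)" for i
    define P where "P = {p :: 'k mvpoly poly. \<forall>j. coeff p j \<in> poly_vars n}"
    define c where "c i = (if i < n then [:var i, const (lam i):] else [:0, const (lam i):])" for i
    define ic where "ic a = [:const a:]" for a :: 'k
    interpret C: k_algebra ic
      by unfold_locales (auto simp: ic_def k_poly.\<iota>_add k_poly.\<iota>_mult k_poly.\<iota>_1 one_pCons)
    define Z where "Z p = poly (map_poly (A.peval z) p) (z n)" for p
    have Z_add: "Z (p + q) = Z p + Z q" and Z_mult: "Z (p * q) = Z p * Z q" for p q
      by (simp_all add: Z_def map_poly_hom A.peval_add A.peval_mult)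
    have Z_alt: "Z p = (\<Sum>j\<le>e. A.peval z (coeff p j) * z n ^ j)" if "degree p \<le> e" for p e
      unfolding Z_def
      by (subst poly_as_sum_upto[where n = e])
        (use that in \<open>auto simp: coeff_map_poly coeff_eq_0 intro!: degree_le\<close>)
    have P_add: "p + q \<in> P" if "p \<in> P" "q \<in> P" for p q
      using that by (auto simp: P_def intro: poly_vars_add)
    have P_mult: "p * q \<in> P" if "p \<in> P" "q \<in> P" for p q
      using that by (auto simp: P_def coeff_mult intro!: poly_vars_mult poly_vars_sum)
    have P_diff: "p - q \<in> P" if "p \<in> P" "q \<in> P" for p q
      using that by (auto simp: P_def intro: poly_vars_diff)
    have P_const: "[:f:] \<in> P" if "f \<in> poly_vars n" for f
      using that by (auto simp: P_def coeff_pCons split: nat.split)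
    have P_monom: "Polynomial.monom f j \<in> P" if "f \<in> poly_vars n" for f j
      using that by (auto simp: P_def)
    have z_in: "\<exists>g\<in>poly_vars (Suc n). A.peval z f = A.peval y g" if "f \<in> poly_vars (Suc n)" for f
      using that
    proof (induction rule: poly_vars_induct)
      case (const a)
      thus ?case by (intro bexI[of _ "const a"]) auto
    next
      case (var i)
      thus ?case
        by (intro bexI[of _ "if i < n then var i - const (lam i) * var n else var i"])
          (auto simp: z_def A.peval_diff A.peval_mult intro!: poly_vars_diff poly_vars_mult)
    next
      case (add f g)
      thus ?case by (metis A.peval_add poly_vars_add)
    next
      case (mult f g)
      thus ?case by (metis A.peval_mult poly_vars_mult)
    qed
    have Imult_z: "A.peval z f * a \<in> I" if "f \<in> poly_vars (Suc n)" "a \<in> I" for f a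
      using z_in[OF that(1)] Imult that(2) by metis
    have Imult_z': "A.peval z f * a \<in> I" if "f \<in> poly_vars n" "a \<in> I" for f a
      using that poly_vars_mono[of n "Suc n"] by (intro Imult_z) auto
    have Isum: "(\<And>j. j \<in> S ==> g j \<in> I) ==> sum g S \<in> I" for g and S :: "nat set"
      by (induction S rule: infinite_finite_induct) (auto intro: I)
    have Imult_Z: "Z p * a \<in> I" if "p \<in> P" "a \<in> I" for p a
    proof -
      have "A.peval z (var n) * b \<in> I" if "b \<in> I" for b using that by (intro Imult_z) auto
      hence "z n * b \<in> I" if "b \<in> I" for b using that by simp
      hence pow: "z n ^ j * b \<in> I" if "b \<in> I" for b j
        using that by (induction j) (auto simp: mult.assoc)
      show ?thesis
        unfolding Z_alt[OF order_refl] sum_distrib_right mult.assoc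
        by (intro Isum Imult_z' pow) (use that in \<open>auto simp: P_def\<close>)
    qed

    from Suc.IH[OF Imult_z'] obtain a where
      a: "\<And>f. f \<in> poly_vars n ==> A.peval z f \<in> I ==> poly_eval f a = 0" by blast

    define p0 where "p0 = C.peval c f0"
    have c_deg: "degree (c i) \<le> 1" for i by (simp add: c_def)
    have ic_P: "ic b \<in> P" for b by (simp add: ic_def P_const)
    have Z_ic: "Z (ic b) = \<iota> b" for b by (simp add: Z_def ic_def map_poly_pCons)
    have C_peval_P: "C.peval c f \<in> P" if "f \<in> poly_vars (Suc n)" for f
      using that
    proof (induction rule: poly_vars_induct)
      case (var i)
      thus ?case by (auto simp: c_def P_def coeff_pCons split: nat.split)
    qed (auto simp: C.peval_add C.peval_mult intro: P_add P_mult ic_P)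
    have p0_P: "p0 \<in> P" unfolding p0_def by (rule C_peval_P) (rule f0)
    have Z_C: "Z (C.peval c f) = A.peval y f" if "f \<in> poly_vars (Suc n)" for f
    proof -
      have "Z (C.peval c f) = A.peval (\<lambda>i. Z (c i)) f"
        by (rule peval_hom[OF C.k_algebra_axioms alg Z_add Z_mult Z_ic])
      also have "\<dots> = A.peval y f"
      proof (rule A.peval_cong)
        fix m i assume "m \<in> mkeys f" "i \<in> mkeys m"
        hence "i \<le> n" using that by (fastforce simp: poly_vars_def)
        then consider "i < n" | "i = n" by linarith
        thus "Z (c i) = y i"
          by cases (auto simp: Z_def c_def map_poly_pCons z_def lam_n A.\<iota>_1)
      qed
      finally show ?thesis .
    qed
    have Z_p0: "Z p0 \<in> I" unfolding p0_def using Z_C f0 by simp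
    have deg_p0: "degree p0 \<le> d"
      unfolding p0_def C.peval_def
    proof (intro degree_sum_le finite_keys)
      fix m assume "m \<in> mkeys f0"
      thus "degree (ic (mcoeff f0 m) * mon_eval c m) \<le> d"
        using degree_mult_le[of "ic (mcoeff f0 m)" "mon_eval c m"] mon_eval_linear_poly(1)[of c m] c_deg d[of m]
        by (fastforce simp: ic_def)
    qed
    define al where "al = poly_eval fd lam"
    \<comment> \<open>Only the monomials of top degree reach the coefficient of index
      \<open>d\<close>, and in them each variable contributes its linear coefficient
      \<open>lam i\<close>; the result is the constant value of \<open>fd\<close> at
      \<open>lam\<close>.\<close>
    have lead_p0: "coeff p0 d = const al"
    proof -
      have "coeff p0 d = (\<Sum>m\<in>mkeys f0. coeff (ic (mcoeff f0 m) * mon_eval c m) d)"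
        by (simp add: p0_def C.peval_def coeff_sum)
      also have "\<dots> = (\<Sum>m\<in>mkeys f0. if mdeg m = d then const (mcoeff f0 m * mon_eval lam m) else 0)"
      proof (intro sum.cong refl)
        fix m assume m: "m \<in> mkeys f0"
        have le: "degree (mon_eval c m) \<le> mdeg m" using c_deg by (rule mon_eval_linear_poly)
        show "coeff (ic (mcoeff f0 m) * mon_eval c m) d =
            (if mdeg m = d then const (mcoeff f0 m * mon_eval lam m) else 0)"
        proof (cases "mdeg m = d")
          case True
          have "coeff (mon_eval c m) d = mon_eval (\<lambda>i. coeff (c i) 1) m"
            using mon_eval_linear_poly(2)[of c m, OF c_deg] True by simp
          also have "(\<lambda>i. coeff (c i) 1) = (\<lambda>i. const (lam i))"
            by (auto simp: c_def)
          also have "mon_eval (\<lambda>i. const (lam i)) m = const (mon_eval lam m)"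
          proof -
            have "const (prod g S) = (\<Prod>i\<in>S. const (g i))" for g :: "nat => 'k" and S
              by (induction S rule: infinite_finite_induct)
                (auto simp: k_poly.\<iota>_1 k_poly.\<iota>_mult)
            thus ?thesis by (simp add: mon_eval_def k_poly.\<iota>_power)
          qed
          finally show ?thesis using True by (simp add: ic_def k_poly.\<iota>_mult)
        next
          case False
          hence "degree (mon_eval c m) < d" using le d[OF m] by linarith
          thus ?thesis using False by (simp add: ic_def coeff_eq_0)
        qed
      qed
      also have "\<dots> = (\<Sum>m\<in>mkeys fd. const (mcoeff f0 m * mon_eval lam m))"
        by (simp add: fd_def mkeys_pfilter sum.If_cases Int_def)
      also have "\<dots> = (\<Sum>m\<in>mkeys fd. const (mcoeff fd m * mon_eval lam m))"
        by (intro sum.cong) (auto simp: fd_def mcoeff_pfilter mkeys_pfilter)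
      also have "\<dots> = const al"
      proof -
        have "const (sum g S) = (\<Sum>i\<in>S. const (g i))" for g :: "(nat \<Rightarrow>\<^sub>0 nat) => 'k" and S
          by (induction S rule: infinite_finite_induct) (auto simp: k_poly.\<iota>_0 k_poly.\<iota>_add)
        thus ?thesis by (simp add: al_def k_eval.peval_def)
      qed
      finally show ?thesis .
    qed
    have al: "al ~= 0" using fd_lam by (simp add: al_def)

    define J where "J = {g \<in> poly_vars n. poly_eval g a = 0}"
    have J_mult: "f * g \<in> J" if "f \<in> poly_vars n" "g \<in> J" for f g
      using that by (auto simp: J_def intro: poly_vars_mult)
    have J_diff: "f - g \<in> J" if "f \<in> J" "g \<in> J" for f g
      using that by (auto simp: J_def intro: poly_vars_diff)
    have J_add: "f + g \<in> J" if "f \<in> J" "g \<in> J" for f g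
      using that by (auto simp: J_def intro: poly_vars_add)
    have J_0: "0 \<in> J" by (simp add: J_def)
    have J_sum: "(\<And>j. j \<in> S ==> g j \<in> J) ==> sum g S \<in> J" for g and S :: "nat set"
      by (induction S rule: infinite_finite_induct) (auto intro: J_add J_0)
    \<comment> \<open>Division by \<open>p0\<close>, whose leading coefficient is a nonzero
      constant: the degree drops below \<open>d\<close>, the coefficients stay in \<open>J\<close>,
      and \<open>Z p\<close> changes by an element of \<open>I\<close> because \<open>Z p0\<close>
      lies in \<open>I\<close>.\<close>
    have reduce: "\<exists>r. (\<forall>j. coeff r j \<in> J) \<and> (\<forall>j\<ge>d. coeff r j = 0) \<and> Z p - Z r \<in> I"
      if "\<forall>j. coeff p j \<in> J" for p
      using that
    proof (induction "degree p" arbitrary: p rule: less_induct)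
      case less
      show ?case
      proof (cases "\<forall>j\<ge>d. coeff p j = 0")
        case True
        with less.prems I(1) show ?thesis by (intro exI[of _ p]) auto
      next
        case False
        define e where "e = degree p"
        have e: "e \<ge> d" using False by (auto simp: e_def dest: le_degree)
        define q where "q = Polynomial.monom (const (1 / al) * coeff p e) (e - d)"
        have q: "coeff (q * p0) j \<in> J" for j
          unfolding coeff_mult
        proof (intro J_sum)
          fix i
          have "coeff q i \<in> J"
            using less.prems by (auto simp: q_def J_def intro!: poly_vars_mult)
          thus "coeff q i * coeff p0 (j - i) \<in> J"
            using J_mult[of "coeff p0 (j - i)" "coeff q i"] p0_P by (simp add: P_def mult.commute)
        qed
        define p' where "p' = p - q * p0"
        have p'_J: "\<forall>j. coeff p' j \<in> J" using less.prems q by (auto simp: p'_def intro: J_diff)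
        have "degree q \<le> e - d" by (simp add: q_def degree_monom_le)
        hence "coeff (q * p0) (e - d + d) = coeff q (e - d) * coeff p0 d"
          using deg_p0 by (rule coeff_mult_bounds)
        also have "\<dots> = const (1 / al) * const al * coeff p e"
          by (simp add: q_def lead_p0 ac_simps)
        also have "const (1 / al) * const al = 1"
          using al by (simp flip: k_poly.\<iota>_mult add: k_poly.\<iota>_1)
        finally have "coeff p' e = 0" using e by (simp add: p'_def)
        moreover have "degree p' \<le> e"
          using \<open>degree q \<le> e - d\<close> deg_p0 e degree_mult_le[of q p0]
          by (auto simp: p'_def e_def intro!: degree_diff_le)
        ultimately have "p' = 0 \<or> degree p' < e"
          by (metis le_neq_implies_less leading_coeff_0_iff)
        have "Z p = Z p' + Z q * Z p0"
          using Z_add[of p' "q * p0"] by (simp add: p'_def Z_mult)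
        moreover have "Z q * Z p0 \<in> I"
          using less.prems by (intro Imult_Z Z_p0)
            (auto simp: q_def J_def intro!: P_monom poly_vars_mult)
        ultimately have diff: "Z p - Z p' \<in> I" by simp
        from \<open>p' = 0 \<or> degree p' < e\<close> show ?thesis
        proof
          assume "p' = 0"
          with diff show ?thesis by (intro exI[of _ 0]) (auto simp: J_0)
        next
          assume "degree p' < e"
          from less.hyps[OF this[unfolded e_def] p'_J] obtain r where
            r: "\<forall>j. coeff r j \<in> J" "\<forall>j\<ge>d. coeff r j = 0" "Z p' - Z r \<in> I" by blast
          have "Z p - Z r = (Z p - Z p') + (Z p' - Z r)" by simp
          also have "\<dots> \<in> I" by (intro I diff r)
          finally show ?thesis using r by blast
        qed
      qed
    qed

    define E where "E p = map_poly (\<lambda>g. poly_eval g a) p" for p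
    have E_add: "E (p + q) = E p + E q" and E_mult: "E (p * q) = E p * E q" for p q
      by (simp_all add: E_def map_poly_hom)
    define T where "T = {E p | p. p \<in> P \<and> Z p \<in> I}"
    \<comment> \<open>If \<open>p\<close> specialises to \<open>1\<close>, the coefficients of
      \<open>1 - p\<close> lie in \<open>J\<close>. Multiplying \<open>1 - p\<close> by the
      \<open>l\<close>-th power of the variable and reducing expresses \<open>z n ^ l\<close> modulo
      \<open>I\<close> by the powers below \<open>d\<close> with coefficients from \<open>J\<close>,
      which is the input of \<open>nakayama\<close>.\<close>
    have one_notin: "1 \<notin> T"
    proof
      assume "1 \<in> T"
      then obtain p where p: "E p = 1" "p \<in> P" "Z p \<in> I" by (auto simp: T_def)
      have e: "coeff (1 - p) j \<in> J" for j
      proof -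
        have "poly_eval (coeff p j) a = coeff (E p) j" by (simp add: E_def coeff_map_poly)
        hence "poly_eval (coeff (1 - p) j) a = 0" by (simp add: p(1) coeff_1 coeff_diff)
        moreover have "coeff (1 - p) j \<in> poly_vars n"
          using P_diff[OF P_const[OF poly_vars_1] p(2)] by (simp add: P_def one_pCons)
        ultimately show ?thesis by (simp add: J_def)
      qed
      have "\<exists>u. u - 1 \<in> A.peval z ` J \<and> (\<forall>l<d. u * z n ^ l \<in> I)"
      proof (rule nakayama, goal_cases)
        case (8)
        show ?case
        proof (intro allI impI)
          fix l assume "l < d"
          define q :: "'k mvpoly poly" where "q = Polynomial.monom 1 l"
          have "\<forall>j. coeff (q * (1 - p)) j \<in> J"
            unfolding coeff_mult using e
            by (intro allI J_sum J_mult) (auto simp: q_def simp del: coeff_diff)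
          from reduce[OF this] obtain r where
            r: "\<forall>j. coeff r j \<in> J" "\<forall>j\<ge>d. coeff r j = 0" "Z (q * (1 - p)) - Z r \<in> I" by blast
          have "degree r \<le> d" using r(2) by (intro degree_le) auto
          hence Zr: "Z r = (\<Sum>j<d. A.peval z (coeff r j) * z n ^ j)"
            using r(2) by (simp add: Z_alt lessThan_Suc_atMost[symmetric])
          have Zq: "Z q = z n ^ l"
            by (simp add: Z_def q_def map_poly_monom poly_monom)
          have "Z q * Z p \<in> I" by (intro Imult_Z p) (simp add: q_def P_monom)
          hence "Z (q * (1 - p)) - Z r + Z q * Z p \<in> I" using r(3) by (intro I)
          also have "Z (q * (1 - p)) - Z r + Z q * Z p = Z q - Z r"
            using Z_add[of "q * (1 - p)" "q * p"] by (simp add: Z_mult algebra_simps)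
          finally have "1 * z n ^ l - (\<Sum>j<d. A.peval z (coeff r j) * z n ^ j) \<in> I"
            by (simp add: Zq Zr)
          with r(1) show "\<exists>u c. u - 1 \<in> A.peval z ` J \<and> (\<forall>m<d. c m \<in> A.peval z ` J) \<and>
              u * z n ^ l - (\<Sum>m<d. c m * z n ^ m) \<in> I"
            by (intro exI[of _ 1] exI[of _ "\<lambda>j. A.peval z (coeff r j)"])
              (auto intro!: image_eqI[of _ _ 0] simp: J_def)
        qed
      next
        case 1
        thus ?case by (auto intro!: image_eqI[of _ _ 0] simp: J_def)
      next
        case (2 a b)
        thus ?case by (auto simp flip: A.peval_add intro!: imageI J_add)
      next
        case (3 a)
        thus ?case by (auto simp flip: A.peval_uminus intro!: imageI simp: J_def poly_vars_uminus)
      next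
        case (4 a b)
        thus ?case
          by (auto simp flip: A.peval_mult intro!: imageI J_mult) (auto simp: J_def)
      next
        case (6 a b)
        thus ?case by (auto simp: J_def intro!: Imult_z')
      qed (use I in auto)
      then obtain g where g: "g \<in> J" "\<And>l. l < d ==> (A.peval z g + 1) * z n ^ l \<in> I"
        by (metis (no_types, lifting) diff_add_cancel image_iff)
      \<comment> \<open>For \<open>d = 0\<close> the relation \<open>p0\<close> is itself a nonzero
        constant. Otherwise the power \<open>l = 0\<close> puts \<open>g + 1\<close> into
        \<open>I\<close>, so it would have to vanish at \<open>a\<close>, where its value is
        \<open>1\<close>.\<close>
      show False
      proof (cases "d = 0")
        case True
        have "coeff p0 j = (if j = 0 then const al else 0)" for j
          using lead_p0 deg_p0 True by (auto intro!: coeff_eq_0)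
        hence "p0 = [:const al:]" by (intro poly_eqI) (auto simp: coeff_pCons split: nat.split)
        hence "\<iota> al \<in> I" using Z_p0 by (simp add: Z_def map_poly_pCons)
        hence "A.peval z (const (1 / al)) * \<iota> al \<in> I" by (intro Imult_z') auto
        thus False using I(3) al by (simp flip: A.\<iota>_mult add: A.\<iota>_1)
      next
        case False
        hence "A.peval z (g + 1) \<in> I" using g(2)[of 0] by (simp add: A.peval_add)
        hence "poly_eval (g + 1) a = 0"
          using g(1) by (intro a) (auto simp: J_def intro: poly_vars_add)
        with g(1) show False by (auto simp: J_def)
      qed
    qed
    have "\<exists>t. \<forall>q\<in>T. poly q t = 0"
    proof (rule ideal_poly_common_root[OF _ _ one_notin])
      fix p q assume "p \<in> T" "q \<in> T"
      then obtain p' q' where "p = E p'" "q = E q'" "p' \<in> P" "q' \<in> P" "Z p' \<in> I" "Z q' \<in> I"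
        by (auto simp: T_def)
      thus "p + q \<in> T"
        unfolding T_def using P_add I(2) by (auto simp: E_add Z_add intro!: exI[of _ "p' + q'"])
    next
      fix p q :: "'k poly" assume "q \<in> T"
      then obtain q' where q': "q = E q'" "q' \<in> P" "Z q' \<in> I" by (auto simp: T_def)
      \<comment> \<open>Every univariate polynomial is the specialisation of one with constant
        coefficients, so \<open>T\<close> is stable under multiplication.\<close>
      define p' where "p' = map_poly const p"
      have p': "p' \<in> P" by (auto simp: p'_def P_def coeff_map_poly k_poly.\<iota>_0)
      have "E p' = p"
        by (rule poly_eqI) (simp add: E_def p'_def coeff_map_poly k_poly.\<iota>_0)
      thus "p * q \<in> T"
        unfolding T_def using P_mult[OF p' q'(2)] Imult_Z[OF p' q'(3)]
        by (auto simp: E_mult Z_mult q'(1) intro!: exI[of _ "p' * q'"])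
    qed
    then obtain t where t: "\<And>q. q \<in> T ==> poly q t = 0" by blast
    have E_ic: "E (ic x) = [:x:]" for x by (simp add: E_def ic_def map_poly_pCons)
    define b where "b i = poly (E (c i)) t" for i
    have "poly_eval f b = 0" if f: "f \<in> poly_vars (Suc n)" "A.peval y f \<in> I" for f
    proof -
      have "poly (E (C.peval c f)) t = poly_eval f b"
        unfolding b_def
        using peval_hom[OF C.k_algebra_axioms k_eval.k_algebra_axioms, where h = "\<lambda>p. poly (E p) t"]
        by (simp add: E_add E_mult E_ic peval_id)
      moreover have "E (C.peval c f) \<in> T"
        unfolding T_def using C_peval_P[OF f(1)] Z_C[OF f(1)] f(2) by auto
      ultimately show ?thesis using t by simp
    qed
    thus ?thesis by blast
  qed
qed

section \<open>The graded Nullstellensatz\<close>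

lemma pfilter_mdeg_mult:
  assumes "g \<in> forms N a"
  shows "pfilter (\<lambda>m. mdeg m = a + j) (g * f) = g * pfilter (\<lambda>m. mdeg m = j) f"
proof (induction f rule: mvpoly_induct)
  case (add f m c)
  let ?s = "Poly_Mapping.single m c"
  have "\<forall>m'\<in>mkeys (g * ?s). mdeg m' = a + mdeg m"
    using assms Poly_Mapping.keys_mult[of g ?s] by (fastforce simp: forms_alt mdeg_add split: if_splits)
  hence "pfilter (\<lambda>m. mdeg m = a + j) (g * ?s) = (if mdeg m = j then g * ?s else 0)"
    by (intro poly_mapping_eqI) (force simp: mcoeff_pfilter in_keys_iff)
  also have "\<dots> = g * pfilter (\<lambda>m. mdeg m = j) ?s"
  proof -
    have "pfilter (\<lambda>m. mdeg m = j) ?s = (if mdeg m = j then ?s else 0)"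
      by (rule poly_mapping_eqI) (auto simp: mcoeff_pfilter lookup_single when_def)
    thus ?thesis by simp
  qed
  finally show ?case
    using add by (simp add: distrib_left pfilter_add)
qed simp

lemma pfilter_mdeg_mult':
  assumes "g \<in> forms N a" "e < a"
  shows "pfilter (\<lambda>m. mdeg m = e) (g * f) = 0"
proof -
  have "mdeg m ~= e" if "m \<in> mkeys (g * f)" for m
    using that assms Poly_Mapping.keys_mult[of g f] by (fastforce simp: forms_alt mdeg_add)
  thus ?thesis by (intro poly_mapping_eqI) (auto simp: mcoeff_pfilter in_keys_iff)
qed

text \<open>The ring containing \<open>k[x\<^sub>0, \<dots>, x\<^sub>N, 1/h]\<close> in the Rabinowitsch argument is the field of
  rational functions.\<close>

theorem nullstellensatz_graded:
  fixes I :: "nat => 'k::{alg_closed_field, field_char_0} mvpoly set"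
  assumes I: "\<And>e. I e \<subseteq> forms N e" "\<And>e. 0 \<in> I e" "\<And>e f g. f \<in> I e ==> g \<in> I e ==> f + g \<in> I e"
    "\<And>a e f g. f \<in> forms N a ==> g \<in> I e ==> f * g \<in> I (a + e)"
    and h: "h \<in> forms N d"
    and zeros: "\<And>v. \<forall>i>N. v i = 0 ==> \<forall>e. \<forall>g\<in>I e. poly_eval g v = 0 ==> poly_eval h v = 0"
  shows "\<exists>K. h ^ K \<in> I (K * d)"
proof (cases "h = 0")
  case True
  thus ?thesis using I(2) by (intro exI[of _ 1]) auto
next
  case False
  define \<iota> where "\<iota> c = to_fract (const c)" for c :: 'k
  interpret A: k_algebra \<iota>
    by unfold_locales (auto simp: \<iota>_def k_poly.\<iota>_add k_poly.\<iota>_mult k_poly.\<iota>_1)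
  \<comment> \<open>The additional variable \<open>var (Suc N)\<close> is sent to the inverse of
    \<open>h\<close>. \<open>S\<close> then collects the polynomials all of whose homogeneous
    components belong to the graded ideal.\<close>
  define y where "y i = (if i \<le> N then to_fract (var i) else 1 / to_fract h)" for i
  define S where "S = {f \<in> poly_vars (Suc N). \<forall>e. pfilter (\<lambda>m. mdeg m = e) f \<in> I e}"
  have S_add: "f + g \<in> S" if "f \<in> S" "g \<in> S" for f g
    using that I by (auto simp: S_def pfilter_add poly_vars_add)
  have S_mult: "f * g \<in> S" if "f \<in> forms N a" "g \<in> S" for f g a
  proof -
    have "pfilter (\<lambda>m. mdeg m = e) (f * g) \<in> I e" for e
    proof (cases "e < a")
      case True
      thus ?thesis using that I by (simp add: pfilter_mdeg_mult'[of f N a e g])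
    next
      case False
      then obtain j where "e = a + j" using le_Suc_ex not_less by blast
      thus ?thesis using pfilter_mdeg_mult[OF that(1)] that I(4) by (simp add: S_def)
    qed
    thus ?thesis using that by (auto simp: S_def forms_alt intro!: poly_vars_mult)
  qed
  have h_pow: "h ^ k \<in> forms N (k * d)" for k by (rule forms_power[OF h])
  have ne: "to_fract h ~= 0" using False by simp
  have to_fract_pow: "to_fract (f ^ k) = to_fract f ^ k" for f :: "'k mvpoly" and k
    by (induction k) auto
  \<comment> \<open>The ideal after inverting \<open>h\<close>; a representation of \<open>1\<close>
    as an element of \<open>J\<close> exhibits a power of \<open>h\<close> in
    \<open>S\<close>.\<close>
  define J where "J = {to_fract f / to_fract h ^ k | f k. f \<in> S}"
  have J_I: "x \<in> J" if "f \<in> S" "x = to_fract f / to_fract h ^ k" for x f k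
    using that by (auto simp: J_def)
  have J_add: "x + y \<in> J" if "x \<in> J" "y \<in> J" for x y
  proof -
    from that obtain f k f' k' where *: "x = to_fract f / to_fract h ^ k" "f \<in> S"
      "y = to_fract f' / to_fract h ^ k'" "f' \<in> S" by (auto simp: J_def)
    have "x + y = to_fract (h ^ k' * f + h ^ k * f') / to_fract h ^ (k + k')"
      using ne by (simp add: * divide_simps power_add to_fract_pow)
    moreover have "h ^ k' * f + h ^ k * f' \<in> S"
      by (intro S_add S_mult[OF h_pow] *)
    ultimately show ?thesis by (rule J_I[rotated])
  qed
  have J0: "0 \<in> J" using I(2) by (auto simp: J_def S_def intro!: exI[of _ 0])
  have J_form: "to_fract f * x \<in> J" if "f \<in> forms N a" "x \<in> J" for f a x
  proof -
    from that obtain g k where "x = to_fract g / to_fract h ^ k" "g \<in> S" by (auto simp: J_def)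
    hence "to_fract f * x = to_fract (f * g) / to_fract h ^ k" "f * g \<in> S"
      using that by (auto intro: S_mult)
    thus ?thesis by (rule J_I[rotated])
  qed
  have J_mult: "A.peval y f * x \<in> J" if "f \<in> poly_vars (N + 2)" "x \<in> J" for f x
    using that
  proof (induction arbitrary: x rule: poly_vars_induct)
    case (const c)
    thus ?case using J_form[of "const c" 0] by (simp add: A.peval_const[unfolded \<iota>_def] flip: \<iota>_def)
  next
    case (var i)
    show ?case
    proof (cases "i \<le> N")
      case True
      thus ?thesis using J_form[OF forms_var] var by (simp add: y_def)
    next
      case False
      from var obtain g k where "x = to_fract g / to_fract h ^ k" "g \<in> S" by (auto simp: J_def)
      hence "1 / to_fract h * x = to_fract g / to_fract h ^ (Suc k)" "g \<in> S"
        by (auto simp: field_simps)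
      hence "1 / to_fract h * x \<in> J" by (intro J_I)
      thus ?thesis using False by (simp add: y_def)
    qed
  qed (auto simp: A.peval_add A.peval_mult distrib_right mult.assoc intro: J_add)
  \<comment> \<open>Otherwise all of \<open>J\<close> has a common zero \<open>v\<close>. The
    relation \<open>h * var (Suc N) - 1\<close> keeps \<open>h\<close> from vanishing at
    \<open>v\<close>, while every element of the graded ideal vanishes there.\<close>
  have "1 \<in> J"
  proof (rule ccontr)
    assume "1 \<notin> J"
    from subalgebra_ideal_zero[OF A.k_algebra_axioms J0 J_add this J_mult] obtain v where
      v: "\<And>f. f \<in> poly_vars (N + 2) ==> A.peval y f \<in> J ==> poly_eval f v = 0" by blast
    have peval_form: "A.peval y g = to_fract g" if "g \<in> poly_vars (Suc N)" for g
      using that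
    proof (induction rule: poly_vars_induct)
      case (const c)
      thus ?case unfolding A.peval_const by (simp add: \<iota>_def)
    qed (auto simp: A.peval_add A.peval_mult y_def)
    have mono: "g \<in> poly_vars (N + 2)" if "g \<in> poly_vars (Suc N)" for g :: "'k mvpoly"
      using that poly_vars_mono[of "Suc N" "N + 2"] by auto
    have h_vars: "h \<in> poly_vars (Suc N)" using h by (simp add: forms_alt)
    have "poly_eval (h * var (Suc N) - 1) v = 0"
    proof (rule v)
      show "A.peval y (h * var (Suc N) - 1) \<in> J"
        using ne J0 by (simp add: A.peval_diff A.peval_mult peval_form[OF h_vars] y_def)
    qed (use mono[OF h_vars] in \<open>auto intro!: poly_vars_diff poly_vars_mult\<close>)
    hence hv: "poly_eval h v ~= 0" by auto
    define w where "w i = (if i \<le> N then v i else 0)" for i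
    have w: "poly_eval g w = poly_eval g v" if "g \<in> poly_vars (Suc N)" for g
      by (rule k_eval.peval_cong) (use that in \<open>fastforce simp: poly_vars_def w_def\<close>)
    have "poly_eval h w = 0"
    proof (rule zeros)
      show "\<forall>e. \<forall>g\<in>I e. poly_eval g w = 0"
      proof (intro allI ballI)
        fix e g assume g: "g \<in> I e"
        hence "g \<in> forms N e" using I(1) by blast
        hence "g \<in> S" and gv: "g \<in> poly_vars (Suc N)"
          using g I(2) by (auto simp: S_def pfilter_mdeg_form) (simp add: forms_alt)+
        hence "to_fract g / to_fract h ^ 0 \<in> J" by (intro J_I[OF _ refl])
        thus "poly_eval g w = 0"
          using w[OF gv] v[OF mono[OF gv]] peval_form[OF gv] by simp
      qed
    qed (auto simp: w_def)
    with hv w[OF h_vars] show False by simp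
  qed
  then obtain f k where fk: "1 = to_fract f / to_fract h ^ k" "f \<in> S" by (auto simp: J_def)
  hence "to_fract (h ^ k) = to_fract f" using ne by (simp add: to_fract_pow divide_simps)
  hence "h ^ k \<in> S" using fk by simp
  hence "pfilter (\<lambda>m. mdeg m = k * d) (h ^ k) \<in> I (k * d)" by (auto simp: S_def)
  thus ?thesis using pfilter_mdeg_form[OF h_pow, of "k * d" k] by auto
qed

section \<open>Points, open sets and local rings of projective space\<close>

abbreviation "zopen N U \<equiv> openin (zariski N) U"

abbreviation "secs F U \<equiv> carrier (sections F U)"

type_synonym 'k ratfun = "'k mvpoly fract"

text \<open>The value at one chosen coordinate vector. For a form its vanishing does not depend on
  the choice, and neither does the quotient of two forms of equal degree; see
  \<open>poly_eval_fval\<close>.\<close>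

definition fval :: "'k::field point => 'k mvpoly => 'k" where
  "fval p f = poly_eval f (SOME v. v \<in> p)"

lemma fval_simps [simp]:
  "fval p 0 = 0" "fval p 1 = 1" "fval p (f + g) = fval p f + fval p g"
  "fval p (f * g) = fval p f * fval p g" "fval p (- f) = - fval p f"
  "fval p (f - g) = fval p f - fval p g" "fval p (f ^ k) = fval p f ^ k"
  "fval p (const c) = c" "fval p (sum h A) = (\<Sum>a\<in>A. fval p (h a))"
  by (simp_all add: fval_def)

lemma fval_prod: "fval p (prod h A) = (\<Prod>a\<in>A. fval p (h a))"
  by (induction A rule: infinite_finite_induct) auto

lemma proj_space_E:
  assumes "p \<in> proj_space N"
  obtains v where "v \<in> p" "v = (SOME v. v \<in> p)" "v ~= (\<lambda>_. 0)" "\<forall>i>N. v i = 0"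
    "p = {w. \<exists>c. c ~= 0 \<and> w = (\<lambda>i. c * v i)}"
proof -
  from assms obtain u where u: "u ~= (\<lambda>_. 0)" "\<forall>i>N. u i = 0"
    "p = {w. \<exists>c. c ~= 0 \<and> w = (\<lambda>i. c * u i)}" by (auto simp: proj_space_def)
  define v where "v = (SOME v. v \<in> p)"
  have "u \<in> p" unfolding u by (auto intro!: exI[of _ 1])
  hence "v \<in> p" unfolding v_def by (rule someI[of "\<lambda>v. v \<in> p"])
  then obtain c where c: "c ~= 0" "v = (\<lambda>i. c * u i)" unfolding u by auto
  have "p = {w. \<exists>c. c ~= 0 \<and> w = (\<lambda>i. c * v i)}"
  proof (intro equalityI subsetI)
    fix w assume "w \<in> p"
    then obtain b where "b ~= 0" "w = (\<lambda>i. b * u i)" unfolding u by auto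
    thus "w \<in> {w. \<exists>c. c ~= 0 \<and> w = (\<lambda>i. c * v i)}"
      using c by (intro CollectI exI[of _ "b / c"]) auto
  next
    fix w assume "w \<in> {w. \<exists>c. c ~= 0 \<and> w = (\<lambda>i. c * v i)}"
    then obtain b where "b ~= 0" "w = (\<lambda>i. b * v i)" by auto
    thus "w \<in> p" unfolding u using c by (intro CollectI exI[of _ "b * c"]) (auto simp: mult.assoc)
  qed
  moreover have "v ~= (\<lambda>_. 0)" "\<forall>i>N. v i = 0" using c u by (auto simp: fun_eq_iff)
  ultimately show thesis using \<open>v \<in> p\<close> by (intro that[of v]) (auto simp: v_def)
qed

lemma poly_eval_fval:
  assumes "p \<in> proj_space N" "v \<in> p"
  obtains c where "c ~= 0" "\<And>d f. f \<in> forms N d ==> poly_eval f v = c ^ d * fval p f"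
proof -
  from assms(1) obtain u where u: "u = (SOME v. v \<in> p)" "p = {w. \<exists>c. c ~= 0 \<and> w = (\<lambda>i. c * u i)}"
    by (rule proj_space_E)
  from assms(2) obtain c where c: "c ~= 0" "v = (\<lambda>i. c * u i)" unfolding u(2) by auto
  have "poly_eval f v = c ^ d * fval p f" if "f \<in> forms N d" for f d
    using forms_scale[OF that, of c u] c(2) by (simp only: fval_def u(1))
  with c(1) show thesis by (rule that)
qed

lemma basic_open_fval:
  assumes "f \<in> forms N d"
  shows "basic_open N f = {p \<in> proj_space N. fval p f ~= 0}"
proof -
  have "(\<forall>v\<in>p. poly_eval f v ~= 0) \<longleftrightarrow> fval p f ~= 0" if p: "p \<in> proj_space N" for p
  proof
    assume *: "\<forall>v\<in>p. poly_eval f v ~= 0"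
    obtain v where "v \<in> p" "v = (SOME v. v \<in> p)" using p by (rule proj_space_E)
    thus "fval p f ~= 0" using * unfolding fval_def by metis
  next
    assume "fval p f ~= 0"
    show "\<forall>v\<in>p. poly_eval f v ~= 0"
    proof
      fix v assume "v \<in> p"
      from poly_eval_fval[OF p this] obtain c where "c ~= 0"
        "\<And>d f. f \<in> forms N d ==> poly_eval f v = c ^ d * fval p f" by blast
      with assms \<open>fval p f ~= 0\<close> show "poly_eval f v ~= 0" by simp
    qed
  qed
  thus ?thesis unfolding basic_open_def by blast
qed

lemma basic_open_mult:
  assumes "f \<in> forms N d" "g \<in> forms N e"
  shows "basic_open N (f * g) = basic_open N f \<inter> basic_open N g"
  using assms forms_mult[OF assms] by (auto simp: basic_open_fval)

lemma point_of:
  assumes "v ~= (\<lambda>_. 0)" "\<forall>i>N. v i = 0"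
  obtains p where "p \<in> proj_space N" "v \<in> p" "\<And>d f. f \<in> forms N d ==> fval p f = 0 \<longleftrightarrow> poly_eval f v = 0"
proof -
  define p where "p = {w. \<exists>c. c ~= 0 \<and> w = (\<lambda>i. c * v i)}"
  have "p \<in> proj_space N" unfolding proj_space_def p_def using assms by blast
  moreover have "v \<in> p" unfolding p_def by (auto intro!: exI[of _ 1])
  ultimately have p: "p \<in> proj_space N" "v \<in> p" .
  from poly_eval_fval[OF p] obtain c where "c ~= 0"
    "\<And>d f. f \<in> forms N d ==> poly_eval f v = c ^ d * fval p f" by blast
  with p show thesis by (intro that[of p]) auto
qed

lemma ex_coord_nonzero:
  assumes "p \<in> proj_space N"
  obtains i where "i \<le> N" "fval p (var i) ~= 0"
proof -
  from assms obtain v where v: "v = (SOME v. v \<in> p)" "v ~= (\<lambda>_. 0)" "\<forall>i>N. v i = 0"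
    by (rule proj_space_E)
  obtain i where i: "v i ~= 0" using v(2) by auto
  hence "i \<le> N" using v(3) by (metis not_le)
  moreover have "fval p (var i) ~= 0" using i by (simp add: fval_def flip: v(1))
  ultimately show thesis by (rule that)
qed

lemma coord_open_eq: "i \<le> N ==> coord_open N i = basic_open N (var i)"
  by (simp add: coord_open_def basic_open_def)

text \<open>The factor \<open>var 0\<close> rules out the zero vector, which a constant form alone
  would not.\<close>

lemma form_nonvanishing:
  fixes f :: "'k::{alg_closed_field, field_char_0} mvpoly"
  assumes "f \<in> forms N d" "f ~= 0"
  obtains p where "p \<in> proj_space N" "fval p f ~= 0"
proof -
  have v0: "var 0 \<in> forms N (Suc 0)" by simp
  have "var 0 ~= (0 :: 'k mvpoly)"
  proof
    assume "var 0 = (0 :: 'k mvpoly)"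
    hence "poly_eval (var 0) (\<lambda>_. 1 :: 'k) = 0" by (simp only: k_eval.peval_0)
    thus False by simp
  qed
  hence "f * var 0 ~= 0" using assms by simp
  moreover have "f * var 0 \<in> poly_vars (Suc N)" using forms_mult[OF assms(1) v0] by (simp add: forms_alt)
  ultimately obtain v where v: "poly_eval (f * var 0) v ~= 0" "\<And>i. i \<ge> Suc N ==> v i = 0"
    using poly_eval_nonzero by blast
  hence "v ~= (\<lambda>_. 0)" by (metis k_eval.peval_mult k_eval.peval_var mult_zero_right)
  moreover have "\<forall>i>N. v i = 0" using v(2) by simp
  ultimately obtain p where p: "p \<in> proj_space N"
    "\<And>d f. f \<in> forms N d ==> fval p f = 0 \<longleftrightarrow> poly_eval f v = 0"
    by (rule point_of) blast
  have "poly_eval f v ~= 0" using v(1) by auto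
  thus thesis using p assms(1) by (intro that[of p]) auto
qed

text \<open>Positive degree, required later by \<open>nullstellensatz_points\<close>, is obtained by
  passing from \<open>f\<close> to \<open>f * var i\<close> with a coordinate that does not vanish
  at the point.\<close>

lemma openin_zariski_iff:
  "zopen N U \<longleftrightarrow> U \<subseteq> proj_space N \<and>
    (\<forall>p\<in>U. \<exists>d>0. \<exists>g\<in>forms N d. fval p g ~= 0 \<and> basic_open N g \<subseteq> U)" (is "?L \<longleftrightarrow> ?R")
proof
  assume ?L
  hence "generate_topology_on {basic_open N f | f d. f \<in> forms N d} U"
    by (simp add: zariski_def openin_topology_generated_by_iff)
  thus ?R
  proof induction
    case (Int a b)
    show ?case
    proof (intro conjI ballI)
      fix p assume "p \<in> a \<inter> b"
      hence "p \<in> a" "p \<in> b" by auto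
      with Int.IH obtain d e f g where *: "f \<in> forms N d" "d > 0" "g \<in> forms N e" "fval p f ~= 0"
        "fval p g ~= 0" "basic_open N f \<subseteq> a" "basic_open N g \<subseteq> b" by meson
      thus "\<exists>d>0. \<exists>h\<in>forms N d. fval p h ~= 0 \<and> basic_open N h \<subseteq> a \<inter> b"
        by (intro exI[of _ "d + e"] conjI bexI[of _ "f * g"])
          (auto simp: basic_open_mult[OF *(1,3)] intro!: forms_mult)
    qed (use Int in auto)
  next
    case (UN K)
    show ?case
    proof (intro conjI ballI)
      fix p assume "p \<in> \<Union> K"
      then obtain k where k: "k \<in> K" "p \<in> k" by blast
      with UN.IH[OF k(1)] obtain d g where "d > 0" "g \<in> forms N d" "fval p g ~= 0"
        "basic_open N g \<subseteq> k" by meson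
      moreover have "k \<subseteq> \<Union> K" using k by blast
      ultimately show "\<exists>d>0. \<exists>g\<in>forms N d. fval p g ~= 0 \<and> basic_open N g \<subseteq> \<Union> K"
        by (meson subset_trans)
    next
      show "\<Union> K \<subseteq> proj_space N" using UN.IH by (meson Union_least)
    qed
  next
    case (Basis s)
    then obtain f d where s: "s = basic_open N f" "f \<in> forms N d" by auto
    show ?case
    proof (intro conjI ballI)
      fix p assume p: "p \<in> s"
      hence pN: "p \<in> proj_space N" "fval p f ~= 0" by (auto simp: s basic_open_fval[OF s(2)])
      then obtain i where i: "i \<le> N" "fval p (var i) ~= 0" using ex_coord_nonzero by blast
      show "\<exists>d>0. \<exists>g\<in>forms N d. fval p g ~= 0 \<and> basic_open N g \<subseteq> s"
        using i pN forms_mult[OF s(2) forms_var[OF i(1)]]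
        by (intro exI[of _ "d + 1"] conjI bexI[of _ "f * var i"])
          (auto simp: s basic_open_mult[OF s(2) forms_var[OF i(1)]])
    qed (auto simp: s basic_open_def)
  qed auto
next
  assume R: ?R
  have "zopen N (\<Union> {basic_open N g | g d. g \<in> forms N d \<and> basic_open N g \<subseteq> U})"
    unfolding zariski_def by (intro openin_Union) (auto intro!: topology_generated_by_Basis)
  also have "\<Union> {basic_open N g | g d. g \<in> forms N d \<and> basic_open N g \<subseteq> U} = U"
  proof (intro equalityI subsetI)
    fix p assume p: "p \<in> U"
    with R obtain d g where g: "g \<in> forms N d" "fval p g ~= 0" "basic_open N g \<subseteq> U" by meson
    moreover have "p \<in> basic_open N g" using R p g by (auto simp: basic_open_fval[OF g(1)])
    ultimately show "p \<in> \<Union> {basic_open N g | g d. g \<in> forms N d \<and> basic_open N g \<subseteq> U}"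
      by (intro UnionI[of "basic_open N g"] CollectI exI[of _ g] exI[of _ d] conjI refl)
  next
    fix p assume "p \<in> \<Union> {basic_open N g | g d. g \<in> forms N d \<and> basic_open N g \<subseteq> U}"
    thus "p \<in> U" by (elim UnionE CollectE exE conjE) (simp add: subset_iff)
  qed
  finally show ?L .
qed

section \<open>Open sets and irreducibility\<close>

lemma open_sub_proj: "zopen N U ==> U \<subseteq> proj_space N"
  by (simp add: openin_zariski_iff)

lemma open_basic:
  assumes "zopen N U" "p \<in> U"
  obtains d g where "d > 0" "g \<in> forms N d" "fval p g ~= 0" "p \<in> basic_open N g" "basic_open N g \<subseteq> U"
proof -
  from assms obtain d g where g: "d > 0" "g \<in> forms N d" "fval p g ~= 0" "basic_open N g \<subseteq> U"
    unfolding openin_zariski_iff by blast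
  moreover have "p \<in> basic_open N g"
    using g assms by (auto simp: basic_open_fval[OF g(2)] openin_zariski_iff)
  ultimately show thesis by (intro that)
qed

lemma basic_open_open: "f \<in> forms N d ==> zopen N (basic_open N f)"
  unfolding zariski_def by (rule topology_generated_by_Basis) auto

lemma open_proj_space: "zopen N (proj_space N)"
proof -
  have "basic_open N 1 = (proj_space N :: 'a point set)" by (auto simp: basic_open_fval[of _ N 0])
  thus ?thesis using basic_open_open[of "1 :: 'a mvpoly" N 0] by simp
qed

lemma topspace_zariski [simp]: "topspace (zariski N) = proj_space N"
  using open_sub_proj open_proj_space by (metis openin_subset openin_topspace subset_antisym)

lemma coord_open_open: "i \<le> N ==> zopen N (coord_open N i)"
  by (simp add: coord_open_eq basic_open_open[OF forms_var])

text \<open>After multiplication by a form whose nonempty basic open set lies in \<open>U\<close>,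
  the form vanishes at every point; a nonzero product would contradict
  \<open>form_nonvanishing\<close>.\<close>

lemma form_zero_on_open:
  fixes U :: "'k::{alg_closed_field, field_char_0} point set"
  assumes "zopen N U" "U ~= {}" "f \<in> forms N d" "\<And>p. p \<in> U ==> fval p f = 0"
  shows "f = 0"
proof (rule ccontr)
  assume "f ~= 0"
  from assms obtain p where "p \<in> U" by blast
  from open_basic[OF assms(1) this] obtain e g where g: "g \<in> forms N e" "fval p g ~= 0"
    "basic_open N g \<subseteq> U" by metis
  hence "g ~= 0" by auto
  with \<open>f ~= 0\<close> have "f * g ~= 0" by simp
  from form_nonvanishing[OF forms_mult[OF assms(3) g(1)] this] obtain q where
    "q \<in> proj_space N" "fval q (f * g) ~= 0" by blast
  with g assms(4) show False by (auto simp: basic_open_fval)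
qed

text \<open>Irreducibility of projective space. It allows rational functions and coordinates of
  sections to be compared on any nonempty open set.\<close>

lemma open_meet:
  fixes U :: "'k::{alg_closed_field, field_char_0} point set"
  assumes "zopen N U" "U ~= {}" "zopen N V" "V ~= {}"
  shows "U \<inter> V ~= {}"
proof -
  from assms obtain p where "p \<in> V" by blast
  from open_basic[OF assms(3) this] obtain e g where g: "g \<in> forms N e" "fval p g ~= 0"
    "basic_open N g \<subseteq> V" by metis
  hence "g ~= 0" by auto
  with form_zero_on_open[OF assms(1,2) g(1)] obtain q where "q \<in> U" "fval q g ~= 0" by blast
  with g open_sub_proj[OF assms(1)] show ?thesis by (auto simp: basic_open_fval)
qed

text \<open>The stalk of \<open>\<O>(m)\<close> at \<open>p\<close>: the part of degree
  \<open>m\<close> of the homogeneous localization, as a subset of the fraction field of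
  \<open>'k mvpoly\<close>.\<close>

definition loc :: "nat => 'k::field point => int => 'k ratfun set" where
  "loc N p m = {to_fract f / to_fract g | f g a b.
     f \<in> forms N a \<and> g \<in> forms N b \<and> int a = int b + m \<and> fval p g ~= 0}"

lemma fval_nonzero: "fval p g ~= 0 ==> g ~= 0" by auto

lemma locE:
  assumes "x \<in> loc N p m"
  obtains f g a b where "f \<in> forms N a" "g \<in> forms N b" "int a = int b + m" "fval p g ~= 0" "g ~= 0"
    "x = to_fract f / to_fract g"
  using assms fval_nonzero by (fastforce simp: loc_def)

lemma locI:
  "f \<in> forms N a ==> g \<in> forms N b ==> int a = int b + m ==> fval p g ~= 0 ==>
    to_fract f / to_fract g \<in> loc N p m"
  by (auto simp: loc_def)

lemma loc_common:
  assumes "x \<in> loc N p m" "y \<in> loc N p n"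
  obtains f h g a b c where "f \<in> forms N a" "h \<in> forms N b" "g \<in> forms N c" "int a = int c + m" "int b = int c + n"
    "fval p g ~= 0" "g ~= 0" "x = to_fract f / to_fract g" "y = to_fract h / to_fract g"
proof -
  from assms(1) obtain f g a c where 1: "f \<in> forms N a" "g \<in> forms N c" "int a = int c + m"
    "fval p g ~= 0" "g ~= 0" "x = to_fract f / to_fract g" by (rule locE)
  from assms(2) obtain h k b d where 2: "h \<in> forms N b" "k \<in> forms N d" "int b = int d + n"
    "fval p k ~= 0" "k ~= 0" "y = to_fract h / to_fract k" by (rule locE)
  show thesis
    by (rule that[OF forms_mult[OF 1(1) 2(2)] forms_mult[OF 2(1) 1(2)] forms_mult[OF 1(2) 2(2)]]) (use 1 2 in simp_all)
qed

lemma loc_mult: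
  assumes "x \<in> loc N p m" "y \<in> loc N p n"
  shows "x * y \<in> loc N p (m + n)"
proof -
  obtain f h g a b c where *: "f \<in> forms N a" "h \<in> forms N b" "g \<in> forms N c" "int a = int c + m" "int b = int c + n"
    "fval p g ~= 0" "g ~= 0" "x = to_fract f / to_fract g" "y = to_fract h / to_fract g"
    using assms by (rule loc_common)
  have "to_fract (f * h) / to_fract (g * g) \<in> loc N p (m + n)"
    using * by (intro locI[OF forms_mult[OF *(1,2)] forms_mult[OF *(3,3)]]) auto
  thus ?thesis by (simp add: *(8,9))
qed

lemma loc_add:
  assumes "x \<in> loc N p m" "y \<in> loc N p m"
  shows "x + y \<in> loc N p m"
proof -
  obtain f h g a b c where *: "f \<in> forms N a" "h \<in> forms N b" "g \<in> forms N c" "int a = int c + m" "int b = int c + m"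
    "fval p g ~= 0" "g ~= 0" "x = to_fract f / to_fract g" "y = to_fract h / to_fract g"
    using assms by (rule loc_common)
  hence "b = a" by simp
  with * have "to_fract (f + h) / to_fract g \<in> loc N p m" by (intro locI[OF forms_add[of f N a h]]) auto
  thus ?thesis by (simp add: *(8,9) add_divide_distrib)
qed

lemma loc_form: "f \<in> forms N d ==> to_fract f \<in> loc N p (int d)"
  using locI[of f N d 1 0 "int d" p] by simp

lemma loc_form': "f \<in> forms N d ==> m = int d ==> to_fract f \<in> loc N p m"
  by (simp add: loc_form)

lemma loc_inverse: "g \<in> forms N d ==> fval p g ~= 0 ==> 1 / to_fract g \<in> loc N p (- int d)"
  using locI[of 1 N 0 g d "- int d" p] by simp

lemma loc_1: "1 \<in> loc N p 0"
  using loc_form[of 1 N 0 p] by simp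

lemma loc_0: "p \<in> proj_space N ==> 0 \<in> loc N p m"
proof (rule ex_coord_nonzero[of p N])
  fix i assume i: "i \<le> N" "fval p (var i) ~= 0"
  have "var i ^ nat \<bar>m\<bar> \<in> forms N (nat \<bar>m\<bar>)" using forms_power[OF forms_var[OF i(1)], of "nat \<bar>m\<bar>"] by simp
  thus ?thesis
    using i locI[of 0 N "nat (\<bar>m\<bar> + m)" "var i ^ nat \<bar>m\<bar>" "nat \<bar>m\<bar>" m p] by (cases "m \<ge> 0") auto
qed

lemma loc_uminus: "x \<in> loc N p m ==> - x \<in> loc N p m"
proof (erule locE)
  fix f g a b assume *: "f \<in> forms N a" "g \<in> forms N b" "int a = int b + m" "fval p g ~= 0"
    "x = to_fract f / to_fract g"
  hence "to_fract (- f) / to_fract g \<in> loc N p m" by (intro locI forms_uminus)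
  thus ?thesis by (simp add: *)
qed

text \<open>A local generator of \<open>\<O>(m)\<close>: a power of a coordinate that does not
  vanish at \<open>p\<close>, or its inverse.\<close>

lemma loc_unit:
  assumes "p \<in> proj_space N"
  obtains u where "u \<in> loc N p m" "1 / u \<in> loc N p (- m)" "u ~= 0"
proof -
  obtain i where i: "i \<le> N" "fval p (var i) ~= 0" using assms by (rule ex_coord_nonzero)
  define g :: "'a mvpoly" where "g = var i ^ nat \<bar>m\<bar>"
  have g: "g \<in> forms N (nat \<bar>m\<bar>)" unfolding g_def using forms_power[OF forms_var[OF i(1)], of "nat \<bar>m\<bar>"] by simp
  have gp: "fval p g ~= 0" using i by (simp add: g_def)
  hence "g ~= 0" by auto
  show thesis
  proof (cases "m \<ge> 0")
    case True
    thus ?thesis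
      using that[of "to_fract g"] loc_form[OF g, of p] loc_inverse[OF g gp] \<open>g ~= 0\<close> by simp
  next
    case False
    thus ?thesis
      using that[of "1 / to_fract g"] loc_form[OF g, of p] loc_inverse[OF g gp] \<open>g ~= 0\<close> by simp
  qed
qed

section \<open>Values of the elements of the local rings\<close>

definition ev :: "nat => 'k::field point => 'k ratfun => 'k" where
  "ev N p x = (THE c. \<exists>f g d. f \<in> forms N d \<and> g \<in> forms N d \<and> fval p g ~= 0 \<and>
     x = to_fract f / to_fract g \<and> c = fval p f / fval p g)"

lemma ev_fract:
  assumes "f \<in> forms N d" "g \<in> forms N d" "fval p g ~= 0"
  shows "ev N p (to_fract f / to_fract g) = fval p f / fval p g"
  unfolding ev_def
proof (rule the_equality)
  fix c assume "\<exists>f' g' d'. f' \<in> forms N d' \<and> g' \<in> forms N d' \<and> fval p g' ~= 0 \<and>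
     to_fract f / to_fract g = to_fract f' / to_fract g' \<and> c = fval p f' / fval p g'"
  then obtain f' g' d' where *: "fval p g' ~= 0" "to_fract f / to_fract g = to_fract f' / to_fract g'"
    "c = fval p f' / fval p g'" by blast
  hence "g ~= 0" "g' ~= 0" using assms by auto
  with *(2) have "to_fract (f * g') = to_fract (f' * g)" by (simp add: field_simps)
  hence "f * g' = f' * g" by (simp only: to_fract_eq_iff)
  hence "fval p f * fval p g' = fval p f' * fval p g" by (metis fval_simps(4))
  thus "c = fval p f / fval p g" unfolding *(3) using *(1) assms(3) by (simp add: divide_simps)
qed (use assms in blast)

lemma loc0E:
  assumes "x \<in> loc N p 0"
  obtains f g d where "f \<in> forms N d" "g \<in> forms N d" "fval p g ~= 0" "g ~= 0"
    "x = to_fract f / to_fract g"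
  using assms by (elim locE) (metis add.right_neutral of_nat_eq_iff)

lemma loc0_common:
  assumes "x \<in> loc N p 0" "y \<in> loc N p 0"
  obtains f h g d where "f \<in> forms N d" "h \<in> forms N d" "g \<in> forms N d" "fval p g ~= 0" "g ~= 0"
    "x = to_fract f / to_fract g" "y = to_fract h / to_fract g"
proof -
  obtain f h g a b c where *: "f \<in> forms N a" "h \<in> forms N b" "g \<in> forms N c" "int a = int c + 0" "int b = int c + 0"
    "fval p g ~= 0" "g ~= 0" "x = to_fract f / to_fract g" "y = to_fract h / to_fract g"
    using assms by (rule loc_common)
  from *(4,5) have "a = c" "b = c" by simp_all
  with * show thesis by (intro that[of f c h g]) simp_all
qed

lemma ev_add:
  assumes "x \<in> loc N p 0" "y \<in> loc N p 0"
  shows "ev N p (x + y) = ev N p x + ev N p y"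
proof -
  obtain f h g d where *: "f \<in> forms N d" "h \<in> forms N d" "g \<in> forms N d" "fval p g ~= 0"
    "x = to_fract f / to_fract g" "y = to_fract h / to_fract g" using assms by (rule loc0_common)
  hence "x + y = to_fract (f + h) / to_fract g" by (simp add: add_divide_distrib)
  thus ?thesis
    using * by (simp add: ev_fract[OF forms_add] ev_fract add_divide_distrib del: to_fract_add)
qed

lemma ev_mult:
  assumes "x \<in> loc N p 0" "y \<in> loc N p 0"
  shows "ev N p (x * y) = ev N p x * ev N p y"
proof -
  obtain f h g d where *: "f \<in> forms N d" "h \<in> forms N d" "g \<in> forms N d" "fval p g ~= 0"
    "x = to_fract f / to_fract g" "y = to_fract h / to_fract g" using assms by (rule loc0_common)
  hence "x * y = to_fract (f * h) / to_fract (g * g)" by simp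
  thus ?thesis
    using * by (simp add: ev_fract[OF forms_mult forms_mult] ev_fract del: to_fract_mult)
qed

lemma ev_1 [simp]: "ev N p 1 = 1" and ev_0 [simp]: "ev N p 0 = 0"
  using ev_fract[of 1 N 0 1 p] ev_fract[of 0 N 0 1 p] by auto

section \<open>Regular functions as rational functions\<close>

text \<open>Sections of \<open>\<O>(m)\<close> as an intersection of stalks. For empty
  \<open>U\<close> this is the whole field, which explains the recurring hypothesis
  \<open>U ~= {}\<close>.\<close>

definition rat_on :: "nat => 'k::field point set => int => 'k ratfun set" where
  "rat_on N U m = (\<Inter>p\<in>U. loc N p m)"

definition reg :: "nat => 'k::field point set => 'k ratfun => 'k point => 'k" where
  "reg N U x = (\<lambda>p\<in>U. ev N p x)"

lemma reg_inj:
  fixes U :: "'k::{alg_closed_field, field_char_0} point set"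
  assumes U: "zopen N U" "U ~= {}" and xy: "x \<in> rat_on N U 0" "y \<in> rat_on N U 0"
    and "reg N U x = reg N U y"
  shows "x = y"
proof -
  obtain p where p: "p \<in> U" using U by blast
  hence xy0: "x \<in> loc N p 0" "y \<in> loc N p 0" using xy by (auto simp: rat_on_def)
  obtain f h g d where *: "f \<in> forms N d" "h \<in> forms N d" "g \<in> forms N d" "fval p g ~= 0"
    "x = to_fract f / to_fract g" "y = to_fract h / to_fract g" using xy0 by (rule loc0_common)
  have "f - h = 0"
  proof (rule form_zero_on_open)
    show "zopen N (U \<inter> basic_open N g)" using U basic_open_open[OF *(3)] by blast
    show "U \<inter> basic_open N g ~= {}"
      using p * open_sub_proj[OF U(1)] by (auto simp: basic_open_fval[OF *(3)])
    show "f - h \<in> forms N d" using * by (intro forms_diff)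
  next
    fix q assume q: "q \<in> U \<inter> basic_open N g"
    hence nz: "fval q g ~= 0" by (auto simp: basic_open_fval[OF *(3)])
    have "ev N q x = ev N q y" using fun_cong[OF assms(5), of q] q by (simp add: reg_def)
    thus "fval q (f - h) = 0" using * nz by (simp add: ev_fract)
  qed
  thus ?thesis by (simp add: *)
qed

text \<open>By irreducibility all local quotients representing a regular function define one and the
  same rational function, which therefore lies in the local ring of every point of
  \<open>U\<close>.\<close>

lemma regular_ring_eq:
  fixes U :: "'k::{alg_closed_field, field_char_0} point set"
  assumes U: "zopen N U" "U ~= {}"
  shows "carrier (regular_ring N U) = reg N U ` rat_on N U 0"
proof (intro equalityI subsetI)
  fix a assume "a \<in> carrier (regular_ring N U)"
  hence a: "a \<in> extensional U" "regular_on N U a" by (auto simp: regular_ring_def)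
  have "\<exists>V f g d. zopen N V \<and> p \<in> V \<and> V \<subseteq> U \<and> f \<in> forms N d \<and> g \<in> forms N d \<and>
      (\<forall>q\<in>V. fval q g ~= 0 \<and> a q = fval q f / fval q g)" if p: "p \<in> U" for p
  proof -
    from a(2) p obtain V d f g where V: "zopen N V" "p \<in> V" "V \<subseteq> U" "f \<in> forms N d"
      "g \<in> forms N d" and *: "\<And>q v. q \<in> V ==> v \<in> q ==> poly_eval g v ~= 0 \<and> a q = poly_eval f v / poly_eval g v"
      unfolding regular_on_def by metis
    have "fval q g ~= 0 \<and> a q = fval q f / fval q g" if q: "q \<in> V" for q
    proof -
      have "q \<in> proj_space N" using open_sub_proj[OF V(1)] q by auto
      then obtain v where v: "v \<in> q" "v = (SOME v. v \<in> q)" by (rule proj_space_E)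
      thus ?thesis using *[OF q v(1)] unfolding v(2) fval_def by simp
    qed
    with V show ?thesis by blast
  qed
  note loc = this
  obtain p0 where p0: "p0 \<in> U" using U by blast
  from loc[OF p0] obtain V0 f0 g0 d0 where V0: "zopen N V0" "p0 \<in> V0" "f0 \<in> forms N d0" "g0 \<in> forms N d0"
    "\<And>q. q \<in> V0 ==> fval q g0 ~= 0 \<and> a q = fval q f0 / fval q g0" by blast
  define x where "x = to_fract f0 / to_fract g0"
  have x: "x \<in> loc N p 0 \<and> a p = ev N p x" if p: "p \<in> U" for p
  proof -
    from loc[OF p] obtain V f g d where V: "zopen N V" "p \<in> V" "f \<in> forms N d" "g \<in> forms N d"
      "\<And>q. q \<in> V ==> fval q g ~= 0 \<and> a q = fval q f / fval q g" by blast
    have "f0 * g - f * g0 = 0"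
    proof (rule form_zero_on_open)
      show "zopen N (V0 \<inter> V)" using V V0 by blast
      show "V0 \<inter> V ~= {}" using V V0 by (intro open_meet[of N]) blast+
      show "f0 * g - f * g0 \<in> forms N (d0 + d)"
        using forms_mult[OF V0(3) V(4)] forms_mult[OF V(3) V0(4)] by (intro forms_diff) (simp_all add: add.commute)
    next
      fix q assume q: "q \<in> V0 \<inter> V"
      thus "fval q (f0 * g - f * g0) = 0" using V0(5)[of q] V(5)[of q] by (simp add: field_simps)
    qed
    hence "to_fract (f0 * g) = to_fract (f * g0)" by simp
    moreover have "g0 ~= 0" "g ~= 0" using V0(5)[OF V0(2)] V(5)[OF V(2)] by auto
    ultimately have "x = to_fract f / to_fract g" unfolding x_def by (simp add: divide_simps)
    thus ?thesis using V(5)[OF V(2)] locI[OF V(3,4), of 0 p] ev_fract[OF V(3,4), of p] by simp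
  qed
  hence "x \<in> rat_on N U 0" by (auto simp: rat_on_def)
  moreover have "a = reg N U x" using x a(1) by (auto simp: reg_def extensional_def fun_eq_iff)
  ultimately show "a \<in> reg N U ` rat_on N U 0" by blast
next
  fix a assume "a \<in> reg N U ` rat_on N U 0"
  then obtain x where x: "x \<in> rat_on N U 0" "a = reg N U x" by blast
  have "regular_on N U a"
    unfolding regular_on_def
  proof
    fix p assume p: "p \<in> U"
    hence "x \<in> loc N p 0" using x by (auto simp: rat_on_def)
    then obtain f g d where *: "f \<in> forms N d" "g \<in> forms N d" "fval p g ~= 0"
      "x = to_fract f / to_fract g" by (rule loc0E)
    have "poly_eval g v ~= 0 \<and> a q = poly_eval f v / poly_eval g v"
      if q: "q \<in> U \<inter> basic_open N g" "v \<in> q" for q v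
    proof -
      have nz: "q \<in> proj_space N" "fval q g ~= 0" using * q by (auto simp: basic_open_fval)
      from poly_eval_fval[OF nz(1) q(2)] obtain c where c: "c ~= 0"
        "\<And>d f. f \<in> forms N d ==> poly_eval f v = c ^ d * fval q f" by metis
      thus ?thesis using * nz q(1) by (simp add: x(2) reg_def ev_fract)
    qed
    moreover have "zopen N (U \<inter> basic_open N g)"
      using U(1) basic_open_open[OF *(2)] by blast
    moreover have "p \<in> U \<inter> basic_open N g"
      using p * open_sub_proj[OF U(1)] by (auto simp: basic_open_fval)
    ultimately show "\<exists>V. zopen N V \<and> p \<in> V \<and> V \<subseteq> U \<and> (\<exists>d. \<exists>f\<in>forms N d. \<exists>g\<in>forms N d.
        \<forall>q\<in>V. \<forall>v\<in>q. poly_eval g v ~= 0 \<and> a q = poly_eval f v / poly_eval g v)"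
      using *(1,2) by (metis Int_lower1)
  qed
  thus "a \<in> carrier (regular_ring N U)" by (auto simp: regular_ring_def x reg_def)
qed

lemma rat_on_mono: "V \<subseteq> U ==> rat_on N U m \<subseteq> rat_on N V m"
  by (auto simp: rat_on_def)

lemma rat_on_ring:
  "x \<in> rat_on N U 0 ==> y \<in> rat_on N U 0 ==> x + y \<in> rat_on N U 0"
  "x \<in> rat_on N U 0 ==> y \<in> rat_on N U 0 ==> x * y \<in> rat_on N U 0"
  "x \<in> rat_on N U 0 ==> - x \<in> rat_on N U 0"
  "1 \<in> rat_on N U 0" "U \<subseteq> proj_space N ==> 0 \<in> rat_on N U 0"
  by (auto simp: rat_on_def loc_1 intro: loc_mult[where m = 0 and n = 0, unfolded add_0] loc_add loc_uminus loc_0)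

lemma reg_ops:
  assumes "x \<in> rat_on N U 0" "y \<in> rat_on N U 0"
  shows "reg N U x \<otimes>\<^bsub>regular_ring N U\<^esub> reg N U y = reg N U (x * y)"
    and "reg N U x \<oplus>\<^bsub>regular_ring N U\<^esub> reg N U y = reg N U (x + y)"
  using assms by (auto simp: regular_ring_def reg_def rat_on_def ev_mult ev_add restrict_def)

lemma reg_0: "\<zero>\<^bsub>regular_ring N U\<^esub> = reg N U 0"
  by (auto simp: regular_ring_def reg_def restrict_def)

lemma restrict_reg: "V \<subseteq> U ==> restrict (reg N U x) V = reg N V x"
  by (auto simp: reg_def restrict_def fun_eq_iff)

section \<open>Sheaves embedded in a constant sheaf\<close>

text \<open>
  \<open>F\<close> is identified, through \<open>\<psi>\<close>, with the subsheaf with stalks \<open>\<Phi> p\<close> of the constant sheaf with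
  value a vector space over the field of rational functions.
\<close>

locale embedded_sheaf = vector_space scale
  for scale :: "'k::{alg_closed_field, field_char_0} ratfun => 'v::ab_group_add => 'v" (infixr \<open>*s\<close> 75) +
  fixes N :: nat and F :: "('k, 'a) proj_sheaf" and \<Phi> :: "'k point => 'v set"
    and \<psi> :: "'k point set => 'a => 'v"
  assumes stalk_0: "p \<in> proj_space N ==> 0 \<in> \<Phi> p"
    and stalk_add: "p \<in> proj_space N ==> v \<in> \<Phi> p ==> w \<in> \<Phi> p ==> v + w \<in> \<Phi> p"
    and stalk_scale: "p \<in> proj_space N ==> x \<in> loc N p 0 ==> v \<in> \<Phi> p ==> x *s v \<in> \<Phi> p"
    and zero_closed: "zopen N U ==> \<zero>\<^bsub>sections F U\<^esub> \<in> secs F U"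
    and add_closed: "zopen N U ==> s \<in> secs F U ==> t \<in> secs F U ==>
      s \<oplus>\<^bsub>sections F U\<^esub> t \<in> secs F U"
    and restr_closed: "zopen N U ==> zopen N V ==> V \<subseteq> U ==>
      s \<in> secs F U ==> restr F U V s \<in> secs F V"
    and smult_closed: "zopen N U ==> a \<in> carrier (regular_ring N U) ==>
      s \<in> secs F U ==> a \<odot>\<^bsub>sections F U\<^esub> s \<in> secs F U"
    and sections_empty: "secs F {} = {\<zero>\<^bsub>sections F {}\<^esub>}"
    and emb_bij: "zopen N U ==> U ~= {} ==>
      bij_betw (\<psi> U) (secs F U) (\<Inter>p\<in>U. \<Phi> p)"
    and emb_zero: "zopen N U ==> U ~= {} ==> \<psi> U \<zero>\<^bsub>sections F U\<^esub> = 0"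
    and emb_add: "zopen N U ==> U ~= {} ==> s \<in> secs F U ==>
      t \<in> secs F U ==> \<psi> U (s \<oplus>\<^bsub>sections F U\<^esub> t) = \<psi> U s + \<psi> U t"
    and emb_smult: "zopen N U ==> U ~= {} ==> x \<in> rat_on N U 0 ==>
      s \<in> secs F U ==> \<psi> U (reg N U x \<odot>\<^bsub>sections F U\<^esub> s) = x *s \<psi> U s"
    and emb_restr: "zopen N U ==> zopen N V ==> V \<subseteq> U ==> V ~= {} ==>
      s \<in> secs F U ==> \<psi> V (restr F U V s) = \<psi> U s"
begin

lemma emb_inj:
  "zopen N U ==> U ~= {} ==> s \<in> secs F U ==> t \<in> secs F U ==>
    \<psi> U s = \<psi> U t \<longleftrightarrow> s = t"
  using emb_bij[of U] unfolding bij_betw_def by (blast dest: inj_onD)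

lemma emb_in: "zopen N U ==> s \<in> secs F U ==> p \<in> U ==> \<psi> U s \<in> \<Phi> p"
  using emb_bij[of U] by (auto simp: bij_betw_def)

lemma emb_surj:
  assumes "zopen N U" "U ~= {}" "\<And>p. p \<in> U ==> v \<in> \<Phi> p"
  obtains s where "s \<in> secs F U" "\<psi> U s = v"
proof -
  have "v \<in> \<psi> U ` secs F U"
    using emb_bij[OF assms(1,2)] assms(3) by (auto simp: bij_betw_def)
  with that show thesis by blast
qed

text \<open>The locale asks only for closure under addition, which keeps twists and direct sums easy
  to fit in; negatives come back by lifting \<open>- 1\<close> times the embedded section.\<close>

lemma sections_group:
  assumes U: "zopen N U"
  shows "abelian_group (sections F U)"
proof (cases "U = {}")
  case True
  have "\<zero>\<^bsub>sections F U\<^esub> \<oplus>\<^bsub>sections F U\<^esub> \<zero>\<^bsub>sections F U\<^esub> = \<zero>\<^bsub>sections F U\<^esub>"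
    using add_closed[OF U zero_closed[OF U] zero_closed[OF U]] sections_empty True by simp
  thus ?thesis using sections_empty True by (intro abelian_groupI) simp_all
next
  case False
  note ops = emb_add[OF U False] emb_zero[OF U False] add_closed[OF U] zero_closed[OF U]
  show ?thesis
  proof (rule abelian_groupI)
    fix s assume s: "s \<in> secs F U"
    have "- 1 *s \<psi> U s \<in> \<Phi> p" if "p \<in> U" for p
      using stalk_scale[of p "- 1" "\<psi> U s"] loc_uminus[OF loc_1] emb_in[OF U s that] openin_subset[OF U] that by auto
    then obtain t where "t \<in> secs F U" "\<psi> U t = - 1 *s \<psi> U s" by (rule emb_surj[OF U False])
    thus "\<exists>t\<in>secs F U. t \<oplus>\<^bsub>sections F U\<^esub> s = \<zero>\<^bsub>sections F U\<^esub>"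
      using s by (intro bexI[of _ t]) (simp_all add: emb_inj[OF U False, symmetric] ops)
  qed (simp_all add: emb_inj[OF U False, symmetric] ops add.assoc add.commute)
qed

lemma emb_neg:
  assumes "zopen N U" "U ~= {}" "s \<in> secs F U"
  shows "\<psi> U (\<ominus>\<^bsub>sections F U\<^esub> s) = - \<psi> U s"
proof -
  interpret abelian_group "sections F U" using sections_group[OF assms(1)] .
  show ?thesis using emb_add[OF assms(1,2) assms(3) a_inv_closed[OF assms(3)]] assms(3) emb_zero[OF assms(1,2)]
    by (simp add: r_neg add_eq_0_iff)
qed

lemma emb_finsum:
  assumes "zopen N U" "U ~= {}" "\<And>i. i \<in> A ==> s i \<in> secs F U" "finite A"
  shows "\<psi> U (finsum (sections F U) s A) = (\<Sum>i\<in>A. \<psi> U (s i))"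
proof -
  interpret abelian_group "sections F U" using sections_group[OF assms(1)] .
  from assms(4,3) show ?thesis
  proof (induction A)
    case (insert i A)
    hence "s \<in> A \<rightarrow> secs F U" "s i \<in> secs F U" by auto
    with insert show ?case
      using emb_add[OF assms(1,2) \<open>s i \<in> _\<close> finsum_closed[of s A]] by simp
  qed (simp add: emb_zero assms)
qed

lemma sections_empty': "s \<in> secs F {} ==> s = \<zero>\<^bsub>sections F {}\<^esub>"
  using sections_empty by auto

end

section \<open>Isomorphisms of embedded sheaves\<close>

lemma restrict_regular:
  fixes U :: "'k::{alg_closed_field, field_char_0} point set"
  assumes "zopen N U" "zopen N V" "V \<subseteq> U" "a \<in> carrier (regular_ring N U)"
  shows "restrict a V \<in> carrier (regular_ring N V)"
proof (cases "V = {}")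
  case True
  thus ?thesis by (simp add: regular_ring_def regular_on_def extensional_def)
next
  case False
  hence "U ~= {}" using assms by auto
  then obtain x where "x \<in> rat_on N U 0" "a = reg N U x"
    using assms regular_ring_eq by blast
  thus ?thesis
    unfolding regular_ring_eq[OF assms(2) False] using subsetD[OF rat_on_mono[OF assms(3)]]
    by (auto simp: restrict_reg assms)
qed

text \<open>Restriction does not change embedded sections, so a single map \<open>T\<close> of the
  ambient spaces yields compatible maps over all open sets. \<open>T\<close> goes from
  \<open>G\<close> to \<open>F\<close> and the isomorphism is its inverse on sections; bijectivity
  is asked on intersections of stalks only, since \<open>T\<close> may fail to be injective on the
  ambient space.\<close>

lemma sheaf_isoI:
  fixes F :: "('k::{alg_closed_field, field_char_0}, 'a) proj_sheaf" and G :: "('k, 'b) proj_sheaf"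
  assumes F: "embedded_sheaf scale N F \<Phi> \<psi>" and G: "embedded_sheaf scale' N G \<Phi>' \<psi>'"
    and bij: "\<And>U. zopen N U ==> U ~= {} ==> bij_betw T (\<Inter>p\<in>U. \<Phi>' p) (\<Inter>p\<in>U. \<Phi> p)"
    and add: "\<And>v w. T (v + w) = T v + T w"
    and smult: "\<And>x v. T (scale' x v) = scale x (T v)"
  shows "sheaf_iso N F G"
proof -
  interpret F: embedded_sheaf scale N F \<Phi> \<psi> by fact
  interpret G: embedded_sheaf scale' N G \<Phi>' \<psi>' by fact
  \<comment> \<open>Over the empty set the embedding carries no information, and zero is the only
    section.\<close>
  define \<phi> where "\<phi> U s = (if U = {} then \<zero>\<^bsub>sections G U\<^esub> else
    inv_into (secs G U) (T \<circ> \<psi>' U) (\<psi> U s))" for U s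
  have bij': "bij_betw (T \<circ> \<psi>' U) (secs G U) (\<Inter>p\<in>U. \<Phi> p)"
    if "zopen N U" "U ~= {}" for U :: "'k point set"
    using G.emb_bij[OF that] bij[OF that] by (rule bij_betw_trans)
  have \<phi>_closed: "\<phi> U s \<in> secs G U"
    and \<phi>: "U ~= {} ==> T (\<psi>' U (\<phi> U s)) = \<psi> U s"
    if U: "zopen N U" and s: "s \<in> secs F U" for U s
  proof -
    have *: "\<psi> U s \<in> (T \<circ> \<psi>' U) ` secs G U" if ne: "U ~= {}"
      using bij'[OF U ne] F.emb_bij[OF U ne] s by (auto simp: bij_betw_def)
    show "\<phi> U s \<in> secs G U"
      using inv_into_into[OF *] G.zero_closed[OF U] by (auto simp: \<phi>_def)
    show "U ~= {} ==> T (\<psi>' U (\<phi> U s)) = \<psi> U s"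
      using f_inv_into_f[OF *] by (simp add: \<phi>_def)
  qed
  have \<phi>_unique: "\<phi> U s = t"
    if "zopen N U" "s \<in> secs F U" "t \<in> secs G U"
      "U ~= {} ==> T (\<psi>' U t) = \<psi> U s" for U s t
  proof (cases "U = {}")
    case True
    thus ?thesis using that G.sections_empty by (auto simp: \<phi>_def)
  next
    case False
    thus ?thesis using bij'[OF that(1) False] \<phi>[OF that(1,2) False] \<phi>_closed[OF that(1,2)] that
      by (auto simp: bij_betw_def inj_on_def)
  qed
  show ?thesis
    unfolding sheaf_iso_def
  proof (intro exI[of _ \<phi>] conjI allI impI ballI)
    fix U :: "'k point set" assume U: "zopen N U"
    interpret FU: abelian_group "sections F U" using F.sections_group[OF U] .
    interpret GU: abelian_group "sections G U" using G.sections_group[OF U] .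
    show "bij_betw (\<phi> U) (secs F U) (secs G U)"
    proof (cases "U = {}")
      case True
      thus ?thesis
        using F.sections_empty G.sections_empty by (auto simp: \<phi>_def bij_betw_def)
    next
      case False
      have "bij_betw (inv_into (secs G U) (T \<circ> \<psi>' U) \<circ> \<psi> U)
          (secs F U) (secs G U)"
        using F.emb_bij[OF U False] bij_betw_inv_into[OF bij'[OF U False]] by (rule bij_betw_trans)
      thus ?thesis by (rule bij_betw_cong[THEN iffD1, rotated]) (simp add: \<phi>_def False)
    qed
    show "abelian_group_hom (sections F U) (sections G U) (\<phi> U)"
    proof (rule abelian_group_homI)
      show "group_hom (add_monoid (sections F U)) (add_monoid (sections G U)) (\<phi> U)"
      proof (intro group_hom.intro group_hom_axioms.intro FU.a_group GU.a_group homI)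
        fix s t assume st: "s \<in> carrier (add_monoid (sections F U))" "t \<in> carrier (add_monoid (sections F U))"
        hence st': "s \<in> secs F U" "t \<in> secs F U" by auto
        have "\<phi> U (s \<oplus>\<^bsub>sections F U\<^esub> t) = \<phi> U s \<oplus>\<^bsub>sections G U\<^esub> \<phi> U t"
        proof (rule \<phi>_unique[OF U FU.a_closed[OF st'] GU.a_closed[OF st'[THEN \<phi>_closed[OF U]]]])
          assume ne: "U ~= {}"
          show "T (\<psi>' U (\<phi> U s \<oplus>\<^bsub>sections G U\<^esub> \<phi> U t)) = \<psi> U (s \<oplus>\<^bsub>sections F U\<^esub> t)"
            using st' U ne \<phi>_closed[OF U] by (simp add: G.emb_add F.emb_add add \<phi>)
        qed
        thus "\<phi> U (s \<otimes>\<^bsub>add_monoid (sections F U)\<^esub> t) = \<phi> U s \<otimes>\<^bsub>add_monoid (sections G U)\<^esub> \<phi> U t"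
          by simp
      qed (use \<phi>_closed[OF U] in auto)
    qed (use F.sections_group[OF U] G.sections_group[OF U] in auto)
    fix a s assume as: "a \<in> carrier (regular_ring N U)" "s \<in> secs F U"
    show "\<phi> U (a \<odot>\<^bsub>sections F U\<^esub> s) = a \<odot>\<^bsub>sections G U\<^esub> \<phi> U s"
    proof (rule \<phi>_unique)
      assume ne: "U ~= {}"
      then obtain x where "x \<in> rat_on N U 0" "a = reg N U x"
        using as(1) regular_ring_eq[OF U ne] by auto
      thus "T (\<psi>' U (a \<odot>\<^bsub>sections G U\<^esub> \<phi> U s)) = \<psi> U (a \<odot>\<^bsub>sections F U\<^esub> s)"
        using as U ne \<phi>_closed[OF U] by (simp add: G.emb_smult F.emb_smult \<phi> smult)
    qed (use as U \<phi>_closed[OF U] in \<open>auto intro: F.smult_closed G.smult_closed\<close>)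
  next
    fix U V :: "'k point set" and s assume *: "zopen N U \<and> zopen N V \<and> V \<subseteq> U" "s \<in> secs F U"
    show "\<phi> V (restr F U V s) = restr G U V (\<phi> U s)"
    proof (rule \<phi>_unique)
      assume "V ~= {}"
      moreover have "U ~= {}" using * calculation by auto
      ultimately show "T (\<psi>' V (restr G U V (\<phi> U s))) = \<psi> V (restr F U V s)"
        using * \<phi>_closed by (simp add: G.emb_restr F.emb_restr \<phi>)
    qed (use * \<phi>_closed in \<open>auto intro: F.restr_closed G.restr_closed\<close>)
  qed
qed

text \<open>The stalks stay the same and only the identification changes: \<open>\<psi>\<close> is
  composed with the isomorphism.\<close>

lemma embedded_sheaf_iso:
  fixes F :: "('k::{alg_closed_field, field_char_0}, 'a) proj_sheaf" and G :: "('k, 'b) proj_sheaf"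
  assumes iso: "sheaf_iso N F G" and F: "sheaf_of_modules N F"
    and G: "embedded_sheaf scale N G \<Phi> \<psi>"
  shows "\<exists>\<psi>'. embedded_sheaf scale N F \<Phi> \<psi>'"
proof -
  interpret G: embedded_sheaf scale N G \<Phi> \<psi> by fact
  from iso obtain \<phi> where *: "\<forall>U. zopen N U -->
             bij_betw (\<phi> U) (secs F U) (secs G U) \<and>
             abelian_group_hom (sections F U) (sections G U) (\<phi> U) \<and>
             (\<forall>a\<in>carrier (regular_ring N U). \<forall>s\<in>secs F U.
                \<phi> U (a \<odot>\<^bsub>sections F U\<^esub> s) = a \<odot>\<^bsub>sections G U\<^esub> \<phi> U s)"
    "\<forall>U V. zopen N U \<and> zopen N V \<and> V \<subseteq> U -->
             (\<forall>s\<in>secs F U. \<phi> V (restr F U V s) = restr G U V (\<phi> U s))"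
    unfolding sheaf_iso_def by (elim exE conjE)
  have \<phi>: "bij_betw (\<phi> U) (secs F U) (secs G U)"
    "abelian_group_hom (sections F U) (sections G U) (\<phi> U)"
    "a \<in> carrier (regular_ring N U) ==> s \<in> secs F U ==>
        \<phi> U (a \<odot>\<^bsub>sections F U\<^esub> s) = a \<odot>\<^bsub>sections G U\<^esub> \<phi> U s"
    "zopen N V ==> V \<subseteq> U ==> s \<in> secs F U ==>
        \<phi> V (restr F U V s) = restr G U V (\<phi> U s)" if "zopen N U" for U V a s
    using * that by simp_all
  have modF: "module (regular_ring N U) (sections F U)" if "zopen N U" for U
    using F that by (simp add: sheaf_of_modules_def)
  have homF: "abelian_group_hom (sections F U) (sections F V) (restr F U V)"
    if "zopen N U" "zopen N V" "V \<subseteq> U" for U V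
    using F that by (simp add: sheaf_of_modules_def)
  have \<phi>_closed: "\<phi> U s \<in> secs G U"
    if "zopen N U" "s \<in> secs F U" for U s
    using \<phi>(1)[OF that(1)] that(2) by (auto simp: bij_betw_def)
  have "embedded_sheaf scale N F \<Phi> (\<lambda>U s. \<psi> U (\<phi> U s))"
  proof (intro embedded_sheaf.intro embedded_sheaf_axioms.intro)
    fix U :: "'k point set" assume U: "zopen N U"
    interpret FU: module "regular_ring N U" "sections F U" by (rule modF[OF U])
    show "\<zero>\<^bsub>sections F U\<^esub> \<in> secs F U" by simp
    show "s \<oplus>\<^bsub>sections F U\<^esub> t \<in> secs F U"
      if "s \<in> secs F U" "t \<in> secs F U" for s t using that by simp
    show "a \<odot>\<^bsub>sections F U\<^esub> s \<in> secs F U"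
      if "a \<in> carrier (regular_ring N U)" "s \<in> secs F U" for a s using that by (rule FU.smult_closed)
    assume ne: "U ~= {}"
    interpret \<phi>: abelian_group_hom "sections F U" "sections G U" "\<phi> U" by (rule \<phi>(2)[OF U])
    show "\<psi> U (\<phi> U \<zero>\<^bsub>sections F U\<^esub>) = 0" by (simp add: G.emb_zero[OF U ne])
    show "bij_betw (\<lambda>s. \<psi> U (\<phi> U s)) (secs F U) (\<Inter>p\<in>U. \<Phi> p)"
      using bij_betw_trans[OF \<phi>(1)[OF U] G.emb_bij[OF U ne]] by (simp add: comp_def)
    show "\<psi> U (\<phi> U (s \<oplus>\<^bsub>sections F U\<^esub> t)) = \<psi> U (\<phi> U s) + \<psi> U (\<phi> U t)"
      if "s \<in> secs F U" "t \<in> secs F U" for s t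
      using that by (simp add: G.emb_add[OF U ne])
    show "\<psi> U (\<phi> U (reg N U x \<odot>\<^bsub>sections F U\<^esub> s)) = scale x (\<psi> U (\<phi> U s))"
      if "x \<in> rat_on N U 0" "s \<in> secs F U" for x s
      using that \<phi>(3)[OF U, of "reg N U x" s] regular_ring_eq[OF U ne] \<phi>_closed[OF U] U ne
      by (simp add: G.emb_smult)
  next
    fix U V :: "'k point set" and s assume *: "zopen N U" "zopen N V" "V \<subseteq> U" "s \<in> secs F U"
    show "restr F U V s \<in> secs F V"
      using abelian_group_hom.hom_closed[OF homF[OF *(1-3)] *(4)] .
    show "\<psi> V (\<phi> V (restr F U V s)) = \<psi> U (\<phi> U s)" if "V ~= {}"
      using * that \<phi>(4)[OF *] \<phi>_closed[OF *(1,4)] by (simp add: G.emb_restr)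
  next
    have e: "zopen N ({} :: 'k point set)" by simp
    have "s = t" if "s \<in> secs F {}" "t \<in> secs F {}" for s t
      using \<phi>_closed[OF e that(1)] \<phi>_closed[OF e that(2)] G.sections_empty
        bij_betw_imp_inj_on[OF \<phi>(1)[OF e], THEN inj_onD, OF _ that] by simp
    moreover have "\<zero>\<^bsub>sections F {}\<^esub> \<in> secs F {}"
      using module.axioms(2)[OF modF[OF e]] by (meson abelian_group.axioms(1) abelian_monoid.zero_closed)
    ultimately show "secs F {} = {\<zero>\<^bsub>sections F {}\<^esub>}" by blast
  qed (auto intro: G.stalk_0 G.stalk_add G.stalk_scale G.vector_space_axioms)
  thus ?thesis by blast
qed

section \<open>The structure sheaf as an embedded sheaf\<close>

lemma regular_ring_zero_closed:
  fixes U :: "'k::{alg_closed_field, field_char_0} point set"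
  assumes U: "zopen N U"
  shows "\<zero>\<^bsub>regular_ring N U\<^esub> \<in> carrier (regular_ring N U)"
proof (cases "U = {}")
  case True
  thus ?thesis by (auto simp: regular_ring_def regular_on_def)
next
  case False
  thus ?thesis
    using open_sub_proj[OF U] by (auto simp: regular_ring_eq[OF U] reg_0 rat_on_ring)
qed

lemma regular_ring_closed:
  fixes U :: "'k::{alg_closed_field, field_char_0} point set"
  assumes U: "zopen N U" and ab: "a \<in> carrier (regular_ring N U)" "b \<in> carrier (regular_ring N U)"
  shows "a \<oplus>\<^bsub>regular_ring N U\<^esub> b \<in> carrier (regular_ring N U)"
    and "a \<otimes>\<^bsub>regular_ring N U\<^esub> b \<in> carrier (regular_ring N U)"
proof -
  have "a \<oplus>\<^bsub>regular_ring N U\<^esub> b \<in> carrier (regular_ring N U) \<and>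
    a \<otimes>\<^bsub>regular_ring N U\<^esub> b \<in> carrier (regular_ring N U)"
  proof (cases "U = {}")
    case True
    thus ?thesis using ab by (auto simp: regular_ring_def regular_on_def)
  next
    case False
    then obtain x y where xy: "x \<in> rat_on N U 0" "y \<in> rat_on N U 0" "a = reg N U x" "b = reg N U y"
      using ab regular_ring_eq[OF U] by auto
    have "a \<oplus>\<^bsub>regular_ring N U\<^esub> b = reg N U (x + y)" "a \<otimes>\<^bsub>regular_ring N U\<^esub> b = reg N U (x * y)"
      using xy by (simp_all add: reg_ops)
    moreover have "reg N U (x + y) \<in> carrier (regular_ring N U)" "reg N U (x * y) \<in> carrier (regular_ring N U)"
      by (auto simp: regular_ring_eq[OF U False] intro: rat_on_ring xy)
    ultimately show ?thesis by simp
  qed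
  thus "a \<oplus>\<^bsub>regular_ring N U\<^esub> b \<in> carrier (regular_ring N U)"
    "a \<otimes>\<^bsub>regular_ring N U\<^esub> b \<in> carrier (regular_ring N U)" by auto
qed

definition ratfun_of :: "nat => 'k::field point set => ('k point => 'k) => 'k ratfun" where
  "ratfun_of N U a = inv_into (rat_on N U 0) (reg N U) a"

lemma ratfun_of_reg:
  fixes U :: "'k::{alg_closed_field, field_char_0} point set"
  assumes "zopen N U" "U ~= {}" "x \<in> rat_on N U 0"
  shows "ratfun_of N U (reg N U x) = x"
  unfolding ratfun_of_def
  by (rule inv_into_f_f[OF _ assms(3)]) (use reg_inj[OF assms(1,2)] in \<open>auto simp: inj_on_def\<close>)

lemma ratfun_of:
  fixes U :: "'k::{alg_closed_field, field_char_0} point set"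
  assumes "zopen N U" "U ~= {}" "a \<in> carrier (regular_ring N U)"
  shows "ratfun_of N U a \<in> rat_on N U 0" "reg N U (ratfun_of N U a) = a"
proof -
  obtain x where "x \<in> rat_on N U 0" "a = reg N U x" using assms regular_ring_eq by blast
  with ratfun_of_reg[OF assms(1,2)] show "ratfun_of N U a \<in> rat_on N U 0" "reg N U (ratfun_of N U a) = a"
    by auto
qed

lemma embedded_structure_sheaf:
  "embedded_sheaf (*) N (structure_sheaf N) (\<lambda>p. loc N p 0)
    (ratfun_of N :: 'k::{alg_closed_field, field_char_0} point set => _)"
proof -
  let ?S = "sections (structure_sheaf N) :: 'k point set => _"
  have carr: "carrier (?S U) = carrier (regular_ring N U)" for U by (simp add: structure_sheaf_def)
  show ?thesis
  proof (intro embedded_sheaf.intro embedded_sheaf_axioms.intro)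
    show "vector_space ((*) :: 'k ratfun => _)" by unfold_locales (auto simp: algebra_simps)
  next
    fix p :: "'k point" assume p: "p \<in> proj_space N"
    show "0 \<in> loc N p 0" by (rule loc_0[OF p])
    fix v w assume "v \<in> loc N p 0" "w \<in> loc N p 0"
    thus "v + w \<in> loc N p 0" "v * w \<in> loc N p 0"
      using loc_add loc_mult[of v N p 0 w 0] by auto
  next
    fix U :: "'k point set" assume U: "zopen N U"
    show "\<zero>\<^bsub>?S U\<^esub> \<in> carrier (?S U)" using regular_ring_zero_closed[OF U] by (simp add: structure_sheaf_def)
    show "s \<oplus>\<^bsub>?S U\<^esub> t \<in> carrier (?S U)" if "s \<in> carrier (?S U)" "t \<in> carrier (?S U)" for s t
      using that regular_ring_closed(1)[OF U] by (simp add: structure_sheaf_def)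
    show "a \<odot>\<^bsub>?S U\<^esub> s \<in> carrier (?S U)"
      if "a \<in> carrier (regular_ring N U)" "s \<in> carrier (?S U)" for a s
      using that regular_ring_closed(2)[OF U] by (simp add: structure_sheaf_def)
    assume ne: "U ~= {}"
    show "bij_betw (ratfun_of N U) (carrier (?S U)) (\<Inter>p\<in>U. loc N p 0)"
      unfolding carr
      by (rule bij_betw_byWitness[where f' = "reg N U"])
        (use ratfun_of[OF U ne] ratfun_of_reg[OF U ne] in \<open>auto simp: regular_ring_eq[OF U ne] rat_on_def\<close>)
    show "ratfun_of N U \<zero>\<^bsub>?S U\<^esub> = 0"
      using ratfun_of_reg[OF U ne rat_on_ring(5)[OF open_sub_proj[OF U]]] by (simp add: structure_sheaf_def reg_0)
    show "ratfun_of N U (s \<oplus>\<^bsub>?S U\<^esub> t) = ratfun_of N U s + ratfun_of N U t"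
      if "s \<in> carrier (?S U)" "t \<in> carrier (?S U)" for s t
      using that unfolding carr
      by (auto simp: regular_ring_eq[OF U ne] structure_sheaf_def reg_ops ratfun_of_reg[OF U ne] rat_on_ring)
    show "ratfun_of N U (reg N U x \<odot>\<^bsub>?S U\<^esub> s) = x * ratfun_of N U s"
      if "x \<in> rat_on N U 0" "s \<in> carrier (?S U)" for x s
      using that unfolding carr
      by (auto simp: regular_ring_eq[OF U ne] structure_sheaf_def reg_ops ratfun_of_reg[OF U ne] rat_on_ring)
  next
    fix U V :: "'k point set" and s
    assume *: "zopen N U" "zopen N V" "V \<subseteq> U" "s \<in> carrier (?S U)"
    thus "restr (structure_sheaf N) U V s \<in> carrier (?S V)"
      using restrict_regular[of N U V s] by (simp add: structure_sheaf_def)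
    assume "V ~= {}"
    moreover hence "U ~= {}" using * by auto
    moreover from this * obtain x where "x \<in> rat_on N U 0" "s = reg N U x"
      by (auto simp: carr regular_ring_eq)
    ultimately show "ratfun_of N V (restr (structure_sheaf N) U V s) = ratfun_of N U s"
      using * rat_on_mono[OF *(3)] by (auto simp: structure_sheaf_def restrict_reg ratfun_of_reg subset_iff)
  next
    show "carrier (?S {}) = {\<zero>\<^bsub>?S {}\<^esub>}"
      by (auto simp: structure_sheaf_def regular_ring_def regular_on_def)
  qed
qed

section \<open>Twists and direct sums of embedded sheaves\<close>

lemma var_neq_0 [simp]: "var i ~= (0 :: 'k::field mvpoly)"
proof
  assume "var i = (0 :: 'k mvpoly)"
  hence "poly_eval (var i) (\<lambda>_. 1 :: 'k) = 0" by (simp only: k_eval.peval_0)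
  thus False by simp
qed

abbreviation X :: "nat => 'k::field ratfun" where "X i \<equiv> to_fract (var i)"

lemma to_fract_power: "to_fract (f ^ n) = to_fract f ^ n"
  by (induction n) auto

section \<open>Charts and transition functions\<close>

lemma mem_coord_open: "i \<le> N ==> p \<in> coord_open N i \<longleftrightarrow> p \<in> proj_space N \<and> fval p (var i) ~= 0"
  by (auto simp: coord_open_eq basic_open_fval[OF forms_var])

lemma coord_ratio_eq:
  assumes p: "p \<in> proj_space N" and j: "fval p (var j) ~= 0"
  shows "coord_ratio i j p = fval p (var i) / fval p (var j)"
proof -
  from p obtain u where u: "u \<in> p" "u = (SOME v. v \<in> p)" "p = {w. \<exists>c. c ~= 0 \<and> w = (\<lambda>i. c * u i)}"
    by (rule proj_space_E)
  have val: "fval p (var l) = u l" for l by (simp add: fval_def flip: u(2))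
  have *: "v i / v j = u i / u j" if "v \<in> p" for v
  proof -
    from that obtain c where "c ~= 0" "v = (\<lambda>i. c * u i)" unfolding u(3) by auto
    thus ?thesis by simp
  qed
  show ?thesis
    unfolding coord_ratio_def val
  proof (rule the_equality)
    show "\<forall>v\<in>p. u i / u j = v i / v j" using * by simp
    fix c assume "\<forall>v\<in>p. c = v i / v j"
    with u(1) show "c = u i / u j" by simp
  qed
qed

lemma loc_powi:
  assumes "i \<le> N" "fval p (var i) ~= 0"
  shows "X i powi m \<in> loc N p m"
proof -
  have f: "var i ^ n \<in> forms N n" for n
    using forms_power[OF forms_var[OF assms(1)], of n] by simp
  show ?thesis
  proof (cases "m \<ge> 0")
    case True
    thus ?thesis using loc_form'[OF f, of m "nat m" p] by (simp add: power_int_def to_fract_power)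
  next
    case False
    thus ?thesis using loc_inverse[OF f, of p "nat (- m)"] assms(2)
      by (simp add: power_int_def to_fract_power power_inverse field_simps)
  qed
qed

lemma ev_powi:
  assumes "i \<le> N" "j \<le> N" "fval p (var i) ~= 0" "fval p (var j) ~= 0"
  shows "ev N p ((X i / X j) powi m) = (fval p (var i) / fval p (var j)) powi m"
proof -
  have f: "var l ^ n \<in> forms N n" if "l \<le> N" for n l
    using forms_power[OF forms_var[OF that], of n] by simp
  show ?thesis
  proof (cases "m \<ge> 0")
    case True
    thus ?thesis using ev_fract[OF f f, of i j p "nat m"] assms
      by (simp add: power_int_def to_fract_power power_divide)
  next
    case False
    thus ?thesis using ev_fract[OF f f, of j i p "nat (- m)"] assms
      by (simp add: power_int_def to_fract_power power_divide power_inverse)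
  qed
qed

lemma powi_divide: "(x / y) powi m = x powi m * y powi (- m)" for x y :: "'a::field"
  by (simp only: power_int_mult_distrib power_int_inverse power_int_minus divide_inverse)

lemma powi_cancel [simp]:
  "x ~= 0 ==> x powi m * x powi (- m) = 1" "x ~= 0 ==> x powi (- m) * x powi m = 1" for x :: "'a::field"
  by (simp_all add: power_int_minus)

lemma transition_rat:
  assumes "i \<le> N" "j \<le> N" "W \<subseteq> coord_open N i" "W \<subseteq> coord_open N j"
  shows "(X i / X j) powi m \<in> rat_on N W 0"
  unfolding rat_on_def
proof
  fix p assume p: "p \<in> W"
  have "X i powi m * X j powi (- m) \<in> loc N p (m + (- m))"
    using p assms by (intro loc_mult loc_powi) (auto simp: mem_coord_open subset_iff)
  thus "(X i / X j) powi m \<in> loc N p 0" by (simp add: powi_divide)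
qed

lemma transition_reg:
  assumes "i \<le> N" "j \<le> N" "W \<subseteq> coord_open N i" "W \<subseteq> coord_open N j"
  shows "(\<lambda>p\<in>W. coord_ratio i j p powi m) = reg N W ((X i / X j) powi m)"
  unfolding reg_def
proof (rule restrict_ext)
  fix p assume "p \<in> W"
  hence "p \<in> proj_space N" "fval p (var i) ~= 0" "fval p (var j) ~= 0"
    using assms by (auto simp: mem_coord_open subset_iff)
  thus "coord_ratio i j p powi m = ev N p ((X i / X j) powi m)"
    using assms by (simp add: ev_powi coord_ratio_eq)
qed

lemma open_int_coord:
  fixes U :: "'k::{alg_closed_field, field_char_0} point set"
  assumes "zopen N U" "i \<le> N"
  shows "zopen N (U \<inter> coord_open N i)" and "U ~= {} ==> U \<inter> coord_open N i ~= {}"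
proof -
  show "zopen N (U \<inter> coord_open N i)" using assms coord_open_open by blast
  obtain p :: "'k point" where "p \<in> proj_space N" "fval p (var i) ~= 0"
    using form_nonvanishing[OF forms_var[OF assms(2)]] var_neq_0 by blast
  hence "coord_open N i ~= ({} :: 'k point set)" using assms by (auto simp: mem_coord_open)
  thus "U ~= {} ==> U \<inter> coord_open N i ~= {}"
    using assms by (intro open_meet[of N] coord_open_open)
qed

text \<open>The stalk of \<open>F(m)\<close> inside the same vector space, without a choice of
  chart: \<open>\<O>(- m)\<close> has to carry \<open>v\<close> into the stalk of \<open>F\<close>.
  One local generator of \<open>\<O>(- m)\<close> suffices to test this, see
  \<open>twist_stalk_unit\<close>.\<close>

definition twist_stalk ::
  "('k::field ratfun => 'v => 'v) => nat => int => ('k point => 'v set) => 'k point => 'v set" where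
  "twist_stalk scale N m \<Phi> p = {v. \<forall>x\<in>loc N p (- m). scale x v \<in> \<Phi> p}"

context embedded_sheaf
begin

lemma twist_stalk_unit:
  assumes p: "p \<in> proj_space N" and u: "u \<in> loc N p (- m)" "1 / u \<in> loc N p m" "u ~= 0"
  shows "v \<in> twist_stalk scale N m \<Phi> p \<longleftrightarrow> u *s v \<in> \<Phi> p"
proof
  assume uv: "u *s v \<in> \<Phi> p"
  show "v \<in> twist_stalk scale N m \<Phi> p"
    unfolding twist_stalk_def
  proof (intro CollectI ballI)
    fix x assume "x \<in> loc N p (- m)"
    hence "x * (1 / u) \<in> loc N p 0" using loc_mult[OF _ u(2)] by fastforce
    from stalk_scale[OF p this uv] show "x *s v \<in> \<Phi> p" using u(3) by simp
  qed
qed (use u in \<open>auto simp: twist_stalk_def\<close>)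

lemma twist_stalk_coord:
  assumes "i \<le> N" "p \<in> coord_open N i"
  shows "v \<in> twist_stalk scale N m \<Phi> p \<longleftrightarrow> X i powi (- m) *s v \<in> \<Phi> p"
proof (rule twist_stalk_unit)
  have *: "p \<in> proj_space N" "fval p (var i) ~= 0" using assms by (auto simp: mem_coord_open)
  thus "X i powi (- m) \<in> loc N p (- m)" "p \<in> proj_space N" "1 / X i powi (- m) \<in> loc N p m"
    using loc_powi[of i N p "- m"] loc_powi[of i N p m] assms by (auto simp: power_int_minus divide_inverse)
qed simp

abbreviation "TW m U \<equiv> sections (twist N m F) U"
abbreviation "D \<equiv> coord_open N :: nat => 'k point set"

text \<open>Embedded and multiplied by \<open>X i powi m\<close>, the components of a section of the
  twist all become the same vector. This common value is \<open>twist_emb\<close>, read off on the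
  chart with index \<open>0\<close>.\<close>

lemma twist_carrier:
  assumes U: "zopen N U"
  shows "s \<in> carrier (TW m U) \<longleftrightarrow> s \<in> (\<Pi>\<^sub>E i\<in>{..N}. secs F (U \<inter> D i)) \<and>
    (U ~= {} --> (\<forall>i\<le>N. \<forall>j\<le>N. X i powi m *s \<psi> (U \<inter> D i) (s i) = X j powi m *s \<psi> (U \<inter> D j) (s j)))"
proof -
  define W where "W i j = U \<inter> D i \<inter> D j" for i j
  have *: "restr F (U \<inter> D j) (W i j) (s j) =
      (\<lambda>p\<in>W i j. coord_ratio i j p powi m) \<odot>\<^bsub>sections F (W i j)\<^esub> restr F (U \<inter> D i) (W i j) (s i) \<longleftrightarrow>
    (U ~= {} --> X i powi m *s \<psi> (U \<inter> D i) (s i) = X j powi m *s \<psi> (U \<inter> D j) (s j))" (is "?L = ?R \<longleftrightarrow> _")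
    if s: "s \<in> (\<Pi>\<^sub>E i\<in>{..N}. secs F (U \<inter> D i))" and ij: "i \<le> N" "j \<le> N" for i j
  proof -
    have oi: "zopen N (U \<inter> D i)" and oj: "zopen N (U \<inter> D j)"
      and oW: "zopen N (W i j)"
      using open_int_coord(1)[OF U] open_int_coord(1)[OF open_int_coord(1)[OF U]] ij by (auto simp: W_def)
    have si: "s i \<in> secs F (U \<inter> D i)" and sj: "s j \<in> secs F (U \<inter> D j)"
      using s ij by auto
    have tr: "(\<lambda>p\<in>W i j. coord_ratio i j p powi m) = reg N (W i j) ((X i / X j) powi m)"
      using ij by (intro transition_reg) (auto simp: W_def)
    have rat: "(X i / X j) powi m \<in> rat_on N (W i j) 0"
      using ij by (intro transition_rat) (auto simp: W_def)
    have L: "?L \<in> secs F (W i j)" and ri: "restr F (U \<inter> D i) (W i j) (s i) \<in> secs F (W i j)"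
      using restr_closed[OF oi oW _ si] restr_closed[OF oj oW _ sj] by (auto simp: W_def)
    show ?thesis
    proof (cases "U = {}")
      case True
      have "(\<lambda>p\<in>{}. coord_ratio i j p powi m) \<in> carrier (regular_ring N {})"
        by (simp add: regular_ring_def regular_on_def extensional_def)
      moreover have W0: "W i j = {}" by (simp add: W_def True)
      ultimately have "?R \<in> secs F (W i j)"
        using oW ri by (intro smult_closed) auto
      with L have "?L = ?R" unfolding W0 by (metis sections_empty')
      with True show ?thesis by simp
    next
      case False
      hence ne: "W i j ~= {}"
        unfolding W_def using open_int_coord(2)[OF U ij(1)] open_int_coord(2)[OF oi ij(2)] by auto
      have R: "?R \<in> secs F (W i j)"
        unfolding tr using rat by (intro smult_closed[OF oW] ri) (auto simp: regular_ring_eq[OF oW ne])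
      have "?L = ?R \<longleftrightarrow> \<psi> (W i j) ?L = \<psi> (W i j) ?R"
        using emb_inj[OF oW ne L R] by simp
      also have "\<psi> (W i j) ?L = \<psi> (U \<inter> D j) (s j)"
        using oj oW ne sj by (intro emb_restr) (auto simp: W_def)
      also have "\<psi> (W i j) ?R = (X i / X j) powi m *s \<psi> (W i j) (restr F (U \<inter> D i) (W i j) (s i))"
        unfolding tr by (rule emb_smult[OF oW ne rat ri])
      also have "\<psi> (W i j) (restr F (U \<inter> D i) (W i j) (s i)) = \<psi> (U \<inter> D i) (s i)"
        using oi oW ne si by (intro emb_restr) (auto simp: W_def)
      also have "\<psi> (U \<inter> D j) (s j) = (X i / X j) powi m *s \<psi> (U \<inter> D i) (s i) \<longleftrightarrow>
          X i powi m *s \<psi> (U \<inter> D i) (s i) = X j powi m *s \<psi> (U \<inter> D j) (s j)" (is "?a = ?b \<longleftrightarrow> ?c = ?d")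
      proof -
        have e: "X j powi m * (X i / X j) powi m = X i powi m"
          unfolding powi_divide mult.left_commute[of "X j powi m"] by simp
        have "?a = ?b \<longleftrightarrow> ?d = X j powi m *s ?b" by (simp del: scale_scale)
        also have "X j powi m *s ?b = ?c" unfolding scale_scale e ..
        finally show ?thesis by (rule trans) auto
      qed
      finally show ?thesis using False by blast
    qed
  qed
  have "s \<in> carrier (TW m U) \<longleftrightarrow> s \<in> (\<Pi>\<^sub>E i\<in>{..N}. secs F (U \<inter> D i)) \<and>
    (\<forall>i\<le>N. \<forall>j\<le>N. restr F (U \<inter> D j) (W i j) (s j) =
      (\<lambda>p\<in>W i j. coord_ratio i j p powi m) \<odot>\<^bsub>sections F (W i j)\<^esub> restr F (U \<inter> D i) (W i j) (s i))"
    by (simp add: twist_def Let_def W_def)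
  with * show ?thesis by blast
qed

lemma twist_carrierI:
  assumes "zopen N U" "\<And>i. i \<le> N ==> s i \<in> secs F (U \<inter> D i)" "\<And>i. \<not> i \<le> N ==> s i = undefined"
    and "\<And>i j. i \<le> N ==> j \<le> N ==> U ~= {} ==> X i powi m *s \<psi> (U \<inter> D i) (s i) = X j powi m *s \<psi> (U \<inter> D j) (s j)"
  shows "s \<in> carrier (TW m U)"
  unfolding twist_carrier[OF assms(1)] PiE_iff extensional_def using assms(2-4) by blast

lemma twist_carrierD:
  assumes "zopen N U" "s \<in> carrier (TW m U)"
  shows "i \<le> N ==> s i \<in> secs F (U \<inter> D i)" and "\<not> i \<le> N ==> s i = undefined"
    and "U ~= {} ==> i \<le> N ==> j \<le> N ==>
      X i powi m *s \<psi> (U \<inter> D i) (s i) = X j powi m *s \<psi> (U \<inter> D j) (s j)"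
  using assms(2) unfolding twist_carrier[OF assms(1)] PiE_iff extensional_def by blast+

definition twist_emb :: "int => 'k point set => (nat => 'a) => 'v" where
  "twist_emb m U s = X 0 powi m *s \<psi> (U \<inter> D 0) (s 0)"

lemma twist_emb_eq:
  "zopen N U ==> U ~= {} ==> s \<in> carrier (TW m U) ==> i \<le> N ==>
    twist_emb m U s = X i powi m *s \<psi> (U \<inter> D i) (s i)"
  unfolding twist_emb_def by (rule twist_carrierD(3)) auto

lemma embedded_twist: "embedded_sheaf scale N (twist N m F) (twist_stalk scale N m \<Phi>) (twist_emb m)"
proof (intro embedded_sheaf.intro embedded_sheaf_axioms.intro)
  show "vector_space (*s)" by (rule vector_space_axioms)
next
  fix p :: "'k point" assume p: "p \<in> proj_space N"
  show "0 \<in> twist_stalk scale N m \<Phi> p" using stalk_0[OF p] by (simp add: twist_stalk_def)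
  fix v w assume v: "v \<in> twist_stalk scale N m \<Phi> p"
  {
    assume "w \<in> twist_stalk scale N m \<Phi> p"
    with v show "v + w \<in> twist_stalk scale N m \<Phi> p"
      using stalk_add[OF p] by (simp add: twist_stalk_def scale_right_distrib)
  }
  fix x assume "x \<in> loc N p 0"
  hence "y * x \<in> loc N p (- m)" if "y \<in> loc N p (- m)" for y using loc_mult[OF that] by fastforce
  with v show "x *s v \<in> twist_stalk scale N m \<Phi> p" by (simp add: twist_stalk_def)
next
  fix U :: "'k point set" assume U: "zopen N U"
  have UD: "zopen N (U \<inter> D i)" "U ~= {} ==> U \<inter> D i ~= {}" if "i \<le> N" for i
    using open_int_coord[OF U that] by auto
  have comp: "s i \<in> secs F (U \<inter> D i)" if "s \<in> carrier (TW m U)" "i \<le> N" for s i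
    by (rule twist_carrierD(1)[OF U that])
  have add_eq: "s \<oplus>\<^bsub>TW m U\<^esub> t = (\<lambda>i\<in>{..N}. s i \<oplus>\<^bsub>sections F (U \<inter> D i)\<^esub> t i)" for s t
    by (simp add: twist_def)
  have zero_eq: "\<zero>\<^bsub>TW m U\<^esub> = (\<lambda>i\<in>{..N}. \<zero>\<^bsub>sections F (U \<inter> D i)\<^esub>)" by (simp add: twist_def)
  show "s \<oplus>\<^bsub>TW m U\<^esub> t \<in> carrier (TW m U)" if "s \<in> carrier (TW m U)" "t \<in> carrier (TW m U)" for s t
  proof (rule twist_carrierI[OF U])
    fix i j assume ij: "i \<le> N" "j \<le> N" "U ~= {}"
    show "X i powi m *s \<psi> (U \<inter> D i) ((s \<oplus>\<^bsub>TW m U\<^esub> t) i) = X j powi m *s \<psi> (U \<inter> D j) ((s \<oplus>\<^bsub>TW m U\<^esub> t) j)"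
      using ij that comp UD
      by (simp add: add_eq emb_add scale_right_distrib twist_carrierD(3)[OF U _ ij(3,1,2)])
  qed (simp_all add: add_eq that comp add_closed UD)
  show "\<zero>\<^bsub>TW m U\<^esub> \<in> carrier (TW m U)"
    by (rule twist_carrierI[OF U]) (simp_all add: zero_eq emb_zero UD zero_closed)
  have smult_eq: "a \<odot>\<^bsub>TW m U\<^esub> s = (\<lambda>i\<in>{..N}. restrict a (U \<inter> D i) \<odot>\<^bsub>sections F (U \<inter> D i)\<^esub> s i)" for a s
    by (simp add: twist_def)
  have reg_smult: "\<psi> (U \<inter> D i) (restrict (reg N U x) (U \<inter> D i) \<odot>\<^bsub>sections F (U \<inter> D i)\<^esub> s i) = x *s \<psi> (U \<inter> D i) (s i)"
    if "i \<le> N" "x \<in> rat_on N U 0" "s \<in> carrier (TW m U)" "U ~= {}" for i x s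
    using emb_smult[OF UD(1)[OF that(1)] UD(2)[OF that(1,4)] _ comp[OF that(3,1)], of x]
      rat_on_mono[of "U \<inter> D i" U N 0] that(2)
    by (auto simp: restrict_reg)
  show "a \<odot>\<^bsub>TW m U\<^esub> s \<in> carrier (TW m U)" if a: "a \<in> carrier (regular_ring N U)" and s: "s \<in> carrier (TW m U)" for a s
  proof -
    have c1: "restrict a (U \<inter> D i) \<odot>\<^bsub>sections F (U \<inter> D i)\<^esub> s i \<in> secs F (U \<inter> D i)" if "i \<le> N" for i
      using that comp[OF s that] restrict_regular[OF U UD(1)[OF that] _ a]
      by (intro smult_closed UD) auto
    have c2: "X i powi m *s \<psi> (U \<inter> D i) (restrict a (U \<inter> D i) \<odot>\<^bsub>sections F (U \<inter> D i)\<^esub> s i) =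
        X j powi m *s \<psi> (U \<inter> D j) (restrict a (U \<inter> D j) \<odot>\<^bsub>sections F (U \<inter> D j)\<^esub> s j)"
      if ij: "i \<le> N" "j \<le> N" "U ~= {}" for i j
    proof -
      obtain x where x: "x \<in> rat_on N U 0" "a = reg N U x" using a ij(3) by (auto simp: regular_ring_eq[OF U])
      have "X i powi m *s \<psi> (U \<inter> D i) (s i) = X j powi m *s \<psi> (U \<inter> D j) (s j)"
        using s ij by (intro twist_carrierD(3)[OF U])
      hence "x *s X i powi m *s \<psi> (U \<inter> D i) (s i) = x *s X j powi m *s \<psi> (U \<inter> D j) (s j)" by (simp only:)
      thus ?thesis unfolding x(2) reg_smult[OF ij(1) x(1) s ij(3)] reg_smult[OF ij(2) x(1) s ij(3)]
        by (simp only: scale_left_commute)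
    qed
    show ?thesis
      unfolding smult_eq
    proof (rule twist_carrierI[OF U])
      fix i j assume ij: "i \<le> N" "j \<le> N" "U ~= {}"
      from c2[OF this] ij show "X i powi m *s \<psi> (U \<inter> D i) ((\<lambda>i\<in>{..N}. restrict a (U \<inter> D i) \<odot>\<^bsub>sections F (U \<inter> D i)\<^esub> s i) i) =
          X j powi m *s \<psi> (U \<inter> D j) ((\<lambda>i\<in>{..N}. restrict a (U \<inter> D i) \<odot>\<^bsub>sections F (U \<inter> D i)\<^esub> s i) j)"
        by simp
    qed (use c1 in auto)
  qed
  assume ne: "U ~= {}"
  show "twist_emb m U \<zero>\<^bsub>TW m U\<^esub> = 0" using UD[of 0] ne by (simp add: twist_emb_def zero_eq emb_zero)
  show "twist_emb m U (s \<oplus>\<^bsub>TW m U\<^esub> t) = twist_emb m U s + twist_emb m U t"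
    if "s \<in> carrier (TW m U)" "t \<in> carrier (TW m U)" for s t
    using comp[OF that(1)] comp[OF that(2)] UD[of 0] ne
    by (simp add: twist_emb_def add_eq emb_add scale_right_distrib)
  show "twist_emb m U (reg N U x \<odot>\<^bsub>TW m U\<^esub> s) = x *s twist_emb m U s"
    if "x \<in> rat_on N U 0" "s \<in> carrier (TW m U)" for x s
    using reg_smult[OF _ that ne, of 0] by (simp add: twist_emb_def smult_eq mult.commute)
  show "bij_betw (twist_emb m U) (carrier (TW m U)) (\<Inter>p\<in>U. twist_stalk scale N m \<Phi> p)"
    unfolding bij_betw_def
  proof (intro conjI inj_onI subset_antisym image_subsetI subsetI)
    fix s t assume *: "s \<in> carrier (TW m U)" "t \<in> carrier (TW m U)" "twist_emb m U s = twist_emb m U t"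
    show "s = t"
    proof
      fix i
      show "s i = t i"
      proof (cases "i \<le> N")
        case True
        hence "X i powi m *s \<psi> (U \<inter> D i) (s i) = X i powi m *s \<psi> (U \<inter> D i) (t i)"
          using * twist_emb_eq[OF U ne] by simp
        hence "\<psi> (U \<inter> D i) (s i) = \<psi> (U \<inter> D i) (t i)" by simp
        thus ?thesis
          using emb_inj[OF UD(1)[OF True] UD(2)[OF True ne] comp[OF *(1) True] comp[OF *(2) True]] by simp
      qed (simp add: twist_carrierD(2)[OF U *(1)] twist_carrierD(2)[OF U *(2)])
    qed
  next
    fix s assume s: "s \<in> carrier (TW m U)"
    show "twist_emb m U s \<in> (\<Inter>p\<in>U. twist_stalk scale N m \<Phi> p)"
    proof
      fix p assume p: "p \<in> U"
      hence "p \<in> proj_space N" using open_sub_proj[OF U] by auto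
      then obtain i where i: "i \<le> N" "fval p (var i) ~= 0" by (rule ex_coord_nonzero)
      hence pi: "p \<in> D i" using \<open>p \<in> proj_space N\<close> by (simp add: mem_coord_open)
      have "\<psi> (U \<inter> D i) (s i) \<in> \<Phi> p"
        using p pi by (intro emb_in UD(1)[OF i(1)] comp[OF s i(1)]) auto
      thus "twist_emb m U s \<in> twist_stalk scale N m \<Phi> p"
        by (simp add: twist_stalk_coord[OF i(1) pi] twist_emb_eq[OF U ne s i(1)])
    qed
  next
    fix v assume v: "v \<in> (\<Inter>p\<in>U. twist_stalk scale N m \<Phi> p)"
    have "\<exists>s. s \<in> secs F (U \<inter> D i) \<and> \<psi> (U \<inter> D i) s = X i powi (- m) *s v" if i: "i \<le> N" for i
    proof -
      have "X i powi (- m) *s v \<in> \<Phi> p" if "p \<in> U \<inter> D i" for p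
        using v that i twist_stalk_coord[of i p v m] by auto
      thus ?thesis using emb_surj[OF UD(1)[OF i] UD(2)[OF i ne]] by metis
    qed
    then obtain s where s: "\<And>i. i \<le> N ==> s i \<in> secs F (U \<inter> D i)"
      "\<And>i. i \<le> N ==> \<psi> (U \<inter> D i) (s i) = X i powi (- m) *s v" by metis
    define s' where "s' = restrict s {..N}"
    have "s' \<in> carrier (TW m U)" by (rule twist_carrierI[OF U]) (simp_all add: s s'_def)
    moreover have "twist_emb m U s' = v" using s by (simp add: twist_emb_def s'_def)
    ultimately show "v \<in> twist_emb m U ` carrier (TW m U)" by blast
  qed
next
  fix U V :: "'k point set" and s
  assume U: "zopen N U" and V: "zopen N V" and VU: "V \<subseteq> U" and s: "s \<in> carrier (TW m U)"
  have comp: "s i \<in> secs F (U \<inter> D i)" if "i \<le> N" for i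
    by (rule twist_carrierD(1)[OF U s that])
  have restr_eq: "restr (twist N m F) U V s = (\<lambda>i\<in>{..N}. restr F (U \<inter> D i) (V \<inter> D i) (s i))"
    by (simp add: twist_def)
  have emb: "\<psi> (V \<inter> D i) (restr F (U \<inter> D i) (V \<inter> D i) (s i)) = \<psi> (U \<inter> D i) (s i)" if "i \<le> N" "V ~= {}" for i
    using open_int_coord[OF U that(1)] open_int_coord[OF V that(1)] VU that comp[OF that(1)]
    by (intro emb_restr) auto
  have "restr F (U \<inter> D i) (V \<inter> D i) (s i) \<in> secs F (V \<inter> D i)" if "i \<le> N" for i
    using open_int_coord[OF U that(1)] open_int_coord[OF V that(1)] VU that comp[OF that(1)]
    by (intro restr_closed) auto
  thus "restr (twist N m F) U V s \<in> carrier (TW m V)"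
    unfolding restr_eq
  proof (intro twist_carrierI[OF V])
    fix i j assume ij: "i \<le> N" "j \<le> N" "V ~= {}"
    hence "U ~= {}" using VU by auto
    from twist_carrierD(3)[OF U s this ij(1,2)] ij
    show "X i powi m *s \<psi> (V \<inter> D i) ((\<lambda>i\<in>{..N}. restr F (U \<inter> D i) (V \<inter> D i) (s i)) i) =
        X j powi m *s \<psi> (V \<inter> D j) ((\<lambda>i\<in>{..N}. restr F (U \<inter> D i) (V \<inter> D i) (s i)) j)"
      by (simp add: emb)
  qed auto
  show "twist_emb m V (restr (twist N m F) U V s) = twist_emb m U s" if "V ~= {}"
    using emb[OF _ that] by (simp add: twist_emb_def restr_eq)
next
  have "carrier (TW m {}) = (\<Pi>\<^sub>E i\<in>{..N}. {\<zero>\<^bsub>sections F {}\<^esub>})"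
    using twist_carrier[of "{}"] sections_empty by auto
  also have "\<dots> = {\<zero>\<^bsub>TW m {}\<^esub>}" by (auto simp: twist_def PiE_eq_singleton)
  finally show "carrier (TW m {}) = {\<zero>\<^bsub>TW m {}\<^esub>}" .
qed

end

text \<open>Vectors have entries zero from index \<open>r\<close> on, so that sums of every length
  live in the one type \<open>nat => 'v\<close>.\<close>

lemma embedded_direct_sum:
  fixes G :: "nat => ('k::{alg_closed_field, field_char_0}, 'a) proj_sheaf"
  assumes G: "\<And>i. i < r ==> embedded_sheaf scale N (G i) (\<Phi> i) (\<psi> i)" and vs: "vector_space scale"
  shows "embedded_sheaf (\<lambda>c f i. scale c (f i)) N (direct_sum r G)
    (\<lambda>p. {f. (\<forall>i<r. f i \<in> \<Phi> i p) \<and> (\<forall>i\<ge>r. f i = 0)}) (\<lambda>U s i. if i < r then \<psi> i U (s i) else 0)"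
proof (intro embedded_sheaf.intro embedded_sheaf_axioms.intro)
  interpret vector_space scale by (rule vs)
  show "vector_space (\<lambda>c f i. scale c (f i))"
    by unfold_locales (auto simp: scale_right_distrib scale_left_distrib)
next
  interpret vector_space scale by (rule vs)
  fix p :: "'k point" assume p: "p \<in> proj_space N"
  show "0 \<in> {f. (\<forall>i<r. f i \<in> \<Phi> i p) \<and> (\<forall>i\<ge>r. f i = 0)}"
    using embedded_sheaf.stalk_0[OF G p] by simp
  fix v w assume v: "v \<in> {f. (\<forall>i<r. f i \<in> \<Phi> i p) \<and> (\<forall>i\<ge>r. f i = 0)}"
  {
    assume "w \<in> {f. (\<forall>i<r. f i \<in> \<Phi> i p) \<and> (\<forall>i\<ge>r. f i = 0)}"
    with v show "v + w \<in> {f. (\<forall>i<r. f i \<in> \<Phi> i p) \<and> (\<forall>i\<ge>r. f i = 0)}"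
      using embedded_sheaf.stalk_add[OF G p] by simp
  }
  fix x assume "x \<in> loc N p 0"
  with v show "(\<lambda>i. scale x (v i)) \<in> {f. (\<forall>i<r. f i \<in> \<Phi> i p) \<and> (\<forall>i\<ge>r. f i = 0)}"
    using embedded_sheaf.stalk_scale[OF G p] by simp
next
  interpret vector_space scale by (rule vs)
  let ?S = "sections (direct_sum r G)"
  fix U :: "'k point set" assume U: "zopen N U"
  show "\<zero>\<^bsub>?S U\<^esub> \<in> carrier (?S U)"
    using embedded_sheaf.zero_closed[OF G U] by (simp add: direct_sum_def)
  show "s \<oplus>\<^bsub>?S U\<^esub> t \<in> carrier (?S U)" if "s \<in> carrier (?S U)" "t \<in> carrier (?S U)" for s t
    using that embedded_sheaf.add_closed[OF G U] by (auto simp: direct_sum_def PiE_iff)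
  show "a \<odot>\<^bsub>?S U\<^esub> s \<in> carrier (?S U)" if "a \<in> carrier (regular_ring N U)" "s \<in> carrier (?S U)" for a s
    using that embedded_sheaf.smult_closed[OF G U that(1)] by (auto simp: direct_sum_def PiE_iff)
  assume ne: "U ~= {}"
  show "(\<lambda>i. if i < r then \<psi> i U (\<zero>\<^bsub>?S U\<^esub> i) else 0) = 0"
    using embedded_sheaf.emb_zero[OF G U ne] by (auto simp: direct_sum_def)
  show "(\<lambda>i. if i < r then \<psi> i U ((s \<oplus>\<^bsub>?S U\<^esub> t) i) else 0) =
      (\<lambda>i. if i < r then \<psi> i U (s i) else 0) + (\<lambda>i. if i < r then \<psi> i U (t i) else 0)"
    if "s \<in> carrier (?S U)" "t \<in> carrier (?S U)" for s t
    using that embedded_sheaf.emb_add[OF G U ne] by (auto simp: direct_sum_def PiE_iff)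
  show "(\<lambda>i. if i < r then \<psi> i U ((reg N U x \<odot>\<^bsub>?S U\<^esub> s) i) else 0) =
      (\<lambda>i. scale x (if i < r then \<psi> i U (s i) else 0))"
    if "x \<in> rat_on N U 0" "s \<in> carrier (?S U)" for x s
    using that embedded_sheaf.emb_smult[OF G U ne that(1)] by (auto simp: direct_sum_def PiE_iff)
  show "bij_betw (\<lambda>s i. if i < r then \<psi> i U (s i) else 0) (carrier (?S U))
      (\<Inter>p\<in>U. {f. (\<forall>i<r. f i \<in> \<Phi> i p) \<and> (\<forall>i\<ge>r. f i = 0)})"
    unfolding bij_betw_def
  proof (intro conjI inj_onI subset_antisym image_subsetI subsetI)
    fix s t assume st: "s \<in> carrier (?S U)" "t \<in> carrier (?S U)"
      "(\<lambda>i. if i < r then \<psi> i U (s i) else 0) = (\<lambda>i. if i < r then \<psi> i U (t i) else 0)"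
    show "s = t"
    proof
      fix i show "s i = t i"
        using st fun_cong[OF st(3), of i] embedded_sheaf.emb_inj[OF G U ne, of i "s i" "t i"]
        by (cases "i < r") (auto simp: direct_sum_def PiE_iff extensional_def)
    qed
  next
    fix s assume "s \<in> carrier (?S U)"
    thus "(\<lambda>i. if i < r then \<psi> i U (s i) else 0) \<in> (\<Inter>p\<in>U. {f. (\<forall>i<r. f i \<in> \<Phi> i p) \<and> (\<forall>i\<ge>r. f i = 0)})"
      using embedded_sheaf.emb_in[OF G U] by (auto simp: direct_sum_def PiE_iff)
  next
    fix f assume f: "f \<in> (\<Inter>p\<in>U. {f. (\<forall>i<r. f i \<in> \<Phi> i p) \<and> (\<forall>i\<ge>r. f i = 0)})"
    have "\<exists>s. s \<in> secs (G i) U \<and> \<psi> i U s = f i" if i: "i < r" for i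
    proof -
      have "\<And>p. p \<in> U ==> f i \<in> \<Phi> i p" using f i by auto
      thus ?thesis using embedded_sheaf.emb_surj[OF G[OF i] U ne] by metis
    qed
    then obtain s where s: "\<And>i. i < r ==> s i \<in> secs (G i) U"
      "\<And>i. i < r ==> \<psi> i U (s i) = f i" by metis
    have "restrict s {..<r} \<in> carrier (?S U)" using s by (auto simp: direct_sum_def)
    moreover have "(\<lambda>i. if i < r then \<psi> i U (restrict s {..<r} i) else 0) = f"
      using s f ne by (auto simp: fun_eq_iff)
    ultimately show "f \<in> (\<lambda>s i. if i < r then \<psi> i U (s i) else 0) ` carrier (?S U)" by blast
  qed
next
  let ?S = "sections (direct_sum r G)"
  fix U V :: "'k point set" and s
  assume *: "zopen N U" "zopen N V" "V \<subseteq> U" "s \<in> carrier (?S U)"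
  show "restr (direct_sum r G) U V s \<in> carrier (?S V)"
    using * embedded_sheaf.restr_closed[OF G *(1-3)] by (auto simp: direct_sum_def PiE_iff)
  show "(\<lambda>i. if i < r then \<psi> i V (restr (direct_sum r G) U V s i) else 0) = (\<lambda>i. if i < r then \<psi> i U (s i) else 0)"
    if "V ~= {}"
    using * embedded_sheaf.emb_restr[OF G *(1-3) that] by (auto simp: direct_sum_def PiE_iff)
next
  have "secs (direct_sum r G) {} = (\<Pi>\<^sub>E i\<in>{..<r}. {\<zero>\<^bsub>sections (G i) {}\<^esub>})"
    using embedded_sheaf.sections_empty[OF G] by (auto simp: direct_sum_def PiE_iff)
  also have "\<dots> = {\<zero>\<^bsub>sections (direct_sum r G) {}\<^esub>}"
    by (auto simp: direct_sum_def PiE_eq_singleton)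
  finally show "secs (direct_sum r G) {} = {\<zero>\<^bsub>sections (direct_sum r G) {}\<^esub>}" .
qed

section \<open>Torsion free coherent sheaves embed in a constant sheaf\<close>

locale module_sheaf =
  fixes N :: nat and F :: "('k::{alg_closed_field, field_char_0}, 'a) proj_sheaf"
  assumes sheaf: "sheaf_of_modules N F"
begin

abbreviation "S U \<equiv> sections F U"
abbreviation "\<Gamma> U \<equiv> carrier (sections F U)"
abbreviation "R U \<equiv> regular_ring N U"

lemma mod: "zopen N U ==> module (R U) (S U)"
  using sheaf by (simp add: sheaf_of_modules_def)

lemma grp: "zopen N U ==> abelian_group (S U)"
  using mod by (rule module.axioms(2))

lemmas mon = abelian_group.axioms(1)[OF grp]

lemma hom: "zopen N U ==> zopen N V ==> V \<subseteq> U ==> abelian_group_hom (S U) (S V) (restr F U V)"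
  using sheaf by (simp add: sheaf_of_modules_def)

lemma restr_in: "zopen N U ==> zopen N V ==> V \<subseteq> U ==> t \<in> \<Gamma> U ==> restr F U V t \<in> \<Gamma> V"
  by (rule abelian_group_hom.hom_closed[OF hom])

lemma restr_add: "zopen N U ==> zopen N V ==> V \<subseteq> U ==> t \<in> \<Gamma> U ==> u \<in> \<Gamma> U ==>
    restr F U V (t \<oplus>\<^bsub>S U\<^esub> u) = restr F U V t \<oplus>\<^bsub>S V\<^esub> restr F U V u"
  by (rule abelian_group_hom.hom_add[OF hom])

lemma restr_zero: "zopen N U ==> zopen N V ==> V \<subseteq> U ==> restr F U V \<zero>\<^bsub>S U\<^esub> = \<zero>\<^bsub>S V\<^esub>"
  by (rule abelian_group_hom.hom_zero[OF hom])

lemma restr_smult: "zopen N U ==> zopen N V ==> V \<subseteq> U ==> a \<in> carrier (R U) ==> t \<in> \<Gamma> U ==>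
    restr F U V (a \<odot>\<^bsub>S U\<^esub> t) = restrict a V \<odot>\<^bsub>S V\<^esub> restr F U V t"
  using sheaf by (simp add: sheaf_of_modules_def)

lemma restr_restr: "zopen N U ==> zopen N V ==> zopen N W ==> W \<subseteq> V ==> V \<subseteq> U ==> t \<in> \<Gamma> U ==>
    restr F V W (restr F U V t) = restr F U W t"
proof -
  assume *: "zopen N U" "zopen N V" "zopen N W" "W \<subseteq> V" "V \<subseteq> U" "t \<in> \<Gamma> U"
  have "\<forall>U V W. zopen N U \<and> zopen N V \<and> zopen N W \<and> W \<subseteq> V \<and> V \<subseteq> U -->
        (\<forall>s\<in>\<Gamma> U. restr F V W (restr F U V s) = restr F U W s)"
    using sheaf unfolding sheaf_of_modules_def by (elim conjE) assumption
  with * show ?thesis by blast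
qed

lemma gluing:
  assumes "\<And>U. U \<in> \<U> ==> zopen N U" "\<And>U. U \<in> \<U> ==> s U \<in> \<Gamma> U"
    and "\<And>U V. U \<in> \<U> ==> V \<in> \<U> ==> restr F U (U \<inter> V) (s U) = restr F V (U \<inter> V) (s V)"
  shows "\<exists>!t. t \<in> \<Gamma> (\<Union>\<U>) \<and> (\<forall>U\<in>\<U>. restr F (\<Union>\<U>) U t = s U)"
proof -
  have "\<forall>\<U> s. (\<forall>U\<in>\<U>. zopen N U \<and> s U \<in> \<Gamma> U) \<and>
        (\<forall>U\<in>\<U>. \<forall>V\<in>\<U>. restr F U (U \<inter> V) (s U) = restr F V (U \<inter> V) (s V)) -->
        (\<exists>!t. t \<in> \<Gamma> (\<Union>\<U>) \<and> (\<forall>U\<in>\<U>. restr F (\<Union>\<U>) U t = s U))"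
    using sheaf unfolding sheaf_of_modules_def by (elim conjE) assumption
  from this[rule_format, of \<U> s] show ?thesis using assms by blast
qed

lemma zero_in: "zopen N U ==> \<zero>\<^bsub>S U\<^esub> \<in> \<Gamma> U"
  by (rule abelian_monoid.zero_closed[OF mon])

text \<open>The family of zero sections on all open sets where \<open>t\<close> restricts to zero is
  glued both by \<open>t\<close> and by zero; the gluing axiom provides uniqueness.\<close>

lemma locally_zero:
  assumes U: "zopen N U" and t: "t \<in> \<Gamma> U"
    and loc: "\<And>p. p \<in> U ==> \<exists>V. zopen N V \<and> p \<in> V \<and> V \<subseteq> U \<and> restr F U V t = \<zero>\<^bsub>S V\<^esub>"
  shows "t = \<zero>\<^bsub>S U\<^esub>"
proof -
  define \<U> where "\<U> = {V. zopen N V \<and> V \<subseteq> U \<and> restr F U V t = \<zero>\<^bsub>S V\<^esub>}"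
  have Un: "\<Union>\<U> = U" using loc by (auto simp: \<U>_def)
  have "\<exists>!u. u \<in> \<Gamma> (\<Union>\<U>) \<and> (\<forall>V\<in>\<U>. restr F (\<Union>\<U>) V u = \<zero>\<^bsub>S V\<^esub>)"
    by (rule gluing) (auto simp: \<U>_def zero_in restr_zero openin_Int)
  hence "\<exists>!u. u \<in> \<Gamma> U \<and> (\<forall>V\<in>\<U>. restr F U V u = \<zero>\<^bsub>S V\<^esub>)" by (simp only: Un)
  moreover have "t \<in> \<Gamma> U \<and> (\<forall>V\<in>\<U>. restr F U V t = \<zero>\<^bsub>S V\<^esub>)"
    using t by (simp add: \<U>_def)
  moreover have "\<zero>\<^bsub>S U\<^esub> \<in> \<Gamma> U \<and> (\<forall>V\<in>\<U>. restr F U V \<zero>\<^bsub>S U\<^esub> = \<zero>\<^bsub>S V\<^esub>)"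
    using U by (simp add: \<U>_def zero_in restr_zero)
  ultimately show ?thesis by blast
qed

end

text \<open>
  The relations of a single section \<open>t\<close> form a sheaf of finite type.  At a point where the germ of
  \<open>t\<close> does not vanish its generators vanish, by torsion freeness; but \<open>1\<close> is a relation wherever
  \<open>t\<close> vanishes.
\<close>

lemma identity_principle:
  fixes F :: "('k::{alg_closed_field, field_char_0}, 'a) proj_sheaf"
  assumes coh: "coherent N F" and tf: "torsion_free N F"
    and U: "zopen N U" and V: "zopen N V" "V \<subseteq> U" "V ~= {}"
    and t: "t \<in> carrier (sections F U)" and tV: "restr F U V t = \<zero>\<^bsub>sections F V\<^esub>"
  shows "t = \<zero>\<^bsub>sections F U\<^esub>"
proof -
  interpret module_sheaf N F using coh by unfold_locales (simp add: coherent_def)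
  show ?thesis
  proof (rule locally_zero[OF U t], rule ccontr)
    fix p assume p: "p \<in> U" and nz: "\<not> (\<exists>V. zopen N V \<and> p \<in> V \<and> V \<subseteq> U \<and> restr F U V t = \<zero>\<^bsub>S V\<^esub>)"
    have "relations_finite_type N F U 1 (\<lambda>_. t)" using coh U t by (simp add: coherent_def)
    from bspec[OF this[unfolded relations_finite_type_def] p]
    obtain V' m r where V': "zopen N V'" "p \<in> V'" "V' \<subseteq> U"
      and r: "\<forall>j<(m::nat). r j \<in> relations N F U 1 (\<lambda>_. t) V'"
      and gen: "\<forall>W a q. zopen N W \<and> W \<subseteq> V' \<and> a \<in> relations N F U 1 (\<lambda>_. t) W \<and> q \<in> W -->
           (\<exists>W' b. zopen N W' \<and> q \<in> W' \<and> W' \<subseteq> W \<and> (\<forall>j<m. b j \<in> carrier (R W')) \<and>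
              (\<forall>i<1. \<forall>x\<in>W'. a i x = (\<Sum>j<m. b j x * r j i x)))"
      by (elim exE conjE) (rule that)
    have rel: "a \<in> relations N F U 1 (\<lambda>_. t) W \<longleftrightarrow> a 0 \<in> carrier (R W) \<and>
        a 0 \<odot>\<^bsub>S W\<^esub> restr F U W t = \<zero>\<^bsub>S W\<^esub>" if W: "zopen N W" "W \<subseteq> U" for a W
    proof -
      interpret M: module "R W" "S W" by (rule mod[OF W(1)])
      have "(\<Oplus>\<^bsub>S W\<^esub>i\<in>{..<Suc 0}. a i \<odot>\<^bsub>S W\<^esub> restr F U W t) = a 0 \<odot>\<^bsub>S W\<^esub> restr F U W t"
        if "a 0 \<in> carrier (R W)"
        using that restr_in[OF U W(1,2) t] by (simp add: lessThan_Suc M.smult_closed)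
      thus ?thesis by (auto simp: relations_def)
    qed
    have r0: "r j 0 q = 0" if j: "j < m" and q: "q \<in> V'" for j q
    proof -
      have *: "r j 0 \<in> carrier (R V')" "r j 0 \<odot>\<^bsub>S V'\<^esub> restr F U V' t = \<zero>\<^bsub>S V'\<^esub>"
        using r j rel[OF V'(1,3), of "r j"] by auto
      have "germ_zero N F V' (r j 0 \<odot>\<^bsub>S V'\<^esub> restr F U V' t) p"
        unfolding germ_zero_def using V' * restr_zero[OF V'(1) V'(1)] by (intro exI[of _ V']) auto
      moreover have "\<not> germ_zero N F V' (restr F U V' t) p"
      proof
        assume "germ_zero N F V' (restr F U V' t) p"
        then obtain V'' where V'': "zopen N V''" "p \<in> V''" "V'' \<subseteq> V'"
          "restr F V' V'' (restr F U V' t) = \<zero>\<^bsub>S V''\<^esub>" unfolding germ_zero_def by (elim exE conjE)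
        hence "restr F U V'' t = \<zero>\<^bsub>S V''\<^esub>" using restr_restr[OF U V'(1) V''(1,3) V'(3) t] by simp
        hence "\<exists>V. zopen N V \<and> p \<in> V \<and> V \<subseteq> U \<and> restr F U V t = \<zero>\<^bsub>S V\<^esub>"
          using V'' V'(3) by (intro exI[of _ V''] conjI) simp_all
        with nz show False by contradiction
      qed
      ultimately have "germ_zero N (structure_sheaf N) V' (r j 0) p"
        using tf[unfolded torsion_free_def, rule_format, OF V'(2) *(1) restr_in[OF U V'(1,3) t]] V'(1) by blast
      then obtain V'' where V'': "zopen N V''" "p \<in> V''" "V'' \<subseteq> V'" "restrict (r j 0) V'' = reg N V'' 0"
        by (auto simp: germ_zero_def structure_sheaf_def reg_0)
      have ne: "V' ~= {}" "V'' ~= {}" using V' V'' by auto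
      obtain x where x: "x \<in> rat_on N V' 0" "r j 0 = reg N V' x"
        using * regular_ring_eq[OF V'(1) ne(1)] by auto
      hence "reg N V'' x = reg N V'' 0" using V'' by (simp add: restrict_reg)
      hence "x = 0"
        using x rat_on_mono[OF V''(3)] rat_on_ring(5)[OF open_sub_proj[OF V''(1)]]
        by (intro reg_inj[OF V''(1) ne(2)]) auto
      thus ?thesis using q x by (simp add: reg_def)
    qed
    define W where "W = V \<inter> V'"
    have W: "zopen N W" "W \<subseteq> V'" "W \<subseteq> V" "W \<subseteq> U" using V V' by (auto simp: W_def)
    have "W ~= {}" unfolding W_def using V V' by (intro open_meet[of N]) auto
    then obtain q where q: "q \<in> W" by blast
    interpret M: module "R W" "S W" by (rule mod[OF W(1)])
    have "restr F U W t = \<zero>\<^bsub>S W\<^esub>"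
      using restr_restr[OF U V(1) W(1,3) V(2) t] restr_zero[OF V(1) W(1,3)] tV by simp
    hence "(\<lambda>_. \<one>\<^bsub>R W\<^esub>) \<in> relations N F U 1 (\<lambda>_. t) W"
      by (subst rel[OF W(1,4)]) simp
    with W(1,2) q have "zopen N W \<and> W \<subseteq> V' \<and> (\<lambda>_. \<one>\<^bsub>R W\<^esub>) \<in> relations N F U 1 (\<lambda>_. t) W \<and> q \<in> W"
      by simp
    from gen[THEN spec, THEN spec, THEN spec, THEN mp, OF this] obtain W' b where *: "q \<in> W'"
      "\<forall>i<(1::nat). \<forall>x\<in>W'. \<one>\<^bsub>R W\<^esub> x = (\<Sum>j<m. b j x * r j i x)"
      by (elim exE conjE) (rule that)
    hence "\<one>\<^bsub>R W\<^esub> q = (\<Sum>j<m. b j q * r j 0 q)" by simp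
    also have "\<dots> = 0" using q W by (intro sum.neutral) (auto simp: r0)
    finally show False using q by (simp add: regular_ring_def)
  qed
qed

section \<open>Linear combinations of finitely many sections\<close>

locale sheaf_sections = module_sheaf N F
  for N and F :: "('k::{alg_closed_field, field_char_0}, 'a) proj_sheaf" +
  fixes W0 :: "'k point set" and n :: nat and \<sigma> :: "nat => 'a"
  assumes W0: "zopen N W0" and \<sigma>: "\<And>i. i < n ==> \<sigma> i \<in> \<Gamma> W0"
begin

abbreviation "tm W x i \<equiv> reg N W (x i) \<odot>\<^bsub>S W\<^esub> restr F W0 W (\<sigma> i)"

definition lincomb :: "nat set => 'k point set => (nat => 'k ratfun) => 'a" where
  "lincomb I W x = (\<Oplus>\<^bsub>S W\<^esub>i\<in>I. tm W x i)"

definition coeffs :: "nat set => 'k point set => (nat => 'k ratfun) set" where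
  "coeffs I W = {x. \<forall>i\<in>I. x i \<in> rat_on N W 0}"

definition sub_open :: "'k point set => bool" where
  "sub_open W \<longleftrightarrow> zopen N W \<and> W ~= {} \<and> W \<subseteq> W0"

lemma reg_in: "zopen N W ==> W ~= {} ==> x \<in> rat_on N W 0 ==> reg N W x \<in> carrier (R W)" for W :: "'k point set"
  by (simp add: regular_ring_eq)

lemma term_in:
  assumes "sub_open W" "I \<subseteq> {..<n}" "x \<in> coeffs I W" "i \<in> I"
  shows "tm W x i \<in> \<Gamma> W"
  using assms \<sigma> W0
  by (intro module.smult_closed[OF mod] reg_in restr_in) (auto simp: sub_open_def coeffs_def)

lemma \<sigma>_in: "sub_open W ==> I \<subseteq> {..<n} ==> i \<in> I ==> restr F W0 W (\<sigma> i) \<in> \<Gamma> W"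
  using \<sigma> W0 by (intro restr_in) (auto simp: sub_open_def)

lemma lincomb_in: "sub_open W ==> I \<subseteq> {..<n} ==> x \<in> coeffs I W ==> lincomb I W x \<in> \<Gamma> W"
  unfolding lincomb_def by (intro abelian_monoid.finsum_closed[OF mon]) (auto simp: term_in, auto simp: sub_open_def)

lemma lincomb_add:
  assumes W: "sub_open W" and I: "I \<subseteq> {..<n}" and x: "x \<in> coeffs I W" and y: "y \<in> coeffs I W"
  shows "lincomb I W (\<lambda>i. x i + y i) = lincomb I W x \<oplus>\<^bsub>S W\<^esub> lincomb I W y"
proof -
  have W': "zopen N W" "W ~= {}" using W by (auto simp: sub_open_def)
  interpret M: module "R W" "S W" by (rule mod[OF W'(1)])
  have xi: "x i \<in> rat_on N W 0" "y i \<in> rat_on N W 0" if "i \<in> I" for i using that x y by (auto simp: coeffs_def)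
  have "lincomb I W (\<lambda>i. x i + y i) = (\<Oplus>\<^bsub>S W\<^esub>i\<in>I. tm W x i \<oplus>\<^bsub>S W\<^esub>
      tm W y i)"
    unfolding lincomb_def
  proof (rule M.finsum_cong')
    fix i assume i: "i \<in> I"
    show "reg N W (x i + y i) \<odot>\<^bsub>S W\<^esub> restr F W0 W (\<sigma> i) = tm W x i \<oplus>\<^bsub>S W\<^esub>
        tm W y i"
      unfolding reg_ops(2)[OF xi[OF i], symmetric]
      by (intro M.smult_l_distr reg_in W' xi i \<sigma>_in[OF W I])
  qed (use term_in[OF W I x] term_in[OF W I y] in auto)
  also have "\<dots> = lincomb I W x \<oplus>\<^bsub>S W\<^esub> lincomb I W y"
    unfolding lincomb_def by (rule M.finsum_addf) (use term_in[OF W I x] term_in[OF W I y] in auto)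
  finally show ?thesis .
qed

lemma lincomb_smult:
  assumes W: "sub_open W" and I: "I \<subseteq> {..<n}" and x: "x \<in> coeffs I W" and z: "z \<in> rat_on N W 0"
  shows "lincomb I W (\<lambda>i. z * x i) = reg N W z \<odot>\<^bsub>S W\<^esub> lincomb I W x"
proof -
  have W': "zopen N W" "W ~= {}" using W by (auto simp: sub_open_def)
  interpret M: module "R W" "S W" by (rule mod[OF W'(1)])
  have xi: "x i \<in> rat_on N W 0" if "i \<in> I" for i using that x by (auto simp: coeffs_def)
  have fin: "finite I" using I finite_subset by blast
  have "lincomb I W (\<lambda>i. z * x i) = (\<Oplus>\<^bsub>S W\<^esub>i\<in>I. reg N W z \<odot>\<^bsub>S W\<^esub> (tm W x i))"
    unfolding lincomb_def
  proof (rule M.finsum_cong')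
    fix i assume i: "i \<in> I"
    show "reg N W (z * x i) \<odot>\<^bsub>S W\<^esub> restr F W0 W (\<sigma> i) = reg N W z \<odot>\<^bsub>S W\<^esub> (tm W x i)"
      unfolding reg_ops(1)[OF z xi[OF i], symmetric]
      by (intro M.smult_assoc1 reg_in W' xi i \<sigma>_in[OF W I] z)
  qed (use term_in[OF W I x] reg_in[OF W' z] in auto)
  also have "\<dots> = reg N W z \<odot>\<^bsub>S W\<^esub> lincomb I W x"
    unfolding lincomb_def using fin reg_in[OF W' z] term_in[OF W I x]
    by (intro M.finsum_smult_ldistr[symmetric]) auto
  finally show ?thesis .
qed

lemma lincomb_restr:
  assumes W: "sub_open W" and V: "zopen N V" "V ~= {}" "V \<subseteq> W" and I: "I \<subseteq> {..<n}" and x: "x \<in> coeffs I W"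
  shows "restr F W V (lincomb I W x) = lincomb I V x"
proof -
  have W': "zopen N W" "W ~= {}" "W \<subseteq> W0" using W by (auto simp: sub_open_def)
  have V': "sub_open V" using V W' by (auto simp: sub_open_def)
  interpret M: module "R W" "S W" by (rule mod[OF W'(1)])
  interpret MV: module "R V" "S V" by (rule mod[OF V(1)])
  have fin: "finite I" using I finite_subset by blast
  have xV: "x \<in> coeffs I V" using x rat_on_mono[OF V(3)] by (auto simp: coeffs_def)
  have tm: "restr F W V (tm W x i) = tm V x i"
    if i: "i \<in> I" for i
  proof -
    have "x i \<in> rat_on N W 0" using x i by (auto simp: coeffs_def)
    thus ?thesis
      using restr_smult[OF W'(1) V(1,3) reg_in[OF W'(1,2)] \<sigma>_in[OF W I i]]
        restr_restr[OF W0 W'(1) V(1,3) W'(3), of "\<sigma> i"] \<sigma> i I V(3)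
      by (auto simp: restrict_reg)
  qed
  have "restr F W V (\<Oplus>\<^bsub>S W\<^esub>i\<in>J. tm W x i) =
      (\<Oplus>\<^bsub>S V\<^esub>i\<in>J. tm V x i)" if "J \<subseteq> I" for J
  proof -
    have "finite J" using that fin finite_subset by blast
    from this that show ?thesis
    proof (induction J)
      case empty
      thus ?case using restr_zero[OF W'(1) V(1,3)] by simp
    next
      case (insert i J)
      have a: "(\<lambda>i. tm W x i) \<in> J \<rightarrow> \<Gamma> W"
        "tm W x i \<in> \<Gamma> W"
        using term_in[OF W I x] insert.prems by auto
      have b: "(\<lambda>i. tm V x i) \<in> J \<rightarrow> \<Gamma> V"
        "tm V x i \<in> \<Gamma> V"
        using term_in[OF V' I xV] insert.prems by auto
      show ?case
        unfolding M.finsum_insert[OF insert.hyps a] MV.finsum_insert[OF insert.hyps b]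
        using restr_add[OF W'(1) V(1,3) a(2) M.finsum_closed[OF a(1)]] insert tm by simp
    qed
  qed
  thus ?thesis by (simp add: lincomb_def)
qed

lemma lincomb_zero:
  assumes W: "sub_open W" and I: "I \<subseteq> {..<n}" and J: "J \<subseteq> I" and x: "x \<in> coeffs I W" "\<And>i. i \<in> I - J ==> x i = 0"
  shows "lincomb I W x = lincomb J W x"
proof -
  have W': "zopen N W" "W ~= {}" "W \<subseteq> W0" using W by (auto simp: sub_open_def)
  interpret M: module "R W" "S W" by (rule mod[OF W'(1)])
  have fin: "finite I" using I finite_subset by blast
  have 0: "tm W x i = \<zero>\<^bsub>S W\<^esub>" if "i \<in> I - J" for i
    using x(2)[OF that] \<sigma>_in[OF W I] that by (simp flip: reg_0)
  show ?thesis
    unfolding lincomb_def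
    by (rule M.add.finprod_mono_neutral_cong_left[symmetric])
      (use fin J 0 term_in[OF W I x(1)] in auto)
qed

text \<open>A version of \<open>generated_by\<close> for a subfamily, with rational instead of
  regular functions as coefficients, so that coefficients can be divided and compared across open
  sets.\<close>

definition gen_on :: "nat set => 'k point set => bool" where
  "gen_on I W \<longleftrightarrow> (\<forall>V t p. zopen N V \<and> V \<subseteq> W \<and> t \<in> \<Gamma> V \<and> p \<in> V -->
     (\<exists>W' x. zopen N W' \<and> p \<in> W' \<and> W' \<subseteq> V \<and> x \<in> coeffs I W' \<and> restr F V W' t = lincomb I W' x))"

lemma sub_open_mono: "sub_open W ==> zopen N V ==> V ~= {} ==> V \<subseteq> W ==> sub_open V"
  by (auto simp: sub_open_def)

lemma coeffs_mono: "V \<subseteq> W ==> x \<in> coeffs I W ==> x \<in> coeffs I V"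
  using rat_on_mono[of V W N 0] by (auto simp: coeffs_def)

text \<open>Where \<open>c j\<close> is invertible, which happens on a nonempty open set, the
  relation can be solved for \<open>\<sigma> j\<close>. Hence a generating subfamily that is
  smallest over all nonempty open sets admits no relation on any of them.\<close>

lemma gen_on_eliminate:
  assumes W: "sub_open W" and I: "I \<subseteq> {..<n}" and gen: "gen_on I W"
    and W': "zopen N W'" "W' \<subseteq> W" "W' ~= {}" and c: "c \<in> coeffs I W'" "lincomb I W' c = \<zero>\<^bsub>S W'\<^esub>"
    and j: "j \<in> I" "c j ~= 0"
  shows "\<exists>W''. sub_open W'' \<and> gen_on (I - {j}) W''"
proof -
  obtain p where p: "p \<in> W'" using W' by blast
  hence "c j \<in> loc N p 0" using c j by (auto simp: coeffs_def rat_on_def)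
  then obtain f g d where fg: "f \<in> forms N d" "g \<in> forms N d" "fval p g ~= 0" "g ~= 0"
    "c j = to_fract f / to_fract g" by (rule loc0E)
  have "f ~= 0" using j fg by auto
  have fg_form: "f * g \<in> forms N (d + d)" using fg by (intro forms_mult)
  define W'' where "W'' = W' \<inter> basic_open N (f * g)"
  have "basic_open N (f * g) ~= {}"
    using form_nonvanishing[OF fg_form] \<open>f ~= 0\<close> fg(4) by (auto simp: basic_open_fval[OF fg_form])
  hence ne: "W'' ~= {}"
    unfolding W''_def using W' basic_open_open[OF fg_form] by (intro open_meet[of N])
  have o: "zopen N W''" unfolding W''_def using W' basic_open_open[OF fg_form] by blast
  have so: "sub_open W''" using sub_open_mono[OF W o ne] W' by (auto simp: W''_def)
  have inv: "1 / c j \<in> rat_on N W'' 0"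
    unfolding rat_on_def
  proof
    fix q assume "q \<in> W''"
    hence "fval q f ~= 0" by (auto simp: W''_def basic_open_fval[OF fg_form])
    hence "to_fract g / to_fract f \<in> loc N q 0" using fg by (intro locI[of _ N d _ d]) auto
    thus "1 / c j \<in> loc N q 0" by (simp add: fg)
  qed
  have cW'': "c \<in> coeffs I W''" using c(1) by (rule coeffs_mono[rotated]) (simp add: W''_def)
  have c0: "lincomb I V c = \<zero>\<^bsub>S V\<^esub>" if V: "zopen N V" "V ~= {}" "V \<subseteq> W''" for V
  proof -
    have sW': "sub_open W'" using sub_open_mono[OF W W'(1,3,2)] .
    have VW': "V \<subseteq> W'" using V by (auto simp: W''_def)
    show ?thesis
      using lincomb_restr[OF sW' V(1,2) VW' I c(1)] restr_zero[OF W'(1) V(1) VW'] c(2) by simp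
  qed
  have "gen_on (I - {j}) W''"
    unfolding gen_on_def
  proof (intro allI impI, elim conjE)
    fix V t q assume V: "zopen N V" "V \<subseteq> W''" "t \<in> \<Gamma> V" "q \<in> V"
    hence "V \<subseteq> W" using W' by (auto simp: W''_def)
    with gen V obtain V' x where V': "zopen N V'" "q \<in> V'" "V' \<subseteq> V" "x \<in> coeffs I V'"
      "restr F V V' t = lincomb I V' x" unfolding gen_on_def by meson
    have ne': "V' ~= {}" and V'W'': "V' \<subseteq> W''" using V' V by auto
    have sV': "sub_open V'" using sub_open_mono[OF so V'(1) ne' V'W''] .
    \<comment> \<open>Adding \<open>z\<close> times the relation cancels the coefficient of
      \<open>\<sigma> j\<close>.\<close>
    define z where "z = - x j / c j"
    have cV': "c \<in> coeffs I V'" using coeffs_mono[OF V'W'' cW''] .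
    have "1 / c j \<in> rat_on N V' 0" using inv rat_on_mono[OF V'W''] by auto
    moreover have "x j \<in> rat_on N V' 0" using V'(4) j by (auto simp: coeffs_def)
    ultimately have z: "z \<in> rat_on N V' 0"
      using rat_on_ring(2)[of "- x j" N V' "1 / c j"] rat_on_ring(3)[of "x j" N V'] by (simp add: z_def)
    have zc: "(\<lambda>i. z * c i) \<in> coeffs I V'" using cV' z by (auto simp: coeffs_def rat_on_ring)
    define y where "y i = x i + z * c i" for i
    have y: "y \<in> coeffs I V'" using V'(4) zc by (auto simp: coeffs_def rat_on_ring y_def)
    interpret M: module "R V'" "S V'" by (rule mod[OF V'(1)])
    have "lincomb I V' y = lincomb I V' x \<oplus>\<^bsub>S V'\<^esub> lincomb I V' (\<lambda>i. z * c i)"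
      unfolding y_def by (rule lincomb_add[OF sV' I V'(4) zc])
    also have "lincomb I V' (\<lambda>i. z * c i) = \<zero>\<^bsub>S V'\<^esub>"
      using lincomb_smult[OF sV' I cV' z] c0[OF V'(1) ne' V'W''] reg_in[OF V'(1) ne' z] by simp
    also have "lincomb I V' x \<oplus>\<^bsub>S V'\<^esub> \<zero>\<^bsub>S V'\<^esub> = restr F V V' t"
      using lincomb_in[OF sV' I V'(4)] V'(5) by simp
    finally have "restr F V V' t = lincomb I V' y" by simp
    also have "\<dots> = lincomb (I - {j}) V' y"
      by (rule lincomb_zero[OF sV' I _ y]) (use j in \<open>auto simp: y_def z_def\<close>)
    finally show "\<exists>W' x. zopen N W' \<and> q \<in> W' \<and> W' \<subseteq> V \<and> x \<in> coeffs (I - {j}) W' \<and>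
        restr F V W' t = lincomb (I - {j}) W' x"
      using V' y by (intro exI[of _ V'] exI[of _ y]) (auto simp: coeffs_def)
  qed
  with so show ?thesis by blast
qed

end

lemma (in sheaf_sections) lincomb_cong:
  assumes "sub_open W" "I \<subseteq> {..<n}" "y \<in> coeffs I W" "\<And>i. i \<in> I ==> x i = y i"
  shows "lincomb I W x = lincomb I W y"
  unfolding lincomb_def using assms term_in[OF assms(1-3)]
  by (intro abelian_monoid.finsum_cong'[OF mon]) (auto simp: sub_open_def)

section \<open>Coordinates with respect to a generic basis\<close>

locale generic_basis = sheaf_sections N F W0 n \<sigma>
  for N and F :: "('k::{alg_closed_field, field_char_0}, 'a) proj_sheaf" and W0 n \<sigma> +
  fixes I :: "nat set" and Wg :: "'k point set"
  assumes coh: "coherent N F" and tf: "torsion_free N F" and Wg: "sub_open Wg" and I: "I \<subseteq> {..<n}"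
    and gen: "gen_on I Wg"
    and indep: "\<And>W c i. zopen N W ==> W \<subseteq> Wg ==> W ~= {} ==> c \<in> coeffs I W ==>
      lincomb I W c = \<zero>\<^bsub>S W\<^esub> ==> i \<in> I ==> c i = 0"
begin

text \<open>\<open>x\<close> is the coordinate vector of \<open>t\<close>. One nonempty open set is
  enough: by irreducibility it determines the coordinates, and by \<open>identity_principle\<close>
  the coordinates determine the section. The entries outside \<open>I\<close> are fixed to
  \<open>0\<close> for the sake of uniqueness.\<close>

definition rep :: "'k point set => 'a => (nat => 'k ratfun) => bool" where
  "rep U t x \<longleftrightarrow> (\<forall>i. i \<notin> I --> x i = 0) \<and>
     (\<exists>W. zopen N W \<and> W ~= {} \<and> W \<subseteq> U \<and> W \<subseteq> Wg \<and> x \<in> coeffs I W \<and> restr F U W t = lincomb I W x)"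

lemma sub_Wg: "zopen N W ==> W ~= {} ==> W \<subseteq> Wg ==> sub_open W"
  using sub_open_mono[OF Wg] .

lemma rep_on:
  assumes "rep U t x" "zopen N U" "t \<in> \<Gamma> U"
  obtains W where "zopen N W" "W ~= {}" "W \<subseteq> U" "W \<subseteq> Wg"
    "\<And>V. zopen N V ==> V ~= {} ==> V \<subseteq> W ==> x \<in> coeffs I V \<and> restr F U V t = lincomb I V x"
proof -
  from assms(1) obtain W where W: "zopen N W" "W ~= {}" "W \<subseteq> U" "W \<subseteq> Wg" "x \<in> coeffs I W"
    "restr F U W t = lincomb I W x" unfolding rep_def by (elim exE conjE)
  have "x \<in> coeffs I V \<and> restr F U V t = lincomb I V x" if V: "zopen N V" "V ~= {}" "V \<subseteq> W" for V
    using lincomb_restr[OF sub_Wg[OF W(1,2,4)] V I W(5)] restr_restr[OF assms(2) W(1) V(1,3) W(3) assms(3)]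
      W(6) coeffs_mono[OF V(3) W(5)] by simp
  with W show thesis by (intro that[of W])
qed

lemma rep_common:
  assumes "rep U t x" "zopen N U" "t \<in> \<Gamma> U" "rep U' t' x'" "zopen N U'" "t' \<in> \<Gamma> U'"
  obtains W where "zopen N W" "W ~= {}" "W \<subseteq> U" "W \<subseteq> U'" "W \<subseteq> Wg" "x \<in> coeffs I W" "x' \<in> coeffs I W"
    "restr F U W t = lincomb I W x" "restr F U' W t' = lincomb I W x'"
proof -
  obtain W where W: "zopen N W" "W ~= {}" "W \<subseteq> U" "W \<subseteq> Wg"
    "\<And>V. zopen N V ==> V ~= {} ==> V \<subseteq> W ==> x \<in> coeffs I V \<and> restr F U V t = lincomb I V x"
    using rep_on[OF assms(1-3)] by blast
  obtain W' where W': "zopen N W'" "W' ~= {}" "W' \<subseteq> U'" "W' \<subseteq> Wg"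
    "\<And>V. zopen N V ==> V ~= {} ==> V \<subseteq> W' ==> x' \<in> coeffs I V \<and> restr F U' V t' = lincomb I V x'"
    using rep_on[OF assms(4-6)] by blast
  have "zopen N (W \<inter> W')" "W \<inter> W' ~= {}" using W W' open_meet[of N W W'] by auto
  thus thesis using W(5)[of "W \<inter> W'"] W'(5)[of "W \<inter> W'"] W(3,4) W'(3)
    by (intro that[of "W \<inter> W'"]) auto
qed

lemma rep_exists:
  assumes U: "zopen N U" "U ~= {}" and t: "t \<in> \<Gamma> U"
  shows "\<exists>x. rep U t x"
proof -
  have Wg': "zopen N Wg" "Wg ~= {}" using Wg by (auto simp: sub_open_def)
  define V where "V = U \<inter> Wg"
  have V: "zopen N V" "V \<subseteq> U" "V \<subseteq> Wg" using U Wg' by (auto simp: V_def)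
  have "V ~= {}" unfolding V_def using U Wg' by (intro open_meet[of N])
  then obtain p where p: "p \<in> V" by blast
  have "zopen N V \<and> V \<subseteq> Wg \<and> restr F U V t \<in> \<Gamma> V \<and> p \<in> V"
    using V p restr_in[OF U(1) V(1,2) t] by simp
  from gen[unfolded gen_on_def, THEN spec, THEN spec, THEN spec, THEN mp, OF this]
  obtain W x where W: "zopen N W" "p \<in> W" "W \<subseteq> V" "x \<in> coeffs I W"
    "restr F V W (restr F U V t) = lincomb I W x" by (elim exE conjE)
  define y where "y i = (if i \<in> I then x i else 0)" for i
  have W': "W ~= {}" "W \<subseteq> U" "W \<subseteq> Wg" using W V by auto
  have "restr F U W t = lincomb I W y"
    using W restr_restr[OF U(1) V(1) W(1,3) V(2) t] lincomb_cong[OF sub_Wg[OF W(1) W'(1,3)] I W(4), of y]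
    by (simp add: y_def)
  moreover have "y \<in> coeffs I W" using W by (auto simp: coeffs_def y_def)
  moreover note W'
  ultimately have "rep U t y" unfolding rep_def using W(1) by (intro conjI exI[of _ W]) (auto simp: y_def)
  thus ?thesis by blast
qed

lemma rep_unique:
  assumes U: "zopen N U" and t: "t \<in> \<Gamma> U" and x: "rep U t x" and y: "rep U t y"
  shows "x = y"
proof -
  from rep_common[OF x U t y U t] obtain W where W: "zopen N W" "W ~= {}" "W \<subseteq> U" "W \<subseteq> Wg"
    "x \<in> coeffs I W" "y \<in> coeffs I W" "restr F U W t = lincomb I W x" "restr F U W t = lincomb I W y"
    by metis
  interpret M: module "R W" "S W" by (rule mod[OF W(1)])
  have sW: "sub_open W" using sub_Wg[OF W(1,2,4)] .
  have ny: "(\<lambda>i. - 1 * y i) \<in> coeffs I W" using W(6) by (auto simp: coeffs_def rat_on_ring)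
  have "lincomb I W (\<lambda>i. x i + - 1 * y i) = lincomb I W y \<oplus>\<^bsub>S W\<^esub> lincomb I W (\<lambda>i. - 1 * y i)"
    using lincomb_add[OF sW I W(5) ny] W by simp
  also have "\<dots> = lincomb I W (\<lambda>i. y i + - 1 * y i)"
    by (rule lincomb_add[OF sW I W(6) ny, symmetric])
  also have "\<dots> = lincomb I W (\<lambda>i. 0 * y i)" by simp
  also have "\<dots> = reg N W 0 \<odot>\<^bsub>S W\<^esub> lincomb I W y"
    using rat_on_ring(5)[OF open_sub_proj[OF W(1)]] by (rule lincomb_smult[OF sW I W(6)])
  also have "\<dots> = \<zero>\<^bsub>S W\<^esub>" using lincomb_in[OF sW I W(6)] by (simp flip: reg_0)
  finally have "lincomb I W (\<lambda>i. x i + - 1 * y i) = \<zero>\<^bsub>S W\<^esub>" .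
  moreover have "(\<lambda>i. x i + - 1 * y i) \<in> coeffs I W"
    using W(5) ny unfolding coeffs_def by (intro CollectI ballI rat_on_ring(1)) blast+
  ultimately have "x i + - 1 * y i = 0" if "i \<in> I" for i using indep[OF W(1,4,2)] that by blast
  hence "x i = y i" if "i \<in> I" for i using that by fastforce
  moreover have "x i = y i" if "i \<notin> I" for i using x y that by (simp add: rep_def)
  ultimately show ?thesis by blast
qed

lemma rep_add:
  assumes U: "zopen N U" and t: "t \<in> \<Gamma> U" "t' \<in> \<Gamma> U" and x: "rep U t x" "rep U t' x'"
  shows "rep U (t \<oplus>\<^bsub>S U\<^esub> t') (\<lambda>i. x i + x' i)"
proof -
  from rep_common[OF x(1) U t(1) x(2) U t(2)] obtain W where W: "zopen N W" "W ~= {}" "W \<subseteq> U" "W \<subseteq> Wg"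
    "x \<in> coeffs I W" "x' \<in> coeffs I W" "restr F U W t = lincomb I W x" "restr F U W t' = lincomb I W x'"
    by metis
  have "(\<lambda>i. x i + x' i) \<in> coeffs I W" using W by (auto simp: coeffs_def rat_on_ring)
  moreover have "restr F U W (t \<oplus>\<^bsub>S U\<^esub> t') = lincomb I W (\<lambda>i. x i + x' i)"
    using lincomb_add[OF sub_Wg[OF W(1,2,4)] I W(5,6)] restr_add[OF U W(1,3) t] W by simp
  ultimately show ?thesis unfolding rep_def using W x by (intro conjI exI[of _ W]) (auto simp: rep_def)
qed

lemma rep_smult:
  assumes U: "zopen N U" "U ~= {}" and t: "t \<in> \<Gamma> U" and x: "rep U t x" and z: "z \<in> rat_on N U 0"
  shows "rep U (reg N U z \<odot>\<^bsub>S U\<^esub> t) (\<lambda>i. z * x i)"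
proof -
  from rep_on[OF x U(1) t] obtain W where W: "zopen N W" "W ~= {}" "W \<subseteq> U" "W \<subseteq> Wg"
    and W': "x \<in> coeffs I W" "restr F U W t = lincomb I W x" by (metis subset_refl)
  have zW: "z \<in> rat_on N W 0" using z rat_on_mono[OF W(3)] by auto
  hence "(\<lambda>i. z * x i) \<in> coeffs I W" using W' by (auto simp: coeffs_def rat_on_ring)
  moreover have "restr F U W (reg N U z \<odot>\<^bsub>S U\<^esub> t) = lincomb I W (\<lambda>i. z * x i)"
    using lincomb_smult[OF sub_Wg[OF W(1,2,4)] I W'(1) zW] restr_smult[OF U(1) W(1,3) reg_in[OF U z] t] W W'
    by (simp add: restrict_reg)
  ultimately show ?thesis unfolding rep_def using W x by (intro conjI exI[of _ W]) (auto simp: rep_def)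
qed

text \<open>The open set on which the coordinates are read off meets \<open>V\<close>, so nothing is
  lost by restricting. This is what turns restriction maps into identities.\<close>

lemma rep_restr:
  assumes U: "zopen N U" and t: "t \<in> \<Gamma> U" and V: "zopen N V" "V ~= {}" "V \<subseteq> U"
  shows "rep V (restr F U V t) x \<longleftrightarrow> rep U t x"
proof
  assume x: "rep V (restr F U V t) x"
  then obtain W where W: "zopen N W" "W ~= {}" "W \<subseteq> V" "W \<subseteq> Wg" "x \<in> coeffs I W"
    "restr F V W (restr F U V t) = lincomb I W x" unfolding rep_def by (elim exE conjE)
  thus "rep U t x"
    unfolding rep_def using x V restr_restr[OF U V(1) W(1,3) V(3) t]
    by (intro conjI exI[of _ W]) (auto simp: rep_def)
next
  assume x: "rep U t x"
  from rep_on[OF this U t] obtain W where W: "zopen N W" "W ~= {}" "W \<subseteq> U" "W \<subseteq> Wg"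
    "\<And>V. zopen N V ==> V ~= {} ==> V \<subseteq> W ==> x \<in> coeffs I V \<and> restr F U V t = lincomb I V x"
    by blast
  have o: "zopen N (W \<inter> V)" "W \<inter> V ~= {}" using W V open_meet[of N W V] by auto
  have "restr F V (W \<inter> V) (restr F U V t) = restr F U (W \<inter> V) t"
    by (rule restr_restr[OF U V(1) o(1) _ V(3) t]) simp
  thus "rep V (restr F U V t) x"
    unfolding rep_def using x o W(4) W(5)[OF o]
    by (intro conjI exI[of _ "W \<inter> V"]) (auto simp: rep_def)
qed

text \<open>Torsion freeness enters here, through \<open>identity_principle\<close>: a section with
  zero coordinates vanishes on a nonempty open set.\<close>

lemma rep_zero:
  assumes U: "zopen N U" "U ~= {}" and t: "t \<in> \<Gamma> U" and x: "rep U t (\<lambda>_. 0)"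
  shows "t = \<zero>\<^bsub>S U\<^esub>"
proof -
  from rep_on[OF x U(1) t] obtain W where W: "zopen N W" "W ~= {}" "W \<subseteq> U" "W \<subseteq> Wg"
    "restr F U W t = lincomb I W (\<lambda>_. 0)" by (metis subset_refl)
  have c: "(\<lambda>_. 0) \<in> coeffs I W" using rat_on_ring(5)[OF open_sub_proj[OF W(1)]] by (auto simp: coeffs_def)
  have "lincomb I W (\<lambda>_. 0) = lincomb {} W (\<lambda>_. 0)"
    by (rule lincomb_zero[OF sub_Wg[OF W(1,2,4)] I _ c]) auto
  also have "\<dots> = \<zero>\<^bsub>S W\<^esub>" using abelian_monoid.finsum_empty[OF mon[OF W(1)]] by (simp add: lincomb_def)
  finally show ?thesis
    using W by (intro identity_principle[OF coh tf U(1) W(1,3,2) t]) simp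
qed

lemma rep_inj:
  assumes U: "zopen N U" "U ~= {}" and t: "t \<in> \<Gamma> U" "t' \<in> \<Gamma> U"
    and x: "rep U t x" "rep U t' x"
  shows "t = t'"
proof -
  interpret M: module "R U" "S U" by (rule mod[OF U(1)])
  have m1: "- 1 \<in> rat_on N U 0" by (intro rat_on_ring)
  define u where "u = reg N U (- 1) \<odot>\<^bsub>S U\<^esub> t'"
  have u: "u \<in> \<Gamma> U" unfolding u_def by (intro M.smult_closed reg_in U m1 t)
  have ru: "rep U u (\<lambda>i. - 1 * x i)" unfolding u_def by (rule rep_smult[OF U t(2) x(2) m1])
  have "rep U (t' \<oplus>\<^bsub>S U\<^esub> u) (\<lambda>i. x i + - 1 * x i)" by (rule rep_add[OF U(1) t(2) u x(2) ru])
  hence 1: "t' \<oplus>\<^bsub>S U\<^esub> u = \<zero>\<^bsub>S U\<^esub>" using t u by (intro rep_zero[OF U]) auto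
  have "rep U (t \<oplus>\<^bsub>S U\<^esub> u) (\<lambda>i. x i + - 1 * x i)" by (rule rep_add[OF U(1) t(1) u x(1) ru])
  hence 2: "t \<oplus>\<^bsub>S U\<^esub> u = \<zero>\<^bsub>S U\<^esub>" using t u by (intro rep_zero[OF U]) auto
  from 1 2 show ?thesis using t u by (metis M.add.right_cancel)
qed

section \<open>Stalks as sets of coordinate vectors\<close>

definition gstalk :: "'k point => (nat => 'k ratfun) set" where
  "gstalk p = {x. \<exists>U t. zopen N U \<and> p \<in> U \<and> t \<in> \<Gamma> U \<and> rep U t x}"

definition gemb :: "'k point set => 'a => nat => 'k ratfun" where
  "gemb U t = (THE x. rep U t x)"

lemma rep_gemb:
  assumes "zopen N U" "U ~= {}" "t \<in> \<Gamma> U"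
  shows "rep U t (gemb U t)"
  unfolding gemb_def using rep_exists[OF assms] rep_unique[OF assms(1,3)] by (metis theI)

lemma gemb_eqI: "zopen N U ==> t \<in> \<Gamma> U ==> rep U t x ==> gemb U t = x"
  unfolding gemb_def using rep_unique by (intro the_equality)

lemma rep_0:
  assumes U: "zopen N U" "U ~= {}"
  shows "rep U \<zero>\<^bsub>S U\<^esub> 0"
  using rep_smult[OF U zero_in[OF U(1)] rep_gemb[OF U zero_in[OF U(1)]] rat_on_ring(5)[OF open_sub_proj[OF U(1)]]]
    module.smult_l_null[OF mod[OF U(1)] zero_in[OF U(1)]] by (simp add: zero_fun_def flip: reg_0)

lemma gstalkE:
  assumes "x \<in> gstalk p" "zopen N V" "p \<in> V"
  obtains U t where "zopen N U" "p \<in> U" "U \<subseteq> V" "t \<in> \<Gamma> U" "rep U t x"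
proof -
  from assms obtain U t where U: "zopen N U" "p \<in> U" "t \<in> \<Gamma> U" "rep U t x"
    by (auto simp: gstalk_def)
  have o: "zopen N (U \<inter> V)" "U \<inter> V ~= {}" using U assms by auto
  hence "rep (U \<inter> V) (restr F U (U \<inter> V) t) x" using rep_restr[OF U(1,3) o] U by simp
  thus thesis using U assms o restr_in[OF U(1) o(1) _ U(3)] by (intro that[of "U \<inter> V"]) auto
qed

text \<open>Local sections with the same coordinate vector agree on overlaps by
  \<open>rep_inj\<close> and therefore glue. Only nonempty open sets enter the family, so that the
  overlaps are nonempty as well.\<close>

lemma gstalk_glue:
  assumes U: "zopen N U" "U ~= {}" and x: "\<And>p. p \<in> U ==> x \<in> gstalk p"
  obtains t where "t \<in> \<Gamma> U" "rep U t x"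
proof -
  define \<U> where "\<U> = {V. zopen N V \<and> V ~= {} \<and> V \<subseteq> U \<and> (\<exists>t\<in>\<Gamma> V. rep V t x)}"
  define s where "s V = (SOME t. t \<in> \<Gamma> V \<and> rep V t x)" for V
  have s: "s V \<in> \<Gamma> V \<and> rep V (s V) x" if "V \<in> \<U>" for V
    unfolding s_def by (rule someI_ex) (use that in \<open>auto simp: \<U>_def\<close>)
  have UnU: "\<Union>\<U> = U"
  proof (intro equalityI subsetI)
    fix p assume p: "p \<in> U"
    from gstalkE[OF x[OF p] U(1) p] obtain V t where "zopen N V" "p \<in> V" "V \<subseteq> U" "t \<in> \<Gamma> V" "rep V t x" .
    hence "V \<in> \<U>" "p \<in> V" by (auto simp: \<U>_def)
    thus "p \<in> \<Union>\<U>" by blast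
  qed (auto simp: \<U>_def)
  have "\<exists>!t. t \<in> \<Gamma> (\<Union>\<U>) \<and> (\<forall>V\<in>\<U>. restr F (\<Union>\<U>) V t = s V)"
  proof (rule gluing)
    fix V V' assume VV: "V \<in> \<U>" "V' \<in> \<U>"
    hence o: "zopen N V" "zopen N V'" "V ~= {}" "V' ~= {}" by (auto simp: \<U>_def)
    hence i: "zopen N (V \<inter> V')" "V \<inter> V' ~= {}" using open_meet[of N V V'] by auto
    show "restr F V (V \<inter> V') (s V) = restr F V' (V \<inter> V') (s V')"
      using s[OF VV(1)] s[OF VV(2)] o i restr_in[OF o(1) i(1), of "s V"] restr_in[OF o(2) i(1), of "s V'"]
        rep_restr[OF o(1) _ i, of "s V" x] rep_restr[OF o(2) _ i, of "s V'" x]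
      by (intro rep_inj[OF i]) auto
  qed (use s in \<open>auto simp: \<U>_def\<close>)
  then obtain t where t: "t \<in> \<Gamma> U" "\<And>V. V \<in> \<U> ==> restr F U V t = s V"
    unfolding UnU by blast
  obtain V where V: "V \<in> \<U>" using UnU U by blast
  hence "zopen N V" "V ~= {}" "V \<subseteq> U" by (auto simp: \<U>_def)
  hence "rep U t x" using rep_restr[OF U(1) t(1), of V x] t(2)[OF V] s[OF V] by simp
  with t(1) show thesis by (rule that)
qed

lemma embedded_gemb: "embedded_sheaf (\<lambda>c x i. c * x i) N F gstalk gemb"
proof (intro embedded_sheaf.intro embedded_sheaf_axioms.intro)
  show "vector_space (\<lambda>(c :: 'k ratfun) (x :: nat => 'k ratfun) i. c * x i)"
    by unfold_locales (auto simp: algebra_simps)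
next
  fix p :: "'k point" assume p: "p \<in> proj_space N"
  have P: "zopen N (proj_space N)" "proj_space N ~= ({} :: 'k point set)" using open_proj_space p by auto
  show "0 \<in> gstalk p" using P p zero_in[OF P(1)] rep_0[OF P] by (auto simp: gstalk_def)
  fix v assume v: "v \<in> gstalk p"
  from gstalkE[OF v P(1) p] obtain U t where U: "zopen N U" "p \<in> U" "t \<in> \<Gamma> U" "rep U t v" by metis
  {
    fix w assume w: "w \<in> gstalk p"
    from gstalkE[OF w U(1,2)] obtain V u where V: "zopen N V" "p \<in> V" "V \<subseteq> U" "u \<in> \<Gamma> V" "rep V u w"
      by metis
    have ne: "V ~= {}" using V by auto
    have t: "restr F U V t \<in> \<Gamma> V" "rep V (restr F U V t) v"
      using restr_in[OF U(1) V(1,3) U(3)] rep_restr[OF U(1,3) V(1) ne V(3)] U(4) by auto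
    have "rep V (restr F U V t \<oplus>\<^bsub>S V\<^esub> u) (\<lambda>i. v i + w i)" by (rule rep_add[OF V(1) t(1) V(4) t(2) V(5)])
    moreover have "restr F U V t \<oplus>\<^bsub>S V\<^esub> u \<in> \<Gamma> V"
      using t V by (intro abelian_monoid.a_closed[OF mon])
    ultimately show "v + w \<in> gstalk p" using V by (auto simp: gstalk_def plus_fun_def)
  }
  fix z assume "z \<in> loc N p 0"
  then obtain f g d where fg: "f \<in> forms N d" "g \<in> forms N d" "fval p g ~= 0"
    "z = to_fract f / to_fract g" by (rule loc0E)
  define V where "V = U \<inter> basic_open N g"
  have V: "zopen N V" "V \<subseteq> U" "p \<in> V" "V ~= {}"
    using U fg p basic_open_open[OF fg(2)] by (auto simp: V_def basic_open_fval[OF fg(2)])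
  have z: "z \<in> rat_on N V 0"
    unfolding rat_on_def fg(4) using fg by (auto simp: V_def basic_open_fval[OF fg(2)] intro!: locI)
  have t: "restr F U V t \<in> \<Gamma> V" "rep V (restr F U V t) v"
    using restr_in[OF U(1) V(1,2) U(3)] rep_restr[OF U(1,3) V(1,4,2)] U(4) by auto
  have "rep V (reg N V z \<odot>\<^bsub>S V\<^esub> restr F U V t) (\<lambda>i. z * v i)" by (rule rep_smult[OF V(1,4) t z])
  moreover have "reg N V z \<odot>\<^bsub>S V\<^esub> restr F U V t \<in> \<Gamma> V"
    by (intro module.smult_closed[OF mod] reg_in V z t)
  ultimately show "(\<lambda>i. z * v i) \<in> gstalk p" using V by (auto simp: gstalk_def)
next
  fix U :: "'k point set" assume U: "zopen N U"
  show "\<zero>\<^bsub>S U\<^esub> \<in> \<Gamma> U" by (rule zero_in[OF U])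
  show "s \<oplus>\<^bsub>S U\<^esub> t \<in> \<Gamma> U" if "s \<in> \<Gamma> U" "t \<in> \<Gamma> U" for s t
    using that by (rule abelian_monoid.a_closed[OF mon[OF U]])
  show "a \<odot>\<^bsub>S U\<^esub> s \<in> \<Gamma> U" if "a \<in> carrier (R U)" "s \<in> \<Gamma> U" for a s
    using that by (rule module.smult_closed[OF mod[OF U]])
  assume ne: "U ~= {}"
  show "gemb U \<zero>\<^bsub>S U\<^esub> = 0" by (rule gemb_eqI[OF U zero_in[OF U] rep_0[OF U ne]])
  show "bij_betw (gemb U) (\<Gamma> U) (\<Inter>p\<in>U. gstalk p)"
    unfolding bij_betw_def
  proof (intro conjI inj_onI subset_antisym image_subsetI subsetI)
    fix s t assume "s \<in> \<Gamma> U" "t \<in> \<Gamma> U" "gemb U s = gemb U t"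
    thus "s = t" using rep_gemb[OF U ne] rep_inj[OF U ne] by metis
  next
    fix s assume "s \<in> \<Gamma> U"
    thus "gemb U s \<in> (\<Inter>p\<in>U. gstalk p)" using rep_gemb[OF U ne] U by (auto simp: gstalk_def)
  next
    fix x assume "x \<in> (\<Inter>p\<in>U. gstalk p)"
    then obtain t where "t \<in> \<Gamma> U" "rep U t x" using gstalk_glue[OF U ne] by blast
    thus "x \<in> gemb U ` \<Gamma> U" using gemb_eqI[OF U] by (metis imageI)
  qed
  show "gemb U (s \<oplus>\<^bsub>S U\<^esub> t) = gemb U s + gemb U t" if "s \<in> \<Gamma> U" "t \<in> \<Gamma> U" for s t
    unfolding plus_fun_def using that
    by (intro gemb_eqI[OF U] rep_add[OF U] rep_gemb[OF U ne] abelian_monoid.a_closed[OF mon[OF U]])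
  show "gemb U (reg N U x \<odot>\<^bsub>S U\<^esub> s) = (\<lambda>i. x * gemb U s i)" if "x \<in> rat_on N U 0" "s \<in> \<Gamma> U" for x s
    using that by (intro gemb_eqI[OF U] rep_smult[OF U ne] rep_gemb[OF U ne] module.smult_closed[OF mod[OF U]] reg_in[OF U ne])
next
  fix U V :: "'k point set" and s assume *: "zopen N U" "zopen N V" "V \<subseteq> U" "s \<in> \<Gamma> U"
  thus "restr F U V s \<in> \<Gamma> V" by (rule restr_in)
  assume ne: "V ~= {}"
  hence "U ~= {}" using * by auto
  thus "gemb V (restr F U V s) = gemb U s"
    using * rep_restr[OF *(1,4,2) ne *(3)] restr_in[OF *] rep_gemb[OF *(1) _ *(4)] by (intro gemb_eqI) auto
next
  have e: "zopen N {}" by simp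
  have "s = \<zero>\<^bsub>S {}\<^esub>" if "s \<in> carrier (S {})" for s
    using that by (intro locally_zero[OF e]) auto
  thus "carrier (S {}) = {\<zero>\<^bsub>S {}\<^esub>}" using zero_in[OF e] by blast
qed

text \<open>The point \<open>q\<close> lies where the generic basis generates, and this need not be
  near \<open>p\<close>. It serves to record that all entries are quotients of forms of equal
  degree.\<close>

lemma gstalk_coords:
  assumes "x \<in> gstalk p"
  shows "\<exists>q. q \<in> proj_space N \<and> (\<forall>i. x i \<in> loc N q 0)" and "i \<notin> I ==> x i = 0"
proof -
  from assms obtain U t where "rep U t x" by (auto simp: gstalk_def)
  then obtain W where *: "\<And>i. i \<notin> I ==> x i = 0" "zopen N W" "W ~= {}" "x \<in> coeffs I W"
    unfolding rep_def by (elim exE conjE) blast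
  then obtain q where "q \<in> W" by blast
  moreover hence "q \<in> proj_space N" using open_sub_proj[OF *(2)] by auto
  ultimately have "x i \<in> loc N q 0" for i
    using * by (cases "i \<in> I") (auto simp: coeffs_def rat_on_def intro: loc_0)
  thus "\<exists>q. q \<in> proj_space N \<and> (\<forall>i. x i \<in> loc N q 0)" using \<open>q \<in> proj_space N\<close> by blast
  show "i \<notin> I ==> x i = 0" using * by blast
qed

end

text \<open>Finite type in terms of stalks alone, so that the sheaf can be forgotten in what
  follows. That the same vectors generate at all points near \<open>p\<close> is what makes the
  Nullstellensatz applicable.\<close>

definition finite_stalks ::
  "('k::{alg_closed_field, field_char_0} ratfun => 'v::ab_group_add => 'v) => nat => ('k point => 'v set) => bool" where
  "finite_stalks scale N \<Phi> \<longleftrightarrow> (\<forall>p\<in>proj_space N. \<exists>d>0. \<exists>g\<in>forms N d. \<exists>(n::nat) v. fval p g ~= 0 \<and>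
     (\<forall>q\<in>basic_open N g. (\<forall>l<n. v l \<in> \<Phi> q) \<and>
        (\<forall>x\<in>\<Phi> q. \<exists>z. (\<forall>l<n. z l \<in> loc N q 0) \<and> x = (\<Sum>l<n. scale (z l) (v l)))))"

lemma (in generic_basis) finite_gstalk: "finite_stalks (\<lambda>c x i. c * x i) N gstalk"
  unfolding finite_stalks_def
proof
  interpret E: embedded_sheaf "\<lambda>c x i. c * x i" N F gstalk gemb by (rule embedded_gemb)
  fix p :: "'k point" assume p: "p \<in> proj_space N"
  have "finite_type N F" using coh by (simp add: coherent_def)
  from bspec[OF this[unfolded finite_type_def] p] obtain U n' s where U: "zopen N U" "p \<in> U"
    and s: "\<And>i. i < n' ==> s i \<in> \<Gamma> U" and gen': "generated_by N F U n' s" by blast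
  obtain d g where g: "d > 0" "g \<in> forms N d" "fval p g ~= 0" "basic_open N g \<subseteq> U"
    using open_basic[OF U] by metis
  define v where "v l = gemb U (s l)" for l
  have "(\<forall>l<n'. v l \<in> gstalk q) \<and> (\<forall>x\<in>gstalk q. \<exists>z. (\<forall>l<n'. z l \<in> loc N q 0) \<and> x = (\<Sum>l<n'. (\<lambda>i. z l * v l i)))"
    if "q \<in> basic_open N g" for q
  proof (intro conjI allI impI ballI)
    have q: "q \<in> U" using that g by auto
    show "v l \<in> gstalk q" if "l < n'" for l unfolding v_def using U q s that by (intro E.emb_in)
    fix x assume "x \<in> gstalk q"
    from gstalkE[OF this U(1) q] obtain V t where V: "zopen N V" "q \<in> V" "V \<subseteq> U" "t \<in> \<Gamma> V" "rep V t x" .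
    hence "zopen N V \<and> V \<subseteq> U \<and> t \<in> \<Gamma> V \<and> q \<in> V" by simp
    from gen'[unfolded generated_by_def, THEN spec, THEN spec, THEN spec, THEN mp, OF this]
    obtain W a where W: "zopen N W" "q \<in> W" "W \<subseteq> V" "\<forall>i<n'. a i \<in> carrier (R W)"
      "restr F V W t = (\<Oplus>\<^bsub>S W\<^esub>i\<in>{..<n'}. a i \<odot>\<^bsub>S W\<^esub> restr F U W (s i))" by (elim exE conjE)
    have ne: "W ~= {}" and WU: "W \<subseteq> U" using W V by auto
    define z where "z i = ratfun_of N W (a i)" for i
    have z: "z i \<in> rat_on N W 0" "reg N W (z i) = a i" if "i < n'" for i
      using W(4) that ratfun_of[OF W(1) ne] by (auto simp: z_def)
    have sW: "restr F U W (s i) \<in> \<Gamma> W" if "i < n'" for i by (rule restr_in[OF U(1) W(1) WU s[OF that]])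
    have "x = gemb V t" using V by (intro gemb_eqI[symmetric])
    also have "\<dots> = gemb W (restr F V W t)" using V W ne by (intro E.emb_restr[symmetric])
    also have "\<dots> = (\<Sum>i<n'. gemb W (a i \<odot>\<^bsub>S W\<^esub> restr F U W (s i)))"
      unfolding W(5) using W(4) sW by (intro E.emb_finsum[OF W(1) ne] E.smult_closed W(1)) auto
    also have "\<dots> = (\<Sum>i<n'. (\<lambda>j. z i * v i j))"
    proof (intro sum.cong refl)
      fix i assume "i \<in> {..<n'}"
      hence i: "i < n'" by simp
      show "gemb W (a i \<odot>\<^bsub>S W\<^esub> restr F U W (s i)) = (\<lambda>j. z i * v i j)"
        using E.emb_smult[OF W(1) ne z(1)[OF i] sW[OF i]] E.emb_restr[OF U(1) W(1) WU ne s[OF i]]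
        by (simp add: z(2)[OF i] v_def)
    qed
    finally show "\<exists>z. (\<forall>l<n'. z l \<in> loc N q 0) \<and> x = (\<Sum>l<n'. (\<lambda>i. z l * v l i))"
      using z W(2) by (intro exI[of _ z]) (auto simp: rat_on_def)
  qed
  thus "\<exists>d>0. \<exists>g\<in>forms N d. \<exists>(n::nat) v. fval p g ~= 0 \<and> (\<forall>q\<in>basic_open N g. (\<forall>l<n. v l \<in> gstalk q) \<and>
        (\<forall>x\<in>gstalk q. \<exists>z. (\<forall>l<n. z l \<in> loc N q 0) \<and> x = (\<Sum>l<n. (\<lambda>i. z l * v l i))))"
    by (intro exI[of _ d] conjI bexI[of _ g] exI[of _ n'] exI[of _ v] g ballI) blast+
qed

theorem torsion_free_coherent_embedding:
  fixes F :: "('k::{alg_closed_field, field_char_0}, 'a) proj_sheaf"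
  assumes coh: "coherent N F" and tf: "torsion_free N F"
  obtains \<Phi> :: "'k point => (nat => 'k ratfun) set" and \<psi> and I :: "nat set"
  where "embedded_sheaf (\<lambda>c x i. c * x i) N F \<Phi> \<psi>" "finite_stalks (\<lambda>c x i. c * x i) N \<Phi>" "finite I"
    "\<And>p x i. x \<in> \<Phi> p ==> i \<notin> I ==> x i = 0"
    "\<And>p x. x \<in> \<Phi> p ==> \<exists>q. q \<in> proj_space N \<and> (\<forall>i. x i \<in> loc N q 0)"
proof -
  interpret module_sheaf N F using coh by unfold_locales (simp add: coherent_def)
  obtain p :: "'k point" where p: "p \<in> proj_space N"
    using form_nonvanishing[OF forms_var[of 0 N]] var_neq_0 by blast
  have "finite_type N F" using coh by (simp add: coherent_def)
  from bspec[OF this[unfolded finite_type_def] p] obtain W0 n \<sigma> where W0': "zopen N W0" "p \<in> W0"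
    and \<sigma>: "\<And>i. i < n ==> \<sigma> i \<in> \<Gamma> W0" and gen: "generated_by N F W0 n \<sigma>" by blast
  interpret sheaf_sections N F W0 n \<sigma> by unfold_locales (use W0' \<sigma> in auto)
  have so: "sub_open W0" using W0' by (auto simp: sub_open_def)
  have "gen_on {..<n} W0"
    unfolding gen_on_def
  proof (intro allI impI)
    fix V t p assume V: "zopen N V \<and> V \<subseteq> W0 \<and> t \<in> \<Gamma> V \<and> p \<in> V"
    from gen[unfolded generated_by_def, THEN spec, THEN spec, THEN spec, THEN mp, OF this]
    obtain W a where W: "zopen N W" "p \<in> W" "W \<subseteq> V" "\<forall>i<n. a i \<in> carrier (R W)"
      "restr F V W t = (\<Oplus>\<^bsub>S W\<^esub>i\<in>{..<n}. a i \<odot>\<^bsub>S W\<^esub> restr F W0 W (\<sigma> i))" by (elim exE conjE)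
    have ne: "W ~= {}" using W by auto
    have so: "sub_open W" using W V ne by (auto simp: sub_open_def)
    define x where "x i = ratfun_of N W (a i)" for i
    have x: "x i \<in> rat_on N W 0" "reg N W (x i) = a i" if "i < n" for i
      using W(4) that ratfun_of[OF W(1) ne] by (auto simp: x_def)
    have xc: "x \<in> coeffs {..<n} W" using x by (auto simp: coeffs_def)
    have "lincomb {..<n} W x = restr F V W t"
      unfolding W(5) lincomb_def using W(4) \<sigma>_in[OF so, of "{..<n}"]
      by (intro abelian_monoid.finsum_cong'[OF mon[OF W(1)]]) (auto simp: x intro!: module.smult_closed[OF mod[OF W(1)]])
    with W xc show "\<exists>W' x. zopen N W' \<and> p \<in> W' \<and> W' \<subseteq> V \<and> x \<in> coeffs {..<n} W' \<and> restr F V W' t = lincomb {..<n} W' x"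
      by (intro exI[of _ W] exI[of _ x]) simp
  qed
  with so have "{..<n} \<subseteq> {..<n} \<and> (\<exists>W. sub_open W \<and> gen_on {..<n} W)" by blast
  \<comment> \<open>The cardinality is minimal among the generating subfamilies over all nonempty
    open sets at once, so \<open>gen_on_eliminate\<close> excludes every nontrivial
    relation.\<close>
  from ex_has_least_nat[of "\<lambda>I. I \<subseteq> {..<n} \<and> (\<exists>W. sub_open W \<and> gen_on I W)", OF this, of card]
  obtain I where I': "I \<subseteq> {..<n} \<and> (\<exists>W. sub_open W \<and> gen_on I W)"
    and least': "\<forall>J. J \<subseteq> {..<n} \<and> (\<exists>W. sub_open W \<and> gen_on J W) --> card I \<le> card J"
    by (elim exE conjE) (rule that, intro conjI exI)
  from I' obtain Wg where I: "I \<subseteq> {..<n}" "sub_open Wg" "gen_on I Wg" by (elim exE conjE)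
  have least: "card I \<le> card J" if "J \<subseteq> {..<n}" "sub_open W" "gen_on J W" for J W
    using that by (intro least'[THEN spec, THEN mp] conjI exI)
  have fin: "finite I" using I(1) finite_subset by blast
  interpret generic_basis N F W0 n \<sigma> I Wg
  proof unfold_locales
    fix W c i assume W: "zopen N W" "W \<subseteq> Wg" "W ~= {}" "c \<in> coeffs I W" "lincomb I W c = \<zero>\<^bsub>S W\<^esub>" "i \<in> I"
    show "c i = 0"
    proof (rule ccontr)
      assume "c i ~= 0"
      from gen_on_eliminate[OF I(2,1,3) W this] obtain W'' where "sub_open W''" "gen_on (I - {i}) W''" by blast
      hence "card I \<le> card (I - {i})" using I(1) by (intro least) auto
      thus False using card_Diff1_less[OF fin W(6)] by linarith
    qed
  qed (use coh tf I in auto)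
  show thesis
    by (rule that[of gstalk gemb I]) (fact embedded_gemb finite_gstalk fin gstalk_coords)+
qed

section \<open>Sections over basic open sets\<close>

lemma poly_eval_form_0:
  assumes "f \<in> forms N d" "d > 0"
  shows "poly_eval f (\<lambda>_. 0) = 0"
  using forms_scale[OF assms(1), of 0 "\<lambda>_. 0"] assms(2) by (cases d) auto

text \<open>Positive degree makes \<open>h\<close> vanish at the zero vector, the only vector that
  represents no point.\<close>

lemma nullstellensatz_points:
  fixes I :: "nat => 'k::{alg_closed_field, field_char_0} mvpoly set"
  assumes I: "\<And>e. I e \<subseteq> forms N e" "\<And>e. 0 \<in> I e" "\<And>e f g. f \<in> I e ==> g \<in> I e ==> f + g \<in> I e"
    "\<And>a e f g. f \<in> forms N a ==> g \<in> I e ==> f * g \<in> I (a + e)"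
    and h: "h \<in> forms N d" "d > 0"
    and pts: "\<And>p. p \<in> basic_open N h ==> \<exists>e. \<exists>g\<in>I e. fval p g ~= 0"
  shows "\<exists>K. h ^ K \<in> I (K * d)"
proof (rule nullstellensatz_graded[OF I h(1)])
  fix v assume v: "\<forall>i>N. v i = (0::'k)" "\<forall>e. \<forall>g\<in>I e. poly_eval g v = 0"
  show "poly_eval h v = 0"
  proof (rule ccontr)
    assume hv: "poly_eval h v ~= 0"
    hence "v ~= (\<lambda>_. 0)" using poly_eval_form_0[OF h] by metis
    from point_of[OF this v(1)] obtain p where p: "p \<in> proj_space N"
      "\<And>d f. f \<in> forms N d ==> fval p f = 0 \<longleftrightarrow> poly_eval f v = 0" by metis
    hence "p \<in> basic_open N h" using hv h by (auto simp: basic_open_fval[OF h(1)])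
    with pts obtain e g where "g \<in> I e" "fval p g ~= 0" by blast
    thus False using p(2) v(2) I(1) by blast
  qed
qed

text \<open>The forms vanishing on the common zeros of some finite part of \<open>G\<close> make up
  a graded ideal without zeros, so it contains a power of every variable; this provides one finite
  part per variable.\<close>

lemma proj_space_compact:
  fixes G :: "'k::{alg_closed_field, field_char_0} mvpoly set"
  assumes G: "\<And>g. g \<in> G ==> \<exists>d. g \<in> forms N d"
    and cover: "\<And>p. p \<in> proj_space N ==> \<exists>g\<in>G. fval p g ~= 0"
  obtains G0 where "finite G0" "G0 \<subseteq> G" "\<And>p. p \<in> proj_space N ==> \<exists>g\<in>G0. fval p g ~= 0"
proof -
  define I where "I e = {f \<in> forms N e. \<exists>G0. finite G0 \<and> G0 \<subseteq> G \<and>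
    (\<forall>p\<in>proj_space N. (\<forall>g\<in>G0. fval p g = 0) --> fval p f = 0)}" for e
  have "\<exists>G0. finite G0 \<and> G0 \<subseteq> G \<and> (\<forall>p\<in>proj_space N. (\<forall>g\<in>G0. fval p g = 0) --> fval p (var i) = 0)"
    if i: "i \<le> N" for i
  proof -
    have "\<exists>K. var i ^ K \<in> I (K * Suc 0)"
    proof (rule nullstellensatz_points[OF _ _ _ _ forms_var[OF i]])
      show "I e \<subseteq> forms N e" for e by (auto simp: I_def)
      show "0 \<in> I e" for e by (auto simp: I_def)
      show "f * g \<in> I (a + e)" if "f \<in> forms N a" "g \<in> I e" for a e f g
        using that unfolding I_def by (auto intro!: forms_mult)
      show "f + g \<in> I e" if fg: "f \<in> I e" "g \<in> I e" for e f g
      proof -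
        from fg obtain A B where AB: "finite A" "A \<subseteq> G" "finite B" "B \<subseteq> G"
          "\<forall>p\<in>proj_space N. (\<forall>g\<in>A. fval p g = 0) --> fval p f = 0"
          "\<forall>p\<in>proj_space N. (\<forall>g\<in>B. fval p g = 0) --> fval p g = 0" "f \<in> forms N e" "g \<in> forms N e"
          by (auto simp: I_def)
        thus ?thesis unfolding I_def by (auto intro!: exI[of _ "A \<union> B"] forms_add)
      qed
      fix p assume "p \<in> basic_open N (var i :: 'k mvpoly)"
      hence "p \<in> proj_space N" by (simp add: basic_open_def)
      then obtain g where g: "g \<in> G" "fval p g ~= 0" using cover by blast
      then obtain e where "g \<in> forms N e" using G by blast
      hence "g \<in> I e" using g(1) by (auto simp: I_def intro!: exI[of _ "{g}"])
      with g show "\<exists>e. \<exists>g\<in>I e. fval p g ~= 0" by blast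
    qed simp
    thus ?thesis by (auto simp: I_def)
  qed
  then obtain G' where G': "\<And>i. i \<le> N ==> finite (G' i) \<and> G' i \<subseteq> G \<and>
      (\<forall>p\<in>proj_space N. (\<forall>g\<in>G' i. fval p g = 0) --> fval p (var i) = 0)" by metis
  have "\<exists>g\<in>(\<Union>i\<le>N. G' i). fval p g ~= 0" if p: "p \<in> proj_space N" for p
  proof -
    obtain i where "i \<le> N" "fval p (var i) ~= 0" using p by (rule ex_coord_nonzero)
    thus ?thesis using G'[of i] p by auto
  qed
  thus thesis using G' by (intro that[of "\<Union>i\<le>N. G' i"]) blast+
qed

text \<open>Forms with an integer as degree. In negative degrees only \<open>0\<close> is left, so
  that degree differences such as \<open>n - d i\<close> need no truncated subtraction.\<close>

definition hform :: "nat => int => 'k::field ratfun set" where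
  "hform N e = {to_fract a | a d. a \<in> forms N d \<and> (int d = e \<or> a = 0)}"

lemma hform_0 [simp]: "0 \<in> hform N e"
  by (auto simp: hform_def intro!: exI[of _ 0])

lemma hform_form: "a \<in> forms N d ==> to_fract a \<in> hform N (int d)"
  by (auto simp: hform_def)

lemma hformE:
  assumes "x \<in> hform N e"
  obtains "x = 0" | a d where "x = to_fract a" "a \<in> forms N d" "int d = e"
  using assms by (auto simp: hform_def)

lemma hform_add: "x \<in> hform N e ==> y \<in> hform N e ==> x + y \<in> hform N e"
proof (elim hformE)
  fix a d b c assume "x = to_fract a" "a \<in> forms N d" "int d = e" "y = to_fract b" "b \<in> forms N c" "int c = e"
  thus ?thesis using hform_form[OF forms_add[of a N d b]] by auto
qed (auto simp: hform_form)

lemma hform_mult: "x \<in> hform N e ==> y \<in> hform N e' ==> x * y \<in> hform N (e + e')"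
proof (elim hformE)
  fix a d b c assume "x = to_fract a" "a \<in> forms N d" "int d = e" "y = to_fract b" "b \<in> forms N c" "int c = e'"
  thus ?thesis using hform_form[OF forms_mult[of a N d b c]] by auto
qed auto

lemma hform_sum: "(\<And>i. i \<in> A ==> f i \<in> hform N e) ==> sum f A \<in> hform N e"
  by (induction A rule: infinite_finite_induct) (auto intro: hform_add)

lemma hform_loc: "x \<in> hform N e ==> p \<in> proj_space N ==> x \<in> loc N p e"
  by (elim hformE) (auto simp: loc_0 loc_form)

lemma loc_common_denominator:
  assumes "finite A" "p \<in> proj_space N" "\<And>b. b \<in> A ==> y b \<in> loc N p (m b)"
  shows "\<exists>e a. a \<in> forms N e \<and> fval p a ~= 0 \<and> (\<forall>b\<in>A. to_fract a * y b \<in> hform N (int e + m b))"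
  using assms(1,3)
proof (induction A)
  case empty
  thus ?case by (intro exI[of _ 0] exI[of _ 1]) (use assms(2) in simp)
next
  case (insert b A)
  then obtain e a where a: "a \<in> forms N e" "fval p a ~= 0" "\<And>c. c \<in> A ==> to_fract a * y c \<in> hform N (int e + m c)"
    by force
  from insert.prems[of b] obtain f g c d where fg: "f \<in> forms N c" "g \<in> forms N d" "int c = int d + m b"
    "fval p g ~= 0" "g ~= 0" "y b = to_fract f / to_fract g" by (auto elim: locE)
  have "to_fract (g * a) * y x \<in> hform N (int (d + e) + m x)" if "x \<in> insert b A" for x
  proof (cases "x = b")
    case True
    have "to_fract (g * a) * y x = to_fract (a * f)" using fg True by simp
    also have "\<dots> \<in> hform N (int (e + c))" by (intro hform_form forms_mult a fg)
    finally show ?thesis using fg True by (simp add: ac_simps)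
  next
    case False
    hence "to_fract g * (to_fract a * y x) \<in> hform N (int d + (int e + m x))"
      using that by (intro hform_mult[OF hform_form[OF fg(2)] a(3)]) simp
    thus ?thesis by (simp add: ac_simps)
  qed
  thus ?case using a fg assms(2) by (intro exI[of _ "d + e"] exI[of _ "g * a"]) (auto intro: forms_mult)
qed

text \<open>What remains of an embedded sheaf: its stalks in a common vector space and their finite
  generation. Twists, sections, global sections and cochains are all defined from these
  data.\<close>

locale stalk_system = vector_space scale
  for scale :: "'k::{alg_closed_field, field_char_0} ratfun => 'v::ab_group_add => 'v" (infixr \<open>*s\<close> 75) +
  fixes N :: nat and \<Phi> :: "'k point => 'v set"
  assumes stalk_0: "p \<in> proj_space N ==> 0 \<in> \<Phi> p"
    and stalk_add: "p \<in> proj_space N ==> v \<in> \<Phi> p ==> w \<in> \<Phi> p ==> v + w \<in> \<Phi> p"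
    and stalk_scale: "p \<in> proj_space N ==> x \<in> loc N p 0 ==> v \<in> \<Phi> p ==> x *s v \<in> \<Phi> p"
    and finite_stalks: "finite_stalks scale N \<Phi>"
begin

abbreviation gr :: "int => 'k point => 'v set" where "gr m \<equiv> twist_stalk scale N m \<Phi>"

definition sec :: "'k point set => int => 'v set" where "sec U m = (\<Inter>p\<in>U. gr m p)"

abbreviation M :: "int => 'v set" where "M \<equiv> sec (proj_space N)"

lemma secI: "(\<And>p. p \<in> U ==> v \<in> gr m p) ==> v \<in> sec U m" by (simp add: sec_def)
lemma secD: "v \<in> sec U m ==> p \<in> U ==> v \<in> gr m p" by (simp add: sec_def)
lemma sec_mono: "V \<subseteq> U ==> v \<in> sec U m ==> v \<in> sec V m" by (auto simp: sec_def)

lemma gr_0: "p \<in> proj_space N ==> 0 \<in> gr m p"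
  using stalk_0 by (simp add: twist_stalk_def)

lemma gr_add: "p \<in> proj_space N ==> v \<in> gr m p ==> w \<in> gr m p ==> v + w \<in> gr m p"
  using stalk_add by (simp add: twist_stalk_def scale_right_distrib)

lemma gr_scale:
  assumes p: "p \<in> proj_space N" and x: "x \<in> loc N p a" and v: "v \<in> gr m p" and m': "m' = m + a"
  shows "x *s v \<in> gr m' p"
  unfolding twist_stalk_def m'
proof (intro CollectI ballI)
  fix y assume "y \<in> loc N p (- (m + a))"
  hence "y * x \<in> loc N p (- m)" using loc_mult[OF _ x, of y "- (m + a)"] by simp
  thus "y *s x *s v \<in> \<Phi> p" using v by (simp add: twist_stalk_def)
qed

lemma gr_0_eq: "p \<in> proj_space N ==> gr 0 p = \<Phi> p"
  using loc_1[of N p] stalk_scale[of p] by (force simp: twist_stalk_def)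

lemma gr_uminus: "p \<in> proj_space N ==> v \<in> gr m p ==> - v \<in> gr m p"
  using gr_scale[of p "- 1" 0 v m m] loc_uminus[OF loc_1, of N p] by simp

lemma gr_sum: "p \<in> proj_space N ==> (\<And>i. i \<in> A ==> f i \<in> gr m p) ==> sum f A \<in> gr m p"
  by (induction A rule: infinite_finite_induct) (auto intro: gr_0 gr_add)

lemma sec_0: "U \<subseteq> proj_space N ==> 0 \<in> sec U m"
  by (auto intro!: secI gr_0)

lemma sec_add: "U \<subseteq> proj_space N ==> v \<in> sec U m ==> w \<in> sec U m ==> v + w \<in> sec U m"
  by (auto intro!: secI gr_add dest: secD)

lemma sec_uminus: "U \<subseteq> proj_space N ==> v \<in> sec U m ==> - v \<in> sec U m"
  by (auto intro!: secI gr_uminus dest: secD)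

lemma sec_diff: "U \<subseteq> proj_space N ==> v \<in> sec U m ==> w \<in> sec U m ==> v - w \<in> sec U m"
  using sec_add[of U v m "- w"] sec_uminus[of U w m] by simp

lemma sec_sum: "U \<subseteq> proj_space N ==> (\<And>i. i \<in> A ==> f i \<in> sec U m) ==> sum f A \<in> sec U m"
  by (auto intro!: secI gr_sum dest: secD)

lemma sec_scale:
  assumes "U \<subseteq> proj_space N" "x \<in> rat_on N U a" "v \<in> sec U m" "m' = m + a"
  shows "x *s v \<in> sec U m'"
  using assms by (auto intro!: secI gr_scale dest: secD simp: rat_on_def)

lemma hform_rat: "U \<subseteq> proj_space N ==> x \<in> hform N e ==> x \<in> rat_on N U e"
  by (auto simp: rat_on_def intro!: hform_loc)

section \<open>Local generators and the extension of sections\<close>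

definition gen_by :: "'k mvpoly => nat => (nat => 'v) => bool" where
  "gen_by g n s \<longleftrightarrow> (\<forall>q\<in>basic_open N g. (\<forall>l<n. s l \<in> \<Phi> q) \<and>
     (\<forall>x\<in>\<Phi> q. \<exists>z. (\<forall>l<n. z l \<in> loc N q 0) \<and> x = (\<Sum>l<n. z l *s s l)))"

lemma gen_by_gr:
  assumes "gen_by g n s" "q \<in> basic_open N g" "v \<in> gr m q"
  obtains z where "\<And>l. l < n ==> z l \<in> loc N q m" "v = (\<Sum>l<n. z l *s s l)"
proof -
  have q: "q \<in> proj_space N" using assms(2) by (simp add: basic_open_def)
  obtain u where u: "u \<in> loc N q m" "1 / u \<in> loc N q (- m)" "u ~= 0" using loc_unit[OF q] .
  have "(1 / u) *s v \<in> \<Phi> q" using assms(3) u by (simp add: twist_stalk_def)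
  with assms(1,2) obtain z where z: "\<forall>l<n. z l \<in> loc N q 0" "(1 / u) *s v = (\<Sum>l<n. z l *s s l)"
    unfolding gen_by_def by meson
  have "v = u *s ((1 / u) *s v)" using u by simp
  also have "\<dots> = (\<Sum>l<n. (u * z l) *s s l)" unfolding z(2) by (simp add: scale_sum_right)
  finally show thesis using z u loc_mult[of u N q m _ 0]
    by (intro that[of "\<lambda>l. u * z l"]) auto
qed

text \<open>The forms \<open>a\<close> for which \<open>a\<close> times \<open>v\<close> is a
  combination of the generators with forms as coefficients make up a graded ideal. At each point of
  \<open>basic_open N f\<close> a common denominator belongs to it, hence so does a power of
  \<open>f\<close>.\<close>

lemma sections_gen:
  assumes f: "f \<in> forms N d" "d > 0" and sub: "basic_open N f \<subseteq> basic_open N g" and gen: "gen_by g n s"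
    and v: "v \<in> sec (basic_open N f) m"
  shows "\<exists>k b. (\<forall>l<n. b l \<in> hform N (int (k * d) + m)) \<and> to_fract (f ^ k) *s v = (\<Sum>l<n. b l *s s l)"
proof -
  define I where "I e = {a \<in> forms N e. \<exists>b. (\<forall>l<n. b l \<in> hform N (int e + m)) \<and> to_fract a *s v = (\<Sum>l<n. b l *s s l)}" for e
  have "\<exists>K. f ^ K \<in> I (K * d)"
  proof (rule nullstellensatz_points[OF _ _ _ _ f])
    show "I e \<subseteq> forms N e" for e by (auto simp: I_def)
    show "0 \<in> I e" for e by (auto simp: I_def intro!: exI[of _ "\<lambda>_. 0"])
    show "a + a' \<in> I e" if aa: "a \<in> I e" "a' \<in> I e" for e a a'
    proof -
      from aa obtain b b' where "a \<in> forms N e" "a' \<in> forms N e" "\<forall>l<n. b l \<in> hform N (int e + m)"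
        "\<forall>l<n. b' l \<in> hform N (int e + m)" "to_fract a *s v = (\<Sum>l<n. b l *s s l)"
        "to_fract a' *s v = (\<Sum>l<n. b' l *s s l)" by (auto simp: I_def)
      thus ?thesis
        by (auto simp: I_def forms_add scale_left_distrib sum.distrib hform_add intro!: exI[of _ "\<lambda>l. b l + b' l"])
    qed
    show "a * a' \<in> I (c + e)" if aa: "a \<in> forms N c" "a' \<in> I e" for c e a a'
    proof -
      from aa obtain b where b: "a' \<in> forms N e" "\<forall>l<n. b l \<in> hform N (int e + m)"
        "to_fract a' *s v = (\<Sum>l<n. b l *s s l)" by (auto simp: I_def)
      have "to_fract (a * a') *s v = to_fract a *s (\<Sum>l<n. b l *s s l)" by (simp flip: b(3))
      also have "\<dots> = (\<Sum>l<n. (to_fract a * b l) *s s l)" by (simp add: scale_sum_right)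
      finally show ?thesis
        using aa b hform_mult[OF hform_form[OF aa(1)], of _ "int e + m"]
        by (auto simp: I_def forms_mult add.assoc intro!: exI[of _ "\<lambda>l. to_fract a * b l"])
    qed
    fix p assume p: "p \<in> basic_open N f"
    hence "p \<in> proj_space N" by (simp add: basic_open_def)
    have "p \<in> basic_open N g" using p sub by blast
    from gen_by_gr[OF gen this secD[OF v p]] obtain z where z: "\<And>l. l < n ==> z l \<in> loc N p m" "v = (\<Sum>l<n. z l *s s l)"
      by metis
    from loc_common_denominator[of "{..<n}" p N z "\<lambda>_. m"] \<open>p \<in> proj_space N\<close> z(1) obtain e a where
      a: "a \<in> forms N e" "fval p a ~= 0" "\<forall>l<n. to_fract a * z l \<in> hform N (int e + m)" by auto
    have "to_fract a *s v = (\<Sum>l<n. (to_fract a * z l) *s s l)" unfolding z(2) by (simp add: scale_sum_right)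
    with a have "a \<in> I e" by (auto simp: I_def intro!: exI[of _ "\<lambda>l. to_fract a * z l"])
    with a show "\<exists>e. \<exists>g\<in>I e. fval p g ~= 0" by blast
  qed
  thus ?thesis by (auto simp: I_def)
qed

lemma finite_gen_cover:
  obtains G where "finite G" "\<And>g. g \<in> G ==> \<exists>d>0. g \<in> forms N d" "\<And>g. g \<in> G ==> \<exists>n s. gen_by g n s"
    "\<And>p. p \<in> proj_space N ==> \<exists>g\<in>G. fval p g ~= 0"
proof -
  define G where "G = {g. (\<exists>d>0. g \<in> forms N d) \<and> (\<exists>n s. gen_by g n s)}"
  have "\<exists>g\<in>G. fval p g ~= 0" if "p \<in> proj_space N" for p
  proof -
    from bspec[OF finite_stalks[unfolded finite_stalks_def] that] obtain d g n s where
      "d > 0" "g \<in> forms N d" "fval p g ~= 0" "gen_by g n s" unfolding gen_by_def by blast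
    thus ?thesis by (auto simp: G_def)
  qed
  moreover have "\<exists>d. g \<in> forms N d" if "g \<in> G" for g using that by (auto simp: G_def)
  ultimately obtain G0 where "finite G0" "G0 \<subseteq> G" "\<And>p. p \<in> proj_space N ==> \<exists>g\<in>G0. fval p g ~= 0"
    using proj_space_compact[of G N] by metis
  thus thesis by (intro that[of G0]) (auto simp: G_def)
qed

text \<open>Since all sections live in one vector space, the local extensions need not be glued.\<close>

lemma sections_extend:
  assumes h: "h \<in> forms N d" and v: "v \<in> sec (basic_open N h) m"
  shows "\<exists>k0. \<forall>k\<ge>k0. to_fract (h ^ k) *s v \<in> M (m + int (k * d))"
proof -
  obtain G where G: "finite G" "\<And>g. g \<in> G ==> \<exists>d>0. g \<in> forms N d" "\<And>g. g \<in> G ==> \<exists>n s. gen_by g n s"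
    "\<And>p. p \<in> proj_space N ==> \<exists>g\<in>G. fval p g ~= 0" using finite_gen_cover by metis
  have "\<exists>k. to_fract (h ^ k) *s v \<in> sec (basic_open N g) (m + int (k * d))" if g: "g \<in> G" for g
  proof -
    from G(2,3)[OF g] obtain e n s where e: "e > 0" "g \<in> forms N e" and gen: "gen_by g n s" by blast
    have hg: "h * g \<in> forms N (d + e)" using h e by (intro forms_mult)
    have sub: "basic_open N (h * g) \<subseteq> basic_open N g" "basic_open N (h * g) \<subseteq> basic_open N h"
      using basic_open_mult[OF h e(2)] by auto
    \<comment> \<open>On the smaller set for \<open>h * g\<close> a power of \<open>h * g\<close>
      clears the denominators. Since \<open>g\<close> is a unit on its own basic open set, the power
      of \<open>h\<close> alone already makes \<open>v\<close> regular there.\<close>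
    from sections_gen[OF hg _ sub(1) gen sec_mono[OF sub(2) v]] e obtain k b where
      b: "\<And>l. l < n ==> b l \<in> hform N (int (k * (d + e)) + m)"
      "to_fract ((h * g) ^ k) *s v = (\<Sum>l<n. b l *s s l)" by auto
    have gk: "g ^ k \<in> forms N (k * e)" using forms_power[OF e(2)] .
    have "to_fract (h ^ k) *s v \<in> gr (m + int (k * d)) q" if q: "q \<in> basic_open N g" for q
    proof -
      have qP: "q \<in> proj_space N" and gq: "fval q g ~= 0" using q by (auto simp: basic_open_fval[OF e(2)])
      hence "g ~= 0" by auto
      have inv: "1 / to_fract (g ^ k) \<in> loc N q (- int (k * e))"
        using gq by (intro loc_inverse gk) simp
      have "to_fract (h ^ k) *s v = (1 / to_fract (g ^ k)) *s (to_fract ((h * g) ^ k) *s v)"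
        using \<open>g ~= 0\<close> by (simp add: power_mult_distrib)
      also have "\<dots> = (\<Sum>l<n. (1 / to_fract (g ^ k) * b l) *s s l)" unfolding b(2) by (simp add: scale_sum_right)
      also have "\<dots> \<in> gr (m + int (k * d)) q"
      proof (intro gr_sum qP)
        fix l assume "l \<in> {..<n}"
        hence l: "l < n" by simp
        have "1 / to_fract (g ^ k) * b l \<in> loc N q (- int (k * e) + (int (k * (d + e)) + m))"
          by (intro loc_mult inv hform_loc b l qP)
        moreover have "s l \<in> gr 0 q" using gen q l by (auto simp: gen_by_def gr_0_eq[OF qP])
        ultimately show "(1 / to_fract (g ^ k) * b l) *s s l \<in> gr (m + int (k * d)) q"
          by (rule gr_scale[OF qP]) (simp add: algebra_simps)
      qed
      finally show ?thesis .
    qed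
    thus ?thesis by (blast intro: secI)
  qed
  then obtain k where k: "\<And>g. g \<in> G ==> to_fract (h ^ k g) *s v \<in> sec (basic_open N g) (m + int (k g * d))" by metis
  show ?thesis
  proof (intro exI[of _ "\<Sum>g\<in>G. k g"] allI impI secI)
    fix K and p :: "'k point" assume K: "K \<ge> (\<Sum>g\<in>G. k g)" and p: "p \<in> proj_space N"
    then obtain g where g: "g \<in> G" "fval p g ~= 0" using G(4) by blast
    then obtain e where e: "g \<in> forms N e" using G(2) by blast
    have "k g \<le> K" using member_le_sum[of g G k] g G(1) K by auto
    then obtain j where j: "K = j + k g" using le_iff_add add.commute by metis
    have pg: "p \<in> basic_open N g" using p g e by (simp add: basic_open_fval)
    have "to_fract (h ^ j) *s (to_fract (h ^ k g) *s v) \<in> gr (m + int (K * d)) p"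
      by (rule gr_scale[OF p loc_form[OF forms_power[OF h]] secD[OF k[OF g(1)] pg]]) (simp add: j algebra_simps)
    thus "to_fract (h ^ K) *s v \<in> gr (m + int (K * d)) p" by (simp add: j power_add)
  qed
qed

lemma stalk_open:
  assumes p: "p \<in> proj_space N" and v: "v \<in> gr m p"
  shows "\<exists>d f. f \<in> forms N d \<and> fval p f ~= 0 \<and> v \<in> sec (basic_open N f) m"
proof -
  from bspec[OF finite_stalks[unfolded finite_stalks_def] p] obtain d g n s where
    g: "g \<in> forms N d" "fval p g ~= 0" and gen: "gen_by g n s" unfolding gen_by_def by blast
  have pg: "p \<in> basic_open N g" using p g by (simp add: basic_open_fval)
  from gen_by_gr[OF gen pg v] obtain z where z: "\<And>l. l < n ==> z l \<in> loc N p m" "v = (\<Sum>l<n. z l *s s l)" by metis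
  from loc_common_denominator[of "{..<n}" p N z "\<lambda>_. m"] p z(1) obtain e a where
    a: "a \<in> forms N e" "fval p a ~= 0" "\<And>l. l < n ==> to_fract a * z l \<in> hform N (int e + m)" by auto
  have ag: "a * g \<in> forms N (e + d)" by (intro forms_mult a g)
  have "v \<in> gr m q" if q: "q \<in> basic_open N (a * g)" for q
  proof -
    have qP: "q \<in> proj_space N" and nz: "fval q a ~= 0" and qg: "q \<in> basic_open N g"
      using q by (auto simp: basic_open_fval[OF ag] basic_open_fval[OF g(1)])
    hence "a ~= 0" by auto
    show ?thesis
      unfolding z(2)
    proof (intro gr_sum qP)
      fix l assume "l \<in> {..<n}"
      hence l: "l < n" by simp
      have "1 / to_fract a * (to_fract a * z l) \<in> loc N q (- int e + (int e + m))"
        by (intro loc_mult loc_inverse a nz hform_loc l qP)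
      hence "z l \<in> loc N q m" using \<open>a ~= 0\<close> by simp
      moreover have "s l \<in> gr 0 q" using gen qg l by (auto simp: gen_by_def gr_0_eq[OF qP])
      ultimately show "z l *s s l \<in> gr m q" by (rule gr_scale[OF qP]) simp
    qed
  qed
  thus ?thesis using ag a g by (intro exI[of _ "e + d"] exI[of _ "a * g"]) (auto intro: secI)
qed

text \<open>Serre's theorem on global generation by sections of high twists, stated for one element
  of a stalk. It converts statements about the graded module \<open>M\<close> into statements about
  stalks.\<close>

lemma stalk_from_global:
  assumes p: "p \<in> proj_space N" and v: "v \<in> gr m p"
  shows "\<exists>d f. f \<in> forms N d \<and> fval p f ~= 0 \<and> to_fract f *s v \<in> M (m + int d)"
proof -
  from stalk_open[OF assms] obtain d f where f: "f \<in> forms N d" "fval p f ~= 0" "v \<in> sec (basic_open N f) m" by blast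
  from sections_extend[OF f(1,3)] obtain k where "to_fract (f ^ k) *s v \<in> M (m + int (k * d))" by blast
  thus ?thesis using f forms_power[OF f(1), of k] by (intro exI[of _ "k * d"] exI[of _ "f ^ k"]) auto
qed

end

section \<open>Cech cochains as functions on lists\<close>

text \<open>The alternating sum over the faces of a list, see \<open>cobd_face_sum\<close>, in a
  recursive form that suits induction. Lists may have repeated entries, and a list of length one has
  the empty list as its only face: the complex is augmented.\<close>

fun cobd :: "('i list => 'v::ab_group_add) => 'i list => 'v" where
  "cobd c [] = 0"
| "cobd c (i # s) = c s - cobd (\<lambda>t. c (i # t)) s"

lemma cobd_hom:
  assumes "\<And>x y. h (x - y) = h x - h y"
  shows "cobd (\<lambda>t. h (c t)) s = h (cobd c s)"
proof -
  have "h 0 = 0" using assms[of 0 0] by simp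
  thus ?thesis by (induction s arbitrary: c) (simp_all add: assms)
qed

lemma cobd_add: "cobd (\<lambda>t. c t + d t) s = cobd c s + cobd d s"
  by (induction s arbitrary: c d) (simp_all add: algebra_simps)

lemma cobd_diff: "cobd (\<lambda>t. c t - d t) s = cobd c s - cobd d s"
  by (induction s arbitrary: c d) (simp_all add: algebra_simps)

lemma cobd_zero: "cobd (\<lambda>_. 0) s = 0"
  by (induction s) simp_all

lemma cobd_uminus: "cobd (\<lambda>t. - c t) s = - cobd c s"
  using cobd_diff[of "\<lambda>_. 0" c s] by (simp add: cobd_zero)

lemma cobd_sum: "cobd (\<lambda>t. \<Sum>i\<in>A. c i t) s = (\<Sum>i\<in>A. cobd (c i) s)"
  by (induction A rule: infinite_finite_induct) (simp_all add: cobd_zero cobd_add)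

lemma cobd_cobd [simp]: "cobd (cobd c) s = 0"
proof (induction s arbitrary: c)
  case (Cons i s)
  have "cobd (\<lambda>t. cobd c (i # t)) s = cobd c s - cobd (cobd (\<lambda>t. c (i # t))) s"
    by (simp add: cobd_diff)
  with Cons show ?case by simp
qed simp

lemma cobd_cong:
  assumes "\<And>t. set t \<subseteq> set s ==> Suc (length t) = length s ==> c t = d t"
  shows "cobd c s = cobd d s"
  using assms
proof (induction s arbitrary: c d)
  case (Cons i s)
  have "cobd (\<lambda>t. c (i # t)) s = cobd (\<lambda>t. d (i # t)) s"
    by (rule Cons.IH, rule Cons.prems) auto
  moreover have "c s = d s" by (rule Cons.prems) auto
  ultimately show ?case by simp
qed simp

lemma cobd_in:
  assumes "0 \<in> A" "\<And>x y. x \<in> A ==> y \<in> A ==> x - y \<in> A"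
    and "\<And>t. set t \<subseteq> set s ==> Suc (length t) = length s ==> c t \<in> A"
  shows "cobd c s \<in> A"
  using assms(3)
proof (induction s arbitrary: c)
  case (Cons i s)
  have "cobd (\<lambda>t. c (i # t)) s \<in> A" by (rule Cons.IH, rule Cons.prems) auto
  moreover have "c s \<in> A" by (rule Cons.prems) auto
  ultimately show ?case by (simp add: assms)
qed (simp add: assms)

text \<open>A face of a concatenation omits an entry either on the left or on the right. In
  \<open>refinement_injective\<close> the two parts belong to different coverings.\<close>

lemma cobd_append:
  "cobd c (s @ t) = cobd (\<lambda>u. c (u @ t)) s + (if even (length s) then cobd (\<lambda>u. c (s @ u)) t else - cobd (\<lambda>u. c (s @ u)) t)"
  by (induction s arbitrary: c) auto

lemma cobd_map: "cobd c (map f s) = cobd (\<lambda>t. c (map f t)) s"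
  by (induction s arbitrary: c) auto

lemma cobd_face_sum:
  "cobd c s = (\<Sum>j<length s. if even j then c (face j s) else - c (face j s))"
proof (induction s arbitrary: c)
  case (Cons i s)
  have "(\<Sum>j<length (i # s). if even j then c (face j (i # s)) else - c (face j (i # s))) =
      c s + (\<Sum>j<length s. if even j then - c (i # face j s) else c (i # face j s))"
    by (simp add: sum.lessThan_Suc_shift face_def del: sum.lessThan_Suc)
      (rule sum.cong, auto simp: face_def)
  also have "(\<Sum>j<length s. if even j then - c (i # face j s) else c (i # face j s)) =
      - (\<Sum>j<length s. if even j then c (i # face j s) else - c (i # face j s))"
    by (simp flip: sum_negf) (rule sum.cong, auto)
  finally show ?case by (simp add: Cons)
qed simp

text \<open>The differentials commute instead of anticommuting: no total complex is formed, elements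
  are chased along a diagonal instead.\<close>

locale double_complex =
  fixes K :: "nat => nat => 'x::ab_group_add set" and dh dv :: "'x => 'x"
  assumes K_diff: "x \<in> K a b ==> y \<in> K a b ==> x - y \<in> K a b"
    and dh_in: "x \<in> K a b ==> dh x \<in> K (Suc a) b" and dv_in: "x \<in> K a b ==> dv x \<in> K a (Suc b)"
    and dh_diff: "dh (x - y) = dh x - dh y" and dv_diff: "dv (x - y) = dv x - dv y"
    and dh_dh: "x \<in> K a b ==> dh (dh x) = 0" and dv_dv: "x \<in> K a b ==> dv (dv x) = 0"
    and \<delta>_commute: "x \<in> K a b ==> dh (dv x) = dv (dh x)"
begin

lemma dh_0: "dh 0 = 0" using dh_diff[of 0 0] by simp
lemma dv_0: "dv 0 = 0" using dv_diff[of 0 0] by simp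

text \<open>If \<open>y (Suc a) = dh u + w\<close> with \<open>dv w = 0\<close>, then
  \<open>dh\<close> kills \<open>y a - dv u\<close>, and exactness of \<open>dh\<close> gives a
  decomposition of the same kind one step lower. The descent starts at \<open>y n = dh t\<close> and
  ends at \<open>a = 0\<close>, where \<open>dh\<close> is injective.\<close>

lemma zigzag_descend:
  assumes y: "\<And>a. a \<le> n ==> y a \<in> K a (n - a)" "\<And>a. a < n ==> dh (y a) = dv (y (Suc a))"
    and t: "t \<in> K (n - 1) 0" "y n = dh t" and n: "n \<ge> 1"
    and col: "\<And>a x. a \<ge> 1 ==> a < n ==> x \<in> K a (n - a) ==> dh x = 0 ==> \<exists>z\<in>K (a - 1) (n - a). x = dh z"
    and inj: "\<And>x. x \<in> K 0 n ==> dh x = 0 ==> x = 0"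
  shows "\<exists>t\<in>K 0 (n - 1). y 0 = dv t"
proof -
  have step: "dh (y a - dv u) = 0 \<and> y a - dv u \<in> K a (n - a)"
    if "a < n" "u \<in> K a (n - Suc a)" "y (Suc a) = dh u + w" "dv w = 0" for a u w
  proof -
    have "Suc (n - Suc a) = n - a" using that(1) by simp
    hence "dv u \<in> K a (n - a)" using dv_in[OF that(2)] by simp
    hence "y a - dv u \<in> K a (n - a)" using y(1)[of a] that(1) by (intro K_diff) auto
    moreover have "dh (y a - dv u) = dv (y (Suc a)) - dv (dh u)"
      using y(2)[OF that(1)] \<delta>_commute[OF that(2)] by (simp add: dh_diff)
    moreover have "\<dots> = dv (y (Suc a) - dh u)" by (simp only: dv_diff)
    ultimately show ?thesis using that by simp
  qed
  have "\<exists>u w. u \<in> K a (n - Suc a) \<and> y (Suc a) = dh u + w \<and> dv w = 0" if "a < n" for a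
    using that
  proof (induction "n - Suc a" arbitrary: a)
    case 0
    hence "Suc a = n" by simp
    with t show ?case by (intro exI[of _ t] exI[of _ 0]) (auto simp: dv_0)
  next
    case (Suc k)
    hence "k = n - Suc (Suc a)" "Suc a < n" by auto
    from Suc.hyps(1)[OF this] obtain u w where u: "u \<in> K (Suc a) (n - Suc (Suc a))"
      "y (Suc (Suc a)) = dh u + w" "dv w = 0" by blast
    from step[OF \<open>Suc a < n\<close> u] col[of "Suc a" "y (Suc a) - dv u"] \<open>Suc a < n\<close>
    have "\<exists>z\<in>K a (n - Suc a). y (Suc a) - dv u = dh z" by simp
    then obtain z where z: "z \<in> K a (n - Suc a)" "y (Suc a) - dv u = dh z" by (elim bexE)
    hence "y (Suc a) = dh z + dv u" by (simp only: diff_eq_eq)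
    with z(1) dv_dv[OF u(1)] show ?case by (intro exI conjI)
  qed
  from this[of 0] n obtain u w where u: "u \<in> K 0 (n - Suc 0)" "y (Suc 0) = dh u + w" "dv w = 0" by auto
  have "0 < n" using n by simp
  from step[OF this u] have "dh (y 0 - dv u) = 0" "y 0 - dv u \<in> K 0 n" by simp_all
  hence "y 0 - dv u = 0" by (metis inj)
  hence "y 0 = dv u" by (simp only: right_minus_eq)
  with u(1) show ?thesis by auto
qed

text \<open>At each stage \<open>dh (y a)\<close> is killed by \<open>dv\<close>, hence of the form
  \<open>dv (y (Suc a))\<close>; the choices are made by recursion. At \<open>b = 0\<close>
  injectivity of \<open>dv\<close> yields \<open>dh (y n) = 0\<close>.\<close>

lemma zigzag_ascend:
  assumes d: "d \<in> K 0 n" "dv d = 0"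
    and row: "\<And>a b x. a \<ge> 1 ==> a + Suc b = Suc n ==> x \<in> K a (Suc b) ==> dv x = 0 ==> \<exists>z\<in>K a b. x = dv z"
    and row0: "\<And>x. x \<in> K (Suc n) 0 ==> dv x = 0 ==> x = 0"
  shows "\<exists>y. y 0 = d \<and> (\<forall>a\<le>n. y a \<in> K a (n - a)) \<and> (\<forall>a<n. dh (y a) = dv (y (Suc a))) \<and> dh (y n) = 0"
proof -
  have ex: "\<exists>z\<in>K (Suc a) (n - Suc a). dh x = dv z" if "a < n" "x \<in> K a (n - a)" "dv (dh x) = 0" for a x
    using row[of "Suc a" "n - Suc a" "dh x"] dh_in[OF that(2)] that by (simp add: Suc_diff_Suc)
  define y where "y = rec_nat d (\<lambda>a x. SOME z. z \<in> K (Suc a) (n - Suc a) \<and> dh x = dv z)"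
  have y0: "y 0 = d" and ySuc: "y (Suc a) = (SOME z. z \<in> K (Suc a) (n - Suc a) \<and> dh (y a) = dv z)" for a
    by (simp_all add: y_def)
  have *: "a \<le> n ==> y a \<in> K a (n - a) \<and> dv (dh (y a)) = 0 \<and> (\<forall>c. a = Suc c --> dh (y c) = dv (y a))" for a
  proof (induction a)
    case 0
    thus ?case using d \<delta>_commute[OF d(1)] by (simp add: y0 dh_0)
  next
    case (Suc a)
    hence a: "a < n" "y a \<in> K a (n - a)" "dv (dh (y a)) = 0" by auto
    have "y (Suc a) \<in> K (Suc a) (n - Suc a) \<and> dh (y a) = dv (y (Suc a))"
      unfolding ySuc by (rule someI_ex) (use ex[OF a] in blast)
    moreover hence "dv (dh (y (Suc a))) = 0"
      using \<delta>_commute[of "y (Suc a)"] dh_dh[OF a(2)] by (metis)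
    ultimately show ?case by simp
  qed
  have "dh (y n) = 0" using *[of n] dh_in[of "y n" n 0] row0 by simp
  moreover have "dh (y a) = dv (y (Suc a))" if "a < n" for a using *[of "Suc a"] that by simp
  moreover have "y a \<in> K a (n - a)" if "a \<le> n" for a using *[OF that] by simp
  ultimately show ?thesis using y0 by (intro exI[of _ y] conjI allI impI)
qed

text \<open>Exactness of \<open>dv\<close> away from the edge \<open>a = 0\<close> lets the element
  climb along the diagonal, exactness of \<open>dh\<close> brings it down again as a boundary on the
  edge. Both the comparison of coverings and the Koszul argument are instances.\<close>

lemma row_col_transfer:
  assumes d: "d \<in> K 0 n" "dv d = 0" and n: "n \<ge> 1"
    and row: "\<And>a b x. a \<ge> 1 ==> a + Suc b = Suc n ==> x \<in> K a (Suc b) ==> dv x = 0 ==> \<exists>z\<in>K a b. x = dv z"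
    and row0: "\<And>x. x \<in> K (Suc n) 0 ==> dv x = 0 ==> x = 0"
    and col: "\<And>a x. a \<ge> 1 ==> a \<le> n ==> x \<in> K a (n - a) ==> dh x = 0 ==> \<exists>z\<in>K (a - 1) (n - a). x = dh z"
    and inj: "\<And>x. x \<in> K 0 n ==> dh x = 0 ==> x = 0"
  shows "\<exists>t\<in>K 0 (n - 1). d = dv t"
proof -
  from zigzag_ascend[OF d row row0] obtain y where y: "y 0 = d" "\<forall>a\<le>n. y a \<in> K a (n - a)"
    "\<forall>a<n. dh (y a) = dv (y (Suc a))" "dh (y n) = 0" by blast
  have "y n \<in> K n (n - n)" using y(2) by blast
  from col[OF n order_refl this y(4)] obtain t where "t \<in> K (n - 1) 0" "y n = dh t" by auto
  from zigzag_descend[of n y t, OF _ _ this n] y col inj show ?thesis by auto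
qed

end

section \<open>Cohomology of affine and of standard coverings\<close>

text \<open>Intersections of basic open sets; \<open>A = {}\<close> gives the whole projective
  space, as the augmentation requires.\<close>

definition Dset :: "nat => 'k::field mvpoly set => 'k point set" where
  "Dset N A = {p \<in> proj_space N. \<forall>f\<in>A. fval p f ~= 0}"

definition pos_forms :: "nat => 'k::field mvpoly set" where
  "pos_forms N = {f. f ~= 0 \<and> (\<exists>d>0. f \<in> forms N d)}"

lemma sum_in_additive:
  assumes "0 \<in> A" "\<And>x y. x \<in> A ==> y \<in> A ==> x + y \<in> A" "\<And>i. i \<in> I ==> f i \<in> A"
  shows "sum f I \<in> A"
  using assms(3) by (induction I rule: infinite_finite_induct) (auto intro: assms(1,2))

lemma Dset_proj: "Dset N A \<subseteq> proj_space N" by (auto simp: Dset_def)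

lemma Dset_mono: "A \<subseteq> B ==> Dset N B \<subseteq> Dset N A" by (auto simp: Dset_def)

lemma prod_pos_forms:
  assumes "finite A" "A \<subseteq> pos_forms N"
  shows "\<exists>d. prod (\<lambda>f. f) A \<in> forms N d \<and> (A ~= {} --> d > 0)"
  using assms
proof (induction A)
  case (insert f A)
  then obtain d e where "prod (\<lambda>f. f) A \<in> forms N d" "f \<in> forms N e" "e > 0" by (auto simp: pos_forms_def)
  thus ?case using insert by (intro exI[of _ "e + d"]) (auto intro: forms_mult)
qed (auto intro!: exI[of _ 0])

lemma Dset_basic:
  assumes "finite A" "prod (\<lambda>f. f) A \<in> forms N d"
  shows "Dset N A = basic_open N (prod (\<lambda>f. f) A)"
  using assms by (auto simp: basic_open_fval Dset_def fval_prod)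

lemma Dset_nonempty:
  assumes "finite A" "A \<subseteq> pos_forms N"
  shows "Dset N (A :: 'k::{alg_closed_field, field_char_0} mvpoly set) ~= {}"
proof -
  from prod_pos_forms[OF assms] obtain d where d: "prod (\<lambda>f. f) A \<in> forms N d" by blast
  have "prod (\<lambda>f. f) A ~= 0" using assms by (auto simp: pos_forms_def)
  from form_nonvanishing[OF d this] show ?thesis by (auto simp: Dset_basic[OF assms(1) d] basic_open_fval[OF d])
qed

definition lists_of :: "'i set => nat => 'i list set" where
  "lists_of I n = {s. set s \<subseteq> I \<and> length s = n}"

lemma finite_lists_of: "finite I ==> finite (lists_of I n)"
  unfolding lists_of_def by (rule finite_lists_length_eq)

lemma lists_of_Cons [simp]: "i # s \<in> lists_of I (Suc n) \<longleftrightarrow> i \<in> I \<and> s \<in> lists_of I n"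
  by (auto simp: lists_of_def)

context stalk_system
begin

text \<open>With \<open>h\<close> the product of \<open>A\<close>, a power of \<open>h * g\<close>
  extends \<open>v\<close> to all of projective space, and the power of \<open>h\<close> is a unit
  over \<open>Dset N A\<close> and can be divided out again.\<close>

lemma sections_extend_Dset:
  assumes A: "finite A" "A \<subseteq> pos_forms N" and g: "g \<in> forms N e" and v: "v \<in> sec (Dset N (insert g A)) m"
  shows "\<exists>k0. \<forall>k\<ge>k0. to_fract (g ^ k) *s v \<in> sec (Dset N A) (m + int (k * e))"
proof -
  define h where "h = prod (\<lambda>f. f) A"
  obtain d where d: "h \<in> forms N d" using prod_pos_forms[OF A] by (auto simp: h_def)
  have hg: "h * g \<in> forms N (d + e)" by (intro forms_mult d g)
  have "Dset N (insert g A) = basic_open N (h * g)"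
    using Dset_basic[OF A(1) d[unfolded h_def]] basic_open_mult[OF d g] basic_open_fval[OF g]
    by (auto simp: Dset_def h_def)
  with v sections_extend[OF hg, of v m] obtain k0 where
    k0: "\<And>k. k \<ge> k0 ==> to_fract ((h * g) ^ k) *s v \<in> M (m + int (k * (d + e)))" by auto
  have "to_fract (g ^ k) *s v \<in> sec (Dset N A) (m + int (k * e))" if "k \<ge> k0" for k
  proof (rule secI)
    fix p assume p: "p \<in> Dset N A"
    hence pP: "p \<in> proj_space N" and hp: "fval p h ~= 0"
      using A(1) by (auto simp: Dset_def h_def fval_prod)
    hence "h ~= 0" by auto
    have inv: "1 / to_fract (h ^ k) \<in> loc N p (- int (k * d))"
      using hp by (intro loc_inverse forms_power d) simp
    have "(1 / to_fract (h ^ k)) *s (to_fract ((h * g) ^ k) *s v) \<in> gr (m + int (k * e)) p"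
      by (rule gr_scale[OF pP inv secD[OF k0[OF that] pP]]) (simp add: algebra_simps)
    thus "to_fract (g ^ k) *s v \<in> gr (m + int (k * e)) p"
      using \<open>h ~= 0\<close> by (simp add: power_mult_distrib)
  qed
  thus ?thesis by blast
qed

text \<open>The exponent \<open>k\<close> is prescribed, because the poles of a cochain dictate it.
  The powers \<open>g ^ k\<close> have no common zero on \<open>basic_open N h\<close>, so the
  graded ideal they generate contains a power of \<open>h\<close>.\<close>

lemma partition_of_unity:
  fixes h :: "'k mvpoly"
  assumes h: "h \<in> forms N d" "d > 0" and J: "finite J" "\<And>g. g \<in> J ==> g \<in> forms N (e g)"
    and cover: "\<And>p. p \<in> basic_open N h ==> \<exists>g\<in>J. fval p g ~= 0"
  shows "\<exists>K a. (\<forall>g\<in>J. a g \<in> hform N (int (K * d) - int (k * e g))) \<and> to_fract (h ^ K) = (\<Sum>g\<in>J. a g * to_fract (g ^ k))"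
proof -
  define I where "I c = {f \<in> forms N c. \<exists>a. (\<forall>g\<in>J. a g \<in> hform N (int c - int (k * e g))) \<and>
    to_fract f = (\<Sum>g\<in>J. a g * to_fract (g ^ k))}" for c
  have "\<exists>K. h ^ K \<in> I (K * d)"
  proof (rule nullstellensatz_points[OF _ _ _ _ h])
    show "I c \<subseteq> forms N c" for c by (auto simp: I_def)
    show "0 \<in> I c" for c by (auto simp: I_def intro!: exI[of _ "\<lambda>_. 0"])
    show "f + f' \<in> I c" if ff: "f \<in> I c" "f' \<in> I c" for c f f'
    proof -
      from ff obtain a a' where "f \<in> forms N c" "f' \<in> forms N c" "\<forall>g\<in>J. a g \<in> hform N (int c - int (k * e g))"
        "\<forall>g\<in>J. a' g \<in> hform N (int c - int (k * e g))"
        "to_fract f = (\<Sum>g\<in>J. a g * to_fract (g ^ k))" "to_fract f' = (\<Sum>g\<in>J. a' g * to_fract (g ^ k))"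
        by (auto simp: I_def)
      thus ?thesis
        by (auto simp: I_def forms_add distrib_right sum.distrib hform_add intro!: exI[of _ "\<lambda>g. a g + a' g"])
    qed
    show "f * f' \<in> I (b + c)" if ff: "f \<in> forms N b" "f' \<in> I c" for b c f f'
    proof -
      from ff obtain a where a: "f' \<in> forms N c" "\<forall>g\<in>J. a g \<in> hform N (int c - int (k * e g))"
        "to_fract f' = (\<Sum>g\<in>J. a g * to_fract (g ^ k))" by (auto simp: I_def)
      have "to_fract f * a g \<in> hform N (int (b + c) - int (k * e g))" if "g \<in> J" for g
        using hform_mult[OF hform_form[OF ff(1)] a(2)[rule_format, OF that]] by (simp add: algebra_simps)
      moreover have "to_fract (f * f') = (\<Sum>g\<in>J. (to_fract f * a g) * to_fract (g ^ k))"
        by (simp add: a(3) sum_distrib_left mult.assoc)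
      ultimately show ?thesis unfolding I_def using ff a by (auto intro!: exI[of _ "\<lambda>g. to_fract f * a g"] forms_mult)
    qed
    fix p assume "p \<in> basic_open N h"
    then obtain g where g: "g \<in> J" "fval p g ~= 0" using cover by blast
    have "to_fract (g ^ k) = (\<Sum>g'\<in>J. (if g' = g then 1 else 0) * to_fract (g' ^ k))"
      using J(1) g(1) by (simp add: if_distrib[of "\<lambda>x. x * _"] sum.delta cong: if_cong)
    moreover have "(1 :: 'k ratfun) \<in> hform N 0" using hform_form[of 1 N 0] by simp
    ultimately have "g ^ k \<in> I (k * e g)"
      unfolding I_def using forms_power[OF J(2)[OF g(1)], of k]
      by (auto intro!: exI[of _ "\<lambda>g'. if g' = g then 1 else 0"])
    with g show "\<exists>c. \<exists>f\<in>I c. fval p f ~= 0" by (intro exI[of _ "k * e g"] bexI[of _ "g ^ k"]) auto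
  qed
  thus ?thesis by (auto simp: I_def)
qed

text \<open>Cech acyclicity of the affine open set \<open>Dset N H\<close>, affine because
  \<open>H\<close> is nonempty. With functions \<open>w g\<close> of sum \<open>1\<close> the
  formula \<open>b t = (\<Sum>g\<in>J. w g *s c (g # t))\<close> is a contracting homotopy.\<close>

lemma affine_acyclic:
  assumes H: "finite H" "H ~= {}" "H \<subseteq> pos_forms N" and J: "finite J" "J \<subseteq> pos_forms N"
    and cover: "\<And>p. p \<in> Dset N H ==> \<exists>g\<in>J. fval p g ~= 0"
    and c: "\<And>t. t \<in> lists_of J (Suc n) ==> c t \<in> sec (Dset N (H \<union> set t)) m"
    and closed: "\<And>t. t \<in> lists_of J (Suc (Suc n)) ==> cobd c t = 0"
  shows "\<exists>b. (\<forall>t\<in>lists_of J n. b t \<in> sec (Dset N (H \<union> set t)) m) \<and> (\<forall>t\<in>lists_of J (Suc n). c t = cobd b t)"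
proof -
  define h where "h = prod (\<lambda>f. f) H"
  obtain d where d: "h \<in> forms N d" "d > 0" using prod_pos_forms[OF H(1,3)] H(2) by (auto simp: h_def)
  have Dh: "Dset N H = basic_open N h" using Dset_basic[OF H(1)] d by (simp add: h_def)
  have "\<forall>g\<in>J. \<exists>e. e > 0 \<and> g \<in> forms N e" using J(2) by (auto simp: pos_forms_def)
  then obtain e where e: "\<And>g. g \<in> J ==> g \<in> forms N (e g)" by metis
  have "\<exists>k0. \<forall>k\<ge>k0. to_fract (g ^ k) *s c (g # t) \<in> sec (Dset N (H \<union> set t)) (m + int (k * e g))"
    if g: "g \<in> J" and t: "t \<in> lists_of J n" for g t
  proof (rule sections_extend_Dset)
    show "finite (H \<union> set t)" "H \<union> set t \<subseteq> pos_forms N" using H J t by (auto simp: lists_of_def)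
    show "g \<in> forms N (e g)" using e g .
    show "c (g # t) \<in> sec (Dset N (insert g (H \<union> set t))) m" using c[of "g # t"] g t by simp
  qed
  then obtain k0 where k0: "\<And>g t k. g \<in> J ==> t \<in> lists_of J n ==> k \<ge> k0 g t ==>
      to_fract (g ^ k) *s c (g # t) \<in> sec (Dset N (H \<union> set t)) (m + int (k * e g))" by metis
  \<comment> \<open>One exponent which clears the pole of \<open>c (g # t)\<close> along
    \<open>g\<close> for all \<open>g\<close> and all \<open>t\<close>; there are finitely
    many.\<close>
  define k where "k = (\<Sum>x\<in>J \<times> lists_of J n. k0 (fst x) (snd x))"
  have k: "k0 g t \<le> k" if "g \<in> J" "t \<in> lists_of J n" for g t
    using member_le_sum[of "(g, t)" "J \<times> lists_of J n" "\<lambda>x. k0 (fst x) (snd x)"] that J(1) finite_lists_of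
    by (auto simp: k_def)
  from partition_of_unity[OF d J(1) e, of k] cover obtain K a where
    a: "\<And>g. g \<in> J ==> a g \<in> hform N (int (K * d) - int (k * e g))" "to_fract (h ^ K) = (\<Sum>g\<in>J. a g * to_fract (g ^ k))"
    unfolding Dh by blast
  \<comment> \<open>The factor \<open>g ^ k\<close> in \<open>w g\<close> removes the pole of
    \<open>c (g # t)\<close> along \<open>g\<close>, so that the product is defined on the larger
    set without \<open>g\<close>.\<close>
  define w where "w g = a g * to_fract (g ^ k) / to_fract (h ^ K)" for g
  define b where "b t = (\<Sum>g\<in>J. w g *s c (g # t))" for t
  have b: "b t \<in> sec (Dset N (H \<union> set t)) m" if t: "t \<in> lists_of J n" for t
  proof (rule secI)
    fix p assume p: "p \<in> Dset N (H \<union> set t)"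
    hence pP: "p \<in> proj_space N" and hp: "fval p h ~= 0"
      using H(1) by (auto simp: Dset_def h_def fval_prod)
    have inv: "1 / to_fract (h ^ K) \<in> loc N p (- int (K * d))"
      using hp by (intro loc_inverse forms_power d) simp
    show "b t \<in> gr m p"
      unfolding b_def
    proof (intro gr_sum pP)
      fix g assume g: "g \<in> J"
      have v: "to_fract (g ^ k) *s c (g # t) \<in> gr (m + int (k * e g)) p"
        using secD[OF k0[OF g t k[OF g t]] p] .
      have "a g * (1 / to_fract (h ^ K)) \<in> loc N p ((int (K * d) - int (k * e g)) + - int (K * d))"
        by (rule loc_mult[OF hform_loc[OF a(1)[OF g] pP] inv])
      from gr_scale[OF pP this v, of m] show "w g *s c (g # t) \<in> gr m p" by (simp add: w_def)
    qed
  qed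
  have "c t = cobd b t" if t: "t \<in> lists_of J (Suc n)" for t
  proof -
    have "h ~= 0" using H by (auto simp: h_def pos_forms_def)
    hence "to_fract (h ^ K) ~= 0" by simp
    hence w1: "(\<Sum>g\<in>J. w g) = 1"
      unfolding w_def sum_divide_distrib[symmetric] a(2)[symmetric] by simp
    have "cobd b t = (\<Sum>g\<in>J. cobd (\<lambda>t. w g *s c (g # t)) t)" unfolding b_def by (rule cobd_sum)
    also have "\<dots> = (\<Sum>g\<in>J. w g *s cobd (\<lambda>t. c (g # t)) t)"
      by (intro sum.cong refl cobd_hom) (simp add: scale_right_diff_distrib)
    also have "\<dots> = (\<Sum>g\<in>J. w g *s c t)"
    proof (intro sum.cong refl arg_cong2[of _ _ _ _ "(*s)"])
      fix g assume "g \<in> J"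
      hence "cobd c (g # t) = 0" using t by (intro closed) simp
      thus "cobd (\<lambda>t. c (g # t)) t = c t" by simp
    qed
    also have "\<dots> = c t" by (simp add: w1 flip: scale_sum_left)
    finally show ?thesis by simp
  qed
  with b show ?thesis by blast
qed

end

section \<open>The standard covering and divisibility by monomials\<close>

lemma var_inj: "var i = (var j :: 'k::field mvpoly) \<longleftrightarrow> i = j"
proof
  assume *: "var i = (var j :: 'k mvpoly)"
  have "poly_eval (var i) (\<lambda>l. if l = i then 1 else 0 :: 'k) = 1"
    "poly_eval (var j) (\<lambda>l. if l = i then 1 else 0 :: 'k) = (if j = i then 1 else 0)" by simp_all
  with * show "i = j" by (metis zero_neq_one)
qed simp

lemma var_prod_power:
  assumes "finite S"
  shows "(\<Prod>i\<in>S. var i) ^ k = (Poly_Mapping.single (\<Sum>i\<in>S. Poly_Mapping.single i k) 1 :: 'k::field mvpoly)"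
proof -
  have var_pow: "var i ^ k = (Poly_Mapping.single (Poly_Mapping.single i k) 1 :: 'k mvpoly)" for i k
    by (induction k) (auto simp: var_def mult_single simp flip: single_add)
  show ?thesis
    using assms by (induction S) (simp_all add: power_mult_distrib var_pow mult_single)
qed

lemma monomial_mult_keys:
  fixes f :: "'k::field mvpoly"
  assumes "finite S" "e \<in> mkeys ((\<Prod>i\<in>S. var i) ^ k * f)" "i \<in> S"
  shows "k \<le> mcoeff e i"
proof -
  have "\<exists>e'. e = (\<Sum>i\<in>S. Poly_Mapping.single i k) + e'"
    using assms(2) Poly_Mapping.keys_mult[of "(\<Prod>i\<in>S. var i) ^ k" f]
    unfolding var_prod_power[OF assms(1)] by (auto split: if_splits)
  then obtain e' where "e = (\<Sum>i\<in>S. Poly_Mapping.single i k) + e'" ..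
  moreover have "(\<Sum>j\<in>S. mcoeff (Poly_Mapping.single j k) i) = k"
    using assms by (simp add: lookup_single when_def)
  ultimately show ?thesis by (simp add: lookup_add lookup_sum)
qed

lemma monomial_divides:
  assumes f: "f \<in> forms N d" and S: "S \<subseteq> {..N}" and keys: "\<And>e i. e \<in> mkeys f ==> i \<in> S ==> k \<le> mcoeff e i"
  obtains f' where "f = (\<Prod>i\<in>S. var i) ^ k * f'" "f' \<in> forms N (d - k * card S)" "f ~= 0 ==> k * card S \<le> d"
proof -
  have fin: "finite S" using S finite_subset by blast
  define e0 :: "nat \<Rightarrow>\<^sub>0 nat" where "e0 = (\<Sum>i\<in>S. Poly_Mapping.single i k)"
  have e0: "mcoeff e0 i = (if i \<in> S then k else 0)" for i
    using fin by (auto simp: e0_def lookup_sum lookup_single when_def)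
  have e0_split: "e0 + (e - e0) = e" if "e \<in> mkeys f" for e
    by (rule poly_mapping_eqI) (use keys[OF that] in \<open>auto simp: lookup_add lookup_minus e0\<close>)
  have "mdeg e0 = (\<Sum>i\<in>S. mcoeff e0 i)"
    by (rule mdeg_superset) (use fin in \<open>auto simp: in_keys_iff e0 split: if_splits\<close>)
  hence deg0: "mdeg e0 = k * card S" by (simp add: e0)
  have deg: "mdeg (e - e0) + k * card S = d" if "e \<in> mkeys f" for e
    using mdeg_add[of e0 "e - e0"] e0_split[OF that] f that deg0 by (auto simp: forms_alt)
  define f' where "f' = (\<Sum>e\<in>mkeys f. Poly_Mapping.single (e - e0) (mcoeff f e))"
  have "(\<Prod>i\<in>S. var i) ^ k * f' = (\<Sum>e\<in>mkeys f. Poly_Mapping.single e0 1 * Poly_Mapping.single (e - e0) (mcoeff f e))"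
    by (simp add: f'_def var_prod_power[OF fin] e0_def sum_distrib_left)
  also have "\<dots> = (\<Sum>e\<in>mkeys f. Poly_Mapping.single e (mcoeff f e))"
    by (intro sum.cong refl) (simp add: mult_single e0_split)
  finally have 1: "f = (\<Prod>i\<in>S. var i) ^ k * f'" by (simp add: sum_single_mcoeff)
  have "f' \<in> forms N (d - k * card S)"
    unfolding f'_def
  proof (rule forms_sum)
    fix e assume e: "e \<in> mkeys f"
    have "mkeys (e - e0) \<subseteq> mkeys e" by (auto simp: in_keys_iff lookup_minus)
    moreover have "mkeys e \<subseteq> {..<Suc N}" using e f by (auto simp: forms_alt poly_vars_def)
    ultimately show "Poly_Mapping.single (e - e0) (mcoeff f e) \<in> forms N (d - k * card S)"
      using deg[OF e] by (auto simp: forms_alt poly_vars_def)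
  qed
  moreover have "k * card S \<le> d" if ne: "f ~= 0"
  proof -
    obtain e where "e \<in> mkeys f" using ne by (metis all_not_in_conv keys_eq_empty)
    from deg[OF this] show ?thesis by simp
  qed
  ultimately show thesis using 1 by (intro that)
qed

section \<open>The structure sheaf as a system of stalks\<close>

lemma structure_stalks:
  "stalk_system ((*) :: 'k::{alg_closed_field, field_char_0} ratfun => _) N (\<lambda>p. loc N p 0)"
proof (intro stalk_system.intro stalk_system_axioms.intro)
  show "vector_space ((*) :: 'k ratfun => _)" by unfold_locales (auto simp: algebra_simps)
  show "finite_stalks ((*) :: 'k ratfun => _) N (\<lambda>p. loc N p 0)"
    unfolding finite_stalks_def
  proof
    fix p :: "'k point" assume "p \<in> proj_space N"
    then obtain i where i: "i \<le> N" "fval p (var i) ~= 0" by (rule ex_coord_nonzero)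
    show "\<exists>d>0. \<exists>g\<in>forms N d. \<exists>(n::nat) v. fval p g ~= 0 \<and> (\<forall>q\<in>basic_open N g. (\<forall>l<n. v l \<in> loc N q 0) \<and>
        (\<forall>x\<in>loc N q 0. \<exists>z. (\<forall>l<n. z l \<in> loc N q 0) \<and> x = (\<Sum>l<n. z l * v l)))"
    proof -
      have "\<exists>z. (\<forall>l<1. z l \<in> loc N q 0) \<and> x = (\<Sum>l<1::nat. z l * 1)" if "x \<in> loc N q 0" for q and x :: "'k ratfun"
        using that by (intro exI[of _ "\<lambda>_. x"]) simp
      hence "\<forall>q\<in>basic_open N (var i). (\<forall>l<1::nat. (\<lambda>_. 1) l \<in> loc N q 0) \<and>
          (\<forall>x\<in>loc N q 0. \<exists>z. (\<forall>l<1. z l \<in> loc N q 0) \<and> x = (\<Sum>l<1::nat. z l * (\<lambda>_. 1) l))"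
        using loc_1 by auto
      with i show ?thesis by (intro exI[of _ "Suc 0"] conjI bexI[of _ "var i"] exI) auto
    qed
  qed
next
  fix p :: "'k point" assume p: "p \<in> proj_space N"
  show "0 \<in> loc N p 0" by (rule loc_0[OF p])
  fix v w assume "v \<in> loc N p 0" "w \<in> loc N p 0"
  thus "v + w \<in> loc N p 0" "v * w \<in> loc N p 0"
    using loc_add loc_mult[of v N p 0 w 0] by auto
qed

lemma twist_structure_stalk:
  assumes p: "p \<in> proj_space N"
  shows "twist_stalk (*) N m (\<lambda>p. loc N p n) p = loc N p (m + n)"
proof (intro equalityI subsetI)
  fix v assume v: "v \<in> twist_stalk (*) N m (\<lambda>p. loc N p n) p"
  obtain u where u: "u \<in> loc N p m" "1 / u \<in> loc N p (- m)" "u ~= 0" using loc_unit[OF p] .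
  hence "(1 / u) * v \<in> loc N p n" using v unfolding twist_stalk_def by blast
  hence "u * ((1 / u) * v) \<in> loc N p (m + n)" by (rule loc_mult[OF u(1)])
  thus "v \<in> loc N p (m + n)" using u by simp
next
  fix v assume "v \<in> loc N p (m + n)"
  thus "v \<in> twist_stalk (*) N m (\<lambda>p. loc N p n) p"
    using loc_mult[of _ N p "- m" v "m + n"] by (auto simp: twist_stalk_def)
qed

lemma structure_sections:
  fixes h :: "'k::{alg_closed_field, field_char_0} mvpoly"
  assumes h: "h \<in> forms N d" "d > 0" and x: "x \<in> rat_on N (basic_open N h) m"
  shows "\<exists>k0. \<forall>k\<ge>k0. to_fract (h ^ k) * x \<in> hform N (int (k * d) + m)"
proof -
  interpret O: stalk_system "(*) :: 'k ratfun => _" N "\<lambda>p. loc N p 0" by (rule structure_stalks)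
  have b1: "basic_open N 1 = (proj_space N :: 'k point set)" by (auto simp: basic_open_fval[of _ N 0])
  have "O.gen_by 1 1 (\<lambda>_. 1)"
    unfolding O.gen_by_def
  proof (intro ballI conjI allI impI)
    fix q and x :: "'k ratfun" assume "x \<in> loc N q 0"
    thus "\<exists>z. (\<forall>l<1. z l \<in> loc N q 0) \<and> x = (\<Sum>l<1::nat. z l * 1)"
      by (intro exI[of _ "\<lambda>_. x"]) simp
  qed (rule loc_1)
  moreover have "x \<in> O.sec (basic_open N h) m"
    using x by (auto simp: O.sec_def rat_on_def twist_structure_stalk basic_open_def)
  moreover have "basic_open N h \<subseteq> basic_open N 1" by (auto simp: b1 basic_open_def)
  ultimately obtain k b where kb: "b (0::nat) \<in> hform N (int (k * d) + m)" "to_fract (h ^ k) * x = b 0"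
    using O.sections_gen[OF h, of 1 1 "\<lambda>_. 1" x m] by auto
  show ?thesis
  proof (intro exI[of _ k] allI impI)
    fix k' assume "k' \<ge> k"
    then obtain j where j: "k' = j + k" using le_iff_add add.commute by metis
    have "to_fract (h ^ j) * (to_fract (h ^ k) * x) \<in> hform N (int (j * d) + (int (k * d) + m))"
      unfolding kb(2) by (intro hform_mult hform_form forms_power h kb)
    moreover have "to_fract (h ^ j) * (to_fract (h ^ k) * x) = to_fract (h ^ k') * x"
      by (simp add: j power_add)
    moreover have "int (j * d) + (int (k * d) + m) = int (k' * d) + m" by (simp add: j distrib_right)
    ultimately show "to_fract (h ^ k') * x \<in> hform N (int (k' * d) + m)" by (simp only:)
  qed
qed

definition std_cover :: "nat => 'k::field mvpoly set" where "std_cover N = var ` {..N}"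

lemma std_cover_finite [simp]: "finite (std_cover N)" by (simp add: std_cover_def)

lemma std_cover_pos: "std_cover N \<subseteq> pos_forms N"
  by (auto simp: std_cover_def pos_forms_def intro!: exI[of _ 1])

lemma std_cover_covers: "p \<in> proj_space N ==> \<exists>g\<in>std_cover N. fval p g ~= 0"
  using ex_coord_nonzero[of p N] by (auto simp: std_cover_def)

lemma std_cover_complement:
  fixes A :: "'k::field mvpoly set"
  assumes "A \<subseteq> std_cover N"
  shows "(\<Prod>i\<le>N. var i) = (\<Prod>i\<in>{i\<in>{..N}. var i \<notin> A}. var i) * (\<Prod>f\<in>A. f)"
    and "card {i\<in>{..N}. var i \<notin> A} + card A = Suc N" and "(\<Prod>f\<in>A. f) \<in> forms N (card A)"
proof -
  define B where "B = {i\<in>{..N}. var i \<in> A}"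
  have A: "A = var ` B" using assms by (auto simp: B_def std_cover_def)
  have inj: "inj_on (var :: nat => 'k mvpoly) B" by (auto simp: inj_on_def var_inj)
  have split: "{..N} = {i\<in>{..N}. var i \<notin> A} \<union> B" "{i\<in>{..N}. var i \<notin> A} \<inter> B = {}" "finite B"
    by (auto simp: B_def)
  have pA: "(\<Prod>f\<in>A. f) = (\<Prod>i\<in>B. var i)" unfolding A by (simp add: prod.reindex[OF inj])
  show "(\<Prod>i\<le>N. var i) = (\<Prod>i\<in>{i\<in>{..N}. var i \<notin> A}. var i) * (\<Prod>f\<in>A. f)"
    unfolding pA by (subst split(1), rule prod.union_disjoint) (use split in auto)
  have "card {i\<in>{..N}. var i \<notin> A} + card B = card {..N}"
    by (subst (2) split(1), rule card_Un_disjoint[symmetric]) (use split in auto)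
  thus "card {i\<in>{..N}. var i \<notin> A} + card A = Suc N" using card_image[OF inj] by (simp add: A)
  have "(\<Prod>i\<in>B. var i) \<in> forms N (\<Sum>i\<in>B. Suc 0)" by (rule forms_prod) (auto simp: B_def)
  moreover have "card A = card B" using card_image[OF inj] by (simp add: A)
  ultimately show "(\<Prod>f\<in>A. f) \<in> forms N (card A)" unfolding pA by simp
qed

text \<open>
  After multiplication by a power \<open>(x\<^sub>0 \<dots> x\<^sub>N)\<^sup>k\<close> a cochain consists of forms.  A monomial is dealt
  with by the contraction with the first index \<open>i\<close> at which its exponent is at least \<open>k\<close>; such an
  index exists as long as a simplex does not contain all indices.
\<close>

lemma std_acyclic:
  fixes c :: "'k::{alg_closed_field, field_char_0} mvpoly list => 'k ratfun"
  assumes c: "\<And>s. s \<in> lists_of (std_cover N) (Suc n) ==> c s \<in> rat_on N (Dset N (set s)) m"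
    and closed: "\<And>s. s \<in> lists_of (std_cover N) (Suc (Suc n)) ==> cobd c s = 0" and n: "Suc n \<le> N"
  shows "\<exists>b. (\<forall>t\<in>lists_of (std_cover N) n. b t \<in> rat_on N (Dset N (set t)) m) \<and>
    (\<forall>s\<in>lists_of (std_cover N) (Suc n). c s = cobd b s)"
proof -
  let ?L = "lists_of (std_cover N :: 'k mvpoly set)"
  define h where "h s = (\<Prod>f\<in>set s. f)" for s :: "'k mvpoly list"
  define S where "S s = {i\<in>{..N}. var i \<notin> set s}" for s :: "'k mvpoly list"
  define T :: "'k mvpoly" where "T = (\<Prod>i\<le>N. var i)"
  have sub: "set s \<subseteq> std_cover N" if "s \<in> ?L r" for s r using that by (simp add: lists_of_def)
  have T: "T = (\<Prod>i\<in>S s. var i) * h s" and cardS: "card (S s) + card (set s) = Suc N"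
    and h: "h s \<in> forms N (card (set s))" if "s \<in> ?L r" for s r
    using std_cover_complement[OF sub[OF that]] by (simp_all add: T_def S_def h_def)
  have T0: "T ~= 0" by (simp add: T_def)
  have "\<exists>k0. \<forall>k\<ge>k0. to_fract (h s ^ k) * c s \<in> hform N (int (k * card (set s)) + m)" if s: "s \<in> ?L (Suc n)" for s
  proof (rule structure_sections[OF h[OF s]])
    show "card (set s) > 0" using s by (auto simp: lists_of_def card_gt_0_iff)
    show "c s \<in> rat_on N (basic_open N (h s)) m"
      using c[OF s] Dset_basic[of "set s" N] h[OF s] by (simp add: h_def)
  qed
  then obtain k0 where k0: "\<And>s k. s \<in> ?L (Suc n) ==> k \<ge> k0 s ==>
      to_fract (h s ^ k) * c s \<in> hform N (int (k * card (set s)) + m)" by metis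
  define k where "k = (\<Sum>s\<in>?L (Suc n). k0 s)"
  have k: "k0 s \<le> k" if "s \<in> ?L (Suc n)" for s
    unfolding k_def by (rule member_le_sum[OF that]) (auto simp: finite_lists_of)
  \<comment> \<open>The common degree of all \<open>T ^ k * c s\<close>. It may be negative, and
    then all of them vanish.\<close>
  define E where "E = int (k * Suc N) + m"
  have "\<exists>P. to_fract P = to_fract (T ^ k) * c s \<and> to_fract P \<in> hform N E \<and> (\<forall>e\<in>mkeys P. \<forall>i\<in>S s. k \<le> mcoeff e i)"
    if s: "s \<in> ?L (Suc n)" for s
  proof -
    from k0[OF s k[OF s]] obtain a d where a: "to_fract (h s ^ k) * c s = to_fract a"
      "a \<in> forms N d" "int d = int (k * card (set s)) + m \<or> a = 0" by (auto simp: hform_def)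
    \<comment> \<open>\<open>T\<close> is the product of \<open>h s\<close> and the variables
      missing from \<open>s\<close>. Passing from \<open>h s ^ k\<close> to \<open>T ^ k\<close>
      therefore forces exponents of at least \<open>k\<close> at the missing variables.\<close>
    define P where "P = (\<Prod>i\<in>S s. var i) ^ k * a"
    have "(\<Prod>i\<in>S s. var i) \<in> forms N (\<Sum>i\<in>S s. Suc 0)" by (rule forms_prod) (auto simp: S_def)
    from forms_mult[OF forms_power[OF this, of k] a(2)] have "P \<in> forms N (k * card (S s) + d)"
      by (simp add: P_def)
    moreover have "int (k * card (S s) + d) = E \<or> P = 0"
      using a(3) by (auto simp: P_def E_def algebra_simps simp flip: cardS[OF s])
    ultimately have "to_fract P \<in> hform N E" by (auto simp: hform_def)
    moreover have "to_fract P = to_fract (T ^ k) * c s"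
      by (simp add: T[OF s] P_def power_mult_distrib mult.assoc a(1))
    moreover have "\<forall>e\<in>mkeys P. \<forall>i\<in>S s. k \<le> mcoeff e i"
      unfolding P_def by (intro ballI monomial_mult_keys[of "S s"]) (auto simp: S_def)
    ultimately show ?thesis by blast
  qed
  then obtain P where P: "\<And>s. s \<in> ?L (Suc n) ==> to_fract (P s) = to_fract (T ^ k) * c s"
    "\<And>s. s \<in> ?L (Suc n) ==> to_fract (P s) \<in> hform N E"
    "\<And>s e i. s \<in> ?L (Suc n) ==> e \<in> mkeys (P s) ==> i \<in> S s ==> k \<le> mcoeff e i" by metis
  define Q where "Q i e \<longleftrightarrow> k \<le> mcoeff e i \<and> (\<forall>j<i. \<not> k \<le> mcoeff e j)" for i and e :: "nat \<Rightarrow>\<^sub>0 nat"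
  define b where "b t = (\<Sum>i\<le>N. to_fract (pfilter (Q i) (P (var i # t)))) / to_fract (T ^ k)" for t
  have var_in: "var i \<in> std_cover N" if "i \<le> N" for i using that by (auto simp: std_cover_def)
  have "b t \<in> rat_on N (Dset N (set t)) m" if t: "t \<in> ?L n" for t
    unfolding rat_on_def
  proof
    fix p assume p: "p \<in> Dset N (set t)"
    hence pP: "p \<in> proj_space N" and hp: "fval p (h t) ~= 0" by (auto simp: Dset_def h_def fval_prod)
    have "to_fract (pfilter (Q i) (P (var i # t))) / to_fract (T ^ k) \<in> loc N p m" if i: "i \<le> N" for i
    proof -
      define f where "f = pfilter (Q i) (P (var i # t))"
      have s: "var i # t \<in> ?L (Suc n)" using t var_in[OF i] by simp
      \<comment> \<open>\<open>P (var i # t)\<close> is divisible by the \<open>k\<close>-th powers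
        of the variables missing from \<open>var i # t\<close>. For the index \<open>i\<close>
        itself, the only further one that \<open>S t\<close> may contain, the filter
        \<open>Q i\<close> supplies the exponent.\<close>
      have keys: "k \<le> mcoeff e j" if "e \<in> mkeys f" "j \<in> S t" for e j
        using that P(3)[OF s, of e j] by (auto simp: f_def mkeys_pfilter Q_def S_def var_inj)
      show ?thesis
      proof (cases "f = 0")
        case True
        thus ?thesis using loc_0[OF pP] by (simp add: f_def)
      next
        case False
        hence "P (var i # t) ~= 0" by (auto simp: f_def)
        then obtain d where d: "P (var i # t) \<in> forms N d" "int d = E"
          using P(2)[OF s] by (auto simp: hform_def)
        hence "f \<in> forms N d" by (simp add: f_def pfilter_forms)
        moreover have "S t \<subseteq> {..N}" by (auto simp: S_def)
        ultimately obtain f' where f': "f = (\<Prod>i\<in>S t. var i) ^ k * f'"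
          "f' \<in> forms N (d - k * card (S t))" "k * card (S t) \<le> d"
          using keys monomial_divides[of f N d "S t" k] False by metis
        have "(\<Prod>i\<in>S t. var i) ~= (0 :: 'k mvpoly)" by (simp add: S_def)
        hence "to_fract f / to_fract (T ^ k) = to_fract f' / to_fract (h t ^ k)"
          unfolding T[OF t] f'(1) by (simp add: power_mult_distrib)
        also have "\<dots> \<in> loc N p m"
        proof (rule locI[OF f'(2) forms_power[OF h[OF t]]])
          have "int (d - k * card (S t)) = E - int (k * card (S t))" using f'(3) d(2) by simp
          thus "int (d - k * card (S t)) = int (k * card (set t)) + m"
            by (simp add: E_def algebra_simps flip: cardS[OF t])
        qed (use hp in simp)
        finally show ?thesis by (simp add: f_def)
      qed
    qed
    hence "(\<Sum>i\<le>N. to_fract (pfilter (Q i) (P (var i # t))) / to_fract (T ^ k)) \<in> loc N p m"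
      using loc_add loc_0[OF pP] by (intro sum_in_additive) auto
    thus "b t \<in> loc N p m" by (simp add: b_def sum_divide_distrib)
  qed
  moreover have "c s = cobd b s" if s: "s \<in> ?L (Suc n)" for s
  proof -
    have P_closed: "cobd P (var i # s) = 0" if i: "i \<le> N" for i
    proof -
      have "to_fract (cobd P (var i # s)) = cobd (\<lambda>t. to_fract (P t)) (var i # s)"
        by (rule cobd_hom[symmetric]) simp
      also have "\<dots> = cobd (\<lambda>t. to_fract (T ^ k) * c t) (var i # s)"
      proof (rule cobd_cong)
        fix t assume "set t \<subseteq> set (var i # s)" "Suc (length t) = length (var i # s)"
        hence "t \<in> ?L (Suc n)" using s var_in[OF i] by (auto simp: lists_of_def)
        thus "to_fract (P t) = to_fract (T ^ k) * c t" by (rule P)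
      qed
      also have "\<dots> = to_fract (T ^ k) * cobd c (var i # s)" by (rule cobd_hom) (simp add: right_diff_distrib)
      also have "cobd c (var i # s) = 0" using s var_in[OF i] by (intro closed) simp
      finally show ?thesis by simp
    qed
    have hom: "to_fract (pfilter R (f - g)) / y = to_fract (pfilter R f) / y - to_fract (pfilter R g) / y"
      for R and f g :: "'k mvpoly" and y
    proof -
      have "pfilter R (f - g) + pfilter R g = pfilter R f" by (simp flip: pfilter_add)
      hence "to_fract (pfilter R (f - g)) + to_fract (pfilter R g) = to_fract (pfilter R f)"
        by (metis to_fract_add)
      thus ?thesis by (simp add: diff_divide_distrib[symmetric] algebra_simps)
    qed
    have "cobd b s = (\<Sum>i\<le>N. cobd (\<lambda>t. to_fract (pfilter (Q i) (P (var i # t))) / to_fract (T ^ k)) s)"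
      unfolding b_def sum_divide_distrib by (rule cobd_sum)
    also have "\<dots> = (\<Sum>i\<le>N. to_fract (pfilter (Q i) (cobd (\<lambda>t. P (var i # t)) s)) / to_fract (T ^ k))"
      by (intro sum.cong refl cobd_hom hom)
    also have "\<dots> = (\<Sum>i\<le>N. to_fract (pfilter (Q i) (P s)) / to_fract (T ^ k))"
      using P_closed by (intro sum.cong refl) simp
    also have "\<dots> = to_fract (\<Sum>i\<le>N. pfilter (Q i) (P s)) / to_fract (T ^ k)"
    proof -
      have "to_fract (sum f A) = (\<Sum>i\<in>A. to_fract (f i))" for f :: "nat => 'k mvpoly" and A
        by (induction A rule: infinite_finite_induct) auto
      thus ?thesis by (simp add: sum_divide_distrib)
    qed
    also have "(\<Sum>i\<le>N. pfilter (Q i) (P s)) = P s"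
    proof (rule poly_mapping_eqI)
      fix e
      show "mcoeff (\<Sum>i\<le>N. pfilter (Q i) (P s)) e = mcoeff (P s) e"
      proof (cases "e \<in> mkeys (P s)")
        case True
        \<comment> \<open>Because of \<open>Suc n \<le> N\<close> at least one of the
          \<open>N + 1\<close> variables is missing from \<open>s\<close>, and the exponent there is
          at least \<open>k\<close>.\<close>
        have "card (set s) \<le> Suc n" using s card_length[of s] by (auto simp: lists_of_def)
        hence "S s ~= {}" using cardS[OF s] n by auto
        then obtain i0 where "i0 \<in> S s" by blast
        hence i0: "i0 \<le> N" "k \<le> mcoeff e i0" using P(3)[OF s True] by (auto simp: S_def)
        define i where "i = (LEAST i. k \<le> mcoeff e i)"
        have i: "k \<le> mcoeff e i" "i \<le> i0" unfolding i_def using i0(2) by (auto intro: LeastI Least_le)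
        have nl: "\<not> k \<le> mcoeff e j" if "j < i" for j
          using that unfolding i_def by (rule not_less_Least)
        have Qi: "Q j e \<longleftrightarrow> j = i" for j
          unfolding Q_def using i(1) nl by (metis linorder_neqE_nat)
        show ?thesis using i i0 by (simp add: lookup_sum mcoeff_pfilter Qi)
      next
        case False
        thus ?thesis by (simp add: lookup_sum mcoeff_pfilter in_keys_iff cong: if_cong)
      qed
    qed
    also have "to_fract (P s) / to_fract (T ^ k) = c s" using P(1)[OF s] T0 by simp
    finally show ?thesis by simp
  qed
  ultimately show ?thesis by blast
qed

section \<open>Comparison of coverings\<close>

lemma cobd_swap: "cobd (\<lambda>s. cobd (\<lambda>t. c s t) t) s = cobd (\<lambda>t. cobd (\<lambda>s. c s t) s) t"
proof (induction s arbitrary: c)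
  case (Cons i s)
  have "cobd (\<lambda>s. cobd (\<lambda>t. c s t) t) (i # s) = cobd (c s) t - cobd (\<lambda>s. cobd (\<lambda>t. c (i # s) t) t) s"
    by simp
  also have "\<dots> = cobd (\<lambda>t. c s t - cobd (\<lambda>s. c (i # s) t) s) t"
    by (simp add: Cons cobd_diff)
  finally show ?case by simp
qed (simp add: cobd_zero)

lemma lists_of_face: "set t \<subseteq> set s ==> Suc (length t) = length s ==> s \<in> lists_of I (Suc n) ==> t \<in> lists_of I n"
  by (auto simp: lists_of_def)

lemma lists_of_0 [simp]: "s \<in> lists_of I 0 \<longleftrightarrow> s = []"
  by (auto simp: lists_of_def)

text \<open>One direction of a double complex: cochains on lists over \<open>X\<close>, with a
  parameter \<open>\<tau>\<close> for the other direction. The parameter will be a list over a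
  second covering, or a set of Koszul indices.\<close>

locale list_columns =
  fixes X :: "'i set" and T :: "nat => 'j set" and \<Gamma> :: "'i list => 'j => 'v::ab_group_add set"
  assumes \<Gamma>_0: "0 \<in> \<Gamma> s \<tau>" and \<Gamma>_diff: "x \<in> \<Gamma> s \<tau> ==> y \<in> \<Gamma> s \<tau> ==> x - y \<in> \<Gamma> s \<tau>"
    and \<Gamma>_mono: "set s' \<subseteq> set s ==> x \<in> \<Gamma> s' \<tau> ==> x \<in> \<Gamma> s \<tau>"
begin

text \<open>Values outside the index range are set to \<open>0\<close>, so that exactness can be
  stated as equality of functions.\<close>

definition K :: "nat => nat => ('i list => 'j => 'v) set" where
  "K a b = {c. \<forall>s \<tau>. (s \<in> lists_of X a \<and> \<tau> \<in> T b --> c s \<tau> \<in> \<Gamma> s \<tau>) \<and> (\<not> (s \<in> lists_of X a \<and> \<tau> \<in> T b) --> c s \<tau> = 0)}"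

definition dh :: "('i list => 'j => 'v) => 'i list => 'j => 'v" where
  "dh c = (\<lambda>s \<tau>. if set s \<subseteq> X then cobd (\<lambda>s. c s \<tau>) s else 0)"

lemma K_I:
  assumes "\<And>s \<tau>. s \<in> lists_of X a ==> \<tau> \<in> T b ==> c s \<tau> \<in> \<Gamma> s \<tau>"
    and "\<And>s \<tau>. s \<notin> lists_of X a \<or> \<tau> \<notin> T b ==> c s \<tau> = 0"
  shows "c \<in> K a b"
  using assms by (auto simp: K_def)

lemma K_D: "c \<in> K a b ==> s \<in> lists_of X a ==> \<tau> \<in> T b ==> c s \<tau> \<in> \<Gamma> s \<tau>"
  and K_D0: "c \<in> K a b ==> s \<notin> lists_of X a \<or> \<tau> \<notin> T b ==> c s \<tau> = 0"
  by (auto simp: K_def)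

lemma K_eqI:
  "c \<in> K a b ==> d \<in> K a b ==> (\<And>s \<tau>. s \<in> lists_of X a ==> \<tau> \<in> T b ==> c s \<tau> = d s \<tau>) ==> c = d"
  by (intro ext) (metis K_D0)

lemma K_diff: "c \<in> K a b ==> d \<in> K a b ==> c - d \<in> K a b"
  by (rule K_I) (auto simp: K_D0 intro: \<Gamma>_diff K_D)

lemma dh_apply: "s \<in> lists_of X n ==> dh c s \<tau> = cobd (\<lambda>s. c s \<tau>) s"
  by (simp add: dh_def lists_of_def)

lemma dh_in:
  assumes "c \<in> K a b"
  shows "dh c \<in> K (Suc a) b"
proof (rule K_I)
  fix s \<tau> assume s: "s \<in> lists_of X (Suc a)" and \<tau>: "\<tau> \<in> T b"
  have "cobd (\<lambda>s. c s \<tau>) s \<in> \<Gamma> s \<tau>"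
  proof (rule cobd_in[OF \<Gamma>_0 \<Gamma>_diff])
    fix t assume "set t \<subseteq> set s" "Suc (length t) = length s"
    thus "c t \<tau> \<in> \<Gamma> s \<tau>" using \<Gamma>_mono[OF _ K_D[OF assms lists_of_face[OF _ _ s] \<tau>]] by blast
  qed
  thus "dh c s \<tau> \<in> \<Gamma> s \<tau>" using s by (simp add: dh_apply)
next
  fix s \<tau> assume *: "s \<notin> lists_of X (Suc a) \<or> \<tau> \<notin> T b"
  have "cobd (\<lambda>s. c s \<tau>) s = 0" if "set s \<subseteq> X"
  proof -
    have "cobd (\<lambda>s. c s \<tau>) s = cobd (\<lambda>_. 0) s"
      by (rule cobd_cong) (use * that in \<open>auto intro!: K_D0[OF assms] simp: lists_of_def\<close>)
    thus ?thesis by (simp add: cobd_zero)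
  qed
  thus "dh c s \<tau> = 0" by (simp add: dh_def)
qed

lemma dh_diff: "dh (c - d) = dh c - dh d"
  by (intro ext) (simp add: dh_def cobd_diff)

lemma dh_dh: "dh (dh c) = 0"
proof (intro ext)
  fix s \<tau>
  show "dh (dh c) s \<tau> = 0 s \<tau>"
  proof (cases "set s \<subseteq> X")
    case True
    hence "cobd (\<lambda>s. dh c s \<tau>) s = cobd (cobd (\<lambda>s. c s \<tau>)) s"
      by (intro cobd_cong) (auto simp: dh_def)
    thus ?thesis by (simp add: dh_def)
  qed (simp add: dh_def)
qed

lemma column_inj:
  assumes "X ~= {}" "x \<in> K 0 b" "dh x = 0"
  shows "x = 0"
proof (intro ext)
  fix s \<tau>
  obtain i where "i \<in> X" using assms(1) by blast
  hence "dh x [i] \<tau> = x [] \<tau>" by (simp add: dh_def)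
  thus "x s \<tau> = 0 s \<tau>" using assms(3) K_D0[OF assms(2), of s \<tau>] by (cases "s = []") simp_all
qed

lemma column_exact:
  assumes x: "x \<in> K (Suc a) b" "dh x = 0"
    and ex: "\<And>\<tau> c. \<tau> \<in> T b ==> (\<And>s. s \<in> lists_of X (Suc a) ==> c s \<in> \<Gamma> s \<tau>) ==>
      (\<And>s. s \<in> lists_of X (Suc (Suc a)) ==> cobd c s = 0) ==>
      \<exists>d. (\<forall>s\<in>lists_of X a. d s \<in> \<Gamma> s \<tau>) \<and> (\<forall>s\<in>lists_of X (Suc a). c s = cobd d s)"
  shows "\<exists>z\<in>K a b. x = dh z"
proof -
  have "\<exists>d. (\<forall>s\<in>lists_of X a. d s \<in> \<Gamma> s \<tau>) \<and> (\<forall>s\<in>lists_of X (Suc a). x s \<tau> = cobd d s)" if \<tau>: "\<tau> \<in> T b" for \<tau>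
  proof (rule ex[OF \<tau>])
    fix s assume "s \<in> lists_of X (Suc (Suc a))"
    hence "cobd (\<lambda>s. x s \<tau>) s = dh x s \<tau>" by (simp add: dh_apply)
    thus "cobd (\<lambda>s. x s \<tau>) s = 0" using x(2) by simp
  qed (use K_D[OF x(1) _ \<tau>] in auto)
  then obtain d where d: "\<And>\<tau> s. \<tau> \<in> T b ==> s \<in> lists_of X a ==> d \<tau> s \<in> \<Gamma> s \<tau>"
    "\<And>\<tau> s. \<tau> \<in> T b ==> s \<in> lists_of X (Suc a) ==> x s \<tau> = cobd (d \<tau>) s" by metis
  define z where "z s \<tau> = (if s \<in> lists_of X a \<and> \<tau> \<in> T b then d \<tau> s else 0)" for s \<tau>
  have z: "z \<in> K a b" by (rule K_I) (auto simp: z_def d)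
  have "x = dh z"
  proof (rule K_eqI[OF x(1) dh_in[OF z]])
    fix s \<tau> assume s: "s \<in> lists_of X (Suc a)" and \<tau>: "\<tau> \<in> T b"
    have "cobd (\<lambda>s. z s \<tau>) s = cobd (d \<tau>) s"
      by (rule cobd_cong) (use \<tau> lists_of_face[OF _ _ s] in \<open>auto simp: z_def\<close>)
    thus "x s \<tau> = dh z s \<tau>" using d(2)[OF \<tau> s] s by (simp add: dh_apply)
  qed
  with z show ?thesis by blast
qed

end

section \<open>Cech complexes of coverings by basic open sets\<close>

context stalk_system
begin

definition cochains :: "'k mvpoly set => nat => int => ('k mvpoly list => 'v) set" where
  "cochains J n m = {c. \<forall>s\<in>lists_of J n. c s \<in> sec (Dset N (set s)) m}"

text \<open>Exactness at the cochains on lists of length \<open>n\<close>, i.e. in degree \<open>n - 1\<close>; lists of length \<open>0\<close>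
  are the augmentation.\<close>

definition acyclic :: "'k mvpoly set => nat => int => bool" where
  "acyclic J n m \<longleftrightarrow> (\<forall>c\<in>cochains J n m. (\<forall>s\<in>lists_of J (Suc n). cobd c s = 0) -->
     (\<exists>b\<in>cochains J (n - 1) m. \<forall>s\<in>lists_of J n. c s = cobd b s))"

definition covering :: "'k mvpoly set => bool" where
  "covering J \<longleftrightarrow> finite J \<and> J \<subseteq> pos_forms N \<and> (\<forall>p\<in>proj_space N. \<exists>g\<in>J. fval p g ~= 0)"

lemma covering_std: "covering (std_cover N)"
  using std_cover_pos std_cover_covers by (auto simp: covering_def)

lemma covering_nonempty: "covering J ==> J ~= {}"
proof -
  assume J: "covering J"
  obtain p :: "'k point" where "p \<in> proj_space N"
    using form_nonvanishing[OF forms_var[of 0 N]] var_neq_0 by blast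
  thus "J ~= {}" using J by (auto simp: covering_def)
qed

lemma local_acyclic:
  assumes J: "covering J" and H: "finite H" "H ~= {}" "H \<subseteq> pos_forms N"
    and c: "\<And>t. t \<in> lists_of J (Suc n) ==> c t \<in> sec (Dset N (H \<union> set t)) m"
    and closed: "\<And>t. t \<in> lists_of J (Suc (Suc n)) ==> cobd c t = 0"
  shows "\<exists>b. (\<forall>t\<in>lists_of J n. b t \<in> sec (Dset N (H \<union> set t)) m) \<and> (\<forall>t\<in>lists_of J (Suc n). c t = cobd b t)"
  using J Dset_proj[of N H] by (intro affine_acyclic[OF H _ _ _ c closed]) (auto simp: covering_def)

definition bisec :: "int => 'k mvpoly list => 'k mvpoly list => 'v set" where
  "bisec m s t = sec (Dset N (set s \<union> set t)) m"

lemma bisec_columns: "list_columns (bisec m)"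
proof
  fix s t :: "'k mvpoly list"
  show "0 \<in> bisec m s t" by (simp add: bisec_def sec_0 Dset_proj)
  fix x assume x: "x \<in> bisec m s t"
  show "x - y \<in> bisec m s t" if "y \<in> bisec m s t" for y
    using x that by (simp add: bisec_def sec_diff Dset_proj)
  show "x \<in> bisec m s' t" if "set s \<subseteq> set s'" for s'
    using x that unfolding bisec_def by (elim sec_mono[rotated]) (intro Dset_mono Un_mono order_refl)
qed

lemma bisec_commute: "bisec m s t = bisec m t s"
  by (simp add: bisec_def Un_commute)

lemma bisec_swap:
  "c \<in> list_columns.K Y (lists_of J) (bisec m) a b \<longleftrightarrow> (\<lambda>t s. c s t) \<in> list_columns.K J (lists_of Y) (bisec m) b a"
proof -
  have "bisec m s t \<subseteq> bisec m t s" for s t by (simp add: bisec_commute)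
  thus ?thesis
    unfolding list_columns.K_def[OF bisec_columns] by blast
qed

lemma bisec_double:
  fixes m Y J
  defines "K \<equiv> list_columns.K Y (lists_of J) (bisec m)" and "\<delta> \<equiv> list_columns.dh Y"
    and "\<delta>' \<equiv> (\<lambda>c s t. list_columns.dh J (\<lambda>t s. c s t) t s)"
  shows "double_complex K \<delta> \<delta>'"
proof -
  interpret Y: list_columns Y "lists_of J" "bisec m" by (rule bisec_columns)
  interpret J: list_columns J "lists_of Y" "bisec m" by (rule bisec_columns)
  note swap = bisec_swap[of _ Y J m]
  show ?thesis
    unfolding K_def \<delta>_def \<delta>'_def
  proof
    fix a b x assume x: "x \<in> Y.K a b"
    show "y \<in> Y.K a b ==> x - y \<in> Y.K a b" for y using x by (rule Y.K_diff)
    show "Y.dh x \<in> Y.K (Suc a) b" using x by (rule Y.dh_in)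
    show "(\<lambda>s t. J.dh (\<lambda>t s. x s t) t s) \<in> Y.K a (Suc b)"
      using J.dh_in x by (simp add: swap)
    show "Y.dh (Y.dh x) = 0" by (rule Y.dh_dh)
    show "(\<lambda>s t. J.dh (\<lambda>t s. J.dh (\<lambda>t s. x s t) t s) t s) = 0"
      using J.dh_dh[of "\<lambda>t s. x s t"] by (simp add: fun_eq_iff)
    show "Y.dh (\<lambda>s t. J.dh (\<lambda>t s. x s t) t s) = (\<lambda>s t. J.dh (\<lambda>t s. Y.dh x s t) t s)"
    proof (intro ext)
      fix s t
      show "Y.dh (\<lambda>s t. J.dh (\<lambda>t s. x s t) t s) s t = J.dh (\<lambda>t s. Y.dh x s t) t s"
        using cobd_swap[of x t s] by (simp add: Y.dh_def J.dh_def cobd_zero)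
    qed
  next
    fix x y
    show "Y.dh (x - y) = Y.dh x - Y.dh y" by (rule Y.dh_diff)
    show "(\<lambda>s t. J.dh (\<lambda>t s. (x - y) s t) t s) = (\<lambda>s t. J.dh (\<lambda>t s. x s t) t s) - (\<lambda>s t. J.dh (\<lambda>t s. y s t) t s)"
      by (intro ext) (simp add: J.dh_def cobd_diff)
  qed
qed

text \<open>The list over the other covering is nonempty, so this is a Cech complex over an affine
  open set.\<close>

lemma bisec_column_exact:
  assumes Y: "covering Y" and J: "covering J"
    and x: "x \<in> list_columns.K Y (lists_of J) (bisec m) (Suc a) (Suc b)" "list_columns.dh Y x = 0"
  shows "\<exists>z\<in>list_columns.K Y (lists_of J) (bisec m) a (Suc b). x = list_columns.dh Y z"
proof -
  interpret Y: list_columns Y "lists_of J" "bisec m" by (rule bisec_columns)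
  show ?thesis
  proof (rule Y.column_exact[OF x])
    fix t and c :: "'k mvpoly list => 'v"
    assume t: "t \<in> lists_of J (Suc b)" and c: "\<And>s. s \<in> lists_of Y (Suc a) ==> c s \<in> bisec m s t"
      "\<And>s. s \<in> lists_of Y (Suc (Suc a)) ==> cobd c s = 0"
    have "finite (set t)" "set t ~= {}" "set t \<subseteq> pos_forms N"
      using t J by (auto simp: lists_of_def covering_def)
    from local_acyclic[OF Y this, of a c m] c
    show "\<exists>d. (\<forall>s\<in>lists_of Y a. d s \<in> bisec m s t) \<and> (\<forall>s\<in>lists_of Y (Suc a). c s = cobd d s)"
      by (simp add: bisec_def Un_commute)
  qed
qed

text \<open>In the double complex of lists over \<open>Y\<close> and over \<open>J\<close> every
  position that the chase meets is governed by affine acyclicity, as soon as the list not being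
  varied is nonempty. The single exception is the end \<open>(n, 0)\<close> of the diagonal, and
  there the acyclicity of \<open>Y\<close> is used.\<close>

lemma acyclic_transfer:
  assumes Y: "covering Y" and J: "covering J" and n: "n \<ge> 1" and ac: "acyclic Y n m"
  shows "acyclic J n m"
  unfolding acyclic_def
proof (intro ballI impI)
  fix c assume c: "c \<in> cochains J n m" and closed: "\<forall>s\<in>lists_of J (Suc n). cobd c s = 0"
  interpret Y: list_columns Y "lists_of J" "bisec m" by (rule bisec_columns)
  interpret J: list_columns J "lists_of Y" "bisec m" by (rule bisec_columns)
  define \<delta>' where "\<delta>' = (\<lambda>c s t. J.dh (\<lambda>t s. c s t) t s)"
  interpret double_complex Y.K Y.dh \<delta>' unfolding \<delta>'_def by (rule bisec_double)
  note swap = bisec_swap[of _ Y J m]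
  define d where "d s t = (if s = [] \<and> t \<in> lists_of J n then c t else 0)" for s t :: "'k mvpoly list"
  have dK: "d \<in> Y.K 0 n" by (rule Y.K_I) (use c in \<open>auto simp: d_def bisec_def cochains_def\<close>)
  have "\<delta>' d = 0"
  proof -
    have "\<delta>' d s t = 0" if "s = []" "t \<in> lists_of J (Suc n)" for s t
    proof -
      have "cobd (d []) t = cobd c t"
        by (rule cobd_cong) (use lists_of_face[OF _ _ that(2)] in \<open>auto simp: d_def\<close>)
      thus ?thesis using closed that J.dh_apply[OF that(2), of "\<lambda>t s. d s t"] by (simp add: \<delta>'_def)
    qed
    thus ?thesis using Y.K_D0[OF dv_in[OF dK]] by (intro ext) (metis lists_of_0 zero_fun_apply)
  qed
  have "\<exists>t\<in>Y.K 0 (n - 1). d = \<delta>' t"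
  proof (rule row_col_transfer[OF dK \<open>\<delta>' d = 0\<close> n])
    fix a b x assume ab: "a \<ge> 1" "a + Suc b = Suc n" and x: "x \<in> Y.K a (Suc b)" "\<delta>' x = 0"
    obtain a' where a': "a = Suc a'" using ab(1) by (cases a) auto
    have "J.dh (\<lambda>t s. x s t) = 0"
      using x(2) unfolding \<delta>'_def fun_eq_iff by simp
    then obtain z where "z \<in> J.K b a" "(\<lambda>t s. x s t) = J.dh z"
      using bisec_column_exact[OF J Y, of "\<lambda>t s. x s t" m b a'] x(1) by (auto simp: swap a')
    thus "\<exists>z\<in>Y.K a b. x = \<delta>' z"
      by (intro bexI[of _ "\<lambda>s t. z t s"]) (auto simp: swap \<delta>'_def fun_eq_iff)
  next
    fix x assume x: "x \<in> Y.K (Suc n) 0" "\<delta>' x = 0"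
    have "(\<lambda>t s. x s t) = 0"
    proof (rule J.column_inj[OF covering_nonempty[OF J]])
      show "(\<lambda>t s. x s t) \<in> J.K 0 (Suc n)" using x(1) by (simp add: swap)
      show "J.dh (\<lambda>t s. x s t) = 0" using x(2) unfolding \<delta>'_def fun_eq_iff by simp
    qed
    thus "x = 0" by (simp add: fun_eq_iff)
  next
    fix a x assume a: "a \<ge> 1" "a \<le> n" and x: "x \<in> Y.K a (n - a)" "Y.dh x = 0"
    obtain a' where a': "a = Suc a'" using a(1) by (cases a) auto
    show "\<exists>z\<in>Y.K (a - 1) (n - a). x = Y.dh z"
    proof (cases "n - a")
      \<comment> \<open>The list over \<open>J\<close> is empty here, and the column is the
        augmented complex of \<open>Y\<close> over all of projective space.\<close>
      case 0
      hence n': "n = Suc a'" using a a' by simp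
      have "\<exists>z\<in>Y.K a' 0. x = Y.dh z"
      proof (rule Y.column_exact)
        show "x \<in> Y.K (Suc a') 0" "Y.dh x = 0" using x 0 a' by auto
        fix t and c :: "'k mvpoly list => 'v"
        assume t: "t \<in> lists_of J 0" and c: "\<And>s. s \<in> lists_of Y (Suc a') ==> c s \<in> bisec m s t"
          "\<And>s. s \<in> lists_of Y (Suc (Suc a')) ==> cobd c s = 0"
        hence "c \<in> cochains Y n m" by (simp add: cochains_def bisec_def n')
        thus "\<exists>d. (\<forall>s\<in>lists_of Y a'. d s \<in> bisec m s t) \<and> (\<forall>s\<in>lists_of Y (Suc a'). c s = cobd d s)"
          using ac c(2) t unfolding acyclic_def by (auto simp: n' cochains_def bisec_def)
      qed
      thus ?thesis by (simp add: n' a')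
    next
      case (Suc b)
      thus ?thesis using bisec_column_exact[OF Y J, of x m a' b] x a' by simp
    qed
  next
    fix x assume "x \<in> Y.K 0 n" "Y.dh x = 0"
    thus "x = 0" by (rule Y.column_inj[OF covering_nonempty[OF Y]])
  qed
  then obtain t where t: "t \<in> Y.K 0 (n - 1)" "d = \<delta>' t" by blast
  have "t [] \<in> cochains J (n - 1) m"
    unfolding cochains_def using Y.K_D[OF t(1), of "[]"] by (simp add: bisec_def)
  moreover have "c s = cobd (t []) s" if s: "s \<in> lists_of J n" for s
  proof -
    have "c s = d [] s" using s by (simp add: d_def)
    also have "\<dots> = cobd (t []) s" using J.dh_apply[OF s, of "\<lambda>t' s. t s t'"] by (simp add: t(2) \<delta>'_def)
    finally show ?thesis .
  qed
  ultimately show "\<exists>b\<in>cochains J (n - 1) m. \<forall>s\<in>lists_of J n. c s = cobd b s" by blast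
qed

text \<open>The cohomology of a basic covering injects into that of a refinement, hence into the
  limit. The zigzag is explicit: up to sign \<open>c (map \<rho> s @ t)\<close> interpolates between
  \<open>c\<close> itself, for empty \<open>s\<close>, and its pullback, for empty \<open>t\<close>;
  neighbours match because \<open>c\<close> is a cocycle on concatenations.\<close>

lemma refinement_injective:
  assumes Y: "covering Y" and J: "covering J" and n: "n \<ge> 1"
    and \<rho>: "\<And>g. g \<in> J ==> \<rho> g \<in> Y \<and> basic_open N g \<subseteq> basic_open N (\<rho> g)"
    and c: "c \<in> cochains Y n m" "\<And>s. s \<in> lists_of Y (Suc n) ==> cobd c s = 0"
    and b: "b \<in> cochains J (n - 1) m" "\<And>t. t \<in> lists_of J n ==> c (map \<rho> t) = cobd b t"
  shows "\<exists>b\<in>cochains Y (n - 1) m. \<forall>s\<in>lists_of Y n. c s = cobd b s"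
proof -
  interpret J: list_columns J "lists_of Y" "bisec m" by (rule bisec_columns)
  interpret Y: list_columns Y "lists_of J" "bisec m" by (rule bisec_columns)
  define \<delta>' where "\<delta>' = (\<lambda>c s t. Y.dh (\<lambda>t s. c s t) t s)"
  interpret double_complex J.K J.dh \<delta>' unfolding \<delta>'_def by (rule bisec_double)
  \<comment> \<open>By \<open>cobd_append\<close> neighbouring terms match with a minus sign exactly
    if the length \<open>Suc a\<close> is even, so the sign has to change there.\<close>
  define e where "e = rec_nat True (\<lambda>a x. if even (Suc a) then \<not> x else x)"
  have e: "e 0" "e (Suc a) = (if even (Suc a) then \<not> e a else e a)" for a by (simp_all add: e_def)
  define sg where "sg a x = (if e a then x else - x)" for a and x :: 'v
  have sg_diff: "sg a (x - y) = sg a x - sg a y" for a x y by (simp add: sg_def)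
  have sg_in: "sg a x \<in> sec (Dset N A) k" if "x \<in> sec (Dset N A) k" for a x A k
    using that sec_uminus[OF Dset_proj] by (simp add: sg_def)
  define y where "y a s t = (if s \<in> lists_of J a \<and> t \<in> lists_of Y (n - a) then sg a (c (map \<rho> s @ t)) else 0)" for a s t
  have map_in: "map \<rho> s @ t \<in> lists_of Y (a + b)" if "s \<in> lists_of J a" "t \<in> lists_of Y b" for s t a b
    using that \<rho> by (auto simp: lists_of_def)
  have map_sec: "c (map \<rho> s @ t) \<in> sec (Dset N (set s \<union> set t)) m" if "s \<in> lists_of J a" "t \<in> lists_of Y b" "a + b = n" for s t a b
  proof -
    have "c (map \<rho> s @ t) \<in> sec (Dset N (set (map \<rho> s @ t))) m"
      using c(1) map_in[OF that(1,2)] unfolding that(3) cochains_def by blast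
    moreover have "fval p (\<rho> g) ~= 0" if g: "g \<in> J" and p: "p \<in> proj_space N" "fval p g ~= 0" for p g
    proof -
      obtain d d' where "g \<in> forms N d" "\<rho> g \<in> forms N d'"
        using \<rho>[OF g] g Y J unfolding covering_def pos_forms_def by blast
      thus ?thesis using \<rho>[OF g] p by (auto simp: basic_open_fval)
    qed
    hence "Dset N (set s \<union> set t) \<subseteq> Dset N (set (map \<rho> s @ t))"
      using that(1) by (auto simp: Dset_def lists_of_def)
    ultimately show ?thesis by (rule sec_mono[rotated])
  qed
  have yK: "y a \<in> J.K a (n - a)" if "a \<le> n" for a
    by (rule J.K_I) (use that in \<open>auto simp: y_def bisec_def intro!: sg_in map_sec\<close>)
  have rel: "J.dh (y a) = \<delta>' (y (Suc a))" if a: "a < n" for a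
  proof (rule J.K_eqI)
    show "J.dh (y a) \<in> J.K (Suc a) (n - a)" using a by (intro J.dh_in yK) simp
    show "\<delta>' (y (Suc a)) \<in> J.K (Suc a) (n - a)" using dv_in[OF yK[of "Suc a"]] a by (simp add: Suc_diff_Suc)
    fix s t assume s: "s \<in> lists_of J (Suc a)" and t: "t \<in> lists_of Y (n - a)"
    have t': "t \<in> lists_of Y (Suc (n - Suc a))" using t a by (simp add: Suc_diff_Suc)
    have len: "length s = Suc a" using s by (simp add: lists_of_def)
    have "cobd c (map \<rho> s @ t) = 0" using map_in[OF s t] a by (intro c(2)) simp
    hence zero: "cobd (\<lambda>u. c (map \<rho> u @ t)) s + (if even (Suc a) then cobd (\<lambda>u. c (map \<rho> s @ u)) t else - cobd (\<lambda>u. c (map \<rho> s @ u)) t) = 0"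
      unfolding cobd_append cobd_map length_map len .
    have "J.dh (y a) s t = cobd (\<lambda>u. sg a (c (map \<rho> u @ t))) s"
      unfolding J.dh_apply[OF s] by (rule cobd_cong) (use lists_of_face[OF _ _ s] t in \<open>auto simp: y_def\<close>)
    also have "\<dots> = sg a (cobd (\<lambda>u. c (map \<rho> u @ t)) s)" by (rule cobd_hom) (rule sg_diff)
    also have "\<dots> = sg (Suc a) (cobd (\<lambda>u. c (map \<rho> s @ u)) t)"
      using zero by (auto simp: sg_def e add_eq_0_iff split: if_splits)
    also have "\<dots> = cobd (\<lambda>u. sg (Suc a) (c (map \<rho> s @ u))) t" by (rule cobd_hom[symmetric]) (rule sg_diff)
    also have "\<dots> = cobd (\<lambda>u. y (Suc a) s u) t"
      by (rule cobd_cong) (use lists_of_face[OF _ _ t'] s in \<open>auto simp: y_def\<close>)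
    also have "\<dots> = \<delta>' (y (Suc a)) s t" unfolding \<delta>'_def by (rule Y.dh_apply[OF t, symmetric])
    finally show "J.dh (y a) s t = \<delta>' (y (Suc a)) s t" .
  qed
  define b' where "b' s t = (if s \<in> lists_of J (n - 1) \<and> t = [] then sg n (b s) else 0)" for s and t :: "'k mvpoly list"
  have b'K: "b' \<in> J.K (n - 1) 0"
    by (rule J.K_I) (use b(1) in \<open>auto simp: b'_def bisec_def cochains_def intro!: sg_in\<close>)
  have n': "Suc (n - 1) = n" using n by simp
  have yn: "y n = J.dh b'"
  proof (rule J.K_eqI)
    show "y n \<in> J.K n 0" using yK[of n] by simp
    show "J.dh b' \<in> J.K n 0" using J.dh_in[OF b'K] n by simp
    fix s t :: "'k mvpoly list" assume s: "s \<in> lists_of J n" and t: "t \<in> lists_of Y 0"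
    have s': "s \<in> lists_of J (Suc (n - 1))" using s n by simp
    have "J.dh b' s t = cobd (\<lambda>u. sg n (b u)) s"
      unfolding J.dh_apply[OF s] by (rule cobd_cong) (use lists_of_face[OF _ _ s'] t in \<open>auto simp: b'_def\<close>)
    also have "\<dots> = sg n (cobd b s)" by (rule cobd_hom) (rule sg_diff)
    finally show "y n s t = J.dh b' s t" using b(2)[OF s] s t by (simp add: y_def)
  qed
  have "\<exists>t\<in>J.K 0 (n - 1). y 0 = \<delta>' t"
  proof (rule zigzag_descend[OF yK rel b'K yn n])
    fix a x assume a: "a \<ge> 1" "a < n" and x: "x \<in> J.K a (n - a)" "J.dh x = 0"
    obtain a' b' where "a = Suc a'" "n - a = Suc b'" using a by (metis Suc_diff_Suc not0_implies_Suc not_one_le_zero)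
    thus "\<exists>z\<in>J.K (a - 1) (n - a). x = J.dh z"
      using bisec_column_exact[OF J Y, of x m a' b'] x by simp
  next
    fix x assume "x \<in> J.K 0 n" "J.dh x = 0"
    thus "x = 0" by (rule J.column_inj[OF covering_nonempty[OF J]])
  qed
  then obtain t where t: "t \<in> J.K 0 (n - 1)" "y 0 = \<delta>' t" by blast
  have "t [] \<in> cochains Y (n - 1) m"
    unfolding cochains_def using J.K_D[OF t(1), of "[]"] by (simp add: bisec_def)
  moreover have "c s = cobd (t []) s" if s: "s \<in> lists_of Y n" for s
  proof -
    have "c s = y 0 [] s" using s e by (simp add: y_def sg_def)
    also have "\<dots> = cobd (t []) s" using Y.dh_apply[OF s, of "\<lambda>t' s. t s t'"] by (simp add: t(2) \<delta>'_def)
    finally show ?thesis .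
  qed
  ultimately show ?thesis by blast
qed

end

section \<open>Relations between global sections\<close>

text \<open>The sign of moving \<open>j\<close> to its place in the increasing enumeration of
  \<open>insert j A\<close>.\<close>

definition kz :: "nat set => nat => 'k::comm_ring_1" where
  "kz A j = (-1) ^ card {i\<in>A. i < j}"

lemma kz_cases: "kz A j = (1::'k::comm_ring_1) \<or> kz A j = (-1::'k)"
  by (cases "even (card {i\<in>A. i < j})") (simp_all add: kz_def)

lemma kz_square [simp]: "kz A j * kz A j = (1::'k::comm_ring_1)"
  by (cases "even (card {i\<in>A. i < j})") (simp_all add: kz_def)

lemma kz_insert:
  assumes "finite A" "l \<notin> A"
  shows "kz (insert l A) j = (if l < j then - kz A j else (kz A j :: 'k::comm_ring_1))"
proof -
  have "{i \<in> insert l A. i < j} = (if l < j then insert l {i\<in>A. i < j} else {i\<in>A. i < j})" by auto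
  thus ?thesis using assms by (simp add: kz_def)
qed

lemma kz_swap:
  assumes "finite A" "i \<notin> A" "j \<notin> A" "i ~= j"
  shows "kz (insert i A) j * kz A i = - (kz (insert j A) i * kz A j :: 'k::comm_ring_1)"
    and "kz (insert i A) j * kz (insert j A) i = - (kz A i * kz A j :: 'k)"
  using assms by (auto simp: kz_insert)

text \<open>The diagonal is required to vanish separately, since \<open>2\<close> cannot be
  cancelled in a general abelian group.\<close>

lemma sum_antisymmetric:
  fixes h :: "'i => 'i => 'v::ab_group_add"
  assumes "finite C" "\<And>i j. i \<in> C ==> j \<in> C ==> h i j = - h j i" "\<And>i. i \<in> C ==> h i i = 0"
  shows "(\<Sum>i\<in>C. \<Sum>j\<in>C. h i j) = 0"
  using assms
proof (induction C)
  case (insert x C)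
  have "(\<Sum>i\<in>insert x C. \<Sum>j\<in>insert x C. h i j) = h x x + (\<Sum>j\<in>C. h x j) + ((\<Sum>i\<in>C. h i x) + (\<Sum>i\<in>C. \<Sum>j\<in>C. h i j))"
    using insert.hyps by (simp add: sum.distrib)
  moreover have "(\<Sum>i\<in>C. h i x) = - (\<Sum>j\<in>C. h x j)"
    unfolding sum_negf[symmetric] by (intro sum.cong refl insert.prems(1)) simp_all
  moreover have "(\<Sum>i\<in>C. \<Sum>j\<in>C. h i j) = 0" by (intro insert.IH insert.prems) simp_all
  moreover have "h x x = 0" by (rule insert.prems(2)) simp
  ultimately show ?case by simp
qed simp

section \<open>The Koszul complex of the variables\<close>

context stalk_system
begin

text \<open>The Koszul differential of \<open>x\<^sub>0, ..., x\<^sub>N\<close>; \<open>c A\<close>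
  is the coefficient at the basis element of the exterior algebra that belongs to \<open>A\<close>,
  and the differential lowers the exterior degree by one.\<close>

definition koszul :: "(nat set => 'v) => nat set => 'v" where
  "koszul c A = (if A \<subseteq> {..N} then \<Sum>j\<in>{..N} - A. (kz A j * X j) *s c (insert j A) else 0)"

lemma koszul_koszul: "koszul (koszul c) A = 0"
proof (cases "A \<subseteq> {..N}")
  case True
  hence fin: "finite A" by (rule finite_subset) simp
  \<comment> \<open>The terms for ordered pairs of distinct indices, extended by zero to the
    diagonal; exchanging the two insertions reverses the sign.\<close>
  define h where "h j l = (if j = l then 0 else (kz A j * X j * (kz (insert j A) l * X l)) *s c (insert l (insert j A)))" for j l
  have "koszul (koszul c) A = (\<Sum>j\<in>{..N} - A. \<Sum>l\<in>{..N} - A. h j l)"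
    unfolding koszul_def if_P[OF True]
  proof (intro sum.cong refl)
    fix j assume j: "j \<in> {..N} - A"
    hence "insert j A \<subseteq> {..N}" using True by auto
    moreover have "(\<Sum>l\<in>{..N} - A. h j l) = (\<Sum>l\<in>{..N} - insert j A. h j l)"
      by (rule sum.mono_neutral_right) (auto simp: h_def)
    moreover have "(\<Sum>l\<in>{..N} - insert j A. h j l) =
        (\<Sum>l\<in>{..N} - insert j A. (kz A j * X j) *s ((kz (insert j A) l * X l) *s c (insert l (insert j A))))"
      by (rule sum.cong) (auto simp: h_def)
    ultimately show "(kz A j * X j) *s (if insert j A \<subseteq> {..N}
        then \<Sum>l\<in>{..N} - insert j A. (kz (insert j A) l * X l) *s c (insert l (insert j A)) else 0) = (\<Sum>l\<in>{..N} - A. h j l)"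
      by (simp add: scale_sum_right)
  qed
  also have "\<dots> = 0"
  proof (rule sum_antisymmetric)
    fix i j assume ij: "i \<in> {..N} - A" "j \<in> {..N} - A"
    show "h i j = - h j i"
    proof (cases "i = j")
      case False
      have "kz A i * X i * (kz (insert i A) j * X j) = kz (insert i A) j * kz A i * (X i * X j)" by (simp add: ac_simps)
      also have "\<dots> = - (kz A j * X j * (kz (insert j A) i * X i))"
        by (subst kz_swap(1)[OF fin]) (use ij False in \<open>simp_all add: ac_simps\<close>)
      finally have e: "kz A i * X i * (kz (insert i A) j * X j) = - (kz A j * X j * (kz (insert j A) i * X i))" .
      have "h i j = (kz A i * X i * (kz (insert i A) j * X j)) *s c (insert j (insert i A))"
        "h j i = (kz A j * X j * (kz (insert j A) i * X i)) *s c (insert j (insert i A))"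
        using False by (simp_all add: h_def insert_commute[of i j])
      thus ?thesis unfolding e by (simp only: scale_minus_left)
    qed (simp add: h_def)
  qed (auto simp: h_def)
  finally show ?thesis .
qed (simp add: koszul_def)

text \<open>Exterior multiplication by the \<open>i\<close>-th basis vector, divided by
  \<open>X i\<close>: the homotopy which makes the Koszul complex exact wherever \<open>X i\<close>
  is invertible.\<close>

definition contract :: "nat => (nat set => 'v) => nat set => 'v" where
  "contract i c A = (if i \<in> A then (kz (A - {i}) i * X i powi (-1)) *s c (A - {i}) else 0)"

lemma koszul_contract:
  assumes i: "i \<le> N" and A: "A \<subseteq> {..N}"
  shows "koszul (contract i c) A + contract i (koszul c) A = c A"
proof (cases "i \<in> A")
  case False
  have "koszul (contract i c) A = (\<Sum>j\<in>{..N} - A. (kz A j * X j) *s contract i c (insert j A))"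
    using A by (simp add: koszul_def)
  also have "\<dots> = (\<Sum>j\<in>{i}. (kz A j * X j) *s contract i c (insert j A))"
    using i False by (intro sum.mono_neutral_right) (auto simp: contract_def)
  also have "\<dots> = (kz A i * X i) *s (kz A i * X i powi (-1)) *s c A"
    using False by (simp add: contract_def del: scale_scale power_int_minus1_right)
  also have "\<dots> = (kz A i * kz A i * (X i * X i powi (-1))) *s c A" by (simp only: scale_scale ac_simps)
  also have "\<dots> = c A" using var_neq_0[of i] by (simp add: power_int_minus)
  finally show ?thesis using False by (simp add: contract_def)
next
  case True
  define B where "B = A - {i}"
  have AB: "A = insert i B" "i \<notin> B" "B \<subseteq> {..N}" "finite B"
    using True A finite_subset[OF A] by (auto simp: B_def)
  \<comment> \<open>Inserting \<open>j\<close> and removing \<open>i\<close> anticommute, by the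
    comparison of signs in \<open>kz_swap\<close>, so these terms cancel against those from
    \<open>contract i (koszul c)\<close>.\<close>
  have step: "(kz A j * X j) *s contract i c (insert j A) = - ((kz B i * X i powi (-1)) *s (kz B j * X j) *s c (insert j B))"
    if j: "j \<in> {..N} - A" for j
  proof -
    have ji: "j ~= i" "j \<notin> B" using j AB by auto
    have e: "insert j A - {i} = insert j B" using ji AB by auto
    have "(kz A j * X j) *s contract i c (insert j A) = (kz (insert i B) j * kz (insert j B) i * (X j * X i powi (-1))) *s c (insert j B)"
      unfolding contract_def e using AB(1) by (simp add: ac_simps)
    also have "kz (insert i B) j * kz (insert j B) i = - (kz B i * kz B j :: 'k ratfun)"
      using AB ji by (intro kz_swap(2)) auto
    finally show ?thesis by (simp add: ac_simps)
  qed
  have "{..N} - B = insert i ({..N} - A)" using AB i by auto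
  hence "koszul c B = (\<Sum>j\<in>insert i ({..N} - A). (kz B j * X j) *s c (insert j B))"
    by (simp only: koszul_def if_P[OF AB(3)])
  also have "\<dots> = (kz B i * X i) *s c A + (\<Sum>j\<in>{..N} - A. (kz B j * X j) *s c (insert j B))"
    by (subst sum.insert) (use True in \<open>simp_all add: AB(1)[symmetric]\<close>)
  finally have "koszul c B = \<dots>" .
  moreover have "contract i (koszul c) A = (kz B i * X i powi (-1)) *s koszul c B"
    using True by (simp add: contract_def B_def)
  moreover have "(kz B i * X i powi (-1)) *s (kz B i * X i) *s c A = (kz B i * kz B i * (X i * X i powi (-1))) *s c A"
    by (simp only: scale_scale ac_simps)
  moreover have "\<dots> = c A" using var_neq_0[of i] by (simp add: power_int_minus)
  ultimately have "contract i (koszul c) A = c A + (\<Sum>j\<in>{..N} - A. (kz B i * X i powi (-1)) *s (kz B j * X j) *s c (insert j B))"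
    by (simp only: scale_right_distrib scale_sum_right)
  moreover have "koszul (contract i c) A = - (\<Sum>j\<in>{..N} - A. (kz B i * X i powi (-1)) *s (kz B j * X j) *s c (insert j B))"
    using A step by (simp add: koszul_def sum_negf)
  ultimately show ?thesis by simp
qed

lemma sec_kz: "U \<subseteq> proj_space N ==> x \<in> rat_on N U a ==> v \<in> sec U m ==> m' = m + a ==> (kz A j * x) *s v \<in> sec U m'"
  using kz_cases[of A j, where 'k = "'k ratfun"] sec_scale[of U x a v m m'] sec_uminus[of U "x *s v" m'] by auto

lemma X_rat_on: "j \<le> N ==> X j \<in> rat_on N U 1"
  using loc_form[OF forms_var[of j N]] by (auto simp: rat_on_def)

text \<open>A cocycle of degree zero takes the same value on all members of the covering. This value
  satisfies the stalk conditions at every point and so lies in \<open>M m\<close>, the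
  augmentation.\<close>

lemma acyclic_1:
  assumes J: "covering J"
  shows "acyclic J 1 m"
  unfolding acyclic_def
proof (intro ballI impI)
  fix c assume c: "c \<in> cochains J 1 m" and closed: "\<forall>s\<in>lists_of J (Suc 1). cobd c s = 0"
  have eq: "c [g] = c [h]" if "g \<in> J" "h \<in> J" for g h
  proof -
    have "[g, h] \<in> lists_of J (Suc 1)" using that by (simp add: lists_of_def)
    from closed[rule_format, OF this] show ?thesis by simp
  qed
  obtain g where g: "g \<in> J" using covering_nonempty[OF J] by blast
  have "c [g] \<in> M m"
  proof (rule secI)
    fix p :: "'k point" assume p: "p \<in> proj_space N"
    then obtain h where h: "h \<in> J" "fval p h ~= 0" using J by (auto simp: covering_def)
    hence "c [h] \<in> sec (Dset N {h}) m"
      using c[unfolded cochains_def mem_Collect_eq, rule_format, of "[h]"] by (simp add: lists_of_def)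
    thus "c [g] \<in> gr m p" using h p eq[OF g h(1)] by (auto simp: Dset_def dest: secD)
  qed
  moreover have "c s = c [g]" if s: "s \<in> lists_of J 1" for s
  proof -
    obtain h where "s = [h]" "h \<in> J" using s by (auto simp: lists_of_def length_Suc_conv)
    thus ?thesis using eq g by blast
  qed
  ultimately show "\<exists>b\<in>cochains J (1 - 1) m. \<forall>s\<in>lists_of J 1. c s = cobd b s"
    by (intro bexI[of _ "\<lambda>_. c [g]"]) (auto simp: cochains_def Dset_def lists_of_def length_Suc_conv)
qed

text \<open>The index \<open>b\<close> stands for subsets of cardinality \<open>N + 1 - b\<close>.
  So the relation sits at \<open>b = N\<close>, on singletons, and the wanted \<open>w\<close> at
  \<open>b = N - 1\<close>, on pairs. The \<open>\<delta>\<close>-direction is exact over nonempty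
  lists because these contain an invertible variable; in the Cech direction length \<open>1\<close>
  is covered by \<open>acyclic_1\<close> and the lengths \<open>2, ..., N\<close> by
  hypothesis.\<close>

theorem koszul_exact:
  assumes ac: "\<And>a m. 2 \<le> a ==> a \<le> N ==> acyclic (std_cover N) a m" and N: "N \<ge> 1"
    and v: "\<And>i. i \<le> N ==> v i \<in> M n" and rel: "(\<Sum>i\<le>N. X i *s v i) = 0"
  shows "\<exists>w. (\<forall>i\<le>N. \<forall>j\<le>N. w i j \<in> M (n - 1) \<and> w j i = - w i j) \<and> (\<forall>i. w i i = 0) \<and> (\<forall>i\<le>N. v i = (\<Sum>j\<le>N. X j *s w i j))"
proof -
  have ac': "acyclic (std_cover N) a m" if "1 \<le> a" "a \<le> N" for a m
    using acyclic_1[OF covering_std, of m] ac[of a m] that by (cases "a = 1") auto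
  define T where "T b = {A. A \<subseteq> {..N} \<and> card A + b = Suc N}" for b
  \<comment> \<open>The twist compensates the degree of the variables in the Koszul differential; it
    is \<open>n\<close> on singletons and \<open>n - 1\<close> on pairs.\<close>
  define \<Gamma> where "\<Gamma> s A = sec (Dset N (set s)) (n + 1 - int (card A))" for s and A :: "nat set"
  interpret L: list_columns "std_cover N" T \<Gamma>
  proof
    fix s :: "'k mvpoly list" and A
    show "0 \<in> \<Gamma> s A" by (simp add: \<Gamma>_def sec_0 Dset_proj)
    fix x assume x: "x \<in> \<Gamma> s A"
    show "x - y \<in> \<Gamma> s A" if "y \<in> \<Gamma> s A" for y using x that by (simp add: \<Gamma>_def sec_diff Dset_proj)
    show "x \<in> \<Gamma> s' A" if "set s \<subseteq> set s'" for s'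
      using x that unfolding \<Gamma>_def by (elim sec_mono[rotated]) (intro Dset_mono)
  qed
  define \<delta> where "\<delta> c s = koszul (c s)" for c :: "'k mvpoly list => nat set => 'v" and s
  have \<delta>_diff: "\<delta> (x - y) = \<delta> x - \<delta> y" for x y
    by (intro ext) (simp add: \<delta>_def koszul_def scale_right_diff_distrib sum_subtractf)
  have card_ins: "card (insert j A) = Suc (card A)" if "A \<subseteq> {..N}" "j \<in> {..N} - A" for A j
    using that finite_subset[OF that(1)] by simp
  have \<delta>_in: "\<delta> x \<in> L.K a (Suc b)" if x: "x \<in> L.K a b" for x a b
  proof (rule L.K_I)
    fix s :: "'k mvpoly list" and A assume s: "s \<in> lists_of (std_cover N) a" and A: "A \<in> T (Suc b)"
    have "(kz A j * X j) *s x s (insert j A) \<in> \<Gamma> s A" if j: "j \<in> {..N} - A" for j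
    proof -
      have "insert j A \<in> T b" using A j card_ins[of A j] by (auto simp: T_def)
      from L.K_D[OF x s this] show ?thesis
        unfolding \<Gamma>_def using j A card_ins[of A j] by (intro sec_kz[OF Dset_proj X_rat_on[of j]]) (auto simp: T_def)
    qed
    moreover have "A \<subseteq> {..N}" using A by (simp add: T_def)
    ultimately show "\<delta> x s A \<in> \<Gamma> s A" unfolding \<Gamma>_def \<delta>_def koszul_def by (simp only: if_True) (intro sec_sum Dset_proj)
  next
    fix s :: "'k mvpoly list" and A assume *: "s \<notin> lists_of (std_cover N) a \<or> A \<notin> T (Suc b)"
    have "x s (insert j A) = 0" if "A \<subseteq> {..N}" "j \<in> {..N} - A" for j
      using * that card_ins[OF that] by (intro L.K_D0[OF x]) (auto simp: T_def)
    thus "\<delta> x s A = 0" by (simp add: \<delta>_def koszul_def)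
  qed
  interpret double_complex L.K L.dh \<delta>
  proof
    fix x a b
    show "L.dh (\<delta> x) = \<delta> (L.dh x)"
    proof (intro ext)
      fix s :: "'k mvpoly list" and A
      show "L.dh (\<delta> x) s A = \<delta> (L.dh x) s A"
      proof (cases "set s \<subseteq> std_cover N")
        case True
        have "cobd (\<lambda>s. (kz A j * X j) *s x s (insert j A)) s = (kz A j * X j) *s cobd (\<lambda>s. x s (insert j A)) s" for j
          by (rule cobd_hom) (simp add: scale_right_diff_distrib)
        thus ?thesis using True by (simp add: L.dh_def \<delta>_def koszul_def cobd_sum cobd_zero)
      qed (simp add: L.dh_def \<delta>_def koszul_def)
    qed
    show "\<delta> (\<delta> x) = 0" by (intro ext) (simp add: \<delta>_def koszul_koszul)
  qed (use L.K_diff L.dh_in L.dh_diff \<delta>_diff L.dh_dh \<delta>_in in auto)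
  define d where "d s A = (if s = [] \<and> A \<in> T N then v (the_elem A) else 0)" for s :: "'k mvpoly list" and A
  have TN: "A \<in> T N \<longleftrightarrow> (\<exists>i\<le>N. A = {i})" for A by (auto simp: T_def card_1_singleton_iff)
  have dK: "d \<in> L.K 0 N"
    by (rule L.K_I) (use v in \<open>auto simp: d_def TN \<Gamma>_def Dset_def\<close>)
  have d0: "\<delta> d = 0"
  proof -
    have "\<delta> d [] {} = (\<Sum>i\<le>N. X i *s v i)"
      unfolding \<delta>_def koszul_def by (auto simp: d_def TN kz_def intro!: sum.cong)
    moreover have "T (Suc N) = {{}}" by (auto simp: T_def card_eq_0_iff dest: finite_subset)
    ultimately show ?thesis using rel L.K_D0[OF \<delta>_in[OF dK]] by (intro ext) (metis lists_of_0 singletonD zero_fun_apply)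
  qed
  have "\<exists>t\<in>L.K 0 (N - 1). d = \<delta> t"
  proof (rule row_col_transfer[OF dK d0 N])
    fix a b x assume a: "a \<ge> 1" and x: "x \<in> L.K a (Suc b)" "\<delta> x = 0"
    \<comment> \<open>Over the open set of \<open>s\<close> this variable is invertible. The choice
      of the index may vary freely with the list, as only the equation \<open>x = \<delta> z\<close>
      is asked for and no compatibility with \<open>L.dh\<close>.\<close>
    have "\<exists>i\<le>N. var i \<in> set s" if "s \<in> lists_of (std_cover N) a" for s :: "'k mvpoly list"
      using that a by (cases s) (auto simp: lists_of_def std_cover_def)
    then obtain \<iota> where \<iota>: "\<And>s :: 'k mvpoly list. s \<in> lists_of (std_cover N) a ==> \<iota> s \<le> N \<and> var (\<iota> s) \<in> set s" by metis
    define z where "z s A = (if s \<in> lists_of (std_cover N) a \<and> A \<in> T b then contract (\<iota> s) (x s) A else 0)" for s :: "'k mvpoly list" and A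
    have "z \<in> L.K a b"
    proof (rule L.K_I)
      fix s :: "'k mvpoly list" and A assume s: "s \<in> lists_of (std_cover N) a" and A: "A \<in> T b"
      let ?i = "\<iota> s"
      have "contract ?i (x s) A \<in> \<Gamma> s A"
      proof (cases "?i \<in> A")
        case True
        have "finite A" using A finite_subset[of A "{..N}"] by (simp add: T_def)
        hence card: "Suc (card (A - {?i})) = card A" using True by (rule card_Suc_Diff1)
        hence "A - {?i} \<in> T (Suc b)" using A by (auto simp: T_def)
        from L.K_D[OF x(1) s this] have "x s (A - {?i}) \<in> sec (Dset N (set s)) (n + 1 - int (card (A - {?i})))"
          by (simp add: \<Gamma>_def)
        moreover have "X ?i powi (-1) \<in> rat_on N (Dset N (set s)) (-1)"
          using \<iota>[OF s] loc_powi[of ?i N _ "- 1"] by (auto simp: rat_on_def Dset_def simp del: power_int_minus1_right)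
        ultimately show ?thesis unfolding contract_def \<Gamma>_def using True card
          by (auto intro!: sec_kz[OF Dset_proj])
      qed (simp add: contract_def \<Gamma>_def sec_0 Dset_proj)
      thus "z s A \<in> \<Gamma> s A" using s A by (simp add: z_def)
    qed (auto simp: z_def)
    moreover have "x = \<delta> z"
    proof (rule L.K_eqI[OF x(1) \<delta>_in[OF \<open>z \<in> L.K a b\<close>]])
      fix s :: "'k mvpoly list" and A assume s: "s \<in> lists_of (std_cover N) a" and A: "A \<in> T (Suc b)"
      have "contract (\<iota> s) (\<delta> x s) A = 0" using x(2) by (simp add: contract_def)
      hence "x s A = koszul (contract (\<iota> s) (x s)) A"
        using koszul_contract[of "\<iota> s" A "x s"] \<iota>[OF s] A by (simp add: \<delta>_def T_def)
      also have "\<dots> = koszul (z s) A"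
        unfolding koszul_def using A s card_ins[of A]
        by (intro if_cong refl sum.cong) (auto simp: z_def T_def)
      finally show "x s A = \<delta> z s A" by (simp add: \<delta>_def)
    qed
    ultimately show "\<exists>z\<in>L.K a b. x = \<delta> z" by blast
  next
    fix x assume x: "x \<in> L.K (Suc N) 0" "\<delta> x = 0"
    \<comment> \<open>At \<open>b = 0\<close> only the full index set is left, and the homotopy
      formula shows that \<open>\<delta>\<close> is injective there; any index \<open>i\<close> may
      be used.\<close>
    have T0: "T 0 = {{..N}}" using card_subset_eq[of "{..N}"] by (auto simp: T_def)
    have "x s {..N} = 0" if s: "s \<in> lists_of (std_cover N) (Suc N)" for s :: "'k mvpoly list"
    proof -
      obtain i where i: "i \<le> N" using s by blast
      have "koszul (contract i (x s)) {..N} = 0" by (simp add: koszul_def)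
      moreover have "contract i (\<delta> x s) {..N} = 0" using x(2) by (simp add: contract_def)
      ultimately show ?thesis using koszul_contract[OF i, of "{..N}" "x s"] by (simp add: \<delta>_def)
    qed
    thus "x = 0" using L.K_D0[OF x(1)] T0 by (intro ext) (metis singletonD zero_fun_apply)
  next
    fix a x assume a: "a \<ge> 1" "a \<le> N" and x: "x \<in> L.K a (N - a)" "L.dh x = 0"
    obtain a' where a': "a = Suc a'" using a(1) by (cases a) auto
    have "\<exists>z\<in>L.K a' (N - a). x = L.dh z"
    proof (rule L.column_exact)
      show "x \<in> L.K (Suc a') (N - a)" "L.dh x = 0" using x a' by auto
      fix A and c :: "'k mvpoly list => 'v" assume A: "A \<in> T (N - a)"
        and c: "\<And>s. s \<in> lists_of (std_cover N) (Suc a') ==> c s \<in> \<Gamma> s A"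
          "\<And>s. s \<in> lists_of (std_cover N) (Suc (Suc a')) ==> cobd c s = 0"
      have "c \<in> cochains (std_cover N) a (n + 1 - int (card A))"
        using c(1) by (simp add: cochains_def \<Gamma>_def a')
      from ac'[OF a, unfolded acyclic_def, rule_format, OF this] c(2)
      show "\<exists>d. (\<forall>s\<in>lists_of (std_cover N) a'. d s \<in> \<Gamma> s A) \<and> (\<forall>s\<in>lists_of (std_cover N) (Suc a'). c s = cobd d s)"
        by (auto simp: a' cochains_def \<Gamma>_def)
    qed
    thus "\<exists>z\<in>L.K (a - 1) (N - a). x = L.dh z" by (simp add: a')
  next
    fix x assume "x \<in> L.K 0 N" "L.dh x = 0"
    thus "x = 0" by (rule L.column_inj[OF covering_nonempty[OF covering_std]])
  qed
  then obtain t where t: "t \<in> L.K 0 (N - 1)" "d = \<delta> t" by blast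
  \<comment> \<open>With the Koszul sign the coefficients on pairs become a skew matrix.\<close>
  define w where "w i j = (if i = j then 0 else (kz {i} j :: 'k ratfun) *s t [] {i, j})" for i j
  have tM: "t [] {i, j} \<in> M (n - 1)" if "i \<le> N" "j \<le> N" "i ~= j" for i j
    using L.K_D[OF t(1), of "[]" "{i, j}"] that N by (simp add: T_def \<Gamma>_def Dset_def)
  have kz2: "kz {i} j = (if i < j then -1 else (1 :: 'k ratfun))" for i j :: nat
    using kz_insert[of "{}" i j, where 'k = "'k ratfun"] by (simp add: kz_def)
  have "w i j \<in> M (n - 1)" if "i \<le> N" "j \<le> N" for i j
    using tM[OF that] by (auto simp: w_def kz2 sec_0 sec_uminus)
  moreover have "w j i = - w i j" for i j
    by (cases i j rule: linorder_cases) (auto simp: w_def kz2 insert_commute)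
  moreover have "v i = (\<Sum>j\<le>N. X j *s w i j)" if i: "i \<le> N" for i
  proof -
    have "v i = d [] {i}" using i by (simp add: d_def TN)
    also have "\<dots> = koszul (t []) {i}" by (simp add: t(2) \<delta>_def)
    also have "\<dots> = (\<Sum>j\<in>{..N} - {i}. X j *s w i j)"
      using i unfolding koszul_def by (auto simp: w_def ac_simps insert_commute intro!: sum.cong)
    also have "\<dots> = (\<Sum>j\<le>N. X j *s w i j)" by (rule sum.mono_neutral_left) (auto simp: w_def)
    finally show ?thesis .
  qed
  moreover have "w i i = 0" for i by (simp add: w_def)
  ultimately show ?thesis by (intro exI[of _ w]) blast
qed

end

section \<open>Freeness of the module of global sections\<close>

text \<open>A basis \<open>C\<close> of \<open>W\<close> is extended to a basis \<open>D\<close> of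
  \<open>V\<close>; the difference \<open>D - C\<close> is a basis of \<open>V\<close> modulo
  \<open>W\<close>.\<close>

lemma (in vector_space) complement_basis:
  assumes W: "subspace W" and V: "subspace V" "W \<subseteq> V"
  shows "\<exists>B\<subseteq>V. (\<forall>v\<in>V. \<exists>w\<in>W. \<exists>F a. finite F \<and> F \<subseteq> B \<and> v = w + (\<Sum>b\<in>F. a b *s b)) \<and>
    (\<forall>F a. finite F \<and> F \<subseteq> B \<and> (\<Sum>b\<in>F. a b *s b) \<in> W --> (\<forall>b\<in>F. a b = 0))"
proof -
  obtain C where C: "C \<subseteq> W" "independent C" "W \<subseteq> span C" by (rule maximal_independent_subset)
  obtain D where D: "C \<subseteq> D" "D \<subseteq> V" "independent D" "V \<subseteq> span D"
    using maximal_independent_subset_extend[of C V] C V(2) by blast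
  have gen: "\<exists>w\<in>W. \<exists>F a. finite F \<and> F \<subseteq> D - C \<and> v = w + (\<Sum>b\<in>F. a b *s b)" if "v \<in> V" for v
  proof -
    have "D = C \<union> (D - C)" using D(1) by blast
    hence "v \<in> span (C \<union> (D - C))" using D(4) that by auto
    then obtain x y where xy: "v = x + y" "x \<in> span C" "y \<in> span (D - C)" unfolding span_Un by blast
    have "x \<in> W" using xy(2) span_minimal[OF C(1) W] by blast
    moreover obtain F a where "finite F" "F \<subseteq> D - C" "y = (\<Sum>b\<in>F. a b *s b)"
      using xy(3) unfolding span_explicit by blast
    ultimately show ?thesis using xy(1) by blast
  qed
  have ind: "a b = 0" if F: "finite F" "F \<subseteq> D - C" "(\<Sum>b\<in>F. a b *s b) \<in> W" and b: "b \<in> F" for F a b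
  proof -
    obtain G c where G: "finite G" "G \<subseteq> C" "(\<Sum>b\<in>F. a b *s b) = (\<Sum>b\<in>G. c b *s b)"
      using F(3) C(3) unfolding span_explicit by blast
    define u where "u x = (if x \<in> F then a x else - c x)" for x
    have disj: "F \<inter> G = {}" using F(2) G(2) by blast
    have "(\<Sum>b\<in>F \<union> G. u b *s b) = (\<Sum>b\<in>F. u b *s b) + (\<Sum>b\<in>G. u b *s b)"
      by (rule sum.union_disjoint) (use F G disj in auto)
    also have "(\<Sum>b\<in>F. u b *s b) = (\<Sum>b\<in>F. a b *s b)" by (rule sum.cong) (auto simp: u_def)
    also have "(\<Sum>b\<in>G. u b *s b) = - (\<Sum>b\<in>G. c b *s b)"
      unfolding sum_negf[symmetric] by (rule sum.cong) (use disj in \<open>auto simp: u_def\<close>)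
    finally have "(\<Sum>b\<in>F \<union> G. u b *s b) = 0" by (simp add: G(3))
    hence "u b = 0" using F G D(1) b by (intro independentD[OF D(3), of "F \<union> G"]) auto
    thus ?thesis using b by (simp add: u_def)
  qed
  show ?thesis
  proof (intro exI[of _ "D - C"] conjI allI ballI impI)
    show "D - C \<subseteq> V" using D(2) by blast
    show "a b = 0" if "finite F \<and> F \<subseteq> D - C \<and> (\<Sum>b\<in>F. a b *s b) \<in> W" "b \<in> F" for F a b
      using ind[of F a b] that by blast
  qed (rule gen)
qed

section \<open>Forms of small degree, and splitting along the variables\<close>

lemma hform_neg: "x \<in> hform N e ==> e < 0 ==> x = 0"
  by (auto simp: hform_def)

lemma hform_uminus: "x \<in> hform N e ==> - x \<in> hform N e"
proof (elim hformE)
  fix a d assume "x = to_fract a" "a \<in> forms N d" "int d = e"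
  thus ?thesis using hform_form[OF forms_uminus[of a N d]] by auto
qed auto

lemma hform_diff: "x \<in> hform N e ==> y \<in> hform N e ==> x - y \<in> hform N e"
  using hform_add[of x N e "- y"] hform_uminus[of y N e] by simp

lemma hform_X: "i \<le> N ==> X i \<in> hform N 1"
  using hform_form[OF forms_var[of i N]] by simp

lemma hform_const: "to_fract (const c) \<in> hform N 0"
  using hform_form[OF forms_const[of c N]] by simp

lemma forms_degree_0:
  assumes "f \<in> forms N 0"
  obtains c where "f = const c"
proof
  show "f = const (mcoeff f 0)"
  proof (rule poly_mapping_eqI)
    fix m
    have "m = 0" if "m \<in> mkeys f"
    proof -
      have "mdeg m = 0" using assms that by (simp add: forms_alt)
      hence "mcoeff m i = 0" for i by (cases "i \<in> mkeys m") (auto simp: mdeg_def in_keys_iff)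
      thus "m = 0" by (intro poly_mapping_eqI) simp
    qed
    thus "mcoeff f m = mcoeff (const (mcoeff f 0)) m"
      by (cases "m = 0") (auto simp: const_def lookup_single when_def in_keys_iff)
  qed
qed

lemma hform_degree_0:
  assumes "x \<in> hform N 0"
  obtains c where "x = to_fract (const c)"
proof -
  obtain f where "x = to_fract f" "f \<in> forms N 0" using assms by (auto simp: hform_def)
  thus thesis using that forms_degree_0 by metis
qed

text \<open>Each monomial is assigned to the first variable which occurs in it.\<close>

lemma forms_split:
  fixes f :: "'k::field mvpoly"
  assumes f: "f \<in> forms N (Suc d)"
  obtains g where "\<And>i. g i \<in> forms N d" "f = (\<Sum>i\<le>N. var i * g i)"
proof -
  define \<phi> where "\<phi> m = (LEAST i. mcoeff m i > 0)" for m :: "nat \<Rightarrow>\<^sub>0 nat"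
  have \<phi>: "mcoeff m (\<phi> m) > 0" "\<phi> m \<le> N" if m: "m \<in> mkeys f" for m
  proof -
    have "mdeg m = Suc d" using f m by (simp add: forms_alt)
    then obtain i where "mcoeff m i > 0" unfolding mdeg_def by (metis gr0I sum.neutral Zero_not_Suc)
    thus *: "mcoeff m (\<phi> m) > 0" unfolding \<phi>_def by (rule LeastI)
    hence "\<phi> m \<in> mkeys m" by (simp add: in_keys_iff)
    thus "\<phi> m \<le> N" using f m by (auto simp: forms_def)
  qed
  have "\<exists>g\<in>forms N d. pfilter (\<lambda>m. \<phi> m = i) f = var i * g" if i: "i \<le> N" for i
  proof -
    have "pfilter (\<lambda>m. \<phi> m = i) f \<in> forms N (Suc d)" using f by (rule pfilter_forms)
    thus ?thesis
    proof (rule monomial_divides[of _ _ _ "{i}" 1])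
      show "{i} \<subseteq> {..N}" using i by simp
      show "1 \<le> mcoeff e j" if "e \<in> mkeys (pfilter (\<lambda>m. \<phi> m = i) f)" "j \<in> {i}" for e j
        using that \<phi>(1)[of e] by (auto simp: mkeys_pfilter)
    qed auto
  qed
  then obtain g where g: "\<And>i. i \<le> N ==> g i \<in> forms N d \<and> pfilter (\<lambda>m. \<phi> m = i) f = var i * g i" by metis
  have "f = (\<Sum>i\<le>N. pfilter (\<lambda>m. \<phi> m = i) f)"
  proof (rule poly_mapping_eqI)
    fix m
    have "mcoeff f m = (\<Sum>i\<le>N. if \<phi> m = i then mcoeff f m else 0)"
      using \<phi>(2)[of m] by (auto simp: in_keys_iff)
    thus "mcoeff f m = mcoeff (\<Sum>i\<le>N. pfilter (\<lambda>m. \<phi> m = i) f) m"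
      by (simp add: lookup_sum mcoeff_pfilter)
  qed
  also have "\<dots> = (\<Sum>i\<le>N. var i * (if i \<le> N then g i else 0))" using g by (intro sum.cong) auto
  finally show thesis using g by (intro that[of "\<lambda>i. if i \<le> N then g i else 0"]) auto
qed

lemma hform_split:
  assumes "x \<in> hform N n" "n \<ge> 1"
  shows "\<exists>g. (\<forall>i. g i \<in> hform N (n - 1)) \<and> x = (\<Sum>i\<le>N. X i * g i)"
  using assms(1)
proof (cases rule: hformE)
  case 1
  thus ?thesis by (intro exI[of _ "\<lambda>_. 0"]) simp
next
  case (2 f d)
  then obtain d' where d: "d = Suc d'" "n - 1 = int d'" using assms(2) by (cases d) auto
  obtain g where g: "\<And>i. g i \<in> forms N d'" "f = (\<Sum>i\<le>N. var i * g i)" using 2(2) d(1) forms_split by metis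
  hence "x = (\<Sum>i\<le>N. X i * to_fract (g i))" using 2(1) by simp
  thus ?thesis using g(1) d(2) hform_form by (intro exI[of _ "\<lambda>i. to_fract (g i)"]) auto
qed

lemma loc_sum: "p \<in> proj_space N ==> (\<And>i. i \<in> A ==> f i \<in> loc N p m) ==> sum f A \<in> loc N p m"
  by (induction A rule: infinite_finite_induct) (auto intro: loc_0 loc_add)

context stalk_system
begin

lemma sec_hform: "U \<subseteq> proj_space N ==> x \<in> hform N a ==> v \<in> sec U m ==> m' = m + a ==> x *s v \<in> sec U m'"
  using sec_scale hform_rat by blast

text \<open>\<open>W n\<close> is the part of \<open>M n\<close> that comes from degree
  \<open>n - 1\<close>, and \<open>B n\<close> is a basis of a complement. For independence, the
  constant coefficients of a relation vanish modulo \<open>W n\<close>. The others are written as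
  \<open>\<Sum>i\<le>N. X i * g b i\<close>; by \<open>koszul_exact\<close> the \<open>v i\<close>
  belonging to \<open>g\<close> come from a skew matrix of elements of lower degree. Expanding these
  and applying the induction hypothesis shows that \<open>g\<close> itself comes from a skew matrix,
  so the coefficients vanish.\<close>

theorem free_basis:
  assumes N: "N \<ge> 1" and ac: "\<And>a m. 2 \<le> a ==> a \<le> N ==> acyclic (std_cover N) a m"
    and low: "\<And>m. m < m0 ==> M m = {0}"
  obtains r :: nat and d e where "\<And>i. i < r ==> e i \<in> M (d i)"
    "\<And>n f. (\<And>i. i < r ==> f i \<in> hform N (n - d i)) ==> (\<Sum>i<r. f i *s e i) = 0 ==> \<forall>i<r. f i = 0"
    "\<And>n v. v \<in> M n ==> \<exists>f. (\<forall>i<r. f i \<in> hform N (n - d i)) \<and> v = (\<Sum>i<r. f i *s e i)"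
proof -
  note split_paired_All [simp del] split_paired_Ex [simp del]
  \<comment> \<open>Restriction of scalars to the base field, over which \<open>M n\<close> is a
    vector space.\<close>
  define ks where "ks a v = to_fract (const a) *s v" for a :: 'k and v
  interpret k: vector_space ks
    by unfold_locales (simp_all add: ks_def scale_right_distrib scale_left_distrib k_poly.\<iota>_add k_poly.\<iota>_mult k_poly.\<iota>_1)
  define W where "W n = {\<Sum>i\<le>N. X i *s v i | v. \<forall>i\<le>N. v i \<in> M (n - 1)}" for n
  have WI: "(\<Sum>i\<le>N. X i *s v i) \<in> W n" if "\<And>i. i \<le> N ==> v i \<in> M (n - 1)" for v n
    using that by (auto simp: W_def)
  have kM: "ks a v \<in> M n" if "v \<in> M n" for a v n
    unfolding ks_def by (rule sec_hform[OF order_refl hform_const that]) simp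
  have "k.subspace (M n)" for n by (rule k.subspaceI) (simp_all add: sec_0 sec_add kM)
  moreover have "k.subspace (W n)" for n
  proof (rule k.subspaceI)
    show "0 \<in> W n" using WI[of "\<lambda>_. 0"] by (simp add: sec_0)
    fix x y assume "x \<in> W n" "y \<in> W n"
    then obtain v w where vw: "x = (\<Sum>i\<le>N. X i *s v i)" "y = (\<Sum>i\<le>N. X i *s w i)"
      "\<And>i. i \<le> N ==> v i \<in> M (n - 1)" "\<And>i. i \<le> N ==> w i \<in> M (n - 1)" by (auto simp: W_def)
    have "(\<Sum>i\<le>N. X i *s (v i + w i)) \<in> W n" using vw by (intro WI sec_add) auto
    thus "x + y \<in> W n" using vw by (simp add: scale_right_distrib sum.distrib)
    have "(\<Sum>i\<le>N. X i *s ks a (v i)) \<in> W n" for a using vw by (intro WI kM) auto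
    thus "ks a x \<in> W n" for a using vw by (simp add: ks_def scale_sum_right mult.commute)
  qed
  moreover have "W n \<subseteq> M n" for n
    by (auto simp: W_def intro!: sec_sum sec_hform[OF order_refl hform_X])
  ultimately have basis: "\<exists>B\<subseteq>M n. (\<forall>v\<in>M n. \<exists>w\<in>W n. \<exists>F a. finite F \<and> F \<subseteq> B \<and> v = w + (\<Sum>b\<in>F. ks (a b) b)) \<and>
    (\<forall>F a. finite F \<and> F \<subseteq> B \<and> (\<Sum>b\<in>F. ks (a b) b) \<in> W n --> (\<forall>b\<in>F. a b = 0))" for n
    by (intro k.complement_basis)
  define Q where "Q n B \<longleftrightarrow> (\<forall>v\<in>M n. \<exists>w\<in>W n. \<exists>F a. finite F \<and> F \<subseteq> B \<and> v = w + (\<Sum>b\<in>F. ks (a b) b)) \<and>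
    (\<forall>F a. finite F \<and> F \<subseteq> B \<and> (\<Sum>b\<in>F. ks (a b) b) \<in> W n --> (\<forall>b\<in>F. a b = 0))" for n B
  have "\<forall>n. \<exists>B. B \<subseteq> M n \<and> Q n B" using basis unfolding Q_def by blast
  from choice[OF this] obtain C where C: "\<And>n. C n \<subseteq> M n \<and> Q n (C n)" by blast
  obtain B where B: "\<And>n. B n \<subseteq> M n"
    and Bgen: "\<And>n. \<forall>v\<in>M n. \<exists>w\<in>W n. \<exists>F a. finite F \<and> F \<subseteq> B n \<and> v = w + (\<Sum>b\<in>F. ks (a b) b)"
    and Bind: "\<And>n. \<forall>F a. finite F \<and> F \<subseteq> B n \<and> (\<Sum>b\<in>F. ks (a b) b) \<in> W n --> (\<forall>b\<in>F. a b = 0)"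
    using C unfolding Q_def by (intro that[of C]) simp_all
  \<comment> \<open>Generators carry their degree, so that \<open>comb\<close> can prescribe the
    degree \<open>n - fst b\<close> of each coefficient.\<close>
  define E where "E = {(n, b). b \<in> B n}"
  define comb where "comb n F f \<longleftrightarrow> finite F \<and> F \<subseteq> E \<and> (\<forall>b. f b \<in> hform N (n - fst b)) \<and> (\<forall>b. b \<notin> F --> f b = 0)"
    for n F and f :: "int \<times> 'v => 'k ratfun"
  define lc where "lc F f = (\<Sum>b\<in>F. f b *s snd b)" for F and f :: "int \<times> 'v => 'k ratfun"
  have E: "snd b \<in> M (fst b)" if "b \<in> E" for b using that by (cases b) (auto simp: E_def intro: subsetD[OF B])
  have E0: "fst b \<ge> m0" if "b \<in> E" for b
  proof (rule ccontr)
    assume "\<not> fst b \<ge> m0"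
    hence "snd b = 0" using low[of "fst b"] E[OF that] by simp
    moreover have "0 \<in> W (fst b)" using WI[of "\<lambda>_. 0"] by (simp add: sec_0)
    ultimately show False using Bind[of "fst b", rule_format, of "{snd b}" "\<lambda>_. 1" "snd b"] that
      by (auto simp: E_def ks_def)
  qed
  have combD: "finite F" "F \<subseteq> E" "f b \<in> hform N (n - fst b)" "b \<notin> F ==> f b = 0" if "comb n F f" for n F f b
    using that unfolding comb_def by blast+
  have comb_mono: "comb n F' f" "lc F' f = lc F f" if "comb n F f" "F \<subseteq> F'" "finite F'" "F' \<subseteq> E" for n F F' f
    using that unfolding comb_def lc_def by (auto intro!: sum.mono_neutral_right)
  have lc_in: "lc F f \<in> M n" if "comb n F f" for n F f
    unfolding lc_def using that E by (auto simp: comb_def intro!: sec_sum sec_hform[OF order_refl])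
  have pre: "\<forall>v n. v \<in> M n --> n < m0 + int k --> (\<exists>F f. comb n F f \<and> v = lc F f)" for k
  proof (induction k)
    case 0
    show ?case
    proof (intro allI impI)
      fix v n assume "v \<in> M n" "n < m0 + int 0"
      hence "v = 0" using low[of n] by simp
      thus "\<exists>F f. comb n F f \<and> v = lc F f"
        by (intro exI[of _ "{}"] exI[of _ "\<lambda>_. 0"]) (simp add: comb_def lc_def)
    qed
  next
    case (Suc k)
    show ?case
    proof (intro allI impI)
      fix v n assume v: "v \<in> M n" "n < m0 + int (Suc k)"
      obtain w F0 a where F0: "w \<in> W n" "finite F0" "F0 \<subseteq> B n" "v = w + (\<Sum>b\<in>F0. ks (a b) b)"
        using bspec[OF Bgen v(1)] by blast
      obtain u where u: "w = (\<Sum>i\<le>N. X i *s u i)" "\<And>i. i \<le> N ==> u i \<in> M (n - 1)"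
        using F0(1) by (auto simp: W_def)
      have "\<exists>F f. comb (n - 1) F f \<and> u i = lc F f" if "i \<le> N" for i
        using Suc u(2)[OF that] v(2) by auto
      then obtain F f where F: "\<And>i. i \<le> N ==> comb (n - 1) (F i) (f i) \<and> u i = lc (F i) (f i)" by metis
      define G where "G = (\<Union>i\<le>N. F i) \<union> Pair n ` F0"
      define h where "h b = (\<Sum>i\<le>N. X i * f i b) + (if b \<in> Pair n ` F0 then to_fract (const (a (snd b))) else 0)" for b
      have "F i \<subseteq> E" "finite (F i)" if "i \<le> N" for i using combD(1,2) F[OF that] by blast+
      hence G: "finite G" "G \<subseteq> E" using F0 by (auto simp: G_def E_def)
      have FG: "comb (n - 1) G (f i)" "u i = lc G (f i)" if "i \<le> N" for i
      proof -
        have "F i \<subseteq> G" using that by (auto simp: G_def)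
        thus "comb (n - 1) G (f i)" "u i = lc G (f i)"
          using comb_mono[of "n - 1" "F i" "f i" G] F[OF that] G by auto
      qed
      have "X i * f i b \<in> hform N (n - fst b)" if "i \<le> N" for i b
        using hform_mult[OF hform_X[OF that], of "f i b" "n - 1 - fst b"] combD(3)[OF FG(1)[OF that]]
        by simp
      moreover have "(if b \<in> Pair n ` F0 then to_fract (const (a (snd b))) else 0) \<in> hform N (n - fst b)" for b
        using hform_const by auto
      ultimately have "h b \<in> hform N (n - fst b)" for b unfolding h_def by (intro hform_add hform_sum) auto
      moreover have "h b = 0" if "b \<notin> G" for b
      proof -
        have "f i b = 0" if "i \<le> N" for i using combD(4)[OF FG(1)[OF that] \<open>b \<notin> G\<close>] .
        thus ?thesis using that by (auto simp: h_def G_def)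
      qed
      ultimately have "comb n G h" using G by (simp add: comb_def)
      moreover have "v = lc G h"
      proof -
        have "lc G h = (\<Sum>b\<in>G. \<Sum>i\<le>N. X i *s f i b *s snd b) + (\<Sum>b\<in>G. (if b \<in> Pair n ` F0 then to_fract (const (a (snd b))) else 0) *s snd b)"
          by (simp add: lc_def h_def scale_left_distrib sum.distrib scale_sum_left)
        also have "(\<Sum>b\<in>G. \<Sum>i\<le>N. X i *s f i b *s snd b) = (\<Sum>i\<le>N. X i *s lc G (f i))"
          unfolding lc_def scale_sum_right by (rule sum.swap)
        also have "\<dots> = w" using FG(2) by (simp add: u(1))
        also have "(\<Sum>b\<in>G. (if b \<in> Pair n ` F0 then to_fract (const (a (snd b))) else 0) *s snd b) = (\<Sum>b\<in>Pair n ` F0. ks (a (snd b)) (snd b))"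
          by (rule sum.mono_neutral_cong_right) (use G in \<open>auto simp: G_def ks_def\<close>)
        also have "\<dots> = (\<Sum>b\<in>F0. ks (a b) b)" by (subst sum.reindex) (auto simp: inj_on_def)
        finally show ?thesis using F0(4) by simp
      qed
      ultimately show "\<exists>F f. comb n F f \<and> v = lc F f" by blast
    qed
  qed
  have gen: "\<exists>F f. comb n F f \<and> v = lc F f" if "v \<in> M n" for v n
  proof -
    have "n < m0 + int (nat (n - m0 + 1))" by linarith
    with pre[of "nat (n - m0 + 1)", THEN spec, THEN spec, THEN mp, OF that] show ?thesis by simp
  qed
  have pre: "\<forall>n F f. comb n F f --> n < m0 + int k --> lc F f = 0 --> (\<forall>b. f b = 0)" for k
  proof (induction k)
    case 0
    show ?case
    proof (intro allI impI)
      fix n F f b assume *: "comb n F f" "n < m0 + int 0"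
      show "f b = 0"
      proof (cases "b \<in> F")
        case True
        hence "n - fst b < 0" using * E0[of b] by (auto simp: comb_def)
        thus ?thesis by (rule hform_neg[OF combD(3)[OF *(1)]])
      qed (use * in \<open>unfold comb_def, blast\<close>)
    qed
  next
    case (Suc k)
    show ?case
    proof (intro allI impI)
      fix n F f b0 assume f: "comb n F f" and n: "n < m0 + int (Suc k)" and zero: "lc F f = 0"
      \<comment> \<open>Coefficients of positive degree are split along the variables, those of
        degree zero are collected in \<open>F0\<close>, and those of negative degree are zero
        anyway.\<close>
      have "\<forall>b. \<exists>g. (\<forall>i. g i \<in> hform N (n - 1 - fst b)) \<and> (b \<in> F \<and> n - fst b \<ge> 1 --> f b = (\<Sum>i\<le>N. X i * g i)) \<and>
          (\<not> (b \<in> F \<and> n - fst b \<ge> 1) --> g = (\<lambda>_. 0))"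
      proof
        fix b
        show "\<exists>g. (\<forall>i. g i \<in> hform N (n - 1 - fst b)) \<and> (b \<in> F \<and> n - fst b \<ge> 1 --> f b = (\<Sum>i\<le>N. X i * g i)) \<and>
          (\<not> (b \<in> F \<and> n - fst b \<ge> 1) --> g = (\<lambda>_. 0))"
        proof (cases "b \<in> F \<and> n - fst b \<ge> 1")
          case True
          thus ?thesis using hform_split[OF combD(3)[OF f, of b]] by (auto simp: diff_diff_add add.commute)
        qed (auto intro!: exI[of _ "\<lambda>_. 0"])
      qed
      from choice[OF this] obtain g where g0: "\<forall>b. (\<forall>i. g b i \<in> hform N (n - 1 - fst b)) \<and>
          (b \<in> F \<and> n - fst b \<ge> 1 --> f b = (\<Sum>i\<le>N. X i * g b i)) \<and> (\<not> (b \<in> F \<and> n - fst b \<ge> 1) --> g b = (\<lambda>_. 0))"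
        by (rule exE)
      have g: "g b i \<in> hform N (n - 1 - fst b)" "b \<in> F ==> n - fst b \<ge> 1 ==> f b = (\<Sum>i\<le>N. X i * g b i)"
        "\<not> (b \<in> F \<and> n - fst b \<ge> 1) ==> g b = (\<lambda>_. 0)" for b i
        using g0[THEN spec, of b] by simp_all
      have "\<exists>c. f b = to_fract (const c)" if "fst b = n" for b
      proof -
        have "f b \<in> hform N 0" using combD(3)[OF f, of b] that by simp
        thus ?thesis by (rule hform_degree_0) blast
      qed
      then obtain c where c: "\<And>b. fst b = n ==> f b = to_fract (const (c b))" by metis
      define F0 where "F0 = {b\<in>F. fst b = n}"
      have fin: "finite F" "F \<subseteq> E" using f by (auto simp: comb_def)
      have fb: "f b = (if b \<in> F0 then to_fract (const (c b)) else 0) + (\<Sum>i\<le>N. X i * g b i)" if b: "b \<in> F" for b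
      proof -
        consider "fst b = n" | "n - fst b \<ge> 1" | "n - fst b < 0" by linarith
        thus ?thesis
        proof cases
          case 1
          thus ?thesis using b c[of b] g(3)[of b] by (simp add: F0_def)
        next
          case 2
          thus ?thesis using b g(2)[of b] by (simp add: F0_def)
        next
          case 3
          thus ?thesis using b g(3)[of b] f hform_neg[of "f b" N "n - fst b"] by (simp add: F0_def comb_def)
        qed
      qed
      have cg: "comb (n - 1) F (\<lambda>b. g b i)" for i using g(1) g(3) fin by (auto simp: comb_def)
      define v where "v i = lc F (\<lambda>b. g b i)" for i
      have v: "v i \<in> M (n - 1)" for i unfolding v_def by (rule lc_in[OF cg])
      have "lc F f = (\<Sum>b\<in>F. (if b \<in> F0 then to_fract (const (c b)) else 0) *s snd b) + (\<Sum>b\<in>F. \<Sum>i\<le>N. X i *s g b i *s snd b)"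
        unfolding lc_def sum.distrib[symmetric]
        by (rule sum.cong) (simp_all only: fb scale_left_distrib scale_sum_left scale_scale)
      also have "(\<Sum>b\<in>F. \<Sum>i\<le>N. X i *s g b i *s snd b) = (\<Sum>i\<le>N. X i *s v i)"
        unfolding v_def lc_def scale_sum_right by (rule sum.swap)
      also have "(\<Sum>b\<in>F. (if b \<in> F0 then to_fract (const (c b)) else 0) *s snd b) = (\<Sum>b\<in>F0. ks (c b) (snd b))"
        by (rule sum.mono_neutral_cong_right) (use fin in \<open>auto simp: F0_def ks_def\<close>)
      finally have sum0: "(\<Sum>b\<in>F0. ks (c b) (snd b)) + (\<Sum>i\<le>N. X i *s v i) = 0" using zero by simp
      have inj: "inj_on snd F0" by (auto simp: inj_on_def F0_def prod_eq_iff)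
      have "(\<Sum>b\<in>F0. ks (c b) (snd b)) = (\<Sum>x\<in>snd ` F0. ks (c (n, x)) x)"
        unfolding sum.reindex[OF inj] by (rule sum.cong) (auto simp: F0_def)
      have "(\<Sum>b\<in>F0. ks (c b) (snd b)) = (\<Sum>i\<le>N. X i *s - v i)"
        using sum0 by (simp add: sum_negf eq_neg_iff_add_eq_0)
      have "(\<Sum>i\<le>N. X i *s - v i) \<in> W n" using v by (intro WI sec_uminus) auto
      have "snd ` F0 \<subseteq> B n" using fin by (auto simp: F0_def E_def)
      \<comment> \<open>The relation puts the constant part into \<open>W n\<close>, and
        \<open>B n\<close> is independent modulo \<open>W n\<close>.\<close>
      have c0: "c b = 0" if "b \<in> F0" for b
      proof -
        have "b = (n, snd b)" "snd b \<in> snd ` F0" using that by (auto simp: F0_def prod_eq_iff)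
        moreover have "finite (snd ` F0)" using fin by (simp add: F0_def)
        moreover have "(\<Sum>x\<in>snd ` F0. ks (c (n, x)) x) \<in> W n" "snd ` F0 \<subseteq> B n"
          using \<open>(\<Sum>i\<le>N. X i *s - v i) \<in> W n\<close> \<open>snd ` F0 \<subseteq> B n\<close>
          by (simp_all only: \<open>(\<Sum>b\<in>F0. ks (c b) (snd b)) = (\<Sum>i\<le>N. X i *s - v i)\<close>[symmetric]
            \<open>(\<Sum>b\<in>F0. ks (c b) (snd b)) = (\<Sum>x\<in>snd ` F0. ks (c (n, x)) x)\<close>[symmetric])
        ultimately show ?thesis
          using Bind[of n, rule_format, of "snd ` F0" "\<lambda>x. c (n, x)" "snd b"] by simp
      qed
      hence rel: "(\<Sum>i\<le>N. X i *s v i) = 0" using sum0 by simp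
      obtain w where w: "\<And>i j. i \<le> N ==> j \<le> N ==> w i j \<in> M (n - 1 - 1)"
        "\<And>i j. i \<le> N ==> j \<le> N ==> w j i = - w i j" "\<And>i. w i i = 0"
        "\<And>i. i \<le> N ==> v i = (\<Sum>j\<le>N. X j *s w i j)"
        using koszul_exact[OF ac N v rel] by blast
      have "\<exists>Fh. comb (n - 1 - 1) (fst Fh) (snd Fh) \<and> w i j = lc (fst Fh) (snd Fh)" if "i \<le> N" "j \<le> N" for i j
        using gen[OF w(1)[OF that]] by (metis fst_conv snd_conv)
      then obtain Fh where Fh: "\<And>i j. i \<le> N ==> j \<le> N ==>
          comb (n - 1 - 1) (fst (Fh i j)) (snd (Fh i j)) \<and> w i j = lc (fst (Fh i j)) (snd (Fh i j))" by metis
      define G where "G = F \<union> (\<Union>i\<le>N. \<Union>j\<le>N. fst (Fh i j))"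
      have "finite (fst (Fh i j))" "fst (Fh i j) \<subseteq> E" if "i \<le> N" "j \<le> N" for i j
        using combD(1,2) Fh[OF that] by blast+
      hence G: "finite G" "G \<subseteq> E" unfolding G_def using fin by (simp, blast)
      have hG: "comb (n - 1 - 1) G (snd (Fh i j))" "w i j = lc G (snd (Fh i j))" if "i \<le> N" "j \<le> N" for i j
      proof -
        have "fst (Fh i j) \<subseteq> G" using that by (auto simp: G_def)
        thus "comb (n - 1 - 1) G (snd (Fh i j))" "w i j = lc G (snd (Fh i j))"
          using comb_mono[of "n - 1 - 1" "fst (Fh i j)" "snd (Fh i j)" G] Fh[OF that] G by auto
      qed
      \<comment> \<open>The expansions in \<open>Fh\<close> are chosen independently of each other.
        Keeping those with \<open>i < j\<close> and their negatives makes the coefficients skew, not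
        just the vectors.\<close>
      define H where "H i j b = (if i < j then snd (Fh i j) b else if j < i then - snd (Fh j i) b else 0)" for i j b
      have H: "comb (n - 1 - 1) G (H i j)" if "i \<le> N" "j \<le> N" for i j
        using hG(1)[OF that] hG(1)[OF that(2,1)] by (auto simp: comb_def H_def hform_uminus)
      have Hw: "w i j = lc G (H i j)" if "i \<le> N" "j \<le> N" for i j
      proof (cases i j rule: linorder_cases)
        case less
        thus ?thesis using hG(2)[OF that] by (simp add: H_def lc_def)
      next
        case equal
        thus ?thesis using w(3) by (simp add: H_def lc_def)
      next
        case greater
        thus ?thesis using hG(2)[OF that(2,1)] w(2)[OF that(2,1)] by (simp add: H_def lc_def sum_negf)
      qed
      \<comment> \<open>Both sides are coefficients of an expansion of \<open>v i\<close>, so their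
        difference is a relation in degree \<open>n - 1\<close>, where the induction hypothesis
        applies.\<close>
      have gH: "g b i = (\<Sum>j\<le>N. X j * H i j b)" if i: "i \<le> N" for b i
      proof -
        have cgG: "comb (n - 1) G (\<lambda>b. g b i)" "lc G (\<lambda>b. g b i) = v i"
          using comb_mono[OF cg _ G, of i] by (auto simp: G_def v_def)
        have "X j * H i j b \<in> hform N (n - 1 - fst b)" if "j \<le> N" for j b
          using hform_mult[OF hform_X[OF that], of "H i j b" "n - 1 - 1 - fst b"] combD(3)[OF H[OF i that]]
          by (simp add: algebra_simps)
        hence "comb (n - 1) G (\<lambda>b. g b i - (\<Sum>j\<le>N. X j * H i j b))"
          using cgG(1) H[OF i] G by (auto simp: comb_def intro!: hform_diff hform_sum)
        moreover have "lc G (\<lambda>b. g b i - (\<Sum>j\<le>N. X j * H i j b)) = 0"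
        proof -
          have "lc G (\<lambda>b. g b i - (\<Sum>j\<le>N. X j * H i j b)) = v i - (\<Sum>b\<in>G. \<Sum>j\<le>N. X j *s H i j b *s snd b)"
            using cgG(2) by (simp add: lc_def scale_left_diff_distrib sum_subtractf scale_sum_left)
          also have "(\<Sum>b\<in>G. \<Sum>j\<le>N. X j *s H i j b *s snd b) = (\<Sum>j\<le>N. X j *s lc G (H i j))"
            unfolding lc_def scale_sum_right by (rule sum.swap)
          also have "\<dots> = v i" using w(4)[OF i] Hw[OF i] by simp
          finally show ?thesis by simp
        qed
        moreover have "n - 1 < m0 + int k" using n by simp
        ultimately have "g b i - (\<Sum>j\<le>N. X j * H i j b) = 0"
          using Suc[THEN spec, THEN spec, THEN spec, THEN mp, THEN mp, THEN mp] by blast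
        thus ?thesis by simp
      qed
      show "f b0 = 0"
      proof (cases "b0 \<in> F")
        case True
        have "f b0 = (\<Sum>i\<le>N. X i * g b0 i)" using fb[OF True] c0[of b0] by (auto simp: const_def)
        also have "\<dots> = (\<Sum>i\<le>N. \<Sum>j\<le>N. X i * X j * H i j b0)"
          by (simp add: gH sum_distrib_left ac_simps)
        also have "\<dots> = 0" by (rule sum_antisymmetric) (auto simp: H_def)
        finally show ?thesis .
      qed (use f in \<open>unfold comb_def, blast\<close>)
    qed
  qed
  have ind: "f b = 0" if "comb n F f" "lc F f = 0" for n F f b
  proof -
    have "n < m0 + int (nat (n - m0 + 1))" by linarith
    with pre[of "nat (n - m0 + 1)", THEN spec, THEN spec, THEN spec, THEN mp, OF that(1)] that(2) show ?thesis by simp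
  qed
  \<comment> \<open>At one point \<open>p\<close> finitely many generators of the stalk become
    global sections after multiplication by forms, and these involve a finite subset
    \<open>E1\<close> of \<open>E\<close>. A further element of \<open>E\<close> would be a
    combination of \<open>E1\<close> with coefficients regular at \<open>p\<close> up to twist;
    clearing denominators contradicts independence.\<close>
  have "finite E"
  proof -
    obtain p :: "'k point" where p: "p \<in> proj_space N"
      using form_nonvanishing[OF forms_var[of 0 N]] var_neq_0 by blast
    from bspec[OF finite_stalks[unfolded finite_stalks_def] p] obtain n0 g s where
      g: "fval p g ~= 0" "gen_by g n0 s" and "\<exists>d. g \<in> forms N d" unfolding gen_by_def by blast
    hence pg: "p \<in> basic_open N g" using p by (auto simp: basic_open_fval)
    have "\<exists>h dh F f. h \<in> forms N dh \<and> fval p h ~= 0 \<and> comb (int dh) F f \<and> to_fract h *s s l = lc F f" if "l < n0" for l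
    proof -
      have "s l \<in> gr 0 p" using g(2) pg that by (simp add: gen_by_def gr_0_eq[OF p])
      from stalk_from_global[OF p this] obtain dh h where "h \<in> forms N dh" "fval p h ~= 0" "to_fract h *s s l \<in> M (int dh)" by auto
      with gen[OF this(3)] show ?thesis by blast
    qed
    then obtain h dh F f where hF: "\<And>l. l < n0 ==> h l \<in> forms N (dh l) \<and> fval p (h l) ~= 0 \<and>
        comb (int (dh l)) (F l) (f l) \<and> to_fract (h l) *s s l = lc (F l) (f l)" by metis
    define E1 where "E1 = (\<Union>l<n0. F l)"
    have E1: "finite E1" "E1 \<subseteq> E" using hF by (auto simp: E1_def comb_def)
    have "b \<in> E1" if b: "b \<in> E" for b
    proof (rule ccontr)
      assume nb: "b \<notin> E1"
      have "snd b \<in> gr (fst b) p" using E[OF b] p by (rule secD)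
      from gen_by_gr[OF g(2) pg this] obtain z where
        z: "\<And>l. l < n0 ==> z l \<in> loc N p (fst b)" "snd b = (\<Sum>l<n0. z l *s s l)" by metis
      define y where "y c = (\<Sum>l<n0. z l * (1 / to_fract (h l)) * f l c)" for c
      have "s l = (\<Sum>c\<in>E1. (1 / to_fract (h l) * f l c) *s snd c)" if l: "l < n0" for l
      proof -
        have "h l ~= 0" using hF[OF l] p by auto
        hence "s l = (1 / to_fract (h l)) *s to_fract (h l) *s s l" by simp
        also have "to_fract (h l) *s s l = lc E1 (f l)"
        proof -
          have "F l \<subseteq> E1" using l by (auto simp: E1_def)
          thus ?thesis using hF[OF l] comb_mono(2)[of "int (dh l)" "F l" "f l" E1] E1 by simp
        qed
        finally show ?thesis by (simp add: lc_def scale_sum_right)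
      qed
      hence "snd b = (\<Sum>l<n0. \<Sum>c\<in>E1. (z l * (1 / to_fract (h l)) * f l c) *s snd c)"
        unfolding z(2) by (intro sum.cong) (simp_all add: scale_sum_right mult.assoc)
      hence bE1: "snd b = (\<Sum>c\<in>E1. y c *s snd c)"
        unfolding y_def scale_sum_left by (subst (asm) sum.swap)
      have "y c \<in> loc N p (fst b - fst c)" for c
        unfolding y_def
      proof (rule loc_sum[OF p])
        fix l assume "l \<in> {..<n0}"
        hence l: "l < n0" by simp
        have "f l c \<in> loc N p (int (dh l) - fst c)" using hF[OF l] p by (auto simp: comb_def intro: hform_loc)
        from loc_mult[OF loc_mult[OF z(1)[OF l] loc_inverse[of "h l" N "dh l" p]] this] hF[OF l]
        show "z l * (1 / to_fract (h l)) * f l c \<in> loc N p (fst b - fst c)" by simp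
      qed
      with loc_common_denominator[of E1 p N y "\<lambda>c. fst b - fst c"] E1 p obtain e a where
        a: "a \<in> forms N e" "fval p a ~= 0" "\<And>c. c \<in> E1 ==> to_fract a * y c \<in> hform N (int e + (fst b - fst c))" by blast
      define q where "q c = (if c = b then - to_fract a else if c \<in> E1 then to_fract a * y c else 0)" for c
      have "comb (int e + fst b) (insert b E1) q"
        using E1 b a hform_uminus[OF hform_form[OF a(1)]] by (auto simp: comb_def q_def algebra_simps)
      moreover have "lc (insert b E1) q = 0"
      proof -
        have "lc (insert b E1) q = - (to_fract a *s snd b) + (\<Sum>c\<in>E1. q c *s snd c)"
          using nb E1 by (simp add: lc_def q_def)
        also have "(\<Sum>c\<in>E1. q c *s snd c) = to_fract a *s snd b"
          unfolding bE1 scale_sum_right using nb by (intro sum.cong) (auto simp: q_def)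
        finally show ?thesis by simp
      qed
      ultimately have "q b = 0" by (rule ind)
      thus False using a(2) p by (auto simp: q_def)
    qed
    thus ?thesis using E1 finite_subset[of E E1] by blast
  qed
  then obtain en where en: "bij_betw en {..<card E} E"
    using ex_bij_betw_nat_finite[of E] by (auto simp: atLeast0LessThan)
  show thesis
  proof (rule that[of "card E" "\<lambda>i. snd (en i)" "\<lambda>i. fst (en i)"])
    show "snd (en i) \<in> M (fst (en i))" if "i < card E" for i
      using that bij_betwE[OF en] by (intro E) auto
    show "\<forall>i<card E. f i = 0" if f: "\<And>i. i < card E ==> f i \<in> hform N (n - fst (en i))"
      and zero: "(\<Sum>i<card E. f i *s snd (en i)) = 0" for n f
    proof (intro allI impI)
      fix i assume i: "i < card E"
      define q where "q b = (if b \<in> E then f (the_inv_into {..<card E} en b) else 0)" for b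
      have inv: "the_inv_into {..<card E} en (en j) = j" if "j < card E" for j
        using en that by (auto simp: bij_betw_def the_inv_into_f_f)
      have q: "q (en j) = f j" if "j < card E" for j
        using en that inv[OF that] by (auto simp: q_def bij_betw_def)
      have "comb n E q"
        unfolding comb_def
      proof (intro conjI allI impI)
        fix b
        show "q b \<in> hform N (n - fst b)"
        proof (cases "b \<in> E")
          case True
          then obtain j where "j < card E" "b = en j" using en by (auto simp: bij_betw_def)
          thus ?thesis using q f by simp
        qed (simp add: q_def)
      qed (use \<open>finite E\<close> in \<open>auto simp: q_def\<close>)
      moreover have "lc E q = 0"
        unfolding lc_def sum.reindex_bij_betw[OF en, symmetric] using zero q by simp
      ultimately have "q (en i) = 0" by (rule ind)
      thus "f i = 0" using q i by simp
    qed
    show "\<exists>f. (\<forall>i<card E. f i \<in> hform N (n - fst (en i))) \<and> v = (\<Sum>i<card E. f i *s snd (en i))" if v: "v \<in> M n" for n v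
    proof -
      obtain F f where F: "comb n F f" "v = lc F f" using gen[OF v] by blast
      have "v = lc E f" using comb_mono(2)[OF F(1), of E] F \<open>finite E\<close> by (auto simp: comb_def)
      also have "\<dots> = (\<Sum>i<card E. f (en i) *s snd (en i))"
        unfolding lc_def sum.reindex_bij_betw[OF en, symmetric] ..
      finally show ?thesis using F(1) by (intro exI[of _ "\<lambda>i. f (en i)"]) (simp add: comb_def)
    qed
  qed
qed

end

section \<open>Sums of line bundles\<close>

lemma sum_fun_apply: "(\<Sum>l\<in>A. f l) x = (\<Sum>l\<in>A. f l x)"
  by (induction A rule: infinite_finite_induct) auto

definition sum_stalk :: "nat => nat => (nat => int) => 'k::{alg_closed_field, field_char_0} point => (nat => 'k ratfun) set" where
  "sum_stalk N r a p = {f. (\<forall>i<r. f i \<in> twist_stalk (*) N (a i) (\<lambda>p. loc N p 0) p) \<and> (\<forall>i\<ge>r. f i = 0)}"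

lemma sum_stalk_iff:
  "p \<in> proj_space N ==> f \<in> sum_stalk N r a p \<longleftrightarrow> (\<forall>i<r. f i \<in> loc N p (a i)) \<and> (\<forall>i\<ge>r. f i = 0)"
  using twist_structure_stalk[of p N _ 0] by (simp add: sum_stalk_def)

lemma embedded_line_bundle_sum:
  fixes a :: "nat => int"
  shows "\<exists>\<psi>. embedded_sheaf (\<lambda>c f i. c * f i) N
    (direct_sum r (\<lambda>i. line_bundle N (a i)) :: ('k::{alg_closed_field, field_char_0}, _) proj_sheaf) (sum_stalk N r a) \<psi>"
proof -
  have "\<exists>\<psi>. embedded_sheaf (*) N (line_bundle N b :: ('k, _) proj_sheaf) (twist_stalk (*) N b (\<lambda>p. loc N p 0)) \<psi>" for b
    unfolding line_bundle_def using embedded_sheaf.embedded_twist[OF embedded_structure_sheaf] by blast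
  then obtain \<psi> where \<psi>: "embedded_sheaf (*) N (line_bundle N b :: ('k, _) proj_sheaf) (twist_stalk (*) N b (\<lambda>p. loc N p 0)) (\<psi> b)" for b
    by metis
  show ?thesis
    unfolding sum_stalk_def[abs_def]
    by (rule exI, rule embedded_direct_sum[where \<psi> = "\<lambda>i. \<psi> (a i)"]) (use \<psi> embedded_sheaf.axioms(1)[OF embedded_structure_sheaf] in auto)
qed

lemma sum_stalks:
  "stalk_system (\<lambda>c f i. c * f i :: 'k::{alg_closed_field, field_char_0} ratfun) N (sum_stalk N r a)"
proof (intro stalk_system.intro stalk_system_axioms.intro)
  show "vector_space (\<lambda>c f i. c * f i :: 'k ratfun)" by unfold_locales (auto simp: fun_eq_iff algebra_simps)
  show "finite_stalks (\<lambda>c f i. c * f i :: 'k ratfun) N (sum_stalk N r a)"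
    unfolding finite_stalks_def
  proof
    fix p :: "'k point" assume "p \<in> proj_space N"
    then obtain i where i: "i \<le> N" "fval p (var i) ~= 0" by (rule ex_coord_nonzero)
    \<comment> \<open>Where the \<open>i\<close>-th coordinate does not vanish, its power with
      exponent \<open>a l\<close> generates the summand with index \<open>l\<close>.\<close>
    define v where "v l j = (if j = l then X i powi a l else (0 :: 'k ratfun))" for l j
    have "(\<forall>l<r. v l \<in> sum_stalk N r a q) \<and>
        (\<forall>x\<in>sum_stalk N r a q. \<exists>z. (\<forall>l<r. z l \<in> loc N q 0) \<and> x = (\<Sum>l<r. (\<lambda>i. z l * v l i)))"
      if "q \<in> basic_open N (var i)" for q
    proof (intro conjI allI impI ballI)
      have q: "q \<in> proj_space N" "fval q (var i) ~= 0" using that by (auto simp: basic_open_fval[OF forms_var[OF i(1)]])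
      show "v l \<in> sum_stalk N r a q" if "l < r" for l
        using that q loc_powi[OF i(1) q(2), of "a l"] by (auto simp: sum_stalk_iff v_def loc_0)
      fix x assume x: "x \<in> sum_stalk N r a q"
      have 1: "x l * X i powi (- a l) \<in> loc N q 0" if "l < r" for l
        using loc_mult[of "x l" N q "a l" "X i powi (- a l)" "- a l"] loc_powi[OF i(1) q(2)] x q that by (simp add: sum_stalk_iff)
      have 2: "x = (\<Sum>l<r. (\<lambda>j. x l * X i powi (- a l) * v l j))"
      proof
        fix j
        have "(\<Sum>l<r. (\<lambda>j. x l * X i powi (- a l) * v l j)) j = (\<Sum>l<r. if l = j then x l else 0)"
          unfolding sum_fun_apply using var_neq_0[of i] by (intro sum.cong) (auto simp: v_def power_int_minus)
        also have "\<dots> = x j" using x q by (auto simp: sum_stalk_iff)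
        finally show "x j = (\<Sum>l<r. (\<lambda>j. x l * X i powi (- a l) * v l j)) j" by simp
      qed
      show "\<exists>z. (\<forall>l<r. z l \<in> loc N q 0) \<and> x = (\<Sum>l<r. (\<lambda>j. z l * v l j))"
        by (intro exI[of _ "\<lambda>l. x l * X i powi (- a l)"] conjI allI impI 1 2)
    qed
    hence "\<forall>q\<in>basic_open N (var i). (\<forall>l<r. v l \<in> sum_stalk N r a q) \<and>
        (\<forall>x\<in>sum_stalk N r a q. \<exists>z. (\<forall>l<r. z l \<in> loc N q 0) \<and> x = (\<Sum>l<r. (\<lambda>i. z l * v l i)))" by blast
    with i show "\<exists>d>0. \<exists>g\<in>forms N d. \<exists>(n::nat) v. fval p g ~= 0 \<and> (\<forall>q\<in>basic_open N g. (\<forall>l<n. v l \<in> sum_stalk N r a q) \<and>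
        (\<forall>x\<in>sum_stalk N r a q. \<exists>z. (\<forall>l<n. z l \<in> loc N q 0) \<and> x = (\<Sum>l<n. (\<lambda>i. z l * v l i))))"
      by - (rule exI[of _ "Suc 0"], rule conjI[rotated], rule bexI[of _ "var i"], rule exI[of _ r], rule exI[of _ v], simp_all)
  qed
next
  fix p :: "'k point" assume p: "p \<in> proj_space N"
  show "0 \<in> sum_stalk N r a p" using p by (simp add: sum_stalk_iff loc_0)
  fix f assume f: "f \<in> sum_stalk N r a p"
  show "f + g \<in> sum_stalk N r a p" if "g \<in> sum_stalk N r a p" for g
    using f that p by (simp add: sum_stalk_iff loc_add)
  show "(\<lambda>i. x * f i) \<in> sum_stalk N r a p" if "x \<in> loc N p 0" for x
    using f p loc_mult[OF that] by (auto simp: sum_stalk_iff)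
qed

lemma twist_sum_stalk:
  assumes p: "p \<in> proj_space N"
  shows "twist_stalk (\<lambda>c f i. c * f i) N m (sum_stalk N r a) p =
    {f. (\<forall>i<r. f i \<in> loc N p (m + a i)) \<and> (\<forall>i\<ge>r. f i = (0 :: 'k::{alg_closed_field, field_char_0} ratfun))}"
proof -
  obtain u :: "'k ratfun" where u: "u \<in> loc N p (- m)" "u ~= 0" using loc_unit[OF p, of "- m"] by blast
  have "f i \<in> loc N p (m + a i) \<longleftrightarrow> (\<forall>x\<in>loc N p (- m). x * f i \<in> loc N p (a i))" for f :: "nat => 'k ratfun" and i
    using twist_structure_stalk[OF p, of m "a i"] by (auto simp: twist_stalk_def)
  moreover have "f i = 0 \<longleftrightarrow> (\<forall>x\<in>loc N p (- m). x * f i = 0)" for f :: "nat => 'k ratfun" and i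
    using u by auto
  ultimately show ?thesis using p unfolding twist_stalk_def by (simp add: sum_stalk_iff) blast
qed

lemma sum_acyclic:
  assumes n: "1 \<le> n" "n \<le> N"
  shows "stalk_system.acyclic (\<lambda>c f i. c * f i :: 'k::{alg_closed_field, field_char_0} ratfun) N (sum_stalk N r a) (std_cover N) n m"
proof -
  interpret S: stalk_system "\<lambda>c f i. c * f i :: 'k ratfun" N "sum_stalk N r a" by (rule sum_stalks)
  obtain n' where n': "n = Suc n'" using n(1) by (cases n) auto
  have sec: "f \<in> S.sec (Dset N A) m \<longleftrightarrow> (\<forall>p\<in>Dset N A. \<forall>i\<ge>r. f i = 0) \<and> (\<forall>i<r. f i \<in> rat_on N (Dset N A) (m + a i))" for f A
    using Dset_proj[of N A] by (auto simp: S.sec_def twist_sum_stalk rat_on_def subset_iff)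
  show ?thesis
    unfolding S.acyclic_def
  proof (intro ballI impI)
    fix c assume c: "c \<in> S.cochains (std_cover N) n m" and closed: "\<forall>s\<in>lists_of (std_cover N) (Suc n). cobd c s = 0"
    have comp: "cobd (\<lambda>s. c s i) s = cobd c s i" for c :: "'k mvpoly list => nat => 'k ratfun" and i s
      using cobd_hom[of "\<lambda>f. f i" c s] by simp
    \<comment> \<open>Needed for the coordinates from \<open>r\<close> on, which are known to be
      zero only if there is a point to test them at.\<close>
    have ne: "Dset N (set s) ~= {}" if "s \<in> lists_of (std_cover N) n" for s :: "'k mvpoly list"
      using that std_cover_pos by (intro Dset_nonempty) (auto simp: lists_of_def)
    have "\<exists>b. (\<forall>t\<in>lists_of (std_cover N :: 'k mvpoly set) n'. b t \<in> rat_on N (Dset N (set t)) (m + a i)) \<and>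
        (\<forall>s\<in>lists_of (std_cover N) (Suc n'). c s i = cobd b s)" if i: "i < r" for i
    proof (rule std_acyclic)
      show "c s i \<in> rat_on N (Dset N (set s)) (m + a i)" if "s \<in> lists_of (std_cover N) (Suc n')" for s
        using c that i by (simp add: S.cochains_def sec n')
      show "cobd (\<lambda>s. c s i) s = 0" if "s \<in> lists_of (std_cover N) (Suc (Suc n'))" for s
        using closed that by (simp add: comp n')
      show "Suc n' \<le> N" using n n' by simp
    qed
    then obtain b where b: "\<And>i t. i < r ==> t \<in> lists_of (std_cover N) n' ==> b i t \<in> rat_on N (Dset N (set t)) (m + a i)"
      "\<And>i s. i < r ==> s \<in> lists_of (std_cover N) (Suc n') ==> c s i = cobd (b i) s" by metis
    define d where "d t i = (if i < r then b i t else 0)" for t i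
    have "d \<in> S.cochains (std_cover N) (n - 1) m" using b(1) by (simp add: S.cochains_def sec d_def n')
    moreover have "c s = cobd d s" if s: "s \<in> lists_of (std_cover N) n" for s
    proof
      fix i
      have "cobd d s i = cobd (\<lambda>t. d t i) s" by (simp add: comp)
      also have "\<dots> = c s i"
      proof (cases "i < r")
        case True
        thus ?thesis using b(2)[OF True, of s] s by (simp add: d_def n')
      next
        case False
        thus ?thesis using c s ne[OF s] by (auto simp: d_def cobd_zero S.cochains_def sec)
      qed
      finally show "c s i = cobd d s i" by simp
    qed
    ultimately show "\<exists>b\<in>S.cochains (std_cover N) (n - 1) m. \<forall>s\<in>lists_of (std_cover N) n. c s = cobd b s" by blast
  qed
qed

section \<open>Splitting\<close>

context stalk_system
begin

text \<open>A basis element of degree \<open>d i\<close> contributes the summand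
  \<open>\<O>(- d i)\<close>. Independence over forms becomes injectivity of \<open>T\<close> after
  clearing denominators; generation of \<open>M\<close> becomes surjectivity on stalks by
  \<open>stalk_from_global\<close>.\<close>

lemma split_of_basis:
  fixes e :: "nat => 'v"
  assumes F: "embedded_sheaf scale N F \<Phi> \<psi>"
    and e: "\<And>i. i < r ==> e i \<in> M (d i)"
    and ind: "\<And>n f. (\<And>i. i < r ==> f i \<in> hform N (n - d i)) ==> (\<Sum>i<r. f i *s e i) = 0 ==> \<forall>i<r. f i = 0"
    and gen: "\<And>n v. v \<in> M n ==> \<exists>f. (\<forall>i<r. f i \<in> hform N (n - d i)) \<and> v = (\<Sum>i<r. f i *s e i)"
  shows "is_split N F"
proof -
  define T where "T c = (\<Sum>i<r. c i *s e i)" for c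
  let ?S = "sum_stalk N r (\<lambda>i. - d i)"
  \<comment> \<open>Two points are allowed, because a preimage found in the stalk at one point has
    to be recognised in the stalks at all other points of an open set.\<close>
  have inj: "c = c'" if pq: "p \<in> proj_space N" "q \<in> proj_space N" and c: "c \<in> ?S p" "c' \<in> ?S q" and T: "T c = T c'" for c c' p q
  proof -
    have "\<And>i. i \<in> {..<r} ==> c i \<in> loc N p (- d i)" "\<And>i. i \<in> {..<r} ==> c' i \<in> loc N q (- d i)"
      using c pq by (simp_all add: sum_stalk_iff)
    with loc_common_denominator[of "{..<r}" p N c "\<lambda>i. - d i"] loc_common_denominator[of "{..<r}" q N c' "\<lambda>i. - d i"] pq
    obtain m a n b where ab: "a \<in> forms N m" "fval p a ~= 0" "\<And>i. i < r ==> to_fract a * c i \<in> hform N (int m + - d i)"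
      "b \<in> forms N n" "fval q b ~= 0" "\<And>i. i < r ==> to_fract b * c' i \<in> hform N (int n + - d i)"
      by (auto simp: Ball_def)
    define f where "f i = to_fract b * (to_fract a * c i) - to_fract a * (to_fract b * c' i)" for i
    have "f i \<in> hform N (int m + int n - d i)" if "i < r" for i
      using hform_mult[OF hform_form[OF ab(4)] ab(3)[OF that]] hform_mult[OF hform_form[OF ab(1)] ab(6)[OF that]]
      unfolding f_def by (intro hform_diff) (simp_all add: algebra_simps)
    moreover have "(\<Sum>i<r. f i *s e i) = (to_fract b * to_fract a) *s T c - (to_fract b * to_fract a) *s T c'"
      by (simp add: f_def T_def scale_sum_right scale_left_diff_distrib sum_subtractf ac_simps)
    ultimately have f: "\<forall>i<r. f i = 0" using T by (intro ind) auto
    have ab0: "a ~= 0" "b ~= 0" using ab(2,5) pq by auto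
    have "c i = c' i" for i
    proof (cases "i < r")
      case True
      hence "to_fract b * to_fract a * (c i - c' i) = 0" using f by (simp add: f_def algebra_simps)
      thus ?thesis using ab0 by simp
    next
      case False
      thus ?thesis using c pq by (simp add: sum_stalk_iff)
    qed
    thus ?thesis by blast
  qed
  have T_in: "T c \<in> \<Phi> p" if p: "p \<in> proj_space N" and c: "c \<in> ?S p" for c p
  proof -
    have "c i *s e i \<in> gr 0 p" if "i < r" for i
      using c p that by (intro gr_scale[OF p _ secD[OF e[OF that] p]]) (auto simp: sum_stalk_iff)
    thus ?thesis unfolding T_def gr_0_eq[OF p, symmetric] by (intro gr_sum[OF p]) auto
  qed
  have T_surj: "\<exists>c\<in>?S p. T c = v" if p: "p \<in> proj_space N" and v: "v \<in> \<Phi> p" for v p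
  proof -
    obtain m h where h: "h \<in> forms N m" "fval p h ~= 0" "to_fract h *s v \<in> M (int m)"
      using stalk_from_global[OF p, of v 0] v by (auto simp: gr_0_eq[OF p])
    from gen[OF h(3)] obtain f where f: "\<And>i. i < r ==> f i \<in> hform N (int m - d i)" "to_fract h *s v = (\<Sum>i<r. f i *s e i)" by auto
    define c where "c i = (if i < r then 1 / to_fract h * f i else 0)" for i
    have "c i \<in> loc N p (- d i)" if "i < r" for i
      using loc_mult[OF loc_inverse[OF h(1,2)] hform_loc[OF f(1)[OF that] p]] that by (simp add: c_def)
    hence "c \<in> ?S p" using p by (simp add: sum_stalk_iff c_def)
    moreover have "T c = v"
    proof -
      have "h ~= 0" using h(2) p by auto
      have "T c = (\<Sum>i<r. (1 / to_fract h) *s f i *s e i)" unfolding T_def by (rule sum.cong) (auto simp: c_def)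
      also have "\<dots> = (1 / to_fract h) *s to_fract h *s v" by (simp only: f(2) scale_sum_right)
      also have "\<dots> = v" using \<open>h ~= 0\<close> by simp
      finally show ?thesis .
    qed
    ultimately show ?thesis by blast
  qed
  obtain \<psi>' where G: "embedded_sheaf (\<lambda>c f i. c * f i) N (direct_sum r (\<lambda>i. line_bundle N (- d i)) :: ('k, _) proj_sheaf) ?S \<psi>'"
    using embedded_line_bundle_sum[of N r "\<lambda>i. - d i"] by blast
  have "sheaf_iso N F (direct_sum r (\<lambda>i. line_bundle N (- d i)))"
  proof (rule sheaf_isoI[OF F G, of T])
    fix U :: "'k point set" assume U: "zopen N U" "U ~= {}"
    then obtain p where p: "p \<in> U" by blast
    have UP: "q \<in> proj_space N" if "q \<in> U" for q using openin_subset[OF U(1)] that by auto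
    show "bij_betw T (\<Inter>p\<in>U. ?S p) (\<Inter>p\<in>U. \<Phi> p)"
      unfolding bij_betw_def
    proof
      show "inj_on T (\<Inter>p\<in>U. ?S p)" using inj[OF UP[OF p] UP[OF p]] p by (auto intro!: inj_onI)
      show "T ` (\<Inter>p\<in>U. ?S p) = (\<Inter>p\<in>U. \<Phi> p)"
      proof (intro equalityI subsetI)
        fix v assume v: "v \<in> (\<Inter>p\<in>U. \<Phi> p)"
        then obtain c where c: "c \<in> ?S p" "T c = v" using T_surj[OF UP[OF p]] p by blast
        have "c \<in> ?S q" if q: "q \<in> U" for q
        proof -
          obtain c' where "c' \<in> ?S q" "T c' = v" using T_surj[OF UP[OF q]] v q by blast
          thus ?thesis using inj[OF UP[OF p] UP[OF q] c(1)] c(2) by simp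
        qed
        thus "v \<in> T ` (\<Inter>p\<in>U. ?S p)" using c(2) by blast
      qed (use T_in UP in auto)
    qed
  next
    show "T (v + w) = T v + T w" for v w by (simp add: T_def scale_left_distrib sum.distrib)
    show "T (\<lambda>i. x * v i) = x *s T v" for x v by (simp add: T_def scale_sum_right)
  qed
  thus ?thesis unfolding is_split_def by (intro exI[of _ r] exI[of _ "\<lambda>i. - d i"])
qed

end

text \<open>Powers of \<open>x\<^sub>0\<close> and \<open>x\<^sub>1\<close>, available as
  \<open>N \<ge> 1\<close>, turn \<open>x\<close> into forms \<open>f\<close> and \<open>g\<close>
  with \<open>x\<^sub>1\<^sup>k f = x\<^sub>0\<^sup>k g\<close>. A monomial of this form would be
  divisible by both powers and have degree at least \<open>2 * k\<close>, but the degree is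
  \<open>2 * k + n\<close>.\<close>

lemma global_negative:
  fixes x :: "'k::{alg_closed_field, field_char_0} ratfun"
  assumes N: "N \<ge> 1" and n: "n < 0" and x: "x \<in> rat_on N (proj_space N) n"
  shows "x = 0"
proof -
  have "x \<in> rat_on N (basic_open N h) n" for h
    using x rat_on_mono[of "basic_open N h" "proj_space N" N n] by (auto simp: basic_open_def)
  hence sections: "\<exists>k0. \<forall>k\<ge>k0. to_fract (var i ^ k) * x \<in> hform N (int k + n)" if "i \<le> N" for i
    using structure_sections[of "var i" N 1 x n] that by simp
  obtain k0 k1 where k: "\<forall>k\<ge>k0. to_fract (var 0 ^ k) * x \<in> hform N (int k + n)"
    "\<forall>k\<ge>k1. to_fract (var 1 ^ k) * x \<in> hform N (int k + n)"
    using sections[of 0] sections[of 1] N by auto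
  define k where "k = max k0 k1"
  obtain f d where f: "to_fract (var 0 ^ k) * x = to_fract f" "f \<in> forms N d" "int d = int k + n \<or> f = 0"
    using k(1)[rule_format, of k] by (auto simp: hform_def k_def)
  obtain g where g: "to_fract (var 1 ^ k) * x = to_fract g" using k(2)[rule_format, of k] by (auto simp: hform_def k_def)
  have "to_fract (var 1 ^ k * f) = to_fract (var 0 ^ k * g)"
    by (simp only: to_fract_mult f(1)[symmetric] g[symmetric] ac_simps)
  hence eq: "var 1 ^ k * f = var 0 ^ k * g" by (simp only: to_fract_eq_iff)
  have "f = 0"
  proof (rule ccontr)
    assume f0: "f ~= 0"
    hence d: "int d = int k + n" using f(3) by simp
    have "var 1 ^ k * f ~= 0" using f0 by (simp add: var_neq_0)
    then obtain m where m: "m \<in> mkeys (var 1 ^ k * f)" by (metis all_not_in_conv keys_eq_empty)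
    have "k \<le> mcoeff m 1" using monomial_mult_keys[of "{1}" m k f 1] m by simp
    moreover have "k \<le> mcoeff m 0" using monomial_mult_keys[of "{0}" m k g 0] m[unfolded eq] by simp
    moreover have "var 1 ^ k * f \<in> forms N (k + d)"
      using forms_mult[OF forms_power[OF forms_var[of 1 N]] f(2), of k] N by simp
    hence "mdeg m = k + d" using m by (simp add: forms_alt)
    moreover have "mcoeff m 0 + mcoeff m 1 \<le> mdeg m"
    proof -
      have "mdeg m = (\<Sum>i\<in>insert 0 (insert 1 (mkeys m)). mcoeff m i)" by (rule mdeg_superset) auto
      moreover have "(\<Sum>i\<in>{0, 1}. mcoeff m i) \<le> (\<Sum>i\<in>insert 0 (insert 1 (mkeys m)). mcoeff m i)"
        by (rule sum_mono2) auto
      ultimately show ?thesis by simp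
    qed
    ultimately show False using d n by linarith
  qed
  thus "x = 0" using f(1) by (simp add: var_neq_0)
qed

text \<open>One form \<open>A\<close> of degree \<open>D\<close> clears the denominators in the
  coordinates of finitely many local generators. For \<open>v \<in> M k\<close> the coordinates of
  \<open>A\<close> times \<open>v\<close> are then global sections of \<open>\<O>(k + D)\<close>,
  which vanish for \<open>k < - D\<close>.\<close>

lemma bounded_below:
  fixes \<Phi> :: "'k::{alg_closed_field, field_char_0} point => (nat => 'k ratfun) set"
  assumes S: "stalk_system (\<lambda>c x i. c * x i) N \<Phi>" and N: "N \<ge> 1" and I: "finite I"
    and supp: "\<And>p x i. x \<in> \<Phi> p ==> i \<notin> I ==> x i = 0"
    and coords: "\<And>p x. x \<in> \<Phi> p ==> \<exists>q. q \<in> proj_space N \<and> (\<forall>i. x i \<in> loc N q 0)"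
  shows "\<exists>m0. \<forall>m<m0. stalk_system.sec (\<lambda>c x i. c * x i) N \<Phi> (proj_space N) m = {0}"
proof -
  interpret stalk_system "\<lambda>c x i. c * x i :: 'k ratfun" N \<Phi> by (rule S)
  obtain G where G: "finite G" "\<And>g. g \<in> G ==> \<exists>n s. gen_by g n s" "\<And>g. g \<in> G ==> \<exists>d>0. g \<in> forms N d"
    "\<And>p. p \<in> proj_space N ==> \<exists>g\<in>G. fval p g ~= 0"
    using finite_gen_cover by metis
  then obtain n s where ns: "\<And>g. g \<in> G ==> gen_by g (n g) (s g)" by metis
  \<comment> \<open>Generators over an empty basic open set are left out: they need not belong to
    any stalk, so nothing is known about their coordinates.\<close>
  define B where "B = {(g, l). g \<in> G \<and> basic_open N g ~= {} \<and> l < n g}"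
  have "B \<subseteq> (SIGMA g:G. {..<n g})" by (auto simp: B_def)
  hence B: "finite B" by (rule finite_subset) (use G(1) in auto)
  have "\<exists>m a. a \<in> forms N m \<and> a ~= 0 \<and> (\<forall>i. to_fract a * s (fst b) (snd b) i \<in> hform N (int m))" if b: "b \<in> B" for b
  proof -
    obtain q where q: "q \<in> basic_open N (fst b)" using b by (auto simp: B_def)
    hence mem: "s (fst b) (snd b) \<in> \<Phi> q" using ns[of "fst b"] b by (auto simp: B_def gen_by_def)
    then obtain q' where q': "q' \<in> proj_space N" "\<forall>i. s (fst b) (snd b) i \<in> loc N q' 0" using coords by blast
    from loc_common_denominator[OF I q'(1), of "s (fst b) (snd b)" "\<lambda>_. 0"] q'(2) obtain m a where
      a: "a \<in> forms N m" "fval q' a ~= 0" "\<forall>i\<in>I. to_fract a * s (fst b) (snd b) i \<in> hform N (int m)" by auto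
    have "to_fract a * s (fst b) (snd b) i \<in> hform N (int m)" for i
      using a(3) supp[OF mem, of i] by (cases "i \<in> I") auto
    moreover have "a ~= 0" using a(2) q'(1) by auto
    ultimately show ?thesis using a(1) by blast
  qed
  then obtain m a where a: "\<And>b. b \<in> B ==> a b \<in> forms N (m b)" "\<And>b. b \<in> B ==> a b ~= 0"
    "\<And>b i. b \<in> B ==> to_fract (a b) * s (fst b) (snd b) i \<in> hform N (int (m b))" by metis
  define A where "A = (\<Prod>b\<in>B. a b)"
  define D where "D = (\<Sum>b\<in>B. m b)"
  have "A ~= 0" using a(2) B by (simp add: A_def)
  have As: "to_fract A * s (fst b) (snd b) i \<in> hform N (int D)" if b: "b \<in> B" for b i
  proof -
    have "(\<Prod>c\<in>B - {b}. a c) \<in> forms N (\<Sum>c\<in>B - {b}. m c)" using a(1) by (intro forms_prod) auto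
    from hform_mult[OF hform_form[OF this] a(3)[OF b]]
    have "to_fract (\<Prod>c\<in>B - {b}. a c) * (to_fract (a b) * s (fst b) (snd b) i) \<in> hform N (int D)"
      using sum.remove[OF B b, of m] by (simp add: D_def add.commute)
    moreover have "A = (\<Prod>c\<in>B - {b}. a c) * a b" using prod.remove[OF B b, of a] by (simp add: A_def ac_simps)
    ultimately show ?thesis by (simp add: ac_simps)
  qed
  have "v = 0" if k: "k < - int D" and v: "v \<in> M k" for k v
  proof
    fix i
    have "to_fract A * v i \<in> loc N p (k + int D)" if p: "p \<in> proj_space N" for p
    proof -
      obtain g where g: "g \<in> G" "fval p g ~= 0" using G(4)[OF p] by blast
      hence pg: "p \<in> basic_open N g" using G(3)[OF g(1)] p by (auto simp: basic_open_fval)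
      obtain z where z: "\<And>l. l < n g ==> z l \<in> loc N p k" "v = (\<Sum>l<n g. (\<lambda>i. z l * s g l i))"
        by (rule gen_by_gr[OF ns[OF g(1)] pg secD[OF v p]]) (rule that)
      have "to_fract A * v i = (\<Sum>l<n g. z l * (to_fract A * s g l i))"
        by (simp add: z(2) sum_fun_apply sum_distrib_left ac_simps)
      also have "\<dots> \<in> loc N p (k + int D)"
      proof (rule loc_sum[OF p])
        fix l assume "l \<in> {..<n g}"
        hence l: "l < n g" by simp
        have "(g, l) \<in> B" using g l pg by (auto simp: B_def)
        from loc_mult[OF z(1)[OF l] hform_loc[OF As[OF this] p]]
        show "z l * (to_fract A * s g l i) \<in> loc N p (k + int D)" by simp
      qed
      finally show ?thesis .
    qed
    hence "to_fract A * v i = 0" using k by (intro global_negative[OF N, of "k + int D"]) (auto simp: rat_on_def)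
    thus "v i = 0 i" using \<open>A ~= 0\<close> by simp
  qed
  thus ?thesis by (intro exI[of _ "- int D"]) (auto simp: sec_0)
qed

section \<open>Cohomology of embedded sheaves\<close>

abbreviation "cap \<sigma> \<equiv> \<Inter>(set \<sigma>)"

lemma simplices_cap_open:
  assumes "\<U> \<in> covers (zariski N)" "\<sigma> \<in> simplices q \<U>"
  shows "zopen N (cap \<sigma>)"
  using assms by (intro openin_Inter) (auto simp: simplices_def covers_def)

lemma face_simplex:
  assumes "\<sigma> \<in> simplices (Suc q) \<U>" "j \<le> Suc q"
  shows "face j \<sigma> \<in> simplices q \<U>" "cap \<sigma> \<subseteq> cap (face j \<sigma>)"
  using assms set_take_subset[of j \<sigma>] set_drop_subset[of "Suc j" \<sigma>] by (auto simp: simplices_def face_def)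

text \<open>\<open>G\<close> will be the twist of the given sheaf by \<open>m\<close>. Its stalks
  are twisted from \<open>\<Phi>\<close>, so one system of stalks serves for all
  \<open>m\<close>.\<close>

locale cech_embedding = stalk_system scale N \<Phi> + emb: embedded_sheaf scale N G "twist_stalk scale N m \<Phi>" \<psi>
  for scale :: "'k::{alg_closed_field, field_char_0} ratfun => 'v::ab_group_add => 'v" (infixr \<open>*s\<close> 75)
    and N \<Phi> and m :: int and G :: "('k, 'a) proj_sheaf" and \<psi>
begin

abbreviation "Ch q \<U> \<equiv> cech_cochains q G \<U>"
abbreviation "cover \<U> \<equiv> \<U> \<in> covers (zariski N)"

text \<open>Abstract cochains as functions into the vector space. Over an empty intersection the
  embedding says nothing, and the value is set to \<open>0\<close>; the group of sections there is
  trivial.\<close>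

definition val :: "('k point set list => 'a) => 'k point set list => 'v" where
  "val c \<sigma> = (if cap \<sigma> = {} then 0 else \<psi> (cap \<sigma>) (c \<sigma>))"

lemma cochains_iff:
  "c \<in> carrier (Ch q \<U>) \<longleftrightarrow> c \<in> (\<Pi>\<^sub>E \<sigma>\<in>simplices q \<U>. secs G (cap \<sigma>))"
  by (simp add: cech_cochains_def)

lemma val_in:
  assumes "cover \<U>" "c \<in> carrier (Ch q \<U>)" "\<sigma> \<in> simplices q \<U>"
  shows "val c \<sigma> \<in> sec (cap \<sigma>) m"
proof (cases "cap \<sigma> = {}")
  case True
  thus ?thesis by (simp add: sec_def)
next
  case False
  thus ?thesis using assms emb.emb_in[OF simplices_cap_open[OF assms(1,3)]]
    by (auto simp: val_def cochains_iff intro!: secI)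
qed

lemma cochains_eqI:
  assumes \<U>: "cover \<U>" and c: "c \<in> carrier (Ch q \<U>)" "d \<in> carrier (Ch q \<U>)"
    and eq: "\<And>\<sigma>. \<sigma> \<in> simplices q \<U> ==> cap \<sigma> ~= {} ==> val c \<sigma> = val d \<sigma>"
  shows "c = d"
proof (rule PiE_ext)
  show "c \<in> (\<Pi>\<^sub>E \<sigma>\<in>simplices q \<U>. secs G (cap \<sigma>))" "d \<in> (\<Pi>\<^sub>E \<sigma>\<in>simplices q \<U>. secs G (cap \<sigma>))"
    using c by (simp_all add: cochains_iff)
  fix \<sigma> assume \<sigma>: "\<sigma> \<in> simplices q \<U>"
  have carr: "c \<sigma> \<in> secs G (cap \<sigma>)" "d \<sigma> \<in> secs G (cap \<sigma>)"
    using c \<sigma> by (auto simp: cochains_iff)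
  show "c \<sigma> = d \<sigma>"
  proof (cases "cap \<sigma> = {}")
    case True
    thus ?thesis using carr emb.sections_empty' by metis
  next
    case False
    thus ?thesis using eq[OF \<sigma> False] emb.emb_inj[OF simplices_cap_open[OF \<U> \<sigma>] False carr] by (simp add: val_def)
  qed
qed

lemma val_mult:
  assumes "cover \<U>" "c \<in> carrier (Ch q \<U>)" "d \<in> carrier (Ch q \<U>)"
    and "\<sigma> \<in> simplices q \<U>"
  shows "val (c \<otimes>\<^bsub>Ch q \<U>\<^esub> d) \<sigma> = val c \<sigma> + val d \<sigma>"
  using assms emb.emb_add[OF simplices_cap_open[OF assms(1,4)]]
  by (auto simp: val_def cech_cochains_def PiE_iff)

lemma mult_closed:
  assumes "cover \<U>" "c \<in> carrier (Ch q \<U>)" "d \<in> carrier (Ch q \<U>)"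
  shows "c \<otimes>\<^bsub>Ch q \<U>\<^esub> d \<in> carrier (Ch q \<U>)"
proof -
  have "c \<sigma> \<oplus>\<^bsub>sections G (cap \<sigma>)\<^esub> d \<sigma> \<in> secs G (cap \<sigma>)" if \<sigma>: "\<sigma> \<in> simplices q \<U>" for \<sigma>
  proof -
    interpret abelian_group "sections G (cap \<sigma>)" using emb.sections_group[OF simplices_cap_open[OF assms(1) \<sigma>]] .
    show ?thesis using assms(2,3) \<sigma> by (auto simp: cochains_iff)
  qed
  thus ?thesis by (simp add: cech_cochains_def)
qed

lemma one_in: "cover \<U> ==> \<one>\<^bsub>Ch q \<U>\<^esub> \<in> carrier (Ch q \<U>)"
  using emb.zero_closed[OF simplices_cap_open] by (auto simp: cech_cochains_def)

lemma val_one: "cover \<U> ==> \<sigma> \<in> simplices q \<U> ==> val \<one>\<^bsub>Ch q \<U>\<^esub> \<sigma> = 0"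
  using emb.emb_zero[OF simplices_cap_open] by (auto simp: val_def cech_cochains_def)

lemma one_mult_one:
  assumes \<U>: "cover \<U>"
  shows "\<one>\<^bsub>Ch q \<U>\<^esub> \<otimes>\<^bsub>Ch q \<U>\<^esub> \<one>\<^bsub>Ch q \<U>\<^esub> = \<one>\<^bsub>Ch q \<U>\<^esub>"
  by (rule cochains_eqI[OF \<U> mult_closed[OF \<U> one_in[OF \<U>] one_in[OF \<U>]] one_in[OF \<U>]])
    (simp add: val_mult[OF \<U> one_in[OF \<U>] one_in[OF \<U>]] val_one[OF \<U>])

lemma lift_cochain:
  assumes \<U>: "cover \<U>" and f: "\<And>\<sigma>. \<sigma> \<in> simplices q \<U> ==> cap \<sigma> ~= {} ==> f \<sigma> \<in> sec (cap \<sigma>) m"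
  obtains c where "c \<in> carrier (Ch q \<U>)" "\<And>\<sigma>. \<sigma> \<in> simplices q \<U> ==> cap \<sigma> ~= {} ==> val c \<sigma> = f \<sigma>"
proof -
  have "\<exists>s\<in>secs G (cap \<sigma>). cap \<sigma> ~= {} --> \<psi> (cap \<sigma>) s = f \<sigma>" if \<sigma>: "\<sigma> \<in> simplices q \<U>" for \<sigma>
  proof (cases "cap \<sigma> = {}")
    case True
    thus ?thesis using emb.zero_closed[OF simplices_cap_open[OF \<U> \<sigma>]] by blast
  next
    case False
    have "f \<sigma> \<in> gr m p" if "p \<in> cap \<sigma>" for p using secD[OF f[OF \<sigma> False] that] .
    from emb.emb_surj[OF simplices_cap_open[OF \<U> \<sigma>] False this] show ?thesis by blast
  qed
  then obtain s where s: "\<And>\<sigma>. \<sigma> \<in> simplices q \<U> ==> s \<sigma> \<in> secs G (cap \<sigma>) \<and> (cap \<sigma> ~= {} --> \<psi> (cap \<sigma>) (s \<sigma>) = f \<sigma>)"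
    by metis
  show thesis
  proof (rule that[of "\<lambda>\<sigma>\<in>simplices q \<U>. s \<sigma>"])
    show "(\<lambda>\<sigma>\<in>simplices q \<U>. s \<sigma>) \<in> carrier (Ch q \<U>)" using s by (simp add: cochains_iff)
    show "val (\<lambda>\<sigma>\<in>simplices q \<U>. s \<sigma>) \<sigma> = f \<sigma>" if "\<sigma> \<in> simplices q \<U>" "cap \<sigma> ~= {}" for \<sigma>
      using s that by (simp add: val_def)
  qed
qed

lemma differential:
  assumes \<U>: "cover \<U>" and c: "c \<in> carrier (Ch q \<U>)"
  shows "cech_differential q G \<U> c \<in> carrier (Ch (Suc q) \<U>)"
    and "\<And>\<sigma>. \<sigma> \<in> simplices (Suc q) \<U> ==> cap \<sigma> ~= {} ==> val (cech_differential q G \<U> c) \<sigma> = cobd (val c) \<sigma>"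
proof -
  define t where "t = (\<lambda>\<sigma> j. restr G (cap (face j \<sigma>)) (cap \<sigma>) (c (face j \<sigma>)))"
  define u where "u = (\<lambda>\<sigma> j. if even j then t \<sigma> j else \<ominus>\<^bsub>sections G (cap \<sigma>)\<^esub> t \<sigma> j)"
  have diff: "cech_differential q G \<U> c = (\<lambda>\<sigma>\<in>simplices (Suc q) \<U>. finsum (sections G (cap \<sigma>)) (u \<sigma>) {..Suc q})"
    unfolding cech_differential_def u_def t_def Let_def ..
  have *: "finsum (sections G (cap \<sigma>)) (u \<sigma>) {..Suc q} \<in> secs G (cap \<sigma>) \<and>
      (cap \<sigma> ~= {} --> \<psi> (cap \<sigma>) (finsum (sections G (cap \<sigma>)) (u \<sigma>) {..Suc q}) = cobd (val c) \<sigma>)"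
    if \<sigma>: "\<sigma> \<in> simplices (Suc q) \<U>" for \<sigma>
  proof
    note o = simplices_cap_open[OF \<U> \<sigma>]
    interpret abelian_group "sections G (cap \<sigma>)" using emb.sections_group[OF o] .
    have carr: "c (face j \<sigma>) \<in> secs G (cap (face j \<sigma>))" and of: "zopen N (cap (face j \<sigma>))"
      if "j \<le> Suc q" for j
      using c face_simplex(1)[OF \<sigma> that] simplices_cap_open[OF \<U>] by (auto simp: cochains_iff)
    have t: "t \<sigma> j \<in> secs G (cap \<sigma>)" if "j \<le> Suc q" for j
      unfolding t_def using emb.restr_closed[OF of[OF that] o face_simplex(2)[OF \<sigma> that] carr[OF that]] .
    hence u: "u \<sigma> j \<in> secs G (cap \<sigma>)" if "j \<le> Suc q" for j
      using that by (simp add: u_def)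
    thus "finsum (sections G (cap \<sigma>)) (u \<sigma>) {..Suc q} \<in> secs G (cap \<sigma>)"
      by (intro finsum_closed) auto
    show "cap \<sigma> ~= {} --> \<psi> (cap \<sigma>) (finsum (sections G (cap \<sigma>)) (u \<sigma>) {..Suc q}) = cobd (val c) \<sigma>"
    proof
      assume ne: "cap \<sigma> ~= {}"
      have "\<psi> (cap \<sigma>) (finsum (sections G (cap \<sigma>)) (u \<sigma>) {..Suc q}) = (\<Sum>j\<le>Suc q. \<psi> (cap \<sigma>) (u \<sigma> j))"
        using u by (intro emb.emb_finsum[OF o ne]) auto
      also have "\<dots> = (\<Sum>j\<le>Suc q. if even j then val c (face j \<sigma>) else - val c (face j \<sigma>))"
      proof (rule sum.cong[OF refl])
        fix j assume "j \<in> {..Suc q}"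
        hence j: "j \<le> Suc q" by simp
        have "cap (face j \<sigma>) ~= {}" using ne face_simplex(2)[OF \<sigma> j] by auto
        hence "\<psi> (cap \<sigma>) (t \<sigma> j) = val c (face j \<sigma>)"
          unfolding t_def val_def using emb.emb_restr[OF of[OF j] o face_simplex(2)[OF \<sigma> j] ne carr[OF j]] by simp
        thus "\<psi> (cap \<sigma>) (u \<sigma> j) = (if even j then val c (face j \<sigma>) else - val c (face j \<sigma>))"
          using emb.emb_neg[OF o ne t[OF j]] by (simp add: u_def)
      qed
      also have "\<dots> = cobd (val c) \<sigma>"
        unfolding cobd_face_sum using \<sigma> by (simp add: simplices_def lessThan_Suc_atMost)
      finally show "\<psi> (cap \<sigma>) (finsum (sections G (cap \<sigma>)) (u \<sigma>) {..Suc q}) = cobd (val c) \<sigma>" .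
    qed
  qed
  show "cech_differential q G \<U> c \<in> carrier (Ch (Suc q) \<U>)"
    unfolding diff cochains_iff using * by simp
  show "val (cech_differential q G \<U> c) \<sigma> = cobd (val c) \<sigma>" if "\<sigma> \<in> simplices (Suc q) \<U>" "cap \<sigma> ~= {}" for \<sigma>
    using * that by (simp add: diff val_def)
qed

lemma cocycles_iff:
  assumes \<U>: "cover \<U>"
  shows "c \<in> cech_cocycles q G \<U> \<longleftrightarrow> c \<in> carrier (Ch q \<U>) \<and>
    (\<forall>\<sigma>\<in>simplices (Suc q) \<U>. cap \<sigma> ~= {} --> cobd (val c) \<sigma> = 0)"
proof (cases "c \<in> carrier (Ch q \<U>)")
  case True
  have "cech_differential q G \<U> c = \<one>\<^bsub>Ch (Suc q) \<U>\<^esub> \<longleftrightarrow>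
      (\<forall>\<sigma>\<in>simplices (Suc q) \<U>. cap \<sigma> ~= {} --> cobd (val c) \<sigma> = 0)" (is "?l = \<one>\<^bsub>?C\<^esub> \<longleftrightarrow> ?r")
  proof
    assume "?l = \<one>\<^bsub>?C\<^esub>"
    thus ?r using differential(2)[OF \<U> True] val_one[OF \<U>] by metis
  next
    assume ?r
    thus "?l = \<one>\<^bsub>?C\<^esub>"
      using differential[OF \<U> True] val_one[OF \<U>] by (intro cochains_eqI[OF \<U> _ one_in[OF \<U>]]) auto
  qed
  thus ?thesis using True by (simp add: cech_cocycles_def kernel_def)
qed (simp add: cech_cocycles_def kernel_def)

lemma one_cocycle: "cover \<U> ==> \<one>\<^bsub>Ch q \<U>\<^esub> \<in> cech_cocycles q G \<U>"
proof -
  assume \<U>: "cover \<U>"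
  have "cobd (val \<one>\<^bsub>Ch q \<U>\<^esub>) \<sigma> = 0" if \<sigma>: "\<sigma> \<in> simplices (Suc q) \<U>" for \<sigma>
  proof -
    have "cobd (val \<one>\<^bsub>Ch q \<U>\<^esub>) \<sigma> = cobd (\<lambda>_. 0) \<sigma>"
      using \<sigma> by (intro cobd_cong val_one[OF \<U>]) (auto simp: simplices_def)
    thus ?thesis by (simp add: cobd_zero)
  qed
  thus ?thesis using one_in[OF \<U>] by (simp add: cocycles_iff[OF \<U>])
qed

lemma pullback:
  assumes \<U>: "cover \<U>" and \<W>: "cover \<W>" and \<rho>: "refinement \<W> \<U> \<rho>"
    and c: "c \<in> carrier (Ch q \<U>)"
  shows "cech_pullback q G \<W> \<rho> c \<in> carrier (Ch q \<W>)"
    and "\<And>\<sigma>. \<sigma> \<in> simplices q \<W> ==> cap \<sigma> ~= {} ==> val (cech_pullback q G \<W> \<rho> c) \<sigma> = val c (map \<rho> \<sigma>)"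
proof -
  have \<sigma>: "map \<rho> \<sigma> \<in> simplices q \<U>" "cap \<sigma> \<subseteq> cap (map \<rho> \<sigma>)" "zopen N (cap \<sigma>)"
    "zopen N (cap (map \<rho> \<sigma>))" "c (map \<rho> \<sigma>) \<in> secs G (cap (map \<rho> \<sigma>))"
    if "\<sigma> \<in> simplices q \<W>" for \<sigma>
  proof -
    show 1: "map \<rho> \<sigma> \<in> simplices q \<U>" using that \<rho> by (auto simp: simplices_def refinement_def)
    show "cap \<sigma> \<subseteq> cap (map \<rho> \<sigma>)" using that \<rho> by (fastforce simp: simplices_def refinement_def)
    show "zopen N (cap \<sigma>)" using that by (rule simplices_cap_open[OF \<W>])
    show "zopen N (cap (map \<rho> \<sigma>))" using 1 by (rule simplices_cap_open[OF \<U>])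
    show "c (map \<rho> \<sigma>) \<in> secs G (cap (map \<rho> \<sigma>))" using 1 c by (auto simp: cochains_iff simp del: set_map)
  qed
  show "cech_pullback q G \<W> \<rho> c \<in> carrier (Ch q \<W>)"
    unfolding cochains_iff cech_pullback_def using emb.restr_closed \<sigma> by (auto simp del: set_map)
  show "val (cech_pullback q G \<W> \<rho> c) \<sigma> = val c (map \<rho> \<sigma>)" if s: "\<sigma> \<in> simplices q \<W>" "cap \<sigma> ~= {}" for \<sigma>
  proof -
    have "cap (map \<rho> \<sigma>) ~= {}" using s(2) \<sigma>(2)[OF s(1)] by blast
    thus ?thesis
      using s emb.emb_restr[OF \<sigma>(4,3,2)[OF s(1)] s(2) \<sigma>(5)[OF s(1)]] by (simp add: val_def cech_pullback_def del: set_map)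
  qed
qed

lemma equiv_sub:
  "(x, y) \<in> cech_equiv q (zariski N) G ==> y \<in> (SIGMA \<U>:covers (zariski N). cech_cocycles q G \<U>)"
  by (auto simp: cech_equiv_def)

lemma topspace_cover: "cover {topspace (zariski N)}"
  by (simp add: covers_def open_proj_space)

lemma one_class_in: "\<one>\<^bsub>cohomology q (zariski N) G\<^esub> \<in> carrier (cohomology q (zariski N) G)"
  using one_cocycle[OF topspace_cover] topspace_cover unfolding cohomology_def by (auto intro!: quotientI)

text \<open>All cocycles form one class \<open>A\<close>. As \<open>trivial_group\<close> contains
  the group axioms, the product of this class with itself still has to be computed, which is done
  with the zero cocycle on the covering by the whole space.\<close>

lemma trivial_cohomology:
  assumes eq: "\<And>\<U> c \<V> d. cover \<U> ==> c \<in> cech_cocycles q G \<U> ==> cover \<V> ==>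
    d \<in> cech_cocycles q G \<V> ==> ((\<U>, c), (\<V>, d)) \<in> cech_equiv q (zariski N) G"
  shows "trivial_group (cohomology q (zariski N) G)"
proof -
  let ?R = "cech_equiv q (zariski N) G" and ?T = "{topspace (zariski N)}"
  define A where "A = (SIGMA \<U>:covers (zariski N). cech_cocycles q G \<U>)"
  have R: "?R `` {x} = A" if "x \<in> A" for x
    using that eq by (auto simp: A_def cech_equiv_def)
  let ?o = "\<one>\<^bsub>Ch q ?T\<^esub>"
  have one: "(?T, ?o) \<in> A" using one_cocycle[OF topspace_cover] topspace_cover by (simp add: A_def)
  have "A // ?R = {A}" using R one by (auto simp: quotient_def)
  hence carr: "carrier (cohomology q (zariski N) G) = {A}" by (simp add: cohomology_def A_def)
  have o: "\<one>\<^bsub>cohomology q (zariski N) G\<^esub> = A" using R[OF one] by (simp add: cohomology_def)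
  have "?o \<otimes>\<^bsub>Ch q ?T\<^esub> ?o = ?o"
    by (rule one_mult_one[OF topspace_cover])
  hence "(?T, ?o) \<in> {(\<W>, c \<otimes>\<^bsub>Ch q \<W>\<^esub> d) | \<W> c d. (\<W>, c) \<in> A \<and> (\<W>, d) \<in> A}"
    using one by force
  hence "A \<subseteq> ?R `` {(\<W>, c \<otimes>\<^bsub>Ch q \<W>\<^esub> d) | \<W> c d. (\<W>, c) \<in> A \<and> (\<W>, d) \<in> A}"
    using R[OF one] by blast
  moreover have "?R `` S \<subseteq> A" for S using equiv_sub unfolding A_def by blast
  ultimately have "A \<otimes>\<^bsub>cohomology q (zariski N) G\<^esub> A = A" by (simp add: cohomology_def) blast
  hence "group (cohomology q (zariski N) G)" by (intro groupI) (auto simp: carr o)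
  thus ?thesis using carr o by (simp add: trivial_group_def)
qed

section \<open>Coverings by basic open sets and their simplices\<close>

lemma basic_cover:
  assumes J: "covering J"
  shows "basic_open N ` J \<in> covers (zariski N)"
    and "\<And>t. set t \<subseteq> J ==> t ~= [] ==> cap (map (basic_open N) t) = Dset N (set t)"
    and "\<And>t. set t \<subseteq> J ==> Dset N (set t) ~= {}"
proof -
  have form: "\<exists>d. g \<in> forms N d" if "g \<in> J" for g using that J by (auto simp: covering_def pos_forms_def)
  have bo: "basic_open N g = {p \<in> proj_space N. fval p g ~= 0}" if "g \<in> J" for g
    using form[OF that] basic_open_fval by blast
  show "basic_open N ` J \<in> covers (zariski N)"
    using form basic_open_open J bo by (fastforce simp: covers_def covering_def)
  show "cap (map (basic_open N) t) = Dset N (set t)" if "set t \<subseteq> J" "t ~= []" for t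
    using that bo by (cases t) (auto simp: Dset_def)
  show "Dset N (set t) ~= {}" if "set t \<subseteq> J" for t
    using that J by (intro Dset_nonempty) (auto simp: covering_def)
qed

text \<open>Simplices of a covering are lists of open sets, whereas \<open>cochains J\<close> is
  indexed by lists of forms. Since several forms may define the same open set,
  \<open>\<gamma>\<close> selects one of them.\<close>

lemma basic_simplices:
  assumes J: "covering J"
  defines "\<gamma> \<equiv> inv_into J (basic_open N)"
  shows "\<And>t n. t \<in> lists_of J (Suc n) ==> map (basic_open N) t \<in> simplices n (basic_open N ` J)"
    and "\<And>t n. t \<in> lists_of J (Suc n) ==> cap (map (basic_open N) t) = Dset N (set t)"
    and "\<And>t n. t \<in> lists_of J (Suc n) ==> cap (map (basic_open N) t) ~= {}"
    and "\<And>\<sigma> n. \<sigma> \<in> simplices n (basic_open N ` J) ==> map \<gamma> \<sigma> \<in> lists_of J (Suc n)"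
    and "\<And>\<sigma> n. \<sigma> \<in> simplices n (basic_open N ` J) ==> map (basic_open N) (map \<gamma> \<sigma>) = \<sigma>"
proof -
  fix t n assume t: "t \<in> lists_of J (Suc n)"
  hence t': "set t \<subseteq> J" "t ~= []" by (auto simp: lists_of_def)
  show "map (basic_open N) t \<in> simplices n (basic_open N ` J)"
    using t by (auto simp: lists_of_def simplices_def)
  show "cap (map (basic_open N) t) = Dset N (set t)" by (rule basic_cover(2)[OF J t'])
  thus "cap (map (basic_open N) t) ~= {}" using basic_cover(3)[OF J t'(1)] by simp
next
  fix \<sigma> n assume \<sigma>: "\<sigma> \<in> simplices n (basic_open N ` J)"
  hence sub: "set \<sigma> \<subseteq> basic_open N ` J" "length \<sigma> = Suc n" by (auto simp: simplices_def)
  have "\<gamma> W \<in> J" "basic_open N (\<gamma> W) = W" if "W \<in> set \<sigma>" for W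
  proof -
    have "W \<in> basic_open N ` J" using sub(1) that by blast
    thus "\<gamma> W \<in> J" "basic_open N (\<gamma> W) = W" unfolding \<gamma>_def by (rule inv_into_into, rule f_inv_into_f)
  qed
  thus "map \<gamma> \<sigma> \<in> lists_of J (Suc n)" "map (basic_open N) (map \<gamma> \<sigma>) = \<sigma>"
    using sub(2) by (auto simp: lists_of_def intro!: map_idI)
qed

text \<open>The forms whose basic open set is contained in a member of each of the two coverings
  have no common zero; compactness leaves finitely many of them.\<close>

lemma basic_refinement:
  assumes \<U>: "cover \<U>" and \<V>: "cover \<V>"
  shows "\<exists>J \<rho> \<tau>. covering J \<and> refinement (basic_open N ` J) \<U> \<rho> \<and> refinement (basic_open N ` J) \<V> \<tau>"
proof -
  define H where "H = {g. g ~= 0 \<and> (\<exists>d>0. g \<in> forms N d) \<and> (\<exists>U\<in>\<U>. basic_open N g \<subseteq> U) \<and> (\<exists>V\<in>\<V>. basic_open N g \<subseteq> V)}"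
  have "\<exists>g\<in>H. fval p g ~= 0" if p: "p \<in> proj_space N" for p
  proof -
    have "p \<in> \<Union>\<U>" "p \<in> \<Union>\<V>" using p \<U> \<V> by (simp_all add: covers_def)
    then obtain U V where UV: "U \<in> \<U>" "V \<in> \<V>" "p \<in> U" "p \<in> V" by blast
    hence o: "zopen N (U \<inter> V)" using \<U> \<V> by (auto simp: covers_def)
    have "p \<in> U \<inter> V" using UV by blast
    from open_basic[OF o this] obtain d g where g: "d > 0" "g \<in> forms N d" "fval p g ~= 0" "basic_open N g \<subseteq> U \<inter> V" .
    hence "g ~= 0" using p by auto
    moreover have "basic_open N g \<subseteq> U" "basic_open N g \<subseteq> V" using g(4) by simp_all
    ultimately have "g \<in> H" using g(1,2) UV(1,2) unfolding H_def by blast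
    thus ?thesis using g(3) by blast
  qed
  moreover have "\<exists>d. g \<in> forms N d" if "g \<in> H" for g using that by (auto simp: H_def)
  ultimately obtain J where J: "finite J" "J \<subseteq> H" "\<And>p. p \<in> proj_space N ==> \<exists>g\<in>J. fval p g ~= 0"
    using proj_space_compact[of H N] by metis
  have "covering J" using J unfolding covering_def H_def pos_forms_def by blast
  moreover have ex: "\<exists>U. U \<in> \<U> \<and> W \<subseteq> U" "\<exists>V. V \<in> \<V> \<and> W \<subseteq> V" if "W \<in> basic_open N ` J" for W
    using that J(2) unfolding H_def by blast+
  define \<rho> where "\<rho> W = (SOME U. U \<in> \<U> \<and> W \<subseteq> U)" for W
  define \<tau> where "\<tau> W = (SOME V. V \<in> \<V> \<and> W \<subseteq> V)" for W
  have "refinement (basic_open N ` J) \<U> \<rho>" unfolding refinement_def \<rho>_def using someI_ex[OF ex(1)] by blast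
  moreover have "refinement (basic_open N ` J) \<V> \<tau>" unfolding refinement_def \<tau>_def using someI_ex[OF ex(2)] by blast
  ultimately show ?thesis by blast
qed

lemma lift_basic:
  assumes J: "covering J" and b: "b \<in> cochains J (Suc q) m"
  defines "\<gamma> \<equiv> inv_into J (basic_open N)" and "\<W> \<equiv> basic_open N ` J"
  obtains e where "e \<in> carrier (Ch q \<W>)"
    "\<And>\<sigma>. \<sigma> \<in> simplices q \<W> ==> cap \<sigma> ~= {} ==> val e \<sigma> = b (map \<gamma> \<sigma>)"
    "\<And>\<sigma>. \<sigma> \<in> simplices (Suc q) \<W> ==> cap \<sigma> ~= {} ==> cobd (val e) \<sigma> = cobd b (map \<gamma> \<sigma>)"
proof -
  note map_simp = basic_simplices(4,5)[OF J, folded \<gamma>_def \<W>_def]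
  have "b (map \<gamma> \<sigma>) \<in> sec (cap \<sigma>) m" if \<sigma>: "\<sigma> \<in> simplices q \<W>" for \<sigma>
    using b map_simp(1)[OF \<sigma>] basic_simplices(2)[OF J map_simp(1)[OF \<sigma>]] map_simp(2)[OF \<sigma>]
    unfolding cochains_def by (metis (no_types, lifting) mem_Collect_eq)
  then obtain e where e: "e \<in> carrier (Ch q \<W>)"
    "\<And>\<sigma>. \<sigma> \<in> simplices q \<W> ==> cap \<sigma> ~= {} ==> val e \<sigma> = b (map \<gamma> \<sigma>)"
    using lift_cochain[of \<W> q "\<lambda>\<sigma>. b (map \<gamma> \<sigma>)"] basic_cover(1)[OF J, folded \<W>_def] by metis
  have "cobd (val e) \<sigma> = cobd b (map \<gamma> \<sigma>)" if \<sigma>: "\<sigma> \<in> simplices (Suc q) \<W>" "cap \<sigma> ~= {}" for \<sigma>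
    unfolding cobd_map
  proof (rule cobd_cong)
    fix s assume s: "set s \<subseteq> set \<sigma>" "Suc (length s) = length \<sigma>"
    hence "s \<in> simplices q \<W>" "cap \<sigma> \<subseteq> cap s" using \<sigma> by (auto simp: simplices_def)
    thus "val e s = b (map \<gamma> s)" using \<sigma>(2) e(2) by blast
  qed
  with e show thesis by (rule that)
qed

text \<open>On a common refinement by basic open sets the difference of the two pullbacks is a
  cocycle, hence a coboundary. Cohomological degree \<open>Suc q\<close> corresponds to lists of
  length \<open>Suc (Suc q)\<close>.\<close>

lemma acyclic_equiv:
  assumes ac: "\<And>J. covering J ==> acyclic J (Suc (Suc q)) m"
    and \<U>: "cover \<U>" and c: "c \<in> cech_cocycles (Suc q) G \<U>"
    and \<V>: "cover \<V>" and d: "d \<in> cech_cocycles (Suc q) G \<V>"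
  shows "((\<U>, c), (\<V>, d)) \<in> cech_equiv (Suc q) (zariski N) G"
proof -
  obtain J \<rho> \<tau> where J: "covering J" and ref0: "refinement (basic_open N ` J) \<U> \<rho>" "refinement (basic_open N ` J) \<V> \<tau>"
    using basic_refinement[OF \<U> \<V>] by blast
  define \<beta> where "\<beta> = (basic_open N :: 'k mvpoly => _)"
  define \<gamma> where "\<gamma> = inv_into J \<beta>"
  define \<W> where "\<W> = \<beta> ` J"
  have \<W>: "cover \<W>" unfolding \<W>_def \<beta>_def by (rule basic_cover(1)[OF J])
  have \<rho>: "refinement \<W> \<U> \<rho>" and \<tau>: "refinement \<W> \<V> \<tau>" using ref0 by (simp_all add: \<W>_def \<beta>_def)
  have c': "c \<in> carrier (Ch (Suc q) \<U>)" and d': "d \<in> carrier (Ch (Suc q) \<V>)"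
    using c d by (simp_all add: cocycles_iff \<U> \<V>)
  note simp_map = basic_simplices(1-3)[OF J, folded \<beta>_def, folded \<W>_def]
  note map_simp = basic_simplices(4,5)[OF J, folded \<beta>_def, folded \<W>_def \<gamma>_def]
  define x where "x t = val c (map \<rho> (map \<beta> t)) - val d (map \<tau> (map \<beta> t))" for t
  have ref: "map \<rho> \<sigma> \<in> simplices n \<U>" "cap \<sigma> \<subseteq> cap (map \<rho> \<sigma>)" "map \<tau> \<sigma> \<in> simplices n \<V>" "cap \<sigma> \<subseteq> cap (map \<tau> \<sigma>)"
    if "\<sigma> \<in> simplices n \<W>" for \<sigma> n
    using that \<rho> \<tau> by (fastforce simp: simplices_def refinement_def)+
  have "x \<in> cochains J (Suc (Suc q)) m"
    unfolding cochains_def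
  proof (intro CollectI ballI)
    fix t assume t: "t \<in> lists_of J (Suc (Suc q))"
    note st = simp_map[OF t] and rt = ref[OF simp_map(1)[OF t]]
    show "x t \<in> sec (Dset N (set t)) m"
      unfolding x_def st(2)[symmetric]
      using Dset_proj[of N "set t"]
      by (intro sec_diff sec_mono[OF rt(2) val_in[OF \<U> c' rt(1)]] sec_mono[OF rt(4) val_in[OF \<V> d' rt(3)]]) (simp only: st(2))
  qed
  moreover have "cobd x t = 0" if t: "t \<in> lists_of J (Suc (Suc (Suc q)))" for t
  proof -
    note st = simp_map[OF t] and rt = ref[OF simp_map(1)[OF t]]
    have "cobd x t = cobd (val c) (map \<rho> (map \<beta> t)) - cobd (val d) (map \<tau> (map \<beta> t))"
      unfolding x_def[abs_def] cobd_diff cobd_map ..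
    also have "\<dots> = 0"
    proof -
      have "cap (map \<rho> (map \<beta> t)) ~= {}" "cap (map \<tau> (map \<beta> t)) ~= {}" using st(3) rt(2,4) by blast+
      thus ?thesis using c d rt(1,3) by (simp only: cocycles_iff[OF \<U>] cocycles_iff[OF \<V>]) simp
    qed
    finally show ?thesis .
  qed
  ultimately obtain b where b: "b \<in> cochains J (Suc q) m" "\<And>t. t \<in> lists_of J (Suc (Suc q)) ==> x t = cobd b t"
    using ac[OF J] unfolding acyclic_def by (metis diff_Suc_1)
  obtain e where e: "e \<in> carrier (Ch q \<W>)"
    "\<And>\<sigma>. \<sigma> \<in> simplices (Suc q) \<W> ==> cap \<sigma> ~= {} ==> cobd (val e) \<sigma> = cobd b (map \<gamma> \<sigma>)"
    using lift_basic[OF J b(1)] unfolding \<W>_def \<gamma>_def \<beta>_def by metis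
  let ?c = "cech_pullback (Suc q) G \<W> \<rho> c" and ?d = "cech_pullback (Suc q) G \<W> \<tau> d" and ?e = "cech_differential q G \<W> e"
  have "?c = ?d \<otimes>\<^bsub>Ch (Suc q) \<W>\<^esub> ?e"
  proof (rule cochains_eqI[OF \<W> pullback(1)[OF \<U> \<W> \<rho> c'] mult_closed[OF \<W> pullback(1)[OF \<V> \<W> \<tau> d'] differential(1)[OF \<W> e(1)]]])
    fix \<sigma> assume \<sigma>: "\<sigma> \<in> simplices (Suc q) \<W>" and ne: "cap \<sigma> ~= {}"
    have "cobd (val e) \<sigma> = cobd b (map \<gamma> \<sigma>)" by (rule e(2)[OF \<sigma> ne])
    also have "\<dots> = x (map \<gamma> \<sigma>)" by (rule b(2)[OF map_simp(1)[OF \<sigma>], symmetric])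
    also have "\<dots> = val ?c \<sigma> - val ?d \<sigma>"
      unfolding x_def map_simp(2)[OF \<sigma>] pullback(2)[OF \<U> \<W> \<rho> c' \<sigma> ne] pullback(2)[OF \<V> \<W> \<tau> d' \<sigma> ne] ..
    finally show "val ?c \<sigma> = val (?d \<otimes>\<^bsub>Ch (Suc q) \<W>\<^esub> ?e) \<sigma>"
      unfolding val_mult[OF \<W> pullback(1)[OF \<V> \<W> \<tau> d'] differential(1)[OF \<W> e(1)] \<sigma>] differential(2)[OF \<W> e(1) \<sigma> ne]
      by simp
  qed
  moreover have "?e \<in> cech_coboundaries (Suc q) G \<W>" using e(1) by (simp add: cech_coboundaries_def)
  ultimately show ?thesis
    unfolding cech_equiv_def using \<U> \<V> c d \<W> \<rho> \<tau> by blast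
qed

text \<open>A cocycle on \<open>J\<close> has the class of zero in the limit, so it becomes a
  coboundary on some covering. After refining this covering by basic open sets,
  \<open>refinement_injective\<close> brings the conclusion back to \<open>J\<close>.\<close>

lemma acyclic_of_cohomology:
  assumes triv: "carrier (cohomology (Suc q) (zariski N) G) \<subseteq> {\<one>\<^bsub>cohomology (Suc q) (zariski N) G\<^esub>}"
    and J: "covering J"
  shows "acyclic J (Suc (Suc q)) m"
  unfolding acyclic_def
proof (intro ballI impI)
  fix c assume c: "c \<in> cochains J (Suc (Suc q)) m" and closed: "\<forall>s\<in>lists_of J (Suc (Suc (Suc q))). cobd c s = 0"
  let ?R = "cech_equiv (Suc q) (zariski N) G" and ?T = "{topspace (zariski N)}"
  let ?o = "\<one>\<^bsub>Ch (Suc q) ?T\<^esub>"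
  define \<beta> where "\<beta> = (basic_open N :: 'k mvpoly => _)"
  define \<gamma> where "\<gamma> = inv_into J \<beta>"
  define \<U> where "\<U> = \<beta> ` J"
  have \<U>: "cover \<U>" unfolding \<U>_def \<beta>_def by (rule basic_cover(1)[OF J])
  obtain e where e: "e \<in> carrier (Ch (Suc q) \<U>)"
    "\<And>\<sigma>. \<sigma> \<in> simplices (Suc q) \<U> ==> cap \<sigma> ~= {} ==> val e \<sigma> = c (map \<gamma> \<sigma>)"
    "\<And>\<sigma>. \<sigma> \<in> simplices (Suc (Suc q)) \<U> ==> cap \<sigma> ~= {} ==> cobd (val e) \<sigma> = cobd c (map \<gamma> \<sigma>)"
    using lift_basic[OF J c] unfolding \<U>_def \<gamma>_def \<beta>_def by metis
  have "cobd (val e) \<sigma> = 0" if \<sigma>: "\<sigma> \<in> simplices (Suc (Suc q)) \<U>" "cap \<sigma> ~= {}" for \<sigma>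
    using closed basic_simplices(4)[OF J, folded \<beta>_def, folded \<U>_def \<gamma>_def, OF \<sigma>(1)] by (simp only: e(3)[OF \<sigma>])
  hence ec: "e \<in> cech_cocycles (Suc q) G \<U>" using e(1) by (simp add: cocycles_iff[OF \<U>])
  \<comment> \<open>Reflexivity at \<open>(\<U>, e)\<close> is checked by hand, with the
    differential of the zero cochain as coboundary. It places the pair in its own class, so that
    equality of classes can be turned into a relation of representatives.\<close>
  have refl: "((\<U>, e), (\<U>, e)) \<in> ?R"
  proof -
    let ?z = "cech_differential q G \<U> \<one>\<^bsub>Ch q \<U>\<^esub>" and ?p = "cech_pullback (Suc q) G \<U> (\<lambda>U. U) e"
    have id: "refinement \<U> \<U> (\<lambda>U. U)" by (simp add: refinement_def)
    have p: "?p \<in> carrier (Ch (Suc q) \<U>)" by (rule pullback(1)[OF \<U> \<U> id e(1)])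
    have z: "?z \<in> carrier (Ch (Suc q) \<U>)" by (rule differential(1)[OF \<U> one_in[OF \<U>]])
    have z1: "?z = \<one>\<^bsub>Ch (Suc q) \<U>\<^esub>"
      using one_cocycle[OF \<U>, of q] by (simp add: cech_cocycles_def kernel_def)
    have "?p = ?p \<otimes>\<^bsub>Ch (Suc q) \<U>\<^esub> ?z"
    proof (rule cochains_eqI[OF \<U> p mult_closed[OF \<U> p z]])
      fix \<sigma> assume \<sigma>: "\<sigma> \<in> simplices (Suc q) \<U>"
      have "val ?z \<sigma> = 0" unfolding z1 by (rule val_one[OF \<U> \<sigma>])
      thus "val ?p \<sigma> = val (?p \<otimes>\<^bsub>Ch (Suc q) \<U>\<^esub> ?z) \<sigma>"
        unfolding val_mult[OF \<U> p z \<sigma>] by simp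
    qed
    moreover have "?z \<in> cech_coboundaries (Suc q) G \<U>" using one_in[OF \<U>] by (simp add: cech_coboundaries_def)
    ultimately show ?thesis unfolding cech_equiv_def using \<U> ec id by blast
  qed
  have "?R `` {(\<U>, e)} \<in> carrier (cohomology (Suc q) (zariski N) G)"
    using \<U> ec unfolding cohomology_def by (auto intro!: quotientI)
  hence "?R `` {(\<U>, e)} = ?R `` {(?T, ?o)}" using triv by (auto simp: cohomology_def)
  hence "((?T, ?o), (\<U>, e)) \<in> ?R" using refl by blast
  then obtain \<W> \<rho> \<tau> b where \<W>: "cover \<W>" and \<rho>: "refinement \<W> ?T \<rho>" and \<tau>: "refinement \<W> \<U> \<tau>"
    and b: "b \<in> cech_coboundaries (Suc q) G \<W>"
    and eq: "cech_pullback (Suc q) G \<W> \<rho> ?o = cech_pullback (Suc q) G \<W> \<tau> e \<otimes>\<^bsub>Ch (Suc q) \<W>\<^esub> b"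
    unfolding cech_equiv_def by blast
  obtain a where a: "a \<in> carrier (Ch q \<W>)" "b = cech_differential q G \<W> a"
    using b by (auto simp: cech_coboundaries_def)
  obtain J2 \<omega>0 where J2: "covering J2" and \<omega>0: "refinement (basic_open N ` J2) \<W> \<omega>0"
    using basic_refinement[OF \<W> \<W>] by blast
  define \<omega> where "\<omega> g = \<omega>0 (basic_open N g)" for g
  have \<omega>: "\<omega> g \<in> \<W> \<and> basic_open N g \<subseteq> \<omega> g" if "g \<in> J2" for g
    using \<omega>0 that unfolding refinement_def \<omega>_def by blast
  \<comment> \<open>The refinement map from \<open>J2\<close> to \<open>J\<close>: through the
    intermediate covering to a member of \<open>\<U>\<close>, and from there to the form selected
    for it.\<close>
  define \<pi> where "\<pi> g = \<gamma> (\<tau> (\<omega> g))" for g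
  have \<omega>s: "map \<omega> t \<in> simplices n \<W>" "Dset N (set t) \<subseteq> cap (map \<omega> t)" "cap (map \<omega> t) ~= {}"
    if t: "t \<in> lists_of J2 (Suc n)" for t n
  proof -
    have t': "set t \<subseteq> J2" "t ~= []" using t by (auto simp: lists_of_def)
    show "map \<omega> t \<in> simplices n \<W>" using t \<omega> by (auto simp: simplices_def lists_of_def)
    show "Dset N (set t) \<subseteq> cap (map \<omega> t)"
      unfolding basic_cover(2)[OF J2 t', symmetric] using t'(1) \<omega> by fastforce
    thus "cap (map \<omega> t) ~= {}" using basic_cover(3)[OF J2 t'(1)] by blast
  qed
  show "\<exists>b\<in>cochains J (Suc (Suc q) - 1) m. \<forall>s\<in>lists_of J (Suc (Suc q)). c s = cobd b s"
  proof (rule refinement_injective[OF J J2 _ _ c])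
    show "1 \<le> Suc (Suc q)" by simp
    show "\<pi> g \<in> J \<and> basic_open N g \<subseteq> basic_open N (\<pi> g)" if g: "g \<in> J2" for g
    proof -
      have "\<tau> (\<omega> g) \<in> \<beta> ` J" "\<omega> g \<subseteq> \<tau> (\<omega> g)" using \<tau> \<omega>[OF g] by (auto simp: refinement_def \<U>_def)
      hence "\<pi> g \<in> J" "\<beta> (\<pi> g) = \<tau> (\<omega> g)"
        by (simp_all only: \<pi>_def \<gamma>_def inv_into_into f_inv_into_f)
      thus ?thesis using \<open>\<omega> g \<subseteq> \<tau> (\<omega> g)\<close> \<omega>[OF g] by (auto simp: \<beta>_def)
    qed
    show "cobd c s = 0" if "s \<in> lists_of J (Suc (Suc (Suc q)))" for s using closed that by blast
    \<comment> \<open>The equality of classes reads \<open>0 = e + da\<close> on the refinement,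
      hence the sign.\<close>
    show "(\<lambda>t. - val a (map \<omega> t)) \<in> cochains J2 (Suc (Suc q) - 1) m"
      unfolding cochains_def
    proof (intro CollectI ballI)
      fix t assume "t \<in> lists_of J2 (Suc (Suc q) - 1)"
      hence t: "t \<in> lists_of J2 (Suc q)" by simp
      show "- val a (map \<omega> t) \<in> sec (Dset N (set t)) m"
        by (rule sec_uminus[OF Dset_proj sec_mono[OF \<omega>s(2)[OF t] val_in[OF \<W> a(1) \<omega>s(1)[OF t]]]])
    qed
    fix t assume t: "t \<in> lists_of J2 (Suc (Suc q))"
    note s = \<omega>s[OF t]
    have e': "map \<tau> (map \<omega> t) \<in> simplices (Suc q) \<U>" "cap (map \<omega> t) \<subseteq> cap (map \<tau> (map \<omega> t))"
      using s(1) \<tau> by (fastforce simp: simplices_def refinement_def)+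
    have o': "map \<rho> (map \<omega> t) \<in> simplices (Suc q) ?T" using s(1) \<rho> by (auto simp: simplices_def refinement_def)
    have "val (cech_pullback (Suc q) G \<W> \<rho> ?o) (map \<omega> t) = 0"
      unfolding pullback(2)[OF topspace_cover \<W> \<rho> one_in[OF topspace_cover] s(1,3)] by (rule val_one[OF topspace_cover o'])
    hence "val (cech_pullback (Suc q) G \<W> \<tau> e) (map \<omega> t) + cobd (val a) (map \<omega> t) = 0"
      unfolding eq a(2) val_mult[OF \<W> pullback(1)[OF \<U> \<W> \<tau> e(1)] differential(1)[OF \<W> a(1)] s(1)]
        differential(2)[OF \<W> a(1) s(1,3)] .
    moreover have "val (cech_pullback (Suc q) G \<W> \<tau> e) (map \<omega> t) = c (map \<gamma> (map \<tau> (map \<omega> t)))"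
      unfolding pullback(2)[OF \<U> \<W> \<tau> e(1) s(1,3)] using e' s(3) by (intro e(2)) blast+
    ultimately show "c (map \<pi> t) = cobd (\<lambda>t. - val a (map \<omega> t)) t"
      by (simp add: cobd_uminus cobd_map \<pi>_def[abs_def] comp_def eq_neg_iff_add_eq_0)
  qed
qed

end

section \<open>The splitting criterion\<close>

text \<open>The \<open>H i\<close> are not known to be groups at this point, only their units are
  known to be elements; so the family with single entry \<open>x\<close> is placed into the direct
  sum as one of its generators.\<close>

lemma sum_group_component:
  assumes triv: "trivial_group (sum_group UNIV H)" and one: "\<And>i. \<one>\<^bsub>H i\<^esub> \<in> carrier (H i)"
    and x: "x \<in> carrier (H j)"
  shows "x = \<one>\<^bsub>H j\<^esub>"
proof -
  define y where "y i = (if i = j then x else \<one>\<^bsub>H i\<^esub>)" for i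
  have fin: "finite {i \<in> UNIV. y i ~= \<one>\<^bsub>H i\<^esub>}" by (rule finite_subset[of _ "{j}"]) (auto simp: y_def)
  have "y \<in> (\<Pi>\<^sub>E i\<in>UNIV. carrier (H i))" using assms by (auto simp: y_def)
  hence "y \<in> carrier (sum_group UNIV H)"
    unfolding sum_group_def carrier_subgroup_generated using fin by (intro generate.incl) simp
  hence "y = \<one>\<^bsub>sum_group UNIV H\<^esub>" using triv by (simp add: trivial_group_def)
  hence "y j = (\<lambda>i\<in>UNIV. \<one>\<^bsub>H i\<^esub>) j" by simp
  thus ?thesis by (simp add: y_def)
qed

lemma trivial_sum_group:
  fixes H :: "'i => ('a, 'b) monoid_scheme"
  assumes "\<And>i. trivial_group (H i)"
  shows "trivial_group (sum_group UNIV H)"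
proof -
  have g: "group (H i)" and c: "carrier (H i) = {\<one>\<^bsub>H i\<^esub>}" for i
    using assms by (auto simp: trivial_group_def)
  have "carrier (sum_group UNIV H) = {x \<in> \<Pi>\<^sub>E i\<in>UNIV. carrier (H i). finite {i \<in> UNIV. x i ~= \<one>\<^bsub>H i\<^esub>}}"
    by (rule carrier_sum_group) (rule g)
  also have "\<dots> = {\<lambda>i\<in>UNIV. \<one>\<^bsub>H i\<^esub>}" by (auto simp: c PiE_iff fun_eq_iff)
  finally show ?thesis using g by (simp add: trivial_group_def)
qed

theorem corollary4:
  fixes N :: nat
    and F :: "('k::{alg_closed_field, field_char_0}, 'a) proj_sheaf"
  assumes "N \<ge> 2"
    and "coherent N F"
    and "torsion_free N F"
  shows "is_split N F \<longleftrightarrow> (\<forall>i\<in>{1..N - 1}. trivial_group (total_cohomology N i F))"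
proof
  assume "is_split N F"
  then obtain r a where iso: "sheaf_iso N F (direct_sum r (\<lambda>i. line_bundle N (a i)))" by (auto simp: is_split_def)
  have sheaf: "sheaf_of_modules N F" using assms(2) by (simp add: coherent_def)
  from embedded_line_bundle_sum[of N r a] obtain \<psi>0 where
    "embedded_sheaf (\<lambda>c f i. c * f i) N (direct_sum r (\<lambda>i. line_bundle N (a i)) :: ('k, _) proj_sheaf) (sum_stalk N r a) \<psi>0" ..
  \<comment> \<open>The embedding comes from the splitting itself, which makes the stalks
    explicit.\<close>
  from embedded_sheaf_iso[OF iso sheaf this] obtain \<psi> where
    F: "embedded_sheaf (\<lambda>c f i. c * f i) N F (sum_stalk N r a) \<psi>" ..
  interpret F: embedded_sheaf "\<lambda>c f i. c * f i" N F "sum_stalk N r a" \<psi> by (rule F)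
  show "\<forall>i\<in>{1..N - 1}. trivial_group (total_cohomology N i F)"
  proof
    fix i assume i: "i \<in> {1..N - 1}"
    then obtain q where q: "i = Suc q" by (cases i) auto
    show "trivial_group (total_cohomology N i F)"
      unfolding total_cohomology_def
    proof (rule trivial_sum_group)
      fix m
      interpret C: cech_embedding "\<lambda>c f i. c * f i" N "sum_stalk N r a" m "twist N m F" "F.twist_emb m"
        by (intro cech_embedding.intro sum_stalks F.embedded_twist)
      show "trivial_group (cohomology i (zariski N) (twist N m F))"
        unfolding q
      proof (rule C.trivial_cohomology, rule C.acyclic_equiv)
        fix J :: "'k mvpoly set" assume J: "C.covering J"
        have ac: "C.acyclic (std_cover N) (Suc (Suc q)) m" using i q by (intro sum_acyclic) auto
        show "C.acyclic J (Suc (Suc q)) m" by (rule C.acyclic_transfer[OF C.covering_std J _ ac]) simp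
      qed
    qed
  qed
next
  assume triv: "\<forall>i\<in>{1..N - 1}. trivial_group (total_cohomology N i F)"
  obtain \<Phi> :: "'k point => (nat => 'k ratfun) set" and \<psi> and I :: "nat set"
    where F: "embedded_sheaf (\<lambda>c x i. c * x i) N F \<Phi> \<psi>" and fin: "finite_stalks (\<lambda>c x i. c * x i) N \<Phi>"
      and I: "finite I" "\<And>p x i. x \<in> \<Phi> p ==> i \<notin> I ==> x i = 0"
      "\<And>p x. x \<in> \<Phi> p ==> \<exists>q. q \<in> proj_space N \<and> (\<forall>i. x i \<in> loc N q 0)"
    using torsion_free_coherent_embedding[OF assms(2,3)] by blast
  interpret F: embedded_sheaf "\<lambda>c x i. c * x i" N F \<Phi> \<psi> by (rule F)
  have S: "stalk_system (\<lambda>c x i. c * x i) N \<Phi>"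
    by (intro stalk_system.intro stalk_system_axioms.intro F.vector_space_axioms F.stalk_0 F.stalk_add F.stalk_scale fin)
  interpret S: stalk_system "\<lambda>c x i. c * x i" N \<Phi> by (rule S)
  have C: "cech_embedding (\<lambda>c x i. c * x i) N \<Phi> m (twist N m F) (F.twist_emb m)" for m
    by (intro cech_embedding.intro S F.embedded_twist)
  have ac: "S.acyclic (std_cover N) a m" if a: "2 \<le> a" "a \<le> N" for a m
  proof -
    \<comment> \<open>List length \<open>a = q + 2\<close> means cohomological degree
      \<open>q + 1\<close>; the bounds \<open>2 \<le> a\<close> and \<open>a \<le> N\<close> are
      exactly the degrees \<open>1, ..., N - 1\<close>.\<close>
    obtain q where q: "a = Suc (Suc q)" using a(1) by (metis add_2_eq_Suc le_Suc_ex)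
    interpret C: cech_embedding "\<lambda>c x i. c * x i" N \<Phi> m "twist N m F" "F.twist_emb m" by (rule C)
    have "trivial_group (total_cohomology N (Suc q) F)" using triv a q by auto
    hence t: "trivial_group (sum_group UNIV (\<lambda>m. cohomology (Suc q) (zariski N) (twist N m F)))"
      by (simp add: total_cohomology_def)
    have "carrier (cohomology (Suc q) (zariski N) (twist N m F)) \<subseteq> {\<one>\<^bsub>cohomology (Suc q) (zariski N) (twist N m F)\<^esub>}"
      using sum_group_component[OF t cech_embedding.one_class_in[OF C], of _ m] by blast
    thus ?thesis unfolding q by (rule C.acyclic_of_cohomology[OF _ S.covering_std])
  qed
  obtain m0 where low: "\<And>m. m < m0 ==> S.sec (proj_space N) m = {0}"
  proof -
    have "1 \<le> N" using assms(1) by simp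
    from bounded_below[OF S this I(1)] I(2,3) show thesis using that by blast
  qed
  have N: "1 \<le> N" using assms(1) by simp
  show "is_split N F"
  proof (rule S.free_basis[OF N ac low], goal_cases)
    case (4 r d e)
    show ?case by (rule S.split_of_basis[OF F 4])
  qed
qed

end
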